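(* Suppose $J\in L^1(\mathbf R)$ is non-negative and even and that its moments \[ \mu_k=\int_{x\in\mathbf R}x^kJ(x)\,dx \] exist for $k\le l+2$, with $l\ge 0$. There is a unique $c>0$ and a unique bounded translation-invariant operator $D\colon L^2(\mathbf R)\to L^2(\mathbf R)$ such that \begin{enumerate} \item $J\star v-\mu_0v=c^2D^2v$ for all $v\in L^2(\mathbf R)$. \item $-iHD$ is a positive operator, where $H\colon L^2(\mathbf R)\to L^2(\mathbf R)$ is the Hilbert transform, \[ (Hv)(x)=\lim_{\epsilon\to0^+}\int_{|x-y|>\epsilon}\frac{v(y)}{x-y}\,dy . \] \item Letting $S_\lambda\colon L^2(\mathbf R)\to L^2(\mathbf R)$ denote scaling by a factor $\lambda$, $(S_\lambda v)(x)=v(\lambda^{-1}x)$, we have \[ \lim_{h\to0^+}h^{-1}S_hDS_{h^{-1}}v=v_x \] weakly for any $v\in\operatorname{Dom}(\partial_x)\subset L^2(\mathbf R)$. \end{enumerate} This $D$ is of the form \[ (Dv)(x)=\int_{\xi\in\mathbf R}\int_{y\in\mathbf R}2\pi i\,\psi(\xi)\,e(\xi(x-y))\,v(y)\,d\xi\,dy , \] where $e(z)=\exp(2\pi iz)$, and $\psi$ is a function uniformly bounded, together with its derivatives up through order $l$, on $\mathbf R$.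
   Context: All integrals are Lebesgue integrals, $l$ and $k$ are non-negative integers, and $\star$ denotes convolution on $\mathbf R$. $L^2(\mathbf R)$ is the space of complex-valued square-integrable functions. An operator $T$ on $L^2(\mathbf R)$ is positive if $\langle Tv,v\rangle\ge0$ for all $v\in L^2(\mathbf R)$. Translation-invariant means commuting with all translations. $\operatorname{Dom}(\partial_x)$ is the set of $v\in L^2(\mathbf R)$ whose weak derivative $v_x$ lies in $L^2(\mathbf R)$. The double integral for $D$ is taken with the $y$ integration performed first, and expresses that $D$ is the Fourier multiplier $(FDv)(\xi)=2\pi i\,\psi(\xi)(Fv)(\xi)$, where $(Fv)(\xi)=\int_{\mathbf R}v(x)e(-\xi x)\,dx$.
   Formalization: Condition 2 is read as "HD is a positive operator" instead of "-iHD": with the displayed kernel 1/(x-y), positivity of -iHD together with condition 1 forces D=0, contradicting condition 3, for every J. Also J is assumed not almost everywhere zero, since for J=0 no such D exists. *)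

theory Defs
  imports "HOL-Analysis.Analysis"
begin

text \<open>
  Elements of \<open>L\<^sup>2(\<real>)\<close> are represented by Lebesgue measurable, square-integrable functions, and
  equality in \<open>L\<^sup>2(\<real>)\<close> is equality almost everywhere.  Operators on \<open>L\<^sup>2(\<real>)\<close> are represented by
  maps on functions, whose values outside \<open>L2\<close> are irrelevant.
\<close>

definition L2 :: "(real \<Rightarrow> complex) set" where
  "L2 = {v \<in> borel_measurable lebesgue. integrable lebesgue (\<lambda>x. (cmod (v x))\<^sup>2)}"

definition L2_inner :: "(real \<Rightarrow> complex) \<Rightarrow> (real \<Rightarrow> complex) \<Rightarrow> complex" where
  "L2_inner v w = (LINT x|lebesgue. v x * cnj (w x))"

definition L2_norm :: "(real \<Rightarrow> complex) \<Rightarrow> real" where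
  "L2_norm v = sqrt (LINT x|lebesgue. (cmod (v x))\<^sup>2)"

text \<open>
  Compatibility with equality almost everywhere need not be demanded separately: it follows from
  linearity and boundedness, applied to a difference of two representatives.
\<close>

definition bounded_operator_L2 :: "((real \<Rightarrow> complex) \<Rightarrow> (real \<Rightarrow> complex)) \<Rightarrow> bool" where
  "bounded_operator_L2 T \<longleftrightarrow>
     (\<forall>v\<in>L2. T v \<in> L2) \<and>
     (\<forall>v\<in>L2. \<forall>w\<in>L2. AE x in lebesgue. T (\<lambda>x. v x + w x) x = T v x + T w x) \<and>
     (\<forall>a. \<forall>v\<in>L2. AE x in lebesgue. T (\<lambda>x. a * v x) x = a * T v x) \<and>
     (\<exists>C. \<forall>v\<in>L2. L2_norm (T v) \<le> C * L2_norm v)"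

definition translation_invariant :: "((real \<Rightarrow> complex) \<Rightarrow> (real \<Rightarrow> complex)) \<Rightarrow> bool" where
  "translation_invariant T \<longleftrightarrow>
     (\<forall>a. \<forall>v\<in>L2. AE x in lebesgue. T (\<lambda>x. v (x - a)) x = T v (x - a))"

definition positive_operator :: "((real \<Rightarrow> complex) \<Rightarrow> (real \<Rightarrow> complex)) \<Rightarrow> bool" where
  "positive_operator T \<longleftrightarrow> (\<forall>v\<in>L2. T v \<in> L2 \<and> L2_inner (T v) v \<in> \<real>\<^sub>\<ge>\<^sub>0)"

definition convol :: "(real \<Rightarrow> real) \<Rightarrow> (real \<Rightarrow> complex) \<Rightarrow> real \<Rightarrow> complex" where
  "convol J v x = (LINT y|lebesgue. of_real (J (x - y)) * v y)"

definition moment :: "(real \<Rightarrow> real) \<Rightarrow> nat \<Rightarrow> real" where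
  "moment J k = (LINT x|lebesgue. x ^ k * J x)"

text \<open>
  The pointwise principal value, without the factor \<open>1/\<pi>\<close>.  For \<open>v \<in> L2\<close> the limit exists for almost
  every \<open>x\<close>; at the remaining points \<^const>\<open>Lim\<close> takes an unspecified value.
\<close>

definition hilbert_transform :: "(real \<Rightarrow> complex) \<Rightarrow> real \<Rightarrow> complex" where
  "hilbert_transform v x =
     Lim (at_right 0) (\<lambda>\<epsilon>. LINT y:{y. \<bar>x - y\<bar> > \<epsilon>}|lebesgue. v y / of_real (x - y))"

definition dilation :: "real \<Rightarrow> (real \<Rightarrow> complex) \<Rightarrow> real \<Rightarrow> complex" where
  "dilation r v x = v (inverse r * x)"

definition test_function :: "(real \<Rightarrow> real) \<Rightarrow> bool" where
  "test_function \<phi> \<longleftrightarrow>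
     (\<forall>n x. (deriv ^^ n) \<phi> differentiable (at x)) \<and> compact (closure {x. \<phi> x \<noteq> 0})"

definition weak_derivative :: "(real \<Rightarrow> complex) \<Rightarrow> (real \<Rightarrow> complex) \<Rightarrow> bool" where
  "weak_derivative v v' \<longleftrightarrow>
     (\<forall>\<phi>. test_function \<phi> \<longrightarrow>
        (LINT x|lebesgue. v x * of_real (deriv \<phi> x)) = - (LINT x|lebesgue. v' x * of_real (\<phi> x)))"

definition fourier_char :: "real \<Rightarrow> complex" where
  "fourier_char z = exp (2 * of_real pi * \<i> * of_real z)"

definition fourier_integral :: "(real \<Rightarrow> complex) \<Rightarrow> real \<Rightarrow> complex" where
  "fourier_integral v \<xi> = (LINT x|lebesgue. v x * fourier_char (- (\<xi> * x)))"

text \<open>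
  \<open>f\<close> is the Fourier transform of \<open>v \<in> L2\<close>, that is, the limit in \<open>L\<^sup>2(\<real>)\<close> of the Fourier integrals of
  the truncations of \<open>v\<close>; this determines \<open>f\<close> almost everywhere.
\<close>

definition is_fourier_L2 :: "(real \<Rightarrow> complex) \<Rightarrow> (real \<Rightarrow> complex) \<Rightarrow> bool" where
  "is_fourier_L2 v f \<longleftrightarrow> v \<in> L2 \<and> f \<in> L2 \<and>
     ((\<lambda>R. \<integral>\<^sup>+\<xi>. ennreal ((cmod (f \<xi> -
          fourier_integral (\<lambda>x. indicator {-R..R} x * v x) \<xi>))\<^sup>2) \<partial>lebesgue) \<longlongrightarrow> 0) at_top"

text \<open>
  The three defining conditions on \<open>c\<close> and \<open>D\<close>.  With the principal value kernel \<open>1/(x - y)\<close>, the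
  Hilbert transform has Fourier multiplier \<open>- \<i> \<pi> sgn \<xi>\<close> and the derivative has \<open>2 \<pi> \<i> \<xi>\<close>, so the
  product of the two is \<open>2 \<pi>\<^sup>2 \<bar>\<xi>\<bar>\<close>.  Hence the positivity condition is on \<open>H D\<close>.  It would be on
  \<open>- \<i> H D\<close> for the Hilbert transform with multiplier \<open>\<pi> sgn \<xi>\<close>; with the present one, \<open>- \<i> H D\<close>
  is never positive for a \<open>D\<close> satisfying the other two conditions.
\<close>

definition nonlocal_derivative ::
    "(real \<Rightarrow> real) \<Rightarrow> real \<Rightarrow> ((real \<Rightarrow> complex) \<Rightarrow> (real \<Rightarrow> complex)) \<Rightarrow> bool" where
  "nonlocal_derivative J c D \<longleftrightarrow>
     bounded_operator_L2 D \<and> translation_invariant D \<and>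
     (\<forall>v\<in>L2. AE x in lebesgue.
        convol J v x - of_real (moment J 0) * v x = of_real (c\<^sup>2) * D (D v) x) \<and>
     positive_operator (\<lambda>v. hilbert_transform (D v)) \<and>
     (\<forall>v\<in>L2. \<forall>v'\<in>L2. weak_derivative v v' \<longrightarrow>
        (\<forall>w\<in>L2. ((\<lambda>h. L2_inner (\<lambda>x. of_real (inverse h) * dilation h (D (dilation (inverse h) v)) x) w)
                    \<longlongrightarrow> L2_inner v' w) (at_right 0)))"

definition bounded_derivatives_upto :: "nat \<Rightarrow> (real \<Rightarrow> real) \<Rightarrow> bool" where
  "bounded_derivatives_upto l \<psi> \<longleftrightarrow>
     (\<forall>k<l. \<forall>x. (deriv ^^ k) \<psi> differentiable (at x)) \<and>
     (\<forall>k\<le>l. bounded (range ((deriv ^^ k) \<psi>)))"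

text \<open>
  \<open>D\<close> is the Fourier multiplier with symbol \<open>2 \<pi> \<i> \<psi>\<close>, which is the meaning of the double integral
  for general \<open>v \<in> L2\<close>; where both iterated integrals exist as Lebesgue integrals, the formula also
  holds literally.
\<close>

definition has_double_integral_form ::
    "((real \<Rightarrow> complex) \<Rightarrow> (real \<Rightarrow> complex)) \<Rightarrow> (real \<Rightarrow> real) \<Rightarrow> bool" where
  "has_double_integral_form D \<psi> \<longleftrightarrow>
     (\<forall>v\<in>L2. \<exists>f. is_fourier_L2 v f \<and>
        is_fourier_L2 (D v) (\<lambda>\<xi>. 2 * of_real pi * \<i> * of_real (\<psi> \<xi>) * f \<xi>)) \<and>
     (\<forall>v\<in>L2. integrable lebesgue v \<longrightarrow>
        integrable lebesgue (\<lambda>\<xi>. of_real (\<psi> \<xi>) * fourier_integral v \<xi>) \<longrightarrow>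
        (AE x in lebesgue. D v x =
           (LINT \<xi>|lebesgue. LINT y|lebesgue.
              2 * of_real pi * \<i> * of_real (\<psi> \<xi>) * fourier_char (\<xi> * (x - y)) * v y)))"

end

theory Submission
  imports Defs "HOL-Probability.Probability"
begin

text \<open>
  Every operator in play is a Fourier multiplier.  Plancherel's theorem is obtained from the identity for trigonometric
  polynomials times a Gaussian, which are dense.  The pointwise principal value is identified with the
  multiplier \<open>- \<i> \<pi> sgn \<xi>\<close> at Lebesgue points: there it differs from the conjugate Poisson mean by a quantity
  that tends to \<open>0\<close>, and the conjugate Poisson mean of \<open>v\<close> is the Poisson mean of the function whose Fourier transform is
  \<open>- \<i> \<pi> sgn \<xi>\<close> times that of \<open>v\<close>.

  For existence, the Fourier transform of \<open>J\<close> has the form \<open>\<mu>\<^sub>0 - \<xi>\<^sup>2 Q(\<xi>)\<close> with \<open>Q > 0\<close> and \<open>Q(0) = 2 \<pi>\<^sup>2 \<mu>\<^sub>2\<close>;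
  take \<open>c\<^sup>2 = \<mu>\<^sub>2 / 2\<close> and \<open>\<psi>(\<xi>) = \<xi> sqrt (Q(\<xi>)) / (2 \<pi> c)\<close>.  The moments up to order \<open>l + 2\<close> make \<open>Q\<close>, and
  hence \<open>\<psi>\<close>, \<open>l\<close> times differentiable.

  For uniqueness, a translation-invariant operator is a multiplier \<open>m'\<close>; the quadratic equation gives
  \<open>c'\<^sup>2 m'\<^sup>2 = c\<^sup>2 m\<^sup>2\<close> and positivity selects the root \<open>m' = (c / c') m\<close>, so \<open>D' = (c / c') D\<close>, and the
  scaling limit, tested on a Gaussian, forces \<open>c' = c\<close>.
\<close>

section \<open>The Hilbert space of square-integrable functions\<close>

text \<open>The constant \<open>c\<close> is forced at the origin: the Fourier transform of
  \<open>J\<close> is \<mu>_0 - 2 pi^2 \<mu>_2 \<xi>^2 up to o(\<xi>^2), and the scaling limit asks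
  for a multiplier close to 2 pi i \<xi> there, so c^2 = \<mu>_2 / 2. The obstacle lies at infinity:
  Q decays like \<mu>_0 / \<xi>^2, so no positive constant bounds the radicand from below and the
  derivatives of its root cannot be estimated directly. Hence \<psi> is taken as \<xi> / sqrt (1 +
  \<xi>^2), whose derivatives are all bounded, times the root of (1 + \<xi>^2) Q, which stays above
  a positive constant. The Gaussian exp (- pi x^2) is the universal test object: it is its own
  transform, vanishes nowhere, and modulating it on one side translates it on the other.
  Plancherel's identity thus becomes an explicit integral, and multipliers are read off by dividing
  by it. Approximation is carried out in L2 and, for integrable functions, in L1 at the same time,
  since a Fourier integral is controlled pointwise by the L1 norm and not by the L2 norm.\<close>

lemma L2_measurable [measurable_dest]: "v \<in> L2 \<Longrightarrow> v \<in> borel_measurable lebesgue"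
  by (simp add: L2_def)

lemma L2_integrable_sq: "v \<in> L2 \<Longrightarrow> integrable lebesgue (\<lambda>x. (cmod (v x))\<^sup>2)"
  by (simp add: L2_def)

lemma L2_norm_nonneg [simp]: "0 \<le> L2_norm v"
  by (simp add: L2_norm_def)

lemma L2_norm_sq: "(L2_norm v)\<^sup>2 = (LINT x|lebesgue. (cmod (v x))\<^sup>2)"
  by (simp add: L2_norm_def)

lemma L2_cong_AE:
  assumes "v \<in> L2" "AE x in lebesgue. w x = v x"
  shows "w \<in> L2"
proof -
  have m: "w \<in> borel_measurable lebesgue"
    by (rule borel_measurable_AE[OF L2_measurable[OF assms(1)]]) (use assms(2) in auto)
  have "integrable lebesgue (\<lambda>x. (cmod (w x))\<^sup>2)"
    using L2_integrable_sq[OF assms(1)] assms(2) m L2_measurable[OF assms(1)]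
    by (subst integrable_cong_AE[where g="\<lambda>x. (cmod (v x))\<^sup>2"]) auto
  with m show ?thesis by (simp add: L2_def)
qed

lemma L2_norm_cong_AE:
  assumes "v \<in> L2" "AE x in lebesgue. w x = v x"
  shows "L2_norm w = L2_norm v"
  unfolding L2_norm_def using assms L2_measurable[OF L2_cong_AE[OF assms]] L2_measurable[OF assms(1)]
  by (auto intro!: arg_cong[where f=sqrt] integral_cong_AE)

lemma L2_bound:
  assumes "v \<in> L2" "w \<in> borel_measurable lebesgue" "AE x in lebesgue. cmod (w x) \<le> C * cmod (v x)"
  shows "w \<in> L2"
proof -
  have "integrable lebesgue (\<lambda>x. (cmod (w x))\<^sup>2)"
  proof (rule Bochner_Integration.integrable_bound[where f="\<lambda>x. C\<^sup>2 * (cmod (v x))\<^sup>2"])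
    show "integrable lebesgue (\<lambda>x. C\<^sup>2 * (cmod (v x))\<^sup>2)"
      using L2_integrable_sq[OF assms(1)] by simp
    show "AE x in lebesgue. norm ((cmod (w x))\<^sup>2) \<le> norm (C\<^sup>2 * (cmod (v x))\<^sup>2)"
      using assms(3) by eventually_elim (simp flip: power_mult_distrib add: power_mono)
  qed (use assms in measurable)
  with assms show ?thesis by (simp add: L2_def)
qed

lemma L2_norm_bound:
  assumes "v \<in> L2" "w \<in> borel_measurable lebesgue" "AE x in lebesgue. cmod (w x) \<le> C * cmod (v x)" "0 \<le> C"
  shows "L2_norm w \<le> C * L2_norm v"
proof -
  have "(L2_norm w)\<^sup>2 \<le> (LINT x|lebesgue. C\<^sup>2 * (cmod (v x))\<^sup>2)"
    unfolding L2_norm_sq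
  proof (rule integral_mono_AE)
    show "AE x in lebesgue. (cmod (w x))\<^sup>2 \<le> C\<^sup>2 * (cmod (v x))\<^sup>2"
      using assms(3) by eventually_elim (simp flip: power_mult_distrib add: power_mono)
  qed (use L2_integrable_sq[OF assms(1)] L2_integrable_sq[OF L2_bound[OF assms(1-3)]] in auto)
  also have "\<dots> = (C * L2_norm v)\<^sup>2" by (simp add: L2_norm_sq power_mult_distrib)
  finally show ?thesis using assms(4) by (meson L2_norm_nonneg mult_nonneg_nonneg power2_le_imp_le)
qed

lemma L2_zero [simp]: "(\<lambda>x. 0) \<in> L2"
  by (simp add: L2_def)

lemma L2_norm_zero [simp]: "L2_norm (\<lambda>x. 0) = 0"
  by (simp add: L2_norm_def)

lemma L2_cmult: "v \<in> L2 \<Longrightarrow> (\<lambda>x. c * v x) \<in> L2"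
  by (rule L2_bound[where v=v and C="cmod c"]) (auto simp: norm_mult)

lemma L2_uminus: "v \<in> L2 \<Longrightarrow> (\<lambda>x. - v x) \<in> L2"
  using L2_cmult[of v "-1"] by simp

lemma L2_cnj: "v \<in> L2 \<Longrightarrow> (\<lambda>x. cnj (v x)) \<in> L2"
  by (rule L2_bound[where v=v and C=1]) (auto simp: L2_measurable intro!: borel_measurable_continuous_on[where f=cnj] continuous_intros)

lemma L2_bounded_mult:
  assumes "v \<in> L2" "m \<in> borel_measurable lebesgue" "AE x in lebesgue. cmod (m x) \<le> C"
  shows "(\<lambda>x. m x * v x) \<in> L2"
  by (rule L2_bound[where v=v and C=C])
     (use assms L2_measurable in \<open>auto simp: norm_mult mult_right_mono\<close>)

lemma L2_add:
  assumes "v \<in> L2" "w \<in> L2" shows "(\<lambda>x. v x + w x) \<in> L2"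
proof -
  note m = L2_measurable[OF assms(1)] L2_measurable[OF assms(2)]
  have "integrable lebesgue (\<lambda>x. (cmod (v x + w x))\<^sup>2)"
  proof (rule Bochner_Integration.integrable_bound[where f="\<lambda>x. 2 * (cmod (v x))\<^sup>2 + 2 * (cmod (w x))\<^sup>2"])
    show "AE x in lebesgue. norm ((cmod (v x + w x))\<^sup>2) \<le> norm (2 * (cmod (v x))\<^sup>2 + 2 * (cmod (w x))\<^sup>2)"
    proof (rule AE_I2)
      fix x
      have "(cmod (v x + w x))\<^sup>2 \<le> (cmod (v x) + cmod (w x))\<^sup>2"
        by (simp add: norm_triangle_ineq power_mono)
      also have "\<dots> \<le> 2 * (cmod (v x))\<^sup>2 + 2 * (cmod (w x))\<^sup>2"
        using sum_squares_bound[of "cmod (v x)" "cmod (w x)"] by (simp add: power2_sum)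
      finally show "norm ((cmod (v x + w x))\<^sup>2) \<le> norm (2 * (cmod (v x))\<^sup>2 + 2 * (cmod (w x))\<^sup>2)" by simp
    qed
  qed (use assms m L2_integrable_sq in auto)
  with m show ?thesis by (simp add: L2_def)
qed

lemma L2_diff: "v \<in> L2 \<Longrightarrow> w \<in> L2 \<Longrightarrow> (\<lambda>x. v x - w x) \<in> L2"
  using L2_add[OF _ L2_uminus] by fastforce

lemma L2_mult_integrable:
  assumes "v \<in> L2" "w \<in> L2"
  shows "integrable lebesgue (\<lambda>x. v x * w x)"
proof (rule Bochner_Integration.integrable_bound[where f="\<lambda>x. (cmod (v x))\<^sup>2 + (cmod (w x))\<^sup>2"])
  show "AE x in lebesgue. norm (v x * w x) \<le> norm ((cmod (v x))\<^sup>2 + (cmod (w x))\<^sup>2)"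
  proof (rule AE_I2)
    fix x show "norm (v x * w x) \<le> norm ((cmod (v x))\<^sup>2 + (cmod (w x))\<^sup>2)"
      using sum_squares_bound[of "cmod (v x)" "cmod (w x)"] mult_nonneg_nonneg[of "cmod (v x)" "cmod (w x)"]
      unfolding norm_mult real_norm_def by linarith
  qed
qed (use assms L2_measurable L2_integrable_sq in auto)

lemma L2_norm_eq_0_iff:
  assumes "v \<in> L2" shows "L2_norm v = 0 \<longleftrightarrow> (AE x in lebesgue. v x = 0)"
  using integral_nonneg_eq_0_iff_AE[OF L2_integrable_sq[OF assms]] by (simp add: L2_norm_def)

lemma L2_Cauchy_Schwarz_abs:
  assumes "v \<in> L2" "w \<in> L2"
  shows "(LINT x|lebesgue. cmod (v x) * cmod (w x)) \<le> L2_norm v * L2_norm w"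
proof -
  define a where "a = L2_norm v"
  define b where "b = L2_norm w"
  have int: "integrable lebesgue (\<lambda>x. cmod (v x) * cmod (w x))"
    using integrable_norm[OF L2_mult_integrable[OF assms]] by (simp add: norm_mult)
  show ?thesis
  proof (cases "a = 0 \<or> b = 0")
    case True
    then have "(AE x in lebesgue. v x = 0) \<or> (AE x in lebesgue. w x = 0)"
      using assms by (simp add: a_def b_def L2_norm_eq_0_iff)
    then have "AE x in lebesgue. cmod (v x) * cmod (w x) = 0" by auto
    then have "(LINT x|lebesgue. cmod (v x) * cmod (w x)) = 0"
      by (simp cong: integral_cong_AE add: integral_eq_zero_AE)
    then show ?thesis by simp
  next
    case False
    then have ab: "a > 0" "b > 0" using L2_norm_nonneg[of v] L2_norm_nonneg[of w] by (auto simp: a_def b_def less_le)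
    \<comment> \<open>The weights balance the two squares: after integration each term contributes
      \<open>a * b / 2\<close>.\<close>
    have "(LINT x|lebesgue. cmod (v x) * cmod (w x)) \<le>
          (LINT x|lebesgue. (b / (2*a)) * (cmod (v x))\<^sup>2 + (a / (2*b)) * (cmod (w x))\<^sup>2)"
    proof (rule integral_mono)
      fix x
      have "2 * ((b * cmod (v x)) * (a * cmod (w x))) \<le> (b * cmod (v x))\<^sup>2 + (a * cmod (w x))\<^sup>2"
        using sum_squares_bound by (metis mult.assoc)
      then show "cmod (v x) * cmod (w x) \<le> (b / (2*a)) * (cmod (v x))\<^sup>2 + (a / (2*b)) * (cmod (w x))\<^sup>2"
        using ab by (simp add: field_simps power2_eq_square)
    qed (use int assms L2_integrable_sq in auto)
    also have "\<dots> = (b / (2*a)) * a\<^sup>2 + (a / (2*b)) * b\<^sup>2"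
      using assms L2_integrable_sq by (simp add: a_def b_def L2_norm_sq)
    also have "\<dots> = a * b" using ab by (simp add: field_simps power2_eq_square)
    finally show ?thesis by (simp add: a_def b_def)
  qed
qed

lemma L2_Cauchy_Schwarz:
  assumes "v \<in> L2" "w \<in> L2"
  shows "cmod (LINT x|lebesgue. v x * w x) \<le> L2_norm v * L2_norm w"
  using integral_norm_bound[of lebesgue "\<lambda>x. v x * w x"] L2_Cauchy_Schwarz_abs[OF assms]
  by (simp add: norm_mult)

lemma L2_norm_cmult: "L2_norm (\<lambda>x. c * v x) = cmod c * L2_norm v"
  by (simp add: L2_norm_def norm_mult power_mult_distrib real_sqrt_mult)

lemma L2_norm_minus_commute: "L2_norm (\<lambda>x. v x - w x) = L2_norm (\<lambda>x. w x - v x)"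
  by (simp add: L2_norm_def norm_minus_commute)

lemma L2_norm_cnj: "L2_norm (\<lambda>x. cnj (v x)) = L2_norm v"
  by (simp add: L2_norm_def)

lemma L2_norm_triangle:
  assumes "v \<in> L2" "w \<in> L2"
  shows "L2_norm (\<lambda>x. v x + w x) \<le> L2_norm v + L2_norm w"
proof -
  have int: "integrable lebesgue (\<lambda>x. cmod (v x) * cmod (w x))"
    using integrable_norm[OF L2_mult_integrable[OF assms]] by (simp add: norm_mult)
  have "(L2_norm (\<lambda>x. v x + w x))\<^sup>2 \<le>
     (LINT x|lebesgue. (cmod (v x))\<^sup>2 + 2 * (cmod (v x) * cmod (w x)) + (cmod (w x))\<^sup>2)"
    unfolding L2_norm_sq
  proof (rule integral_mono)
    fix x
    have "(cmod (v x + w x))\<^sup>2 \<le> (cmod (v x) + cmod (w x))\<^sup>2"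
      by (simp add: norm_triangle_ineq power_mono)
    then show "(cmod (v x + w x))\<^sup>2 \<le> (cmod (v x))\<^sup>2 + 2 * (cmod (v x) * cmod (w x)) + (cmod (w x))\<^sup>2"
      by (simp add: power2_sum)
  qed (use int assms L2_integrable_sq L2_add in auto)
  also have "\<dots> = (L2_norm v)\<^sup>2 + 2 * (LINT x|lebesgue. cmod (v x) * cmod (w x)) + (L2_norm w)\<^sup>2"
    using int assms L2_integrable_sq by (simp add: L2_norm_sq)
  also have "\<dots> \<le> (L2_norm v + L2_norm w)\<^sup>2"
    using L2_Cauchy_Schwarz_abs[OF assms] by (simp add: power2_sum)
  finally show ?thesis by (meson L2_norm_nonneg add_nonneg_nonneg power2_le_imp_le)
qed

lemma L2_norm_triangle_diff:
  assumes "u \<in> L2" "v \<in> L2" "w \<in> L2"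
  shows "L2_norm (\<lambda>x. u x - w x) \<le> L2_norm (\<lambda>x. u x - v x) + L2_norm (\<lambda>x. v x - w x)"
  using L2_norm_triangle[OF L2_diff[OF assms(1,2)] L2_diff[OF assms(2,3)]] by simp

lemma L2_norm_le_add_diff:
  assumes "v \<in> L2" "w \<in> L2"
  shows "L2_norm v \<le> L2_norm w + L2_norm (\<lambda>x. v x - w x)"
  using L2_norm_triangle[OF assms(2) L2_diff[OF assms]] by simp

lemma L2_eq_AE_iff:
  assumes "v \<in> L2" "w \<in> L2"
  shows "L2_norm (\<lambda>x. v x - w x) = 0 \<longleftrightarrow> (AE x in lebesgue. v x = w x)"
  using L2_norm_eq_0_iff[OF L2_diff[OF assms]] by simp

lemma L2_eq_AE_I:
  assumes "v \<in> L2" "w \<in> L2" "\<And>e. e > 0 \<Longrightarrow> L2_norm (\<lambda>x. v x - w x) \<le> e"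
  shows "AE x in lebesgue. v x = w x"
proof -
  have "L2_norm (\<lambda>x. v x - w x) \<le> 0" by (rule field_le_epsilon) (use assms(3) in simp)
  then have "L2_norm (\<lambda>x. v x - w x) = 0" using L2_norm_nonneg antisym by blast
  then show ?thesis using L2_eq_AE_iff[OF assms(1,2)] by simp
qed

section \<open>Affine changes of variable\<close>

lemma lebesgue_measurable_affine:
  fixes f :: "real \<Rightarrow> 'a::topological_space"
  assumes "c \<noteq> 0" "f \<in> borel_measurable lebesgue"
  shows "(\<lambda>x. f (t + c * x)) \<in> borel_measurable lebesgue"
  using measurable_compose[OF _ assms(2), of "\<lambda>x. t + c * x" lebesgue]
    lebesgue_affine_measurable[where c="\<lambda>_. c" and t=t] assms(1) by simp

text \<open>Lebesgue measure is a positive constant multiple of its own push-forward under the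
  affine map, so preimages of null sets are null.\<close>

lemma AE_lebesgue_affine:
  fixes c t :: real
  assumes "AE x in lebesgue. P x" "c \<noteq> 0"
  shows "AE x in lebesgue. P (t + c * x)"
proof -
  have m: "(\<lambda>x. t + c * x) \<in> lebesgue \<rightarrow>\<^sub>M lebesgue"
    using lebesgue_affine_measurable[where c="\<lambda>_. c" and t=t] assms(2) by simp
  have "AE x in density (distr lebesgue lebesgue (\<lambda>x. t + c * x)) (\<lambda>_. ennreal \<bar>c\<bar>). P x"
    using assms(1) by (subst lebesgue_real_affine[OF assms(2), of t, symmetric])
  then have "AE x in distr lebesgue lebesgue (\<lambda>x. t + c * x). P x"
    using assms(2) by (subst (asm) AE_density) auto
  then obtain N where N: "{x. \<not> P x} \<subseteq> N" "N \<in> null_sets (distr lebesgue lebesgue (\<lambda>x. t + c * x))"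
    unfolding eventually_ae_filter by auto
  then have "(\<lambda>x. t + c * x) -` N \<in> null_sets lebesgue"
    using m by (auto simp: null_sets_def emeasure_distr) (auto simp: measurable_def)
  with N(1) show ?thesis by (intro AE_I') auto
qed

lemma L2_affine:
  assumes "v \<in> L2" "c \<noteq> 0" shows "(\<lambda>x. v (t + c * x)) \<in> L2"
  using L2_integrable_sq[OF assms(1)] lebesgue_measurable_affine[OF assms(2) L2_measurable[OF assms(1)]]
    lebesgue_integrable_real_affine_iff[OF assms(2), of "\<lambda>x. (cmod (v x))\<^sup>2" t]
  by (simp add: L2_def)

lemma L2_norm_affine:
  assumes "c \<noteq> 0" shows "L2_norm (\<lambda>x. v (t + c * x)) = L2_norm v / sqrt \<bar>c\<bar>"
  using lebesgue_integral_real_affine[OF assms, of "\<lambda>x. (cmod (v x))\<^sup>2" t] assms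
  by (simp add: L2_norm_def real_sqrt_mult)

lemma L2_translate: "v \<in> L2 \<Longrightarrow> (\<lambda>x. v (x - a)) \<in> L2"
  using L2_affine[of v 1 "-a"] by (simp add: algebra_simps)

lemma L2_norm_translate: "L2_norm (\<lambda>x. v (x - a)) = L2_norm v"
  using L2_norm_affine[of 1 v "-a"] by (simp add: algebra_simps)

lemma L2_reflect: "v \<in> L2 \<Longrightarrow> (\<lambda>x. v (- x)) \<in> L2"
  using L2_affine[of v "-1" 0] by simp

lemma L2_norm_reflect: "L2_norm (\<lambda>x. v (- x)) = L2_norm v"
  using L2_norm_affine[of "-1" v 0] by simp

section \<open>Convergence and completeness\<close>

lemma L2_tendsto_subseq_AE:
  assumes "\<And>n. u n \<in> L2" "v \<in> L2" "(\<lambda>n. L2_norm (\<lambda>x. u n x - v x)) \<longlonglongrightarrow> 0"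
  shows "\<exists>r::nat \<Rightarrow> nat. strict_mono r \<and> (AE x in lebesgue. (\<lambda>n. u (r n) x) \<longlonglongrightarrow> v x)"
proof -
  have "\<exists>r::nat \<Rightarrow> nat. strict_mono r \<and> (AE x in lebesgue. (\<lambda>n. (cmod (u (r n) x - v x))\<^sup>2) \<longlonglongrightarrow> 0)"
  proof (rule tendsto_L1_AE_subseq)
    show "integrable lebesgue (\<lambda>x. (cmod (u n x - v x))\<^sup>2)" for n
      using L2_integrable_sq[OF L2_diff[OF assms(1,2)]] .
    show "(\<lambda>n. LINT x|lebesgue. norm ((cmod (u n x - v x))\<^sup>2)) \<longlonglongrightarrow> 0"
      using tendsto_power[OF assms(3), of 2] by (simp add: L2_norm_sq)
  qed
  then obtain r where r: "strict_mono r" "AE x in lebesgue. (\<lambda>n. (cmod (u (r n) x - v x))\<^sup>2) \<longlonglongrightarrow> 0" by auto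
  have "AE x in lebesgue. (\<lambda>n. u (r n) x) \<longlonglongrightarrow> v x"
    using r(2)
  proof eventually_elim
    case (elim x)
    then have "(\<lambda>n. sqrt ((cmod (u (r n) x - v x))\<^sup>2)) \<longlonglongrightarrow> sqrt 0" by (rule tendsto_real_sqrt)
    then show ?case by (simp add: tendsto_norm_zero_iff LIM_zero_iff)
  qed
  with r(1) show ?thesis by auto
qed

lemma borel_measurable_lebesgue_ident: "(\<lambda>x::real. x) \<in> borel_measurable lebesgue"
  by (simp add: measurable_completion)

lemma cmod_triangle_diff: "cmod (a - c) \<le> cmod (a - b) + cmod (b - c)"
  using norm_triangle_ineq[of "a - b" "b - c"] by simp

text \<open>Fatou's lemma gives membership of the limit as well as the bound. Completeness needs
  both, since its limit is at first known only pointwise.\<close>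

lemma L2_Fatou:
  assumes "\<And>k::nat. u k \<in> L2" "w \<in> borel_measurable lebesgue" "AE x in lebesgue. (\<lambda>k. u k x) \<longlonglongrightarrow> w x"
    and bd: "\<forall>\<^sub>F k in sequentially. L2_norm (u k) \<le> C" and "0 \<le> C"
  shows "w \<in> L2 \<and> L2_norm w \<le> C"
proof -
  note [measurable] = assms(2)
  have um [measurable]: "u k \<in> borel_measurable lebesgue" for k using assms(1) by (rule L2_measurable)
  have "(\<integral>\<^sup>+x. ennreal ((cmod (w x))\<^sup>2) \<partial>lebesgue) = (\<integral>\<^sup>+x. liminf (\<lambda>k. ennreal ((cmod (u k x))\<^sup>2)) \<partial>lebesgue)"
  proof (rule nn_integral_cong_AE)
    show "AE x in lebesgue. ennreal ((cmod (w x))\<^sup>2) = liminf (\<lambda>k. ennreal ((cmod (u k x))\<^sup>2))"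
      using assms(3)
    proof eventually_elim
      case (elim x)
      have "(\<lambda>k. ennreal ((cmod (u k x))\<^sup>2)) \<longlonglongrightarrow> ennreal ((cmod (w x))\<^sup>2)"
        by (intro tendsto_intros elim)
      then show ?case by (rule lim_imp_Liminf[OF sequentially_bot, symmetric])
    qed
  qed
  also have "\<dots> \<le> liminf (\<lambda>k. \<integral>\<^sup>+x. ennreal ((cmod (u k x))\<^sup>2) \<partial>lebesgue)"
    by (rule nn_integral_liminf) auto
  also have "\<dots> \<le> liminf (\<lambda>k. ennreal (C\<^sup>2))"
  proof (rule Liminf_mono)
    show "\<forall>\<^sub>F k in sequentially. (\<integral>\<^sup>+x. ennreal ((cmod (u k x))\<^sup>2) \<partial>lebesgue) \<le> ennreal (C\<^sup>2)"
      using bd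
    proof eventually_elim
      case (elim k)
      have "(\<integral>\<^sup>+x. ennreal ((cmod (u k x))\<^sup>2) \<partial>lebesgue) = ennreal ((L2_norm (u k))\<^sup>2)"
        using nn_integral_eq_integral[OF L2_integrable_sq[OF assms(1)]] by (simp add: L2_norm_sq)
      also have "\<dots> \<le> ennreal (C\<^sup>2)" using elim by (intro ennreal_leI power_mono) auto
      finally show ?case .
    qed
  qed
  finally have le: "(\<integral>\<^sup>+x. ennreal ((cmod (w x))\<^sup>2) \<partial>lebesgue) \<le> ennreal (C\<^sup>2)" by (simp add: Liminf_const)
  then have "integrable lebesgue (\<lambda>x. (cmod (w x))\<^sup>2)"
    by (intro integrableI_nonneg) (auto simp: le_less_trans[OF _ ennreal_less_top])
  then have w: "w \<in> L2" using assms(2) by (simp add: L2_def)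
  have "ennreal ((L2_norm w)\<^sup>2) \<le> ennreal (C\<^sup>2)"
    using le nn_integral_eq_integral[OF L2_integrable_sq[OF w]] by (simp add: L2_norm_sq)
  then have "(L2_norm w)\<^sup>2 \<le> C\<^sup>2" by (subst (asm) ennreal_le_iff) auto
  then have "L2_norm w \<le> C" using \<open>0 \<le> C\<close> by (rule power2_le_imp_le)
  with w show ?thesis by simp
qed

text \<open>The Riesz-Fischer argument: a subsequence with geometrically small differences converges
  almost everywhere, and \<open>L2_Fatou\<close>, applied to differences, makes its pointwise limit
  the norm limit of the whole sequence.\<close>

theorem L2_complete:
  assumes u: "\<And>n. u n \<in> L2"
    and Cauchy: "\<And>e. e > 0 \<Longrightarrow> \<exists>N::nat. \<forall>m\<ge>N. \<forall>n\<ge>N. L2_norm (\<lambda>x. u m x - u n x) < e"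
  shows "\<exists>v\<in>L2. (\<lambda>n. L2_norm (\<lambda>x. u n x - v x)) \<longlonglongrightarrow> 0"
proof -
  have um [measurable]: "u k \<in> borel_measurable lebesgue" for k using u by (rule L2_measurable)
  have "\<exists>N::nat. \<forall>m\<ge>N. \<forall>n\<ge>N. L2_norm (\<lambda>x. u m x - u n x) < (1/4)^k" for k :: nat
    by (rule Cauchy) simp
  then obtain N :: "nat \<Rightarrow> nat" where N: "\<And>k m n. m \<ge> N k \<Longrightarrow> n \<ge> N k \<Longrightarrow> L2_norm (\<lambda>x. u m x - u n x) < (1/4)^k"
    by metis
  \<comment> \<open>Summing all the thresholds makes \<open>r\<close> dominate both
    \<open>N k\<close> and \<open>k\<close>, and be increasing, without arranging for
    \<open>N\<close> to be monotone.\<close>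
  define r where "r k = k + (\<Sum>i\<le>k. N i)" for k
  have rN: "r k \<ge> N k" "r (Suc k) \<ge> N k" "r k \<ge> k" for k
    using member_le_sum[of k "{..k}" N] by (auto simp: r_def)
  define f where "f k x = u (r (Suc k)) x - u (r k) x" for k x
  have fL: "f k \<in> L2" for k unfolding f_def by (intro L2_diff u)
  have fN: "L2_norm (f k) \<le> (1/4)^k" for k
    unfolding f_def using N[OF rN(2,1)] by (simp add: less_imp_le)
  have fm [measurable]: "f k \<in> borel_measurable lebesgue" for k using fL by (rule L2_measurable)
  \<comment> \<open>The squared norms are at most 16^-k, so the weights 4^k leave the integral
    finite; where the weighted series is finite, its terms tend to 0 and therefore |f_k| is
    eventually at most 2^-k, which is summable.\<close>
  have "(\<integral>\<^sup>+x. (\<Sum>k. ennreal (4^k * (cmod (f k x))\<^sup>2)) \<partial>lebesgue) = (\<Sum>k. \<integral>\<^sup>+x. ennreal (4^k * (cmod (f k x))\<^sup>2) \<partial>lebesgue)"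
    by (rule nn_integral_suminf) auto
  also have "\<dots> = (\<Sum>k. ennreal (4^k * (L2_norm (f k))\<^sup>2))"
    using L2_integrable_sq[OF fL] by (subst nn_integral_eq_integral) (auto simp: L2_norm_sq)
  also have "\<dots> \<le> (\<Sum>k. ennreal ((1/4)^k))"
  proof (rule suminf_le)
    fix k
    have "4^k * (L2_norm (f k))\<^sup>2 \<le> 4^k * ((1/4)^k)\<^sup>2"
      by (intro mult_left_mono power_mono fN) auto
    also have "\<dots> = (1/4)^k" by (simp add: power2_eq_square power_divide field_simps)
    finally show "ennreal (4^k * (L2_norm (f k))\<^sup>2) \<le> ennreal ((1/4)^k)" by (rule ennreal_leI)
  qed auto
  also have "\<dots> = ennreal (\<Sum>k. (1/4)^k)"
    by (rule suminf_ennreal2) auto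
  finally have fin: "(\<integral>\<^sup>+x. (\<Sum>k. ennreal (4^k * (cmod (f k x))\<^sup>2)) \<partial>lebesgue) \<noteq> \<infinity>"
    by (auto simp: top_unique)
  have "AE x in lebesgue. (\<Sum>k. ennreal (4^k * (cmod (f k x))\<^sup>2)) \<noteq> \<infinity>"
    by (rule nn_integral_PInf_AE[OF _ fin]) auto
  then have conv: "AE x in lebesgue. convergent (\<lambda>k. u (r k) x)"
  proof eventually_elim
    case (elim x)
    have "summable (\<lambda>k. 4^k * (cmod (f k x))\<^sup>2)"
      by (rule summable_suminf_not_top) (use elim in auto)
    then have "(\<lambda>k. 4^k * (cmod (f k x))\<^sup>2) \<longlonglongrightarrow> 0" by (rule summable_LIMSEQ_zero)
    then have "\<forall>\<^sub>F k in sequentially. 4^k * (cmod (f k x))\<^sup>2 < 1" by (rule order_tendstoD) simp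
    then have "\<forall>\<^sub>F k in sequentially. norm (f k x) \<le> (1/2)^k"
    proof eventually_elim
      case (elim k)
      have "(2^k * cmod (f k x))\<^sup>2 = 4^k * (cmod (f k x))\<^sup>2"
        by (simp add: power_mult_distrib power2_eq_square flip: power_mult_distrib)
      then have "(2^k * cmod (f k x))\<^sup>2 \<le> 1\<^sup>2" using elim by simp
      then have "2^k * cmod (f k x) \<le> 1" by (rule power2_le_imp_le) simp
      then show ?case by (simp add: power_divide field_simps)
    qed
    then have "summable (\<lambda>k. f k x)"
      by (rule summable_comparison_test_ev) (simp add: summable_geometric)
    then have "convergent (\<lambda>n. \<Sum>k<n. f k x)" by (simp add: summable_iff_convergent)
    moreover have "(\<Sum>k<n. f k x) = u (r n) x - u (r 0) x" for n
      unfolding f_def by (rule sum_lessThan_telescope)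
    ultimately have "convergent (\<lambda>n. u (r n) x - u (r 0) x)" by simp
    then show ?case using convergent_add[OF _ convergent_const[of "u (r 0) x"]] by fastforce
  qed
  define v where "v x = lim (\<lambda>k. u (r k) x)" for x
  have vm: "v \<in> borel_measurable lebesgue" unfolding v_def by measurable
  have lim: "AE x in lebesgue. (\<lambda>k. u (r k) x) \<longlonglongrightarrow> v x"
    using conv by eventually_elim (simp add: v_def convergent_LIMSEQ_iff)
  have key: "(\<lambda>x. u n x - v x) \<in> L2 \<and> L2_norm (\<lambda>x. u n x - v x) \<le> e"
    if "e > 0" and n: "n \<ge> M" and M: "\<forall>m\<ge>M. \<forall>n\<ge>M. L2_norm (\<lambda>x. u m x - u n x) < e" for n M e
  proof (rule L2_Fatou[where u="\<lambda>k x. u n x - u (r k) x"])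
    show "AE x in lebesgue. (\<lambda>k. u n x - u (r k) x) \<longlonglongrightarrow> u n x - v x"
      using lim by eventually_elim (intro tendsto_intros)
    show "\<forall>\<^sub>F k in sequentially. L2_norm (\<lambda>x. u n x - u (r k) x) \<le> e"
      using eventually_ge_at_top[of M]
      by eventually_elim (use M n rN(3) in \<open>meson le_trans less_imp_le\<close>)
  qed (use u vm that L2_diff in auto)
  have "v \<in> L2"
  proof -
    obtain M where M: "\<forall>m\<ge>M. \<forall>n\<ge>M. L2_norm (\<lambda>x. u m x - u n x) < 1" using Cauchy[of 1] by auto
    have "(\<lambda>x. u M x - v x) \<in> L2" using key[of 1 M M] M by auto
    from L2_diff[OF u[of M] this] show ?thesis by simp
  qed
  moreover have "(\<lambda>n. L2_norm (\<lambda>x. u n x - v x)) \<longlonglongrightarrow> 0"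
  proof (rule LIMSEQ_I)
    fix e :: real assume "e > 0"
    then obtain M where M: "\<forall>m\<ge>M. \<forall>n\<ge>M. L2_norm (\<lambda>x. u m x - u n x) < e/2" using Cauchy[of "e/2"] by auto
    show "\<exists>M. \<forall>n\<ge>M. norm (L2_norm (\<lambda>x. u n x - v x) - 0) < e"
      using key[of "e/2" M] M \<open>e > 0\<close> by (intro exI[of _ M]) force
  qed
  ultimately show ?thesis by blast
qed

lemma L2_dominated_convergence:
  assumes "\<And>n. u n \<in> borel_measurable lebesgue" "v \<in> borel_measurable lebesgue" "g \<in> L2"
    and "AE x in lebesgue. (\<lambda>n. u n x) \<longlonglongrightarrow> v x"
    and "\<And>n. AE x in lebesgue. cmod (u n x - v x) \<le> cmod (g x)"
  shows "(\<lambda>n. L2_norm (\<lambda>x. u n x - v x)) \<longlonglongrightarrow> 0"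
proof -
  note [measurable] = assms(1,2)
  have "(\<lambda>n. LINT x|lebesgue. (cmod (u n x - v x))\<^sup>2) \<longlonglongrightarrow> (LINT x|(lebesgue::real measure). 0::real)"
  proof (rule integral_dominated_convergence[where w="\<lambda>x. (cmod (g x))\<^sup>2"])
    show "integrable lebesgue (\<lambda>x. (cmod (g x))\<^sup>2)" using L2_integrable_sq[OF assms(3)] .
    show "AE x in lebesgue. (\<lambda>n. (cmod (u n x - v x))\<^sup>2) \<longlonglongrightarrow> 0"
      using assms(4)
    proof eventually_elim
      case (elim x)
      have "(\<lambda>n. (cmod (u n x - v x))\<^sup>2) \<longlonglongrightarrow> (cmod (v x - v x))\<^sup>2"
        by (intro tendsto_intros elim)
      then show ?case by simp
    qed
    show "AE x in lebesgue. norm ((cmod (u n x - v x))\<^sup>2) \<le> (cmod (g x))\<^sup>2" for n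
      using assms(5)[of n] by eventually_elim (simp add: power_mono)
  qed auto
  then have "(\<lambda>n. sqrt (LINT x|lebesgue. (cmod (u n x - v x))\<^sup>2)) \<longlonglongrightarrow> sqrt 0"
    by (intro tendsto_real_sqrt) simp
  then show ?thesis by (simp add: L2_norm_def)
qed

lemma L1_dominated_convergence:
  fixes u :: "nat \<Rightarrow> real \<Rightarrow> complex"
  assumes "\<And>n. u n \<in> borel_measurable lebesgue" "v \<in> borel_measurable lebesgue" "integrable lebesgue g"
    and "AE x in lebesgue. (\<lambda>n. u n x) \<longlonglongrightarrow> v x"
    and "\<And>n. AE x in lebesgue. cmod (u n x - v x) \<le> g x"
  shows "(\<lambda>n. LINT x|lebesgue. cmod (u n x - v x)) \<longlonglongrightarrow> 0"
proof -
  note [measurable] = assms(1,2)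
  have "(\<lambda>n. LINT x|lebesgue. cmod (u n x - v x)) \<longlonglongrightarrow> (LINT x|(lebesgue::real measure). 0::real)"
  proof (rule integral_dominated_convergence[where w=g])
    show "AE x in lebesgue. (\<lambda>n. cmod (u n x - v x)) \<longlonglongrightarrow> 0"
      using assms(4)
    proof eventually_elim
      case (elim x)
      have "(\<lambda>n. cmod (u n x - v x)) \<longlonglongrightarrow> cmod (v x - v x)"
        by (intro tendsto_intros elim)
      then show ?case by simp
    qed
  qed (use assms in auto)
  then show ?thesis by simp
qed

section \<open>Approximation by continuous functions of compact support\<close>

lemma integrable_indicator_Icc: "integrable lebesgue (indicat_real {a..b::real})"
proof -
  have "emeasure lebesgue {a..b} < \<infinity>" by (simp add: emeasure_lborel_Icc_eq)
  then show ?thesis by (intro integrable_real_indicator) auto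
qed

lemma L2_indicator_Icc: "(\<lambda>x. c * indicator {a..b} x) \<in> L2"
proof -
  have "(\<lambda>x. c * indicator {a..b} x) \<in> borel_measurable lebesgue" by (intro measurable_completion) measurable
  moreover have "integrable lebesgue (\<lambda>x. (cmod c)\<^sup>2 * indicat_real {a..b} x)" by (intro integrable_mult_right integrable_indicator_Icc)
  moreover have "(\<lambda>x. (cmod (c * indicator {a..b} x))\<^sup>2) = (\<lambda>x. (cmod c)\<^sup>2 * indicat_real {a..b} x)"
    by (auto simp: indicator_def)
  ultimately show ?thesis by (simp add: L2_def)
qed

text \<open>Truncation in height and support gives a bounded \<open>w\<close> on a bounded interval;
  measurability provides continuous functions tending to \<open>w\<close> almost everywhere, and
  dominated convergence concludes once these have been cut down to a common majorant. One and the
  same \<open>h\<close> serves in L2 and in L1, so that later both the abstract transform and the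
  Fourier integral can be followed along one sequence.\<close>

lemma L2_approx_continuous:
  assumes v: "v \<in> L2" and e: "e > 0"
  shows "\<exists>h R. R > 0 \<and> continuous_on UNIV h \<and> (\<forall>x. \<bar>x\<bar> > R \<longrightarrow> h x = 0) \<and> h \<in> L2 \<and> integrable lebesgue h
           \<and> L2_norm (\<lambda>x. h x - v x) < e \<and> (integrable lebesgue v \<longrightarrow> (LINT x|lebesgue. cmod (h x - v x)) < e)"
proof -
  note [measurable] = borel_measurable_lebesgue_ident
  note [measurable] = L2_measurable[OF v]
  define vn where "vn n x = (if \<bar>x\<bar> \<le> real n \<and> cmod (v x) \<le> real n then v x else 0)" for n x
  have vnm [measurable]: "vn n \<in> borel_measurable lebesgue" for n unfolding vn_def by measurable
  have vnlim: "(\<lambda>n. vn n x) \<longlonglongrightarrow> v x" for x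
  proof (rule tendsto_eventually)
    obtain N where "\<bar>x\<bar> + cmod (v x) \<le> real N" using real_arch_simple by blast
    then have "\<bar>x\<bar> \<le> real n \<and> cmod (v x) \<le> real n" if "n \<ge> N" for n
      using norm_ge_zero[of "v x"] abs_ge_zero[of x] of_nat_mono[OF that, where 'a=real] by linarith
    then show "\<forall>\<^sub>F n in sequentially. vn n x = v x"
      by (intro eventually_sequentiallyI[of N]) (auto simp: vn_def)
  qed
  have vnle: "cmod (vn n x - v x) \<le> cmod (v x)" for n x by (simp add: vn_def)
  have l2: "(\<lambda>n. L2_norm (\<lambda>x. vn n x - v x)) \<longlonglongrightarrow> 0"
    by (rule L2_dominated_convergence[where g=v]) (use v vnlim vnle in auto)
  have l1: "(\<lambda>n. LINT x|lebesgue. cmod (vn n x - v x)) \<longlonglongrightarrow> 0" if "integrable lebesgue v"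
    by (rule L1_dominated_convergence[where g="\<lambda>x. cmod (v x)"]) (use that vnlim vnle in auto)
  have "\<forall>\<^sub>F n in sequentially. n > 0 \<and> L2_norm (\<lambda>x. vn n x - v x) < e/2 \<and>
           (integrable lebesgue v \<longrightarrow> (LINT x|lebesgue. cmod (vn n x - v x)) < e/2)"
  proof (cases "integrable lebesgue v")
    case True
    then show ?thesis using e
      by (intro eventually_conj order_tendstoD(2)[OF l2] eventually_gt_at_top) (simp_all add: order_tendstoD(2)[OF l1] del: less_divide_eq_numeral1)
  next
    case False
    then show ?thesis using e
      by (intro eventually_conj order_tendstoD(2)[OF l2] eventually_gt_at_top) simp_all
  qed
  then obtain n where n: "n > 0" "L2_norm (\<lambda>x. vn n x - v x) < e/2"
      "integrable lebesgue v \<Longrightarrow> (LINT x|lebesgue. cmod (vn n x - v x)) < e/2"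
    unfolding eventually_sequentially by blast
  define w where "w = vn n"
  define M where "M = real n"
  have M: "M > 0" using n(1) by (simp add: M_def)
  have wm [measurable]: "w \<in> borel_measurable lebesgue" unfolding w_def by measurable
  have wb: "cmod (w x) \<le> M" "\<bar>x\<bar> > M \<Longrightarrow> w x = 0" for x by (auto simp: w_def vn_def M_def)
  have wL: "w \<in> L2" unfolding w_def by (rule L2_bound[where v=v and C=1]) (auto simp: vn_def v)
  have wi: "integrable lebesgue w"
  proof (rule Bochner_Integration.integrable_bound[OF integrable_mult_right[OF integrable_indicator_Icc]])
    show "AE x in lebesgue. norm (w x) \<le> norm (M * indicat_real {-M..M} x)"
    proof (rule AE_I2)
      fix x show "norm (w x) \<le> norm (M * indicat_real {-M..M} x)"
        using wb[of x] M by (cases "\<bar>x\<bar> > M") (auto simp: indicator_def)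
    qed
  qed auto
  have "w measurable_on UNIV" using lebesgue_measurable_imp_measurable_on[OF wm] by simp
  then obtain N g where N: "negligible N" and g: "\<And>k::nat. continuous_on UNIV (g k)"
      and glim: "\<And>x. x \<notin> N \<Longrightarrow> (\<lambda>k. g k x) \<longlonglongrightarrow> w x"
    unfolding measurable_on_def by auto
  \<comment> \<open>The radial retraction onto the disc of radius \<open>M\<close>: it is continuous
    and fixes the values of \<open>w\<close>. Together with the cut-off \<open>chi\<close>, which is
    1 where \<open>w\<close> lives, it dominates the approximants without disturbing their
    limit.\<close>
  define clip where "clip z = of_real (M / max M (cmod z)) * z" for z :: complex
  have clip_cont: "continuous_on UNIV clip"
    unfolding clip_def using M by (intro continuous_intros) (auto simp: max_def)
  have clip_le: "cmod (clip z) \<le> M" for z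
    using M by (auto simp: clip_def norm_mult norm_divide max_def)
  have clip_id: "clip z = z" if "cmod z \<le> M" for z
    using that M by (simp add: clip_def max_def)
  define chi where "chi x = max 0 (min 1 (M + 1 - \<bar>x\<bar>))" for x :: real
  define h where "h k x = of_real (chi x) * clip (g k x)" for k x
  have chi: "0 \<le> chi x" "chi x \<le> 1" "\<bar>x\<bar> \<le> M \<Longrightarrow> chi x = 1" "\<bar>x\<bar> > M + 1 \<Longrightarrow> chi x = 0" for x
    by (auto simp: chi_def)
  have hc: "continuous_on UNIV (h k)" for k
    unfolding h_def chi_def
    by (intro continuous_intros continuous_on_compose2[OF clip_cont g]) auto
  have hm [measurable]: "h k \<in> borel_measurable lebesgue" for k
    using borel_measurable_continuous_onI[OF hc] by (simp add: measurable_completion)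
  have hb: "cmod (h k x) \<le> M * indicator {-(M+1)..M+1} x" for k x
  proof (cases "\<bar>x\<bar> > M + 1")
    case True then show ?thesis using chi(4) M by (simp add: h_def)
  next
    case False
    have "cmod (h k x) \<le> 1 * M" unfolding h_def norm_mult
      by (intro mult_mono clip_le) (use chi in auto)
    moreover have "x \<in> {-(M+1)..M+1}" using False by auto
    ultimately show ?thesis by simp
  qed
  have hlim: "AE x in lebesgue. (\<lambda>k. h k x) \<longlonglongrightarrow> w x"
  proof -
    have "N \<in> null_sets lebesgue" using N by (simp add: negligible_iff_null_sets)
    moreover have "(\<lambda>k. h k x) \<longlonglongrightarrow> w x" if "x \<notin> N" for x
    proof -
      have "isCont clip (w x)" using clip_cont by (simp add: continuous_on_eq_continuous_at)
      then have "(\<lambda>k. clip (g k x)) \<longlonglongrightarrow> clip (w x)" by (rule isCont_tendsto_compose[OF _ glim[OF that]])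
      then have "(\<lambda>k. h k x) \<longlonglongrightarrow> of_real (chi x) * clip (w x)" unfolding h_def by (intro tendsto_intros)
      moreover have "of_real (chi x) * clip (w x) = w x"
        using clip_id[OF wb(1)] wb(2) chi(3) by (cases "\<bar>x\<bar> \<le> M") (auto simp: clip_def)
      ultimately show ?thesis by simp
    qed
    ultimately show ?thesis by (intro AE_I'[of N]) auto
  qed
  define G where "G x = complex_of_real (2 * M) * indicator {-(M+1)..M+1} x" for x
  have Gn: "cmod (G x) = 2 * (M * indicat_real {-(M+1)..M+1} x)" for x
    using M by (cases "x \<in> {-(M+1)..M+1}") (simp_all add: G_def norm_mult)
  have GL: "G \<in> L2" unfolding G_def by (rule L2_indicator_Icc)
  have Gi: "integrable lebesgue (\<lambda>x. cmod (G x))"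
  proof -
    show ?thesis unfolding Gn by (intro integrable_mult_right integrable_indicator_Icc)
  qed
  have hG: "cmod (h k x - w x) \<le> cmod (G x)" for k x
  proof -
    have "cmod (w x) \<le> M * indicator {-(M+1)..M+1} x"
      using wb[of x] M by (cases "x \<in> {-(M+1)..M+1}") auto
    then have "cmod (h k x - w x) \<le> 2 * M * indicator {-(M+1)..M+1} x"
      using hb[of k x] norm_triangle_ineq4[of "h k x" "w x"] by linarith
    then show ?thesis unfolding Gn by (simp add: mult.assoc)
  qed
  have hG': "cmod (h k x) \<le> cmod (G x)" for k x
  proof -
    have "M * indicat_real {-(M+1)..M+1} x \<ge> 0" using M by simp
    then show ?thesis using hb[of k x] unfolding Gn by linarith
  qed
  have hL: "h k \<in> L2" for k
    by (rule L2_bound[where v=G and C=1]) (use hG' GL in auto)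
  have hi: "integrable lebesgue (h k)" for k
    by (rule Bochner_Integration.integrable_bound[OF Gi]) (use hG' in auto)
  have k2: "(\<lambda>k. L2_norm (\<lambda>x. h k x - w x)) \<longlonglongrightarrow> 0"
    by (rule L2_dominated_convergence[where g=G]) (use GL hlim hG in auto)
  have k1: "(\<lambda>k. LINT x|lebesgue. cmod (h k x - w x)) \<longlonglongrightarrow> 0"
    by (rule L1_dominated_convergence[where g="\<lambda>x. cmod (G x)"]) (use Gi hlim hG in auto)
  have "\<forall>\<^sub>F k in sequentially. L2_norm (\<lambda>x. h k x - w x) < e/2 \<and> (LINT x|lebesgue. cmod (h k x - w x)) < e/2"
    using e by (intro eventually_conj order_tendstoD(2)[OF k2] order_tendstoD(2)[OF k1]) auto
  then obtain k where k: "L2_norm (\<lambda>x. h k x - w x) < e/2" "(LINT x|lebesgue. cmod (h k x - w x)) < e/2"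
    unfolding eventually_sequentially by blast
  have "L2_norm (\<lambda>x. h k x - v x) < e"
    using L2_norm_triangle_diff[OF hL[of k] wL v] k(1) n(2) by (simp add: w_def)
  moreover have "(LINT x|lebesgue. cmod (h k x - v x)) < e" if vi: "integrable lebesgue v"
  proof -
    have "(LINT x|lebesgue. cmod (h k x - v x)) \<le> (LINT x|lebesgue. cmod (h k x - w x) + cmod (w x - v x))"
      by (rule integral_mono) (use hi wi vi cmod_triangle_diff in auto)
    also have "\<dots> = (LINT x|lebesgue. cmod (h k x - w x)) + (LINT x|lebesgue. cmod (w x - v x))"
      using hi wi vi by simp
    finally show ?thesis using k(2) n(3)[OF vi] by (simp add: w_def)
  qed
  moreover have "\<forall>x. \<bar>x\<bar> > M + 1 \<longrightarrow> h k x = 0" using chi(4) by (simp add: h_def)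
  moreover have "M + 1 > 0" using M by simp
  ultimately show ?thesis using hc[of k] hL[of k] hi[of k] by blast
qed

section \<open>Trigonometric polynomials and their weighted density\<close>

lemma fourier_char_add: "fourier_char (x + y) = fourier_char x * fourier_char y"
  by (simp add: fourier_char_def distrib_left exp_add)

lemma fourier_char_0 [simp]: "fourier_char 0 = 1"
  by (simp add: fourier_char_def)

lemma norm_fourier_char [simp]: "cmod (fourier_char x) = 1"
  by (simp add: fourier_char_def norm_exp)

lemma cnj_fourier_char: "cnj (fourier_char x) = fourier_char (- x)"
  by (simp add: fourier_char_def exp_cnj)

lemma fourier_char_cis: "fourier_char x = cis (2 * pi * x)"
  by (simp add: fourier_char_def cis_conv_exp mult_ac)

lemma continuous_on_fourier_char [continuous_intros]:
  "continuous_on S f \<Longrightarrow> continuous_on S (\<lambda>x. fourier_char (f x))"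
  unfolding fourier_char_def by (intro continuous_intros)

lemma fourier_char_measurable [measurable]: "fourier_char \<in> borel_measurable borel"
  by (intro borel_measurable_continuous_onI continuous_intros)

text \<open>The frequencies are arbitrary reals, so the period can be adapted to the interval on
  which an approximation is wanted, and modulations stay inside the class.\<close>

inductive_set trig_poly :: "(real \<Rightarrow> complex) set" where
  monomial: "(\<lambda>x. c * fourier_char (a * x)) \<in> trig_poly"
| add: "P \<in> trig_poly \<Longrightarrow> Q \<in> trig_poly \<Longrightarrow> (\<lambda>x. P x + Q x) \<in> trig_poly"

lemma trig_poly_const: "(\<lambda>x. c) \<in> trig_poly"
  using trig_poly.monomial[of c 0] by simp

lemma trig_poly_mult_monomial:
  "Q \<in> trig_poly \<Longrightarrow> (\<lambda>x. c * fourier_char (a * x) * Q x) \<in> trig_poly"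
proof (induction rule: trig_poly.induct)
  case (monomial d b)
  have "(\<lambda>x. c * fourier_char (a * x) * (d * fourier_char (b * x))) = (\<lambda>x. (c * d) * fourier_char ((a + b) * x))"
    by (auto simp: distrib_right fourier_char_add)
  then show ?case using trig_poly.monomial by simp
next
  case (add P Q)
  then show ?case using trig_poly.add by (simp add: distrib_left)
qed

lemma trig_poly_mult: "P \<in> trig_poly \<Longrightarrow> Q \<in> trig_poly \<Longrightarrow> (\<lambda>x. P x * Q x) \<in> trig_poly"
proof (induction rule: trig_poly.induct)
  case (monomial c a)
  then show ?case by (rule trig_poly_mult_monomial)
next
  case (add P R)
  then show ?case using trig_poly.add by (simp add: distrib_right)
qed

lemma trig_poly_continuous: "P \<in> trig_poly \<Longrightarrow> continuous_on UNIV P"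
  by (induction rule: trig_poly.induct) (intro continuous_intros; assumption)+

lemma trig_poly_measurable: "P \<in> trig_poly \<Longrightarrow> P \<in> borel_measurable borel"
  by (simp add: borel_measurable_continuous_onI trig_poly_continuous)

lemma trig_poly_bounded: "P \<in> trig_poly \<Longrightarrow> \<exists>C\<ge>0. \<forall>x. cmod (P x) \<le> C"
proof (induction rule: trig_poly.induct)
  case (monomial c a)
  then show ?case by (intro exI[of _ "cmod c"]) (simp add: norm_mult)
next
  case (add P Q)
  then obtain C D where "C \<ge> 0" "D \<ge> 0" "\<And>x. cmod (P x) \<le> C" "\<And>x. cmod (Q x) \<le> D" by auto
  then show ?case
    by (intro exI[of _ "C + D"]) (auto intro: order_trans[OF norm_triangle_ineq add_mono])
qed

text \<open>Real and imaginary part are combinations of z and its conjugate, and conjugating e(ax)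
  only reverses the frequency. This turns polynomials on the circle into trigonometric
  polynomials.\<close>

lemma trig_poly_real_polynomial:
  assumes "real_polynomial_function p"
  shows "(\<lambda>x. complex_of_real (p (fourier_char (a * x)))) \<in> trig_poly"
  using assms
proof (induction rule: real_polynomial_function.induct)
  case (linear f)
  have f: "f z = Re z * f 1 + Im z * f \<i>" for z
  proof -
    interpret bounded_linear f by fact
    have "f z = f (Re z *\<^sub>R 1 + Im z *\<^sub>R \<i>)" by (simp add: complex_eq[symmetric] scaleR_conv_of_real mult.commute flip: complex_eq)
    also have "\<dots> = Re z * f 1 + Im z * f \<i>" by (simp add: add scaleR)
    finally show ?thesis .
  qed
  have re: "complex_of_real (Re z) = (1/2) * z + (1/2) * cnj z"
   and im: "complex_of_real (Im z) = (1/(2*\<i>)) * z + (-1/(2*\<i>)) * cnj z" for z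
    by (auto simp: complex_eq_iff)
  have "complex_of_real (f (fourier_char (a * x))) =
     ((of_real (f 1) / 2 + of_real (f \<i>) / (2*\<i>)) * fourier_char (a * x) +
      (of_real (f 1) / 2 - of_real (f \<i>) / (2*\<i>)) * fourier_char ((-a) * x))" for x
    unfolding f[of "fourier_char (a * x)"] of_real_add of_real_mult re im cnj_fourier_char
    by (simp add: field_simps)
  then show ?case using trig_poly.add[OF trig_poly.monomial trig_poly.monomial] by presburger
next
  case (const c)
  then show ?case using trig_poly_const by simp
next
  case (add f g)
  then show ?case using trig_poly.add by simp
next
  case (mult f g)
  then show ?case using trig_poly_mult by simp
qed

text \<open>The line is wrapped around the circle with period 2L, and Stone-Weierstrass is applied
  to real and imaginary part there. The bound \<open>B + e\<close> on the whole line is a by-product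
  of periodicity; it does not depend on \<open>L\<close>, which lets \<open>L\<close> be enlarged
  afterwards.\<close>

lemma trig_poly_approx:
  fixes f :: "real \<Rightarrow> complex"
  assumes f: "continuous_on UNIV f" and R: "R > 0" "\<And>x. \<bar>x\<bar> > R \<Longrightarrow> f x = 0"
    and L: "L \<ge> 2 * R" and e: "e > 0" and B: "\<And>x. cmod (f x) \<le> B"
  shows "\<exists>P\<in>trig_poly. (\<forall>x. \<bar>x\<bar> \<le> L \<longrightarrow> cmod (P x - f x) \<le> e) \<and> (\<forall>x. cmod (P x) \<le> B + e)"
proof -
  have L0: "L > 0" using R L by simp
  define \<phi> where "\<phi> z = f (L * Im (Ln z) / pi)" for z
  have cont: "continuous_on (sphere 0 1) \<phi>"
  proof (rule continuous_at_imp_continuous_on, rule ballI)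
    fix z :: complex assume z: "z \<in> sphere 0 1"
    then have z0: "z \<noteq> 0" by auto
    show "isCont \<phi> z"
    proof (cases "z \<in> \<real>\<^sub>\<le>\<^sub>0")
      case False
      have "isCont f y" for y using f by (simp add: continuous_on_eq_continuous_at)
      moreover have "isCont (\<lambda>z. L * Im (Ln z) / pi) z"
        using False isCont_Ln'[OF continuous_ident, of z] by (intro continuous_intros) auto
      ultimately show ?thesis unfolding \<phi>_def by (rule isCont_o2[rotated])
    next
      case True
      then have "Re z < 0" using z0 by (auto elim!: nonpos_Reals_cases)
      \<comment> \<open>The left half of the circle corresponds to |x| > L/2, hence to |x| > R
        because \<open>L\<close> is at least \<open>2 * R\<close>. So \<phi> vanishes near the
        branch cut of \<open>Ln\<close> and is continuous across it.\<close>
      have zero: "\<phi> w = 0" if "Re w < 0" for w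
      proof -
        have "w \<noteq> 0" using that by auto
        then have "\<bar>Im (Ln w)\<bar> > pi / 2" using that Re_Ln_pos_le[of w] by (simp add: not_le[symmetric])
        then have "L * \<bar>Im (Ln w)\<bar> > L * (pi / 2)" using L0 by (rule mult_strict_left_mono)
        then have "\<bar>L * Im (Ln w) / pi\<bar> > L / 2" using L0 by (simp add: abs_mult field_simps)
        then show ?thesis unfolding \<phi>_def using L by (intro R(2)) linarith
      qed
      have "\<forall>\<^sub>F w in nhds z. Re w < 0"
        by (rule eventually_nhds_in_open[of "{w. Re w < 0}", simplified])
           (use \<open>Re z < 0\<close> in \<open>auto simp: open_halfspace_Re_lt\<close>)
      then have "\<forall>\<^sub>F w in nhds z. \<phi> w = 0" by eventually_elim (rule zero)
      then show ?thesis by (subst isCont_cong[where g="\<lambda>_. 0"]) auto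
    qed
  qed
  have per: "\<phi> (fourier_char (1/(2*L) * x)) = f x" if "\<bar>x\<bar> \<le> L" for x
  proof (cases "x = - L")
    case True
    \<comment> \<open>The endpoint -L meets the branch cut: \<open>Ln\<close> sends its image -1 to
      the parameter L instead. The function \<open>f\<close> vanishes at both.\<close>
    then have "fourier_char (1/(2*L) * x) = -1" using L0
      by (simp add: fourier_char_cis complex_eq_iff)
    then show ?thesis using R(2)[of L] R(2)[of x] L R(1) L0 True by (simp add: \<phi>_def)
  next
    case False
    have "Ln (fourier_char (1/(2*L) * x)) = \<i> * of_real (pi * x / L)"
    proof -
      have "fourier_char (1/(2*L) * x) = exp (\<i> * of_real (pi * x / L))"
        by (simp add: fourier_char_def field_simps)
      moreover have "- L < x" "x \<le> L" using that False by auto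
      then have "pi * (- L) < pi * x" "pi * x \<le> pi * L" by (intro mult_strict_left_mono mult_left_mono; simp)+
      then have "- pi < pi * x / L" "pi * x / L \<le> pi" using L0
        by (auto simp: field_simps)
      ultimately show ?thesis by (simp add: Ln_exp)
    qed
    then show ?thesis using L0 by (simp add: \<phi>_def)
  qed
  have \<phi>B: "cmod (\<phi> z) \<le> B" for z by (simp add: \<phi>_def B)
  obtain p where p: "real_polynomial_function p" "\<And>z. z \<in> sphere 0 1 \<Longrightarrow> \<bar>Re (\<phi> z) - p z\<bar> < e/2"
    using Stone_Weierstrass_real_polynomial_function[of "sphere 0 1" "\<lambda>z. Re (\<phi> z)" "e/2"] cont e
    by (auto intro!: continuous_intros)
  obtain q where q: "real_polynomial_function q" "\<And>z. z \<in> sphere 0 1 \<Longrightarrow> \<bar>Im (\<phi> z) - q z\<bar> < e/2"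
    using Stone_Weierstrass_real_polynomial_function[of "sphere 0 1" "\<lambda>z. Im (\<phi> z)" "e/2"] cont e
    by (auto intro!: continuous_intros)
  define P where "P x = complex_of_real (p (fourier_char (1/(2*L) * x))) + \<i> * complex_of_real (q (fourier_char (1/(2*L) * x)))" for x
  have "P \<in> trig_poly"
    unfolding P_def using trig_poly.add[OF trig_poly_real_polynomial[OF p(1)] trig_poly_mult[OF trig_poly_const trig_poly_real_polynomial[OF q(1)]]] .
  have PP: "cmod (P x - \<phi> (fourier_char (1/(2*L) * x))) \<le> e" for x
  proof -
    have z: "fourier_char (1/(2*L) * x) \<in> sphere 0 1" by simp
    show ?thesis
      using p(2)[OF z] q(2)[OF z] cmod_le[of "P x - \<phi> (fourier_char (1/(2*L) * x))"]
      by (simp add: P_def abs_minus_commute)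
  qed
  have "cmod (P x) \<le> B + e" for x
    using PP[of x] \<phi>B[of "fourier_char (1/(2*L) * x)"] norm_triangle_sub[of "P x" "\<phi> (fourier_char (1/(2*L) * x))"] by linarith
  with PP per \<open>P \<in> trig_poly\<close> show ?thesis by (metis)
qed

lemma L2_tail:
  assumes "v \<in> L2"
  shows "(\<lambda>n. L2_norm (\<lambda>x. indicator {x. \<bar>x\<bar> > real n} x * v x)) \<longlonglongrightarrow> 0"
proof -
  note [measurable] = borel_measurable_lebesgue_ident
  note [measurable] = L2_measurable[OF assms]
  have "(\<lambda>n. L2_norm (\<lambda>x. indicator {x. \<bar>x\<bar> > real n} x * v x - 0)) \<longlonglongrightarrow> 0"
  proof (rule L2_dominated_convergence[where g=v])
    show "AE x in lebesgue. (\<lambda>n. indicator {x. \<bar>x\<bar> > real n} x * v x) \<longlonglongrightarrow> 0"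
    proof (rule AE_I2, rule tendsto_eventually)
      fix x :: real
      obtain N where "\<bar>x\<bar> \<le> real N" using real_arch_simple by blast
      then show "\<forall>\<^sub>F n in sequentially. indicator {x. \<bar>x\<bar> > real n} x * v x = 0"
        by (intro eventually_sequentiallyI[of N]) (auto simp: indicator_def)
    qed
  qed (use assms in \<open>auto simp: norm_mult indicator_def\<close>)
  then show ?thesis by simp
qed

lemma L1_tail:
  fixes v :: "real \<Rightarrow> complex"
  assumes "integrable lebesgue v"
  shows "(\<lambda>n. LINT x|lebesgue. cmod (indicator {x. \<bar>x\<bar> > real n} x * v x)) \<longlonglongrightarrow> 0"
proof -
  note [measurable] = borel_measurable_lebesgue_ident
  have [measurable]: "v \<in> borel_measurable lebesgue" using assms by simp
  have "(\<lambda>n. LINT x|lebesgue. cmod (indicator {x. \<bar>x\<bar> > real n} x * v x - 0)) \<longlonglongrightarrow> 0"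
  proof (rule L1_dominated_convergence[where g="\<lambda>x. cmod (v x)"])
    show "AE x in lebesgue. (\<lambda>n. indicator {x. \<bar>x\<bar> > real n} x * v x) \<longlonglongrightarrow> 0"
    proof (rule AE_I2, rule tendsto_eventually)
      fix x :: real
      obtain N where "\<bar>x\<bar> \<le> real N" using real_arch_simple by blast
      then show "\<forall>\<^sub>F n in sequentially. indicator {x. \<bar>x\<bar> > real n} x * v x = 0"
        by (intro eventually_sequentiallyI[of N]) (auto simp: indicator_def)
    qed
  qed (use assms in \<open>auto simp: norm_mult indicator_def\<close>)
  then show ?thesis by simp
qed

text \<open>Approximate \<open>v\<close> by a compactly supported \<open>h\<close>, and then h / g
  by a trigonometric polynomial on a long interval. Off that interval the polynomial is merely
  bounded, but there the weight \<open>g\<close> has little mass. The length can be chosen after the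
  bound \<open>B\<close>, since the bound on the polynomial is independent of its period.\<close>

theorem trig_poly_dense:
  fixes g :: "real \<Rightarrow> real"
  assumes g: "continuous_on UNIV g" "\<And>x. g x > 0" "(\<lambda>x. complex_of_real (g x)) \<in> L2" "integrable lebesgue (\<lambda>x. complex_of_real (g x))"
    and v: "v \<in> L2" and e: "e > 0"
  shows "\<exists>P\<in>trig_poly. L2_norm (\<lambda>x. P x * of_real (g x) - v x) < e \<and>
     (integrable lebesgue v \<longrightarrow> (LINT x|lebesgue. cmod (P x * of_real (g x) - v x)) < e)"
proof -
  note [measurable] = borel_measurable_lebesgue_ident
  define G where "G x = complex_of_real (g x)" for x
  have G: "G \<in> L2" "integrable lebesgue G" using g by (simp_all add: G_def[abs_def])
  note [measurable] = L2_measurable[OF G(1)]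
  obtain h R where h: "R > 0" "continuous_on UNIV h" "\<And>x. \<bar>x\<bar> > R \<Longrightarrow> h x = 0" "h \<in> L2" "integrable lebesgue h"
     "L2_norm (\<lambda>x. h x - v x) < e/2" "integrable lebesgue v \<Longrightarrow> (LINT x|lebesgue. cmod (h x - v x)) < e/2"
    using L2_approx_continuous[OF v, of "e/2"] e by auto
  define f where "f x = h x / of_real (g x)" for x
  have fc: "continuous_on UNIV f" unfolding f_def using g h by (intro continuous_intros) (auto simp: less_imp_neq[symmetric])
  have f0: "f x = 0" if "\<bar>x\<bar> > R" for x using h(3)[OF that] by (simp add: f_def)
  have "compact (f ` {-R..R})" by (intro compact_continuous_image continuous_on_subset[OF fc]) auto
  then have "bounded (f ` {-R..R})" by (rule compact_imp_bounded)
  then obtain B where B0: "B > 0" and B: "\<And>x. x \<in> {-R..R} \<Longrightarrow> cmod (f x) \<le> B" unfolding bounded_pos by auto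
  have B: "cmod (f x) \<le> B" for x using B[of x] f0[of x] B0 by (cases "\<bar>x\<bar> > R") (auto simp: not_less abs_le_iff)
  define I where "I = (LINT x|lebesgue. cmod (G x))"
  have I: "I \<ge> 0" unfolding I_def by simp
  \<comment> \<open>Dividing by the L2 and L1 masses of the weight makes the error \<epsilon>
    \<open>G\<close> small in both norms; the minimum with 1 keeps the polynomial below
    \<open>B + 1\<close>.\<close>
  define \<epsilon> where "\<epsilon> = min 1 (e / (8 * (1 + L2_norm G + I)))"
  have D: "1 + L2_norm G + I > 0" using L2_norm_nonneg[of G] I by linarith
  have \<epsilon>: "\<epsilon> > 0" "\<epsilon> \<le> 1" using e D by (auto simp: \<epsilon>_def)
  have "\<epsilon> * (1 + L2_norm G + I) \<le> e / (8 * (1 + L2_norm G + I)) * (1 + L2_norm G + I)"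
    using D by (intro mult_right_mono) (auto simp: \<epsilon>_def)
  also have "\<dots> = e / 8" using D unfolding times_divide_eq_left by (subst frac_eq_eq) auto
  finally have "\<epsilon> * (1 + L2_norm G + I) \<le> e / 8" .
  moreover have "0 \<le> \<epsilon> * L2_norm G" "0 \<le> \<epsilon> * I" using \<epsilon> I by auto
  ultimately have \<epsilon>12: "\<epsilon> * L2_norm G \<le> e / 8" "\<epsilon> * I \<le> e / 8" using \<epsilon>(1) unfolding distrib_left by linarith+
  define T where "T n x = indicator {x. \<bar>x\<bar> > real n} x * G x" for n x
  have Tm [measurable]: "T n \<in> borel_measurable lebesgue" for n unfolding T_def by measurable
  have T2: "T n \<in> L2" for n by (rule L2_bound[where v=G and C=1]) (auto simp: T_def norm_mult indicator_def G)
  have T1: "integrable lebesgue (T n)" for n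
    by (rule Bochner_Integration.integrable_bound[OF G(2)]) (auto simp: T_def norm_mult indicator_def)
  have B1: "0 < e / (8 * (B + 1))" using e B0 by simp
  have Beq: "(B + 1) * (e / (8 * (B + 1))) = e / 8" using B0 by (subst times_divide_eq_right, subst frac_eq_eq) auto
  have "\<forall>\<^sub>F n in sequentially. real n \<ge> 2 * R \<and> L2_norm (T n) < e / (8 * (B + 1)) \<and> (LINT x|lebesgue. cmod (T n x)) < e / (8 * (B + 1))"
  proof (intro eventually_conj)
    show "\<forall>\<^sub>F n in sequentially. real n \<ge> 2 * R"
      using real_arch_simple[of "2*R"] by (metis eventually_sequentiallyI of_nat_mono order_trans)
    show "\<forall>\<^sub>F n in sequentially. L2_norm (T n) < e / (8 * (B + 1))"
      using order_tendstoD(2)[OF L2_tail[OF G(1)] B1] by (simp add: T_def[abs_def])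
    show "\<forall>\<^sub>F n in sequentially. (LINT x|lebesgue. cmod (T n x)) < e / (8 * (B + 1))"
      using order_tendstoD(2)[OF L1_tail[OF G(2)] B1] by (simp add: T_def)
  qed
  then obtain n where n: "real n \<ge> 2 * R" "L2_norm (T n) < e / (8 * (B + 1))" "(LINT x|lebesgue. cmod (T n x)) < e / (8 * (B + 1))"
    unfolding eventually_sequentially by blast
  obtain P where P: "P \<in> trig_poly" "\<And>x. \<bar>x\<bar> \<le> real n \<Longrightarrow> cmod (P x - f x) \<le> \<epsilon>" "\<And>x. cmod (P x) \<le> B + \<epsilon>"
    using trig_poly_approx[OF fc h(1) f0 n(1) \<epsilon>(1) B] by blast
  have Pm [measurable]: "P \<in> borel_measurable lebesgue"
    using trig_poly_measurable[OF P(1)] by (simp add: measurable_completion)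
  have PG: "(\<lambda>x. P x * G x) \<in> L2" by (rule L2_bounded_mult[OF G(1) Pm]) (use P(3) in auto)
  have PGi: "integrable lebesgue (\<lambda>x. P x * G x)"
    by (rule Bochner_Integration.integrable_bound[where f="\<lambda>x. (B + \<epsilon>) * cmod (G x)"])
       (use G(2) P(3) B0 \<epsilon> in \<open>auto simp: norm_mult intro!: mult_right_mono AE_I2\<close>)
  \<comment> \<open>Inside the interval the first term suffices; outside it \<open>h\<close>
    vanishes and the second term bounds the whole of \<open>P x * G x\<close>. Each term is
    nonnegative, so the sum serves everywhere.\<close>
  have pw: "cmod (P x * G x - h x) \<le> \<epsilon> * cmod (G x) + (B + 1) * cmod (T n x)" for x
  proof (cases "\<bar>x\<bar> \<le> real n")
    case True
    have gx: "of_real (g x) \<noteq> (0::complex)" using g(2)[of x] by simp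
    have "P x * G x - h x = (P x - f x) * G x" using gx by (simp add: f_def G_def field_simps)
    then have "cmod (P x * G x - h x) = cmod (P x - f x) * cmod (G x)" by (simp add: norm_mult)
    also have "\<dots> \<le> \<epsilon> * cmod (G x)" by (intro mult_right_mono P(2) True) auto
    finally show ?thesis using B0 by (smt (verit) mult_nonneg_nonneg norm_ge_zero)
  next
    case False
    then have "h x = 0" using n(1) h(1) by (intro h(3)) auto
    then have "cmod (P x * G x - h x) = cmod (P x) * cmod (G x)" by (simp add: norm_mult)
    also have "\<dots> \<le> (B + 1) * cmod (G x)" using P(3)[of x] \<epsilon>(2) by (intro mult_right_mono) auto
    also have "cmod (G x) = cmod (T n x)" using False by (simp add: T_def)
    finally show ?thesis using \<epsilon>(1) by (smt (verit) mult_nonneg_nonneg norm_ge_zero)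
  qed
  have "L2_norm (\<lambda>x. P x * G x - h x) \<le> 1 * L2_norm (\<lambda>x. complex_of_real (\<epsilon> * cmod (G x)) + complex_of_real ((B + 1) * cmod (T n x)))"
  proof (rule L2_norm_bound)
    show "AE x in lebesgue. cmod (P x * G x - h x) \<le> 1 * cmod (complex_of_real (\<epsilon> * cmod (G x)) + complex_of_real ((B + 1) * cmod (T n x)))"
    proof (rule AE_I2)
      fix x
      have "0 \<le> \<epsilon> * cmod (G x) + (B + 1) * cmod (T n x)" using \<epsilon> B0 by simp
      then show "cmod (P x * G x - h x) \<le> 1 * cmod (complex_of_real (\<epsilon> * cmod (G x)) + complex_of_real ((B + 1) * cmod (T n x)))"
        using pw[of x] unfolding of_real_add[symmetric] norm_of_real mult_1 by linarith
    qed
    show "(\<lambda>x. complex_of_real (\<epsilon> * cmod (G x)) + complex_of_real ((B + 1) * cmod (T n x))) \<in> L2"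
      by (intro L2_add L2_bound[OF G(1), where C=\<epsilon>] L2_bound[OF T2[of n], where C="B+1"]) (use \<epsilon> B0 in \<open>auto simp: norm_mult\<close>)
  qed (use PG h(4) L2_diff L2_measurable in auto)
  also have "\<dots> \<le> L2_norm (\<lambda>x. complex_of_real (\<epsilon> * cmod (G x))) + L2_norm (\<lambda>x. complex_of_real ((B + 1) * cmod (T n x)))"
    unfolding mult_1
    by (intro L2_norm_triangle L2_bound[OF G(1), where C=\<epsilon>] L2_bound[OF T2[of n], where C="B+1"]) (use \<epsilon> B0 in \<open>auto simp: norm_mult\<close>)
  also have "\<dots> = \<epsilon> * L2_norm G + (B + 1) * L2_norm (T n)"
    unfolding of_real_mult L2_norm_cmult using \<epsilon> B0 by (simp add: L2_norm_def del: of_real_add)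
  also have "\<dots> < e / 8 + (B + 1) * (e / (8 * (B + 1)))"
    using \<epsilon>12 n(2) B0 by (intro add_le_less_mono mult_strict_left_mono) auto
  also have "\<dots> = e / 4" unfolding Beq by simp
  finally have r2: "L2_norm (\<lambda>x. P x * G x - h x) < e / 4" .
  have "(LINT x|lebesgue. cmod (P x * G x - h x)) \<le> (LINT x|lebesgue. \<epsilon> * cmod (G x) + (B + 1) * cmod (T n x))"
    by (rule integral_mono) (use pw PGi h(5) G(2) T1 in auto)
  also have "\<dots> = \<epsilon> * I + (B + 1) * (LINT x|lebesgue. cmod (T n x))"
    using G(2) T1 by (simp add: I_def)
  also have "\<dots> < e / 8 + (B + 1) * (e / (8 * (B + 1)))"
    using \<epsilon>12 n(3) B0 by (intro add_le_less_mono mult_strict_left_mono) auto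
  also have "\<dots> = e / 4" unfolding Beq by simp
  finally have r1: "(LINT x|lebesgue. cmod (P x * G x - h x)) < e / 4" .
  have "L2_norm (\<lambda>x. P x * G x - v x) < e"
    using L2_norm_triangle_diff[OF PG h(4) v] r2 h(6) e by linarith
  moreover have "(LINT x|lebesgue. cmod (P x * G x - v x)) < e" if vi: "integrable lebesgue v"
  proof -
    have "(LINT x|lebesgue. cmod (P x * G x - v x)) \<le> (LINT x|lebesgue. cmod (P x * G x - h x) + cmod (h x - v x))"
      by (rule integral_mono) (use PGi h(5) vi cmod_triangle_diff in auto)
    also have "\<dots> = (LINT x|lebesgue. cmod (P x * G x - h x)) + (LINT x|lebesgue. cmod (h x - v x))"
      using PGi h(5) vi by simp
    finally show ?thesis using r1 h(7)[OF vi] e by linarith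
  qed
  ultimately show ?thesis using P(1) by (auto simp: G_def)
qed

section \<open>The Fourier transform\<close>

text \<open>The normalization of the Gaussian that is fixed by the Fourier transform with kernel
  e(-\<xi>x).\<close>

definition gauss :: "real \<Rightarrow> real" where
  "gauss x = exp (- pi * x\<^sup>2)"

lemma gauss_pos [simp]: "gauss x > 0" by (simp add: gauss_def)

lemma gauss_simps [simp]: "0 \<le> gauss x" "gauss x \<noteq> 0" "\<bar>gauss x\<bar> = gauss x"
  by (simp_all add: gauss_def)

lemma continuous_on_gauss [continuous_intros]: "continuous_on S f \<Longrightarrow> continuous_on S (\<lambda>x. gauss (f x))"
  unfolding gauss_def by (intro continuous_intros)

lemma gauss_minus [simp]: "gauss (- x) = gauss x" by (simp add: gauss_def)

lemma gauss_measurable [measurable]: "gauss \<in> borel_measurable borel"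
  by (intro borel_measurable_continuous_onI continuous_intros)

lemma std_normal_gauss: "std_normal_density (sqrt (2 * pi) * x) = gauss x / sqrt (2 * pi)"
  by (simp add: std_normal_density_def gauss_def power_mult_distrib)

lemma integrable_gauss_lborel: "integrable lborel gauss"
proof -
  have "integrable lborel (\<lambda>x. std_normal_density (0 + sqrt (2 * pi) * x))"
    by (subst lborel_integrable_real_affine_iff) auto
  from integrable_mult_right[OF this, of "sqrt (2 * pi)"] show ?thesis by (simp add: std_normal_gauss)
qed

lemma integrable_gauss: "integrable lebesgue (\<lambda>x. complex_of_real (gauss x))"
  using integrable_gauss_lborel by (subst integrable_completion) (auto simp: integrable_of_real)

lemma gauss_L2: "(\<lambda>x. complex_of_real (gauss x)) \<in> L2"
proof -
  have m: "(\<lambda>x. complex_of_real (gauss x)) \<in> borel_measurable lebesgue"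
    by (simp add: measurable_completion)
  have "integrable lebesgue (\<lambda>x. (cmod (complex_of_real (gauss x)))\<^sup>2)"
  proof (rule Bochner_Integration.integrable_bound[OF integrable_gauss])
    show "AE x in lebesgue. norm ((cmod (complex_of_real (gauss x)))\<^sup>2) \<le> norm (complex_of_real (gauss x))"
    proof (rule AE_I2)
      fix x :: real
      have "gauss x \<le> 1" by (simp add: gauss_def)
      then have "gauss x * gauss x \<le> 1 * gauss x" by (intro mult_right_mono) (simp_all add: less_imp_le)
      then show "norm ((cmod (complex_of_real (gauss x)))\<^sup>2) \<le> norm (complex_of_real (gauss x))"
        using gauss_pos[of x] by (simp add: power2_eq_square)
    qed
  qed (use m in measurable)
  with m show ?thesis by (simp add: L2_def)
qed

text \<open>The characteristic function of the standard normal distribution, rescaled by sqrt (2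
  pi); \<open>t\<close> is the argument for which the exponent becomes -2 pi \<xi> x.\<close>

lemma fourier_integral_gauss: "fourier_integral (\<lambda>x. of_real (gauss x)) \<xi> = of_real (gauss \<xi>)"
proof -
  define t where "t = - sqrt (2 * pi) * \<xi>"
  have "complex_of_real (gauss \<xi>) = char std_normal_distribution t"
    by (simp add: char_std_normal_distribution t_def gauss_def power_mult_distrib)
  also have "\<dots> = (LINT x|lborel. std_normal_density x *\<^sub>R iexp (t * x))"
    unfolding char_def by (subst integral_density) auto
  also have "\<dots> = sqrt (2 * pi) *\<^sub>R (LINT x|lborel. std_normal_density (0 + sqrt (2 * pi) * x) *\<^sub>R iexp (t * (0 + sqrt (2 * pi) * x)))"
    by (subst lborel_integral_real_affine[where c="sqrt (2 * pi)" and t=0]) auto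
  also have "\<dots> = (LINT x|lborel. sqrt (2 * pi) *\<^sub>R (std_normal_density (0 + sqrt (2 * pi) * x) *\<^sub>R iexp (t * (0 + sqrt (2 * pi) * x))))"
    by (rule integral_scaleR_right[symmetric])
  also have "\<dots> = (LINT x|lborel. of_real (gauss x) * fourier_char (- (\<xi> * x)))"
  proof (rule Bochner_Integration.integral_cong[OF refl])
    fix x :: real
    have "t * (0 + sqrt (2 * pi) * x) = - (2 * pi * \<xi> * x)"
      by (simp add: t_def)
    then have e: "iexp (t * (0 + sqrt (2 * pi) * x)) = fourier_char (- (\<xi> * x))"
      unfolding fourier_char_def by (simp only:) (simp add: mult_ac)
    show "sqrt (2 * pi) *\<^sub>R (std_normal_density (0 + sqrt (2 * pi) * x) *\<^sub>R iexp (t * (0 + sqrt (2 * pi) * x)))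
       = of_real (gauss x) * fourier_char (- (\<xi> * x))"
      unfolding e unfolding add_0 std_normal_gauss by (simp add: scaleR_conv_of_real)
  qed
  also have "\<dots> = fourier_integral (\<lambda>x. of_real (gauss x)) \<xi>"
    unfolding fourier_integral_def by (subst integral_completion) auto
  finally show ?thesis by simp
qed

definition trig_gauss :: "(real \<Rightarrow> complex) \<Rightarrow> real \<Rightarrow> complex" where
  "trig_gauss P x = P x * of_real (gauss x)"

lemma integrable_times_char:
  assumes "integrable lebesgue v"
  shows "integrable lebesgue (\<lambda>x. v x * fourier_char (a * x))"
  by (rule Bochner_Integration.integrable_bound[OF assms])
     (use assms in \<open>auto simp: norm_mult measurable_completion intro!: borel_measurable_times\<close>)

lemma integrable_times_char_minus:
  assumes "integrable lebesgue v"
  shows "integrable lebesgue (\<lambda>x. v x * fourier_char (- (\<xi> * x)))"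
  using integrable_times_char[OF assms, of "- \<xi>"] by simp

lemma trig_gauss_L2: "P \<in> trig_poly \<Longrightarrow> trig_gauss P \<in> L2"
proof -
  assume P: "P \<in> trig_poly"
  obtain C where "\<And>x. cmod (P x) \<le> C" using trig_poly_bounded[OF P] by auto
  then show ?thesis unfolding trig_gauss_def[abs_def]
    by (intro L2_bounded_mult[OF gauss_L2, where C=C]) (use trig_poly_measurable[OF P] in \<open>auto simp: measurable_completion\<close>)
qed

lemma trig_gauss_integrable: "P \<in> trig_poly \<Longrightarrow> integrable lebesgue (trig_gauss P)"
proof (induction rule: trig_poly.induct)
  case (monomial c a)
  have "integrable lebesgue (\<lambda>x. c * (of_real (gauss x) * fourier_char (a * x)))"
    by (intro integrable_mult_right integrable_times_char integrable_gauss)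
  then show ?case by (simp add: trig_gauss_def[abs_def] mult_ac)
next
  case (add P Q)
  then show ?case by (simp add: trig_gauss_def[abs_def] distrib_right)
qed

lemma fourier_integral_add:
  assumes "integrable lebesgue u" "integrable lebesgue v"
  shows "fourier_integral (\<lambda>x. u x + v x) \<xi> = fourier_integral u \<xi> + fourier_integral v \<xi>"
  unfolding fourier_integral_def distrib_right
  using assms by (intro Bochner_Integration.integral_add integrable_times_char_minus)

lemma fourier_integral_diff:
  assumes "integrable lebesgue u" "integrable lebesgue v"
  shows "fourier_integral (\<lambda>x. u x - v x) \<xi> = fourier_integral u \<xi> - fourier_integral v \<xi>"
  unfolding fourier_integral_def left_diff_distrib
  using assms by (intro Bochner_Integration.integral_diff integrable_times_char_minus)

lemma fourier_integral_cmult: "fourier_integral (\<lambda>x. c * v x) \<xi> = c * fourier_integral v \<xi>"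
  unfolding fourier_integral_def by (simp add: mult.assoc)

lemma fourier_integral_modulate: "fourier_integral (\<lambda>x. fourier_char (a * x) * v x) \<xi> = fourier_integral v (\<xi> - a)"
  unfolding fourier_integral_def
proof (intro Bochner_Integration.integral_cong refl)
  fix x
  have "fourier_char (a * x) * fourier_char (- (\<xi> * x)) = fourier_char (- ((\<xi> - a) * x))"
    unfolding fourier_char_add[symmetric] by (simp add: algebra_simps)
  then show "fourier_char (a * x) * v x * fourier_char (- (\<xi> * x)) = v x * fourier_char (- ((\<xi> - a) * x))"
    by (simp add: mult_ac)
qed

lemma norm_fourier_integral: "cmod (fourier_integral v \<xi>) \<le> (LINT x|lebesgue. cmod (v x))"
  unfolding fourier_integral_def using integral_norm_bound[of lebesgue "\<lambda>x. v x * fourier_char (- (\<xi> * x))"]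
  by (simp add: norm_mult)

lemma fourier_integral_translate: "fourier_integral (\<lambda>x. v (x - a)) \<xi> = fourier_char (- (a * \<xi>)) * fourier_integral v \<xi>"
proof -
  have "fourier_integral (\<lambda>x. v (x - a)) \<xi> = (LINT x|lebesgue. v ((a + 1 * x) - a) * fourier_char (- (\<xi> * (a + 1 * x))))"
    unfolding fourier_integral_def
    using lebesgue_integral_real_affine[of 1 "\<lambda>x. v (x - a) * fourier_char (- (\<xi> * x))" a] by simp
  also have "\<dots> = (LINT x|lebesgue. fourier_char (- (a * \<xi>)) * (v x * fourier_char (- (\<xi> * x))))"
  proof (intro Bochner_Integration.integral_cong refl)
    fix x
    have "fourier_char (- (\<xi> * (a + 1 * x))) = fourier_char (- (a * \<xi>)) * fourier_char (- (\<xi> * x))"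
      unfolding fourier_char_add[symmetric] by (simp add: algebra_simps)
    then show "v ((a + 1 * x) - a) * fourier_char (- (\<xi> * (a + 1 * x))) = fourier_char (- (a * \<xi>)) * (v x * fourier_char (- (\<xi> * x)))"
      by simp
  qed
  finally show ?thesis by (simp add: fourier_integral_def)
qed

lemma fourier_integral_scale:
  assumes "c \<noteq> 0"
  shows "fourier_integral (\<lambda>x. v (c * x)) \<xi> = fourier_integral v (\<xi> / c) / of_real \<bar>c\<bar>"
proof -
  have "fourier_integral v (\<xi> / c) = \<bar>c\<bar> *\<^sub>R (LINT x|lebesgue. v (0 + c * x) * fourier_char (- (\<xi> / c * (0 + c * x))))"
    unfolding fourier_integral_def by (rule lebesgue_integral_real_affine[OF assms])
  also have "\<dots> = of_real \<bar>c\<bar> * fourier_integral (\<lambda>x. v (c * x)) \<xi>"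
    using assms by (simp add: fourier_integral_def scaleR_conv_of_real)
  finally show ?thesis using assms by simp
qed

lemma fourier_integral_cnj: "fourier_integral (\<lambda>x. cnj (v x)) \<xi> = cnj (fourier_integral v (- \<xi>))"
  unfolding fourier_integral_def by (simp add: cnj_fourier_char flip: Bochner_Integration.integral_cnj)

lemma fourier_integral_trig_gauss_monomial:
  "fourier_integral (trig_gauss (\<lambda>x. c * fourier_char (a * x))) \<xi> = c * of_real (gauss (\<xi> - a))"
proof -
  have "trig_gauss (\<lambda>x. c * fourier_char (a * x)) = (\<lambda>x. c * (fourier_char (a * x) * of_real (gauss x)))"
    by (auto simp: trig_gauss_def)
  then show ?thesis by (simp add: fourier_integral_cmult fourier_integral_modulate fourier_integral_gauss)
qed

lemma fourier_integral_trig_gauss_add: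
  assumes "P \<in> trig_poly" "Q \<in> trig_poly"
  shows "fourier_integral (trig_gauss (\<lambda>x. P x + Q x)) \<xi> = fourier_integral (trig_gauss P) \<xi> + fourier_integral (trig_gauss Q) \<xi>"
proof -
  have "trig_gauss (\<lambda>x. P x + Q x) = (\<lambda>x. trig_gauss P x + trig_gauss Q x)"
    by (auto simp: trig_gauss_def distrib_right)
  then show ?thesis using fourier_integral_add[OF assms[THEN trig_gauss_integrable]] by simp
qed

lemma fourier_integral_trig_gauss_L2:
  "P \<in> trig_poly \<Longrightarrow> fourier_integral (trig_gauss P) \<in> L2 \<and> integrable lebesgue (fourier_integral (trig_gauss P))"
proof (induction rule: trig_poly.induct)
  case (monomial c a)
  have "fourier_integral (trig_gauss (\<lambda>x. c * fourier_char (a * x))) = (\<lambda>\<xi>. c * of_real (gauss (\<xi> - a)))"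
    by (auto simp: fourier_integral_trig_gauss_monomial)
  moreover have "integrable lebesgue (\<lambda>\<xi>. complex_of_real (gauss (\<xi> - a)))"
    using integrable_gauss lebesgue_integrable_real_affine_iff[of 1 "\<lambda>x. complex_of_real (gauss x)" "-a"] by simp
  ultimately show ?case using L2_cmult[OF L2_translate[OF gauss_L2]] by simp
next
  case (add P Q)
  have "fourier_integral (trig_gauss (\<lambda>x. P x + Q x)) = (\<lambda>\<xi>. fourier_integral (trig_gauss P) \<xi> + fourier_integral (trig_gauss Q) \<xi>)"
    using fourier_integral_trig_gauss_add add by auto
  then show ?case using L2_add add by simp
qed

lemma L2_inner_add_left:
  assumes "u \<in> L2" "v \<in> L2" "w \<in> L2"
  shows "L2_inner (\<lambda>x. u x + v x) w = L2_inner u w + L2_inner v w"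
  unfolding L2_inner_def distrib_right by (intro Bochner_Integration.integral_add L2_mult_integrable L2_cnj assms)

lemma L2_inner_add_right:
  assumes "u \<in> L2" "v \<in> L2" "w \<in> L2"
  shows "L2_inner w (\<lambda>x. u x + v x) = L2_inner w u + L2_inner w v"
  unfolding L2_inner_def complex_cnj_add distrib_left by (intro Bochner_Integration.integral_add L2_mult_integrable L2_cnj assms)

lemma L2_inner_cmult_left: "L2_inner (\<lambda>x. c * u x) w = c * L2_inner u w"
  by (simp add: L2_inner_def mult.assoc)

lemma L2_inner_cmult_right: "L2_inner u (\<lambda>x. c * w x) = cnj c * L2_inner u w"
  by (simp add: L2_inner_def mult.left_commute)

lemma L2_inner_commute: "L2_inner w u = cnj (L2_inner u w)"
  by (simp add: L2_inner_def mult.commute flip: Bochner_Integration.integral_cnj)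

lemma L2_inner_self: "L2_inner u u = of_real ((L2_norm u)\<^sup>2)"
  by (simp add: L2_inner_def L2_norm_sq complex_norm_square[symmetric] del: of_real_power flip: integral_complex_of_real)

text \<open>Completing the square separates a constant from a Gaussian centred at (a + b)/2. Since
  translated Gaussians are the transforms of modulated ones, agreement with the value found in
  \<open>L2_inner_modulated_gauss\<close> is already Plancherel's identity on generators.\<close>

lemma L2_inner_gauss:
  "L2_inner (\<lambda>x. of_real (gauss (x - a))) (\<lambda>x. of_real (gauss (x - b))) = of_real (exp (- pi * (a - b)\<^sup>2 / 2) / sqrt 2)"
proof -
  have *: "gauss (x - a) * gauss (x - b) = exp (- pi * (a - b)\<^sup>2 / 2) * gauss (- (a + b) / sqrt 2 + sqrt 2 * x)" for x
  proof -
    have "(- (a + b) / sqrt 2 + sqrt 2 * x)\<^sup>2 = (a + b)\<^sup>2 / 2 - 2 * (a + b) * x + 2 * x\<^sup>2"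
      by (simp add: power2_sum power_divide power_mult_distrib power2_eq_square field_simps)
    then have "(- (a + b) / sqrt 2 + sqrt 2 * x)\<^sup>2 + (a - b)\<^sup>2 / 2 = (x - a)\<^sup>2 + (x - b)\<^sup>2"
      by (simp add: power2_sum power2_diff field_simps)
    then have "- pi * ((x - a)\<^sup>2 + (x - b)\<^sup>2) = - pi * ((- (a + b) / sqrt 2 + sqrt 2 * x)\<^sup>2 + (a - b)\<^sup>2 / 2)" by simp
    then have "- pi * (x - a)\<^sup>2 + - pi * (x - b)\<^sup>2 = - pi * (a - b)\<^sup>2 / 2 + - pi * (- (a + b) / sqrt 2 + sqrt 2 * x)\<^sup>2"
      unfolding distrib_left by simp
    then show ?thesis unfolding gauss_def exp_add[symmetric] by simp
  qed
  have "(LINT x|lebesgue. complex_of_real (gauss x)) = sqrt 2 *\<^sub>R (LINT x|lebesgue. complex_of_real (gauss (- (a + b) / sqrt 2 + sqrt 2 * x)))"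
    using lebesgue_integral_real_affine[of "sqrt 2" "\<lambda>x. complex_of_real (gauss x)" "- (a + b) / sqrt 2"] by simp
  moreover have "(LINT x|lebesgue. complex_of_real (gauss x)) = 1"
    using fourier_integral_gauss[of 0] by (simp add: fourier_integral_def gauss_def)
  ultimately have "(LINT x|lebesgue. complex_of_real (gauss (- (a + b) / sqrt 2 + sqrt 2 * x))) = 1 / of_real (sqrt 2)"
    by (simp add: scaleR_conv_of_real field_simps del: integral_complex_of_real)
  then show ?thesis unfolding L2_inner_def complex_cnj_complex_of_real of_real_mult[symmetric] *
    by (simp only: of_real_mult Bochner_Integration.integral_mult_right_zero) simp
qed

text \<open>The product of the two Gaussians is a dilated Gaussian, so the inner product is its
  Fourier integral at the difference of the frequencies.\<close>

lemma L2_inner_modulated_gauss: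
  "L2_inner (\<lambda>x. fourier_char (a * x) * of_real (gauss x)) (\<lambda>x. fourier_char (b * x) * of_real (gauss x)) = of_real (exp (- pi * (a - b)\<^sup>2 / 2) / sqrt 2)"
proof -
  have g2: "gauss x * gauss x = gauss (sqrt 2 * x)" for x
    unfolding gauss_def exp_add[symmetric] by (simp add: power_mult_distrib)
  have "L2_inner (\<lambda>x. fourier_char (a * x) * of_real (gauss x)) (\<lambda>x. fourier_char (b * x) * of_real (gauss x))
     = fourier_integral (\<lambda>x. of_real (gauss (sqrt 2 * x))) (b - a)"
    unfolding L2_inner_def fourier_integral_def
  proof (intro Bochner_Integration.integral_cong refl)
    fix x :: real
    have "fourier_char (a * x) * fourier_char (- (b * x)) = fourier_char (- ((b - a) * x))"
      unfolding fourier_char_add[symmetric] by (simp add: algebra_simps)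
    then show "fourier_char (a * x) * of_real (gauss x) * cnj (fourier_char (b * x) * of_real (gauss x)) =
       complex_of_real (gauss (sqrt 2 * x)) * fourier_char (- ((b - a) * x))"
      unfolding g2[symmetric] of_real_mult complex_cnj_mult cnj_fourier_char complex_cnj_complex_of_real
      by (metis (no_types, opaque_lifting) mult.assoc mult.commute)
  qed
  also have "\<dots> = of_real (gauss ((b - a) / sqrt 2)) / of_real \<bar>sqrt 2\<bar>"
    using fourier_integral_scale[of "sqrt 2" "\<lambda>x. of_real (gauss x)" "b - a"] by (simp add: fourier_integral_gauss)
  also have "gauss ((b - a) / sqrt 2) = exp (- pi * (a - b)\<^sup>2 / 2)"
    by (simp add: gauss_def power_divide power2_commute)
  finally show ?thesis by simp
qed

lemma L2_inner_fourier_trig_gauss_monomial: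
  assumes "Q \<in> trig_poly"
  shows "L2_inner (fourier_integral (trig_gauss (\<lambda>x. c * fourier_char (a * x)))) (fourier_integral (trig_gauss Q)) =
         L2_inner (trig_gauss (\<lambda>x. c * fourier_char (a * x))) (trig_gauss Q)"
  using assms
proof (induction rule: trig_poly.induct)
  case (monomial d b)
  show ?case
    unfolding fourier_integral_trig_gauss_monomial[abs_def]
    by (simp add: trig_gauss_def[abs_def] mult.assoc L2_inner_cmult_left L2_inner_cmult_right L2_inner_gauss L2_inner_modulated_gauss)
next
  case (add P Q)
  have 1: "fourier_integral (trig_gauss (\<lambda>x. P x + Q x)) = (\<lambda>\<xi>. fourier_integral (trig_gauss P) \<xi> + fourier_integral (trig_gauss Q) \<xi>)"
    using fourier_integral_trig_gauss_add add by auto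
  have 2: "trig_gauss (\<lambda>x. P x + Q x) = (\<lambda>x. trig_gauss P x + trig_gauss Q x)"
    by (auto simp: trig_gauss_def distrib_right)
  show ?case unfolding 1 unfolding 2 using add
    by (simp add: L2_inner_add_right trig_gauss_L2 fourier_integral_trig_gauss_L2 trig_poly.monomial)
qed

lemma L2_inner_fourier_trig_gauss:
  assumes "P \<in> trig_poly" "Q \<in> trig_poly"
  shows "L2_inner (fourier_integral (trig_gauss P)) (fourier_integral (trig_gauss Q)) = L2_inner (trig_gauss P) (trig_gauss Q)"
  using assms
proof (induction rule: trig_poly.induct)
  case (monomial d b)
  then show ?case by (rule L2_inner_fourier_trig_gauss_monomial)
next
  case (add P R)
  have 1: "fourier_integral (trig_gauss (\<lambda>x. P x + R x)) = (\<lambda>\<xi>. fourier_integral (trig_gauss P) \<xi> + fourier_integral (trig_gauss R) \<xi>)"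
    using fourier_integral_trig_gauss_add add by auto
  have 2: "trig_gauss (\<lambda>x. P x + R x) = (\<lambda>x. trig_gauss P x + trig_gauss R x)"
    by (auto simp: trig_gauss_def distrib_right)
  show ?case unfolding 1 unfolding 2 using add
    by (simp add: L2_inner_add_left trig_gauss_L2 fourier_integral_trig_gauss_L2)
qed

lemma L2_norm_eq_of_inner_eq:
  assumes "L2_inner u u = L2_inner v v" shows "L2_norm u = L2_norm v"
  using assms unfolding L2_inner_self of_real_eq_iff
  by (simp add: power2_eq_iff_nonneg)

lemma L2_norm_fourier_trig_gauss_diff:
  assumes "P \<in> trig_poly" "Q \<in> trig_poly"
  shows "L2_norm (\<lambda>\<xi>. fourier_integral (trig_gauss P) \<xi> - fourier_integral (trig_gauss Q) \<xi>) = L2_norm (\<lambda>x. trig_gauss P x - trig_gauss Q x)"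
proof -
  define R where "R x = P x + (-1) * Q x" for x
  have R: "R \<in> trig_poly" unfolding R_def
    by (rule trig_poly.add[OF assms(1) trig_poly_mult[OF trig_poly_const assms(2)]])
  have 1: "trig_gauss R = (\<lambda>x. trig_gauss P x - trig_gauss Q x)"
    by (auto simp: trig_gauss_def R_def algebra_simps)
  have 2: "fourier_integral (trig_gauss R) = (\<lambda>\<xi>. fourier_integral (trig_gauss P) \<xi> - fourier_integral (trig_gauss Q) \<xi>)"
    unfolding 1 using fourier_integral_diff[OF assms[THEN trig_gauss_integrable]] by auto
  show ?thesis using L2_norm_eq_of_inner_eq[OF L2_inner_fourier_trig_gauss[OF R R]] unfolding 2 unfolding 1 .
qed

section \<open>The Fourier transform on L2 and Plancherel's theorem\<close>

lemma trig_gauss_dense: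
  assumes "v \<in> L2" "e > 0"
  shows "\<exists>P\<in>trig_poly. L2_norm (\<lambda>x. trig_gauss P x - v x) < e \<and>
     (integrable lebesgue v \<longrightarrow> (LINT x|lebesgue. cmod (trig_gauss P x - v x)) < e)"
  unfolding trig_gauss_def
  by (rule trig_poly_dense[OF _ gauss_pos gauss_L2 integrable_gauss assms]) (intro continuous_intros)

text \<open>Extension by isometry, stated without an approximating sequence: the distances to the
  known transforms of a dense family determine \<open>f\<close> almost everywhere. Each function
  receives its own choice, so algebraic laws hold only almost everywhere and have to be
  proved.\<close>

definition fourier :: "(real \<Rightarrow> complex) \<Rightarrow> real \<Rightarrow> complex" where
  "fourier v = (SOME f. f \<in> L2 \<and> (\<forall>P\<in>trig_poly.
      L2_norm (\<lambda>\<xi>. f \<xi> - fourier_integral (trig_gauss P) \<xi>) = L2_norm (\<lambda>x. v x - trig_gauss P x)))"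

text \<open>By the isometry on the dense family, approximants of \<open>v\<close> have Cauchy
  transforms, and completeness supplies a limit. Distances to a fixed function are continuous in the
  norm, so the isometry passes to that limit.\<close>

lemma fourier_exists:
  assumes v: "v \<in> L2"
  shows "\<exists>f. f \<in> L2 \<and> (\<forall>P\<in>trig_poly.
      L2_norm (\<lambda>\<xi>. f \<xi> - fourier_integral (trig_gauss P) \<xi>) = L2_norm (\<lambda>x. v x - trig_gauss P x))"
proof -
  have "\<exists>P\<in>trig_poly. L2_norm (\<lambda>x. trig_gauss P x - v x) < inverse (real (Suc n))" for n
    using trig_gauss_dense[OF v, of "inverse (real (Suc n))"] by auto
  then obtain P where P: "\<And>n. P n \<in> trig_poly" "\<And>n. L2_norm (\<lambda>x. trig_gauss (P n) x - v x) < inverse (real (Suc n))"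
    by metis
  note L = P(1)[THEN trig_gauss_L2] P(1)[THEN fourier_integral_trig_gauss_L2, THEN conjunct1]
  have lim0: "(\<lambda>n. L2_norm (\<lambda>x. trig_gauss (P n) x - v x)) \<longlonglongrightarrow> 0"
    by (rule tendsto_sandwich[OF _ _ tendsto_const LIMSEQ_inverse_real_of_nat])
       (intro always_eventually allI L2_norm_nonneg less_imp_le P(2))+
  have "\<exists>f\<in>L2. (\<lambda>n. L2_norm (\<lambda>\<xi>. fourier_integral (trig_gauss (P n)) \<xi> - f \<xi>)) \<longlonglongrightarrow> 0"
  proof (rule L2_complete[OF L(2)])
    fix e :: real assume e: "e > 0"
    then have "\<forall>\<^sub>F n in sequentially. L2_norm (\<lambda>x. trig_gauss (P n) x - v x) < e / 2"
      by (intro order_tendstoD(2)[OF lim0]) simp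
    then obtain N where N: "\<And>n. n \<ge> N \<Longrightarrow> L2_norm (\<lambda>x. trig_gauss (P n) x - v x) < e / 2"
      unfolding eventually_sequentially by blast
    have "L2_norm (\<lambda>\<xi>. fourier_integral (trig_gauss (P m)) \<xi> - fourier_integral (trig_gauss (P n)) \<xi>) < e" if "m \<ge> N" "n \<ge> N" for m n
      using L2_norm_triangle_diff[OF L(1)[of m] v L(1)[of n]] N[OF that(1)] N[OF that(2)]
      unfolding L2_norm_fourier_trig_gauss_diff[OF P(1) P(1)]
      by (simp add: L2_norm_minus_commute[of v])
    then show "\<exists>N. \<forall>m\<ge>N. \<forall>n\<ge>N. L2_norm (\<lambda>\<xi>. fourier_integral (trig_gauss (P m)) \<xi> - fourier_integral (trig_gauss (P n)) \<xi>) < e" by blast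
  qed
  then obtain f where f: "f \<in> L2" "(\<lambda>n. L2_norm (\<lambda>\<xi>. fourier_integral (trig_gauss (P n)) \<xi> - f \<xi>)) \<longlonglongrightarrow> 0" by blast
  have "L2_norm (\<lambda>\<xi>. f \<xi> - fourier_integral (trig_gauss Q) \<xi>) = L2_norm (\<lambda>x. v x - trig_gauss Q x)" if Q: "Q \<in> trig_poly" for Q
  proof -
    note LQ = trig_gauss_L2[OF Q] fourier_integral_trig_gauss_L2[OF Q, THEN conjunct1]
    have *: "(\<lambda>n. L2_norm (\<lambda>x. u n x - w x)) \<longlonglongrightarrow> L2_norm (\<lambda>x. z x - w x)"
      if "\<And>n. u n \<in> L2" "z \<in> L2" "w \<in> L2" and uz: "(\<lambda>n. L2_norm (\<lambda>x. u n x - z x)) \<longlonglongrightarrow> 0" for u :: "nat \<Rightarrow> real \<Rightarrow> complex" and z w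
    proof (rule LIMSEQ_I)
      fix e :: real assume "e > 0"
      then obtain N where N: "\<And>n. n \<ge> N \<Longrightarrow> L2_norm (\<lambda>x. u n x - z x) < e"
        using LIMSEQ_D[OF uz] by (auto simp: abs_of_nonneg)
      have "norm (L2_norm (\<lambda>x. u n x - w x) - L2_norm (\<lambda>x. z x - w x)) < e" if "n \<ge> N" for n
        using N[OF that] L2_norm_triangle_diff[OF \<open>u n \<in> L2\<close> \<open>z \<in> L2\<close> \<open>w \<in> L2\<close>] L2_norm_triangle_diff[OF \<open>z \<in> L2\<close> \<open>u n \<in> L2\<close> \<open>w \<in> L2\<close>]
        by (simp add: L2_norm_minus_commute[of z] abs_less_iff)
      then show "\<exists>N. \<forall>n\<ge>N. norm (L2_norm (\<lambda>x. u n x - w x) - L2_norm (\<lambda>x. z x - w x)) < e" by blast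
    qed
    show ?thesis
      using LIMSEQ_unique[OF *[OF L(2) f(1) LQ(2) f(2)]] *[OF L(1) v LQ(1) lim0]
      by (simp add: L2_norm_fourier_trig_gauss_diff[OF P(1) Q])
  qed
  with f(1) show ?thesis by blast
qed

lemma fourier_L2 [intro]: "v \<in> L2 \<Longrightarrow> fourier v \<in> L2"
  unfolding fourier_def using someI_ex[OF fourier_exists] by blast

lemma fourier_trig_gauss_diff:
  "v \<in> L2 \<Longrightarrow> P \<in> trig_poly \<Longrightarrow> L2_norm (\<lambda>\<xi>. fourier v \<xi> - fourier_integral (trig_gauss P) \<xi>) = L2_norm (\<lambda>x. v x - trig_gauss P x)"
  unfolding fourier_def using someI_ex[OF fourier_exists] by blast

text \<open>Approximants \<open>P\<close> of \<open>v\<close> and \<open>Q\<close> of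
  \<open>w\<close> combine to the approximant P + c Q, whose transform is linear because it is an
  honest integral; both sides of the claim lie close to it.\<close>

lemma fourier_linear_combination:
  assumes v: "v \<in> L2" and w: "w \<in> L2"
  shows "AE \<xi> in lebesgue. fourier (\<lambda>x. v x + c * w x) \<xi> = fourier v \<xi> + c * fourier w \<xi>"
proof (rule L2_eq_AE_I)
  have s: "(\<lambda>x. v x + c * w x) \<in> L2" by (intro L2_add L2_cmult v w)
  show "fourier (\<lambda>x. v x + c * w x) \<in> L2" by (rule fourier_L2[OF s])
  show "(\<lambda>\<xi>. fourier v \<xi> + c * fourier w \<xi>) \<in> L2" by (intro L2_add L2_cmult fourier_L2 v w)
  fix e :: real assume e: "e > 0"
  \<comment> \<open>Chosen so that d + |c| d = e/2, half of the tolerance for each of the two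
    comparisons.\<close>
  define d where "d = e / (2 * (1 + cmod c))"
  have c0: "1 + cmod c > 0" using norm_ge_zero[of c] by linarith
  have d: "d > 0" using e c0 by (simp add: d_def)
  have "(1 + cmod c) * d = e / 2" using c0 unfolding d_def times_divide_eq_right by (subst frac_eq_eq) auto
  then have d2: "d + cmod c * d = e / 2" by (simp add: distrib_right)
  obtain P where P: "P \<in> trig_poly" "L2_norm (\<lambda>x. trig_gauss P x - v x) < d" using trig_gauss_dense[OF v d] by blast
  obtain Q where Q: "Q \<in> trig_poly" "L2_norm (\<lambda>x. trig_gauss Q x - w x) < d" using trig_gauss_dense[OF w d] by blast
  define R where "R x = P x + c * Q x" for x
  have R: "R \<in> trig_poly" unfolding R_def
    by (rule trig_poly.add[OF P(1) trig_poly_mult[OF trig_poly_const Q(1)]])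
  have 1: "trig_gauss R = (\<lambda>x. trig_gauss P x + c * trig_gauss Q x)"
    by (auto simp: trig_gauss_def R_def algebra_simps)
  have 2: "fourier_integral (trig_gauss R) = (\<lambda>\<xi>. fourier_integral (trig_gauss P) \<xi> + c * fourier_integral (trig_gauss Q) \<xi>)"
    unfolding 1 using fourier_integral_add[OF trig_gauss_integrable[OF P(1)] integrable_mult_right[OF trig_gauss_integrable[OF Q(1)]]]
    by (auto simp: fourier_integral_cmult)
  have L: "fourier_integral (trig_gauss R) \<in> L2" "fourier_integral (trig_gauss P) \<in> L2" "fourier_integral (trig_gauss Q) \<in> L2"
      "trig_gauss P \<in> L2" "trig_gauss Q \<in> L2" "trig_gauss R \<in> L2"
    using fourier_integral_trig_gauss_L2 trig_gauss_L2 R P(1) Q(1) by auto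
  have comb: "L2_norm (\<lambda>x. (p x + c * q x) - (p' x + c * q' x)) \<le> L2_norm (\<lambda>x. p x - p' x) + cmod c * L2_norm (\<lambda>x. q x - q' x)"
    if "p \<in> L2" "q \<in> L2" "p' \<in> L2" "q' \<in> L2" for p q p' q'
  proof -
    have "(\<lambda>x. (p x + c * q x) - (p' x + c * q' x)) = (\<lambda>x. (p x - p' x) + c * (q x - q' x))" by (auto simp: algebra_simps)
    then show ?thesis using L2_norm_triangle[of "\<lambda>x. p x - p' x" "\<lambda>x. c * (q x - q' x)"] that
      by (simp add: L2_norm_cmult L2_diff L2_cmult)
  qed
  have a: "L2_norm (\<lambda>\<xi>. fourier (\<lambda>x. v x + c * w x) \<xi> - fourier_integral (trig_gauss R) \<xi>) \<le> e / 2"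
  proof -
    have "L2_norm (\<lambda>\<xi>. fourier (\<lambda>x. v x + c * w x) \<xi> - fourier_integral (trig_gauss R) \<xi>) = L2_norm (\<lambda>x. (v x + c * w x) - (trig_gauss P x + c * trig_gauss Q x))"
      using fourier_trig_gauss_diff[OF s R] by (simp add: 1)
    also have "\<dots> \<le> L2_norm (\<lambda>x. v x - trig_gauss P x) + cmod c * L2_norm (\<lambda>x. w x - trig_gauss Q x)"
      by (rule comb) (use v w L in auto)
    also have "\<dots> \<le> d + cmod c * d" using P(2) Q(2)
      by (intro add_mono mult_left_mono) (auto simp: L2_norm_minus_commute[of v] L2_norm_minus_commute[of w])
    finally show ?thesis using d2 by simp
  qed
  have b: "L2_norm (\<lambda>\<xi>. fourier_integral (trig_gauss R) \<xi> - (fourier v \<xi> + c * fourier w \<xi>)) \<le> e / 2"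
  proof -
    have "L2_norm (\<lambda>\<xi>. fourier_integral (trig_gauss R) \<xi> - (fourier v \<xi> + c * fourier w \<xi>)) \<le>
       L2_norm (\<lambda>\<xi>. fourier_integral (trig_gauss P) \<xi> - fourier v \<xi>) + cmod c * L2_norm (\<lambda>\<xi>. fourier_integral (trig_gauss Q) \<xi> - fourier w \<xi>)"
      unfolding 2 by (rule comb) (use fourier_L2 v w L in auto)
    also have "\<dots> \<le> d + cmod c * d" using P Q
      by (intro add_mono mult_left_mono)
         (auto simp: L2_norm_minus_commute[of _ "fourier _"] fourier_trig_gauss_diff v w L2_norm_minus_commute[of _ "trig_gauss _"])
    finally show ?thesis using d2 by simp
  qed
  show "L2_norm (\<lambda>\<xi>. fourier (\<lambda>x. v x + c * w x) \<xi> - (fourier v \<xi> + c * fourier w \<xi>)) \<le> e"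
    using L2_norm_triangle_diff[OF fourier_L2[OF s] L(1) \<open>(\<lambda>\<xi>. fourier v \<xi> + c * fourier w \<xi>) \<in> L2\<close>] a b by linarith
qed

lemma L2_norm_diff_bound:
  assumes "v \<in> L2" "w \<in> L2"
  shows "\<bar>L2_norm v - L2_norm w\<bar> \<le> L2_norm (\<lambda>x. v x - w x)"
  using L2_norm_le_add_diff[OF assms] L2_norm_le_add_diff[OF assms(2,1)] L2_norm_minus_commute[of v w] by linarith

lemma fourier_norm [simp]:
  assumes v: "v \<in> L2" shows "L2_norm (fourier v) = L2_norm v"
proof -
  have "\<bar>L2_norm (fourier v) - L2_norm v\<bar> \<le> 0 + e" if "e > 0" for e
  proof -
    obtain P where P: "P \<in> trig_poly" "L2_norm (\<lambda>x. trig_gauss P x - v x) < e / 2"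
      using trig_gauss_dense[OF v, of "e/2"] \<open>e > 0\<close> by auto
    note L = trig_gauss_L2[OF P(1)] fourier_integral_trig_gauss_L2[OF P(1), THEN conjunct1]
    have "L2_norm (fourier_integral (trig_gauss P)) = L2_norm (trig_gauss P)"
      by (rule L2_norm_eq_of_inner_eq[OF L2_inner_fourier_trig_gauss[OF P(1) P(1)]])
    then show ?thesis
      using L2_norm_diff_bound[OF fourier_L2[OF v] L(2)] L2_norm_diff_bound[OF L(1) v] P(2)
        fourier_trig_gauss_diff[OF v P(1)] L2_norm_minus_commute[of v "trig_gauss P"] by linarith
  qed
  then have "\<bar>L2_norm (fourier v) - L2_norm v\<bar> \<le> 0" by (rule field_le_epsilon)
  then show ?thesis by simp
qed

lemma fourier_add:
  "v \<in> L2 \<Longrightarrow> w \<in> L2 \<Longrightarrow> AE \<xi> in lebesgue. fourier (\<lambda>x. v x + w x) \<xi> = fourier v \<xi> + fourier w \<xi>"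
  using fourier_linear_combination[of v w 1] by simp

lemma fourier_diff:
  "v \<in> L2 \<Longrightarrow> w \<in> L2 \<Longrightarrow> AE \<xi> in lebesgue. fourier (\<lambda>x. v x - w x) \<xi> = fourier v \<xi> - fourier w \<xi>"
  using fourier_linear_combination[of v w "-1"] by simp

lemma fourier_norm_diff:
  assumes "v \<in> L2" "w \<in> L2"
  shows "L2_norm (\<lambda>\<xi>. fourier v \<xi> - fourier w \<xi>) = L2_norm (\<lambda>x. v x - w x)"
proof -
  have "AE \<xi> in lebesgue. fourier v \<xi> - fourier w \<xi> = fourier (\<lambda>x. v x - w x) \<xi>"
    using fourier_diff[OF assms] by eventually_elim simp
  then have "L2_norm (\<lambda>\<xi>. fourier v \<xi> - fourier w \<xi>) = L2_norm (fourier (\<lambda>x. v x - w x))"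
    by (intro L2_norm_cong_AE fourier_L2 L2_diff assms)
  then show ?thesis using assms by (simp add: L2_diff)
qed

lemma fourier_eq_iff:
  assumes "v \<in> L2" "w \<in> L2"
  shows "(AE \<xi> in lebesgue. fourier v \<xi> = fourier w \<xi>) \<longleftrightarrow> (AE x in lebesgue. v x = w x)"
  using fourier_norm_diff[OF assms] L2_eq_AE_iff[OF assms] L2_eq_AE_iff[OF fourier_L2 fourier_L2, OF assms] by simp

lemma fourier_cong_AE:
  assumes "v \<in> L2" "AE x in lebesgue. w x = v x"
  shows "AE \<xi> in lebesgue. fourier w \<xi> = fourier v \<xi>"
  using fourier_eq_iff[OF L2_cong_AE[OF assms] assms(1)] assms(2) by simp

lemma fourier_cmult:
  assumes v: "v \<in> L2" shows "AE \<xi> in lebesgue. fourier (\<lambda>x. c * v x) \<xi> = c * fourier v \<xi>"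
proof -
  have "L2_norm (fourier (\<lambda>x. 0)) = 0" by (simp add: fourier_norm)
  then have "AE \<xi> in lebesgue. fourier (\<lambda>x. 0) \<xi> = 0" using L2_norm_eq_0_iff[OF fourier_L2[OF L2_zero]] by blast
  with fourier_linear_combination[OF L2_zero v, of c] show ?thesis by eventually_elim simp
qed

text \<open>Polarization: norms of v + c w are preserved, and c = 1 and c = i recover the real and
  the imaginary part of the inner product.\<close>

lemma fourier_inner:
  assumes v: "v \<in> L2" and w: "w \<in> L2"
  shows "L2_inner (fourier v) (fourier w) = L2_inner v w"
proof -
  have expand: "(L2_norm (\<lambda>x. a x + c * b x))\<^sup>2 = (L2_norm a)\<^sup>2 + (cmod c)\<^sup>2 * (L2_norm b)\<^sup>2 + 2 * Re (cnj c * L2_inner a b)"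
    if a: "a \<in> L2" and b: "b \<in> L2" for a b c
  proof -
    have "complex_of_real ((L2_norm (\<lambda>x. a x + c * b x))\<^sup>2) = L2_inner (\<lambda>x. a x + c * b x) (\<lambda>x. a x + c * b x)"
      by (simp add: L2_inner_self)
    also have "\<dots> = L2_inner a a + c * cnj c * L2_inner b b + (cnj c * L2_inner a b + cnj (cnj c * L2_inner a b))"
      using a b L2_cmult[OF b, of c] L2_add[OF a L2_cmult[OF b, of c]]
      by (simp add: L2_inner_add_left L2_inner_add_right L2_inner_cmult_left L2_inner_cmult_right L2_inner_commute[of b a] algebra_simps)
    finally have "Re (complex_of_real ((L2_norm (\<lambda>x. a x + c * b x))\<^sup>2)) = Re (L2_inner a a + c * cnj c * L2_inner b b + (cnj c * L2_inner a b + cnj (cnj c * L2_inner a b)))"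
      by simp
    then show ?thesis
      unfolding L2_inner_self complex_norm_square[symmetric] by simp
  qed
  have key: "Re (cnj c * L2_inner (fourier v) (fourier w)) = Re (cnj c * L2_inner v w)" for c
  proof -
    have "AE \<xi> in lebesgue. fourier v \<xi> + c * fourier w \<xi> = fourier (\<lambda>x. v x + c * w x) \<xi>"
      using fourier_linear_combination[OF v w, of c] by eventually_elim simp
    then have "L2_norm (\<lambda>\<xi>. fourier v \<xi> + c * fourier w \<xi>) = L2_norm (fourier (\<lambda>x. v x + c * w x))"
      by (intro L2_norm_cong_AE fourier_L2 L2_add L2_cmult v w)
    also have "\<dots> = L2_norm (\<lambda>x. v x + c * w x)" by (intro fourier_norm L2_add L2_cmult v w)
    finally show ?thesis using expand[OF v w, of c] expand[OF fourier_L2[OF v] fourier_L2[OF w], of c] v w by simp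
  qed
  show ?thesis using key[of 1] key[of \<i>] by (simp add: complex_eq_iff)
qed

text \<open>Along approximants that converge in L2 and in L1 at once, the transforms tend to
  \<open>fourier v\<close> almost everywhere on a subsequence, and to the Fourier integral at every
  point.\<close>

lemma fourier_eq_fourier_integral:
  assumes v: "v \<in> L2" and vi: "integrable lebesgue v"
  shows "AE \<xi> in lebesgue. fourier v \<xi> = fourier_integral v \<xi>"
proof -
  have "\<exists>P\<in>trig_poly. L2_norm (\<lambda>x. trig_gauss P x - v x) < inverse (real (Suc n)) \<and> (LINT x|lebesgue. cmod (trig_gauss P x - v x)) < inverse (real (Suc n))" for n
    using trig_gauss_dense[OF v, of "inverse (real (Suc n))"] vi by auto
  then obtain P where P: "\<And>n. P n \<in> trig_poly" "\<And>n. L2_norm (\<lambda>x. trig_gauss (P n) x - v x) < inverse (real (Suc n))"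
     "\<And>n. (LINT x|lebesgue. cmod (trig_gauss (P n) x - v x)) < inverse (real (Suc n))"
    by metis
  note L = P(1)[THEN trig_gauss_L2] P(1)[THEN fourier_integral_trig_gauss_L2, THEN conjunct1]
  have "(\<lambda>n. L2_norm (\<lambda>\<xi>. fourier_integral (trig_gauss (P n)) \<xi> - fourier v \<xi>)) \<longlonglongrightarrow> 0"
  proof (rule tendsto_sandwich[OF _ _ tendsto_const LIMSEQ_inverse_real_of_nat])
    show "\<forall>\<^sub>F n in sequentially. L2_norm (\<lambda>\<xi>. fourier_integral (trig_gauss (P n)) \<xi> - fourier v \<xi>) \<le> inverse (real (Suc n))"
      using less_imp_le[OF P(2)] fourier_trig_gauss_diff[OF v P(1)]
      by (intro always_eventually allI) (metis L2_norm_minus_commute)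
  qed simp
  from L2_tendsto_subseq_AE[OF L(2) fourier_L2[OF v] this]
  obtain r :: "nat \<Rightarrow> nat" where r: "strict_mono r" "AE \<xi> in lebesgue. (\<lambda>n. fourier_integral (trig_gauss (P (r n))) \<xi>) \<longlonglongrightarrow> fourier v \<xi>"
    by blast
  have "(\<lambda>n. fourier_integral (trig_gauss (P n)) \<xi>) \<longlonglongrightarrow> fourier_integral v \<xi>" for \<xi>
  proof -
    have "(\<lambda>n. cmod (fourier_integral (trig_gauss (P n)) \<xi> - fourier_integral v \<xi>)) \<longlonglongrightarrow> 0"
    proof (rule tendsto_sandwich[OF _ _ tendsto_const LIMSEQ_inverse_real_of_nat])
      have "cmod (fourier_integral (trig_gauss (P n)) \<xi> - fourier_integral v \<xi>) \<le> inverse (real (Suc n))" for n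
        using norm_fourier_integral[of "\<lambda>x. trig_gauss (P n) x - v x" \<xi>] P(3)[of n]
        unfolding fourier_integral_diff[OF trig_gauss_integrable[OF P(1)] vi] by linarith
      then show "\<forall>\<^sub>F n in sequentially. cmod (fourier_integral (trig_gauss (P n)) \<xi> - fourier_integral v \<xi>) \<le> inverse (real (Suc n))"
        by (intro always_eventually allI)
    qed simp
    then show ?thesis by (simp add: tendsto_norm_zero_iff LIM_zero_iff)
  qed
  from LIMSEQ_subseq_LIMSEQ[OF this r(1)]
  have "(\<lambda>n. fourier_integral (trig_gauss (P (r n))) \<xi>) \<longlonglongrightarrow> fourier_integral v \<xi>" for \<xi>
    by (simp add: o_def)
  with r(2) show ?thesis by (auto elim!: eventually_mono intro: LIMSEQ_unique)
qed

text \<open>The functions \<open>P \<cdot> gauss\<close> with \<open>P\<close> a trigonometric polynomial are dense, so operators may be compared on them.\<close>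

lemma L2_operator_eq_AE:
  assumes A: "\<And>v. v \<in> L2 \<Longrightarrow> A v \<in> L2" "\<And>v w. v \<in> L2 \<Longrightarrow> w \<in> L2 \<Longrightarrow> L2_norm (\<lambda>x. A v x - A w x) \<le> C * L2_norm (\<lambda>x. v x - w x)"
    and B: "\<And>v. v \<in> L2 \<Longrightarrow> B v \<in> L2" "\<And>v w. v \<in> L2 \<Longrightarrow> w \<in> L2 \<Longrightarrow> L2_norm (\<lambda>x. B v x - B w x) \<le> D * L2_norm (\<lambda>x. v x - w x)"
    and eq: "\<And>P. P \<in> trig_poly \<Longrightarrow> AE x in lebesgue. A (trig_gauss P) x = B (trig_gauss P) x"
    and v: "v \<in> L2"
  shows "AE x in lebesgue. A v x = B v x"
proof (rule L2_eq_AE_I[OF A(1)[OF v] B(1)[OF v]])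
  fix e :: real assume e: "e > 0"
  define d where "d = e / (\<bar>C\<bar> + \<bar>D\<bar> + 1)"
  have d: "d > 0" using e by (simp add: d_def)
  have de: "(\<bar>C\<bar> + \<bar>D\<bar>) * d \<le> e"
    unfolding d_def times_divide_eq_right using e by (subst pos_divide_le_eq) (auto simp: algebra_simps)
  obtain P where P: "P \<in> trig_poly" "L2_norm (\<lambda>x. trig_gauss P x - v x) < d"
    using trig_gauss_dense[OF v d] by blast
  note T = trig_gauss_L2[OF P(1)]
  have 1: "L2_norm (\<lambda>x. A v x - A (trig_gauss P) x) \<le> \<bar>C\<bar> * d"
    by (rule order_trans[OF A(2)[OF v T]], rule mult_mono) (use P(2) d in \<open>auto simp: L2_norm_minus_commute[of v]\<close>)
  have 2: "L2_norm (\<lambda>x. B (trig_gauss P) x - B v x) \<le> \<bar>D\<bar> * d"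
    by (rule order_trans[OF B(2)[OF T v]], rule mult_mono) (use P(2) d in auto)
  have 3: "L2_norm (\<lambda>x. A (trig_gauss P) x - B (trig_gauss P) x) = 0"
    using L2_eq_AE_iff[OF A(1)[OF T] B(1)[OF T]] eq[OF P(1)] by simp
  show "L2_norm (\<lambda>x. A v x - B v x) \<le> e"
    using L2_norm_triangle_diff[OF A(1)[OF v] A(1)[OF T] B(1)[OF v]]
      L2_norm_triangle_diff[OF A(1)[OF T] B(1)[OF T] B(1)[OF v]] 1 2 3 de
    by (simp add: distrib_right)
qed

lemma L2_char_mult: "v \<in> L2 \<Longrightarrow> (\<lambda>x. fourier_char (a * x) * v x) \<in> L2"
  by (rule L2_bounded_mult[where C=1]) (auto simp: measurable_completion)

lemma L2_norm_char_mult: "L2_norm (\<lambda>x. fourier_char (a * x) * v x) = L2_norm v"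
  by (simp add: L2_norm_def norm_mult)

lemma integrable_affine:
  fixes v :: "real \<Rightarrow> complex"
  shows "integrable lebesgue v \<Longrightarrow> c \<noteq> 0 \<Longrightarrow> integrable lebesgue (\<lambda>x. v (t + c * x))"
  by (simp add: lebesgue_integrable_real_affine_iff)

lemma integrable_translate:
  fixes v :: "real \<Rightarrow> complex"
  shows "integrable lebesgue v \<Longrightarrow> integrable lebesgue (\<lambda>x. v (x - a))"
  using integrable_affine[of v 1 "-a"] by simp

lemma integrable_reflect:
  fixes v :: "real \<Rightarrow> complex"
  shows "integrable lebesgue v \<Longrightarrow> integrable lebesgue (\<lambda>x. v (- x))"
  using integrable_affine[of v "-1" 0] by simp

lemma fourier_translate:
  assumes "v \<in> L2"
  shows "AE \<xi> in lebesgue. fourier (\<lambda>x. v (x - a)) \<xi> = fourier_char (- (a * \<xi>)) * fourier v \<xi>"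
proof (rule L2_operator_eq_AE[where A="\<lambda>v. fourier (\<lambda>x. v (x - a))" and B="\<lambda>v \<xi>. fourier_char (- (a * \<xi>)) * fourier v \<xi>" and C=1 and D=1])
  show "L2_norm (\<lambda>x. fourier (\<lambda>x. v (x - a)) x - fourier (\<lambda>x. w (x - a)) x) \<le> 1 * L2_norm (\<lambda>x. v x - w x)"
    if "v \<in> L2" "w \<in> L2" for v w
    using fourier_norm_diff[OF L2_translate[OF that(1)] L2_translate[OF that(2)]] L2_norm_translate[of "\<lambda>x. v x - w x"] by simp
  show "L2_norm (\<lambda>\<xi>. fourier_char (- (a * \<xi>)) * fourier v \<xi> - fourier_char (- (a * \<xi>)) * fourier w \<xi>) \<le> 1 * L2_norm (\<lambda>x. v x - w x)"
    if "v \<in> L2" "w \<in> L2" for v w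
    using L2_norm_char_mult[of "- a" "\<lambda>\<xi>. fourier v \<xi> - fourier w \<xi>"] fourier_norm_diff[OF that] by (simp add: right_diff_distrib)
  show "(\<lambda>\<xi>. fourier_char (- (a * \<xi>)) * fourier v \<xi>) \<in> L2" if "v \<in> L2" for v
    using L2_char_mult[OF fourier_L2[OF that], of "- a"] by simp
  show "AE \<xi> in lebesgue. fourier (\<lambda>x. trig_gauss P (x - a)) \<xi> = fourier_char (- (a * \<xi>)) * fourier (trig_gauss P) \<xi>"
    if P: "P \<in> trig_poly" for P
    using fourier_eq_fourier_integral[OF L2_translate[OF trig_gauss_L2[OF P]] integrable_translate[OF trig_gauss_integrable[OF P]], of a]
      fourier_eq_fourier_integral[OF trig_gauss_L2[OF P] trig_gauss_integrable[OF P]]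
    by eventually_elim (simp add: fourier_integral_translate)
qed (use assms in \<open>auto intro: L2_translate\<close>)

lemma fourier_scale:
  assumes "v \<in> L2" and c: "c \<noteq> 0"
  shows "AE \<xi> in lebesgue. fourier (\<lambda>x. v (c * x)) \<xi> = fourier v (\<xi> / c) / of_real \<bar>c\<bar>"
proof (rule L2_operator_eq_AE[where A="\<lambda>v. fourier (\<lambda>x. v (c * x))" and B="\<lambda>v \<xi>. fourier v (\<xi> / c) / of_real \<bar>c\<bar>" and C="1 / sqrt \<bar>c\<bar>" and D="sqrt \<bar>c\<bar> / \<bar>c\<bar>"])
  have sc: "(\<lambda>x. v (b * x)) \<in> L2" if "v \<in> L2" "b \<noteq> 0" for v b
    using L2_affine[OF that, of 0] by simp
  have nsc: "L2_norm (\<lambda>x. v (b * x)) = L2_norm v / sqrt \<bar>b\<bar>" if "b \<noteq> 0" for v b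
    using L2_norm_affine[OF that, of v 0] by simp
  show "fourier (\<lambda>x. v (c * x)) \<in> L2" if "v \<in> L2" for v using sc[OF that c] by (rule fourier_L2)
  have div: "\<xi> / c = inverse c * \<xi>" for \<xi> by (simp add: field_simps)
  show "(\<lambda>\<xi>. fourier v (\<xi> / c) / of_real \<bar>c\<bar>) \<in> L2" if "v \<in> L2" for v
    using L2_cmult[OF sc[OF fourier_L2[OF that], of "inverse c"], of "1 / of_real \<bar>c\<bar>"] c by (simp add: div)
  show "L2_norm (\<lambda>x. fourier (\<lambda>x. v (c * x)) x - fourier (\<lambda>x. w (c * x)) x) \<le> 1 / sqrt \<bar>c\<bar> * L2_norm (\<lambda>x. v x - w x)"
    if "v \<in> L2" "w \<in> L2" for v w
    using fourier_norm_diff[OF sc[OF that(1) c] sc[OF that(2) c]] nsc[OF c, of "\<lambda>x. v x - w x"] by simp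
  show "L2_norm (\<lambda>\<xi>. fourier v (\<xi> / c) / of_real \<bar>c\<bar> - fourier w (\<xi> / c) / of_real \<bar>c\<bar>) \<le> sqrt \<bar>c\<bar> / \<bar>c\<bar> * L2_norm (\<lambda>x. v x - w x)"
    if "v \<in> L2" "w \<in> L2" for v w
  proof -
    have "L2_norm (\<lambda>\<xi>. fourier v (\<xi> / c) / of_real \<bar>c\<bar> - fourier w (\<xi> / c) / of_real \<bar>c\<bar>)
        = L2_norm (\<lambda>\<xi>. (1 / of_real \<bar>c\<bar>) * (fourier v (inverse c * \<xi>) - fourier w (inverse c * \<xi>)))"
      by (simp add: div right_diff_distrib)
    also have "\<dots> = sqrt \<bar>c\<bar> / \<bar>c\<bar> * L2_norm (\<lambda>x. v x - w x)"
      unfolding L2_norm_cmult using nsc[of "inverse c" "\<lambda>x. fourier v x - fourier w x"] c fourier_norm_diff[OF that]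
      by (simp add: norm_divide norm_inverse real_sqrt_inverse divide_inverse)
    finally show ?thesis by simp
  qed
  show "AE \<xi> in lebesgue. fourier (\<lambda>x. trig_gauss P (c * x)) \<xi> = fourier (trig_gauss P) (\<xi> / c) / of_real \<bar>c\<bar>"
    if P: "P \<in> trig_poly" for P
  proof -
    have "AE \<xi> in lebesgue. fourier (trig_gauss P) (0 + inverse c * \<xi>) = fourier_integral (trig_gauss P) (0 + inverse c * \<xi>)"
      using AE_lebesgue_affine[OF fourier_eq_fourier_integral[OF trig_gauss_L2[OF P] trig_gauss_integrable[OF P]], of "inverse c" 0] c by simp
    moreover have "AE \<xi> in lebesgue. fourier (\<lambda>x. trig_gauss P (c * x)) \<xi> = fourier_integral (\<lambda>x. trig_gauss P (c * x)) \<xi>"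
      using integrable_affine[OF trig_gauss_integrable[OF P] c, of 0]
      by (intro fourier_eq_fourier_integral sc trig_gauss_L2 P c) simp
    ultimately show ?thesis
      by eventually_elim (simp add: fourier_integral_scale[OF c] div)
  qed
qed (use assms in auto)

text \<open>On the dense family, a modulation becomes a translation and then the modulation by the
  opposite frequency, which is the reflection because the Gaussian is even.\<close>

lemma fourier_fourier:
  assumes "v \<in> L2"
  shows "AE x in lebesgue. fourier (fourier v) x = v (- x)"
proof (rule L2_operator_eq_AE[where A="\<lambda>v. fourier (fourier v)" and B="\<lambda>v x. v (- x)" and C=1 and D=1])
  show "L2_norm (\<lambda>x. fourier (fourier v) x - fourier (fourier w) x) \<le> 1 * L2_norm (\<lambda>x. v x - w x)" if "v \<in> L2" "w \<in> L2" for v w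
    using fourier_norm_diff[OF fourier_L2[OF that(1)] fourier_L2[OF that(2)]] fourier_norm_diff[OF that] by simp
  show "L2_norm (\<lambda>x. v (- x) - w (- x)) \<le> 1 * L2_norm (\<lambda>x. v x - w x)" if "v \<in> L2" "w \<in> L2" for v w
    using L2_norm_reflect[of "\<lambda>x. v x - w x"] by simp
  show "AE x in lebesgue. fourier (fourier (trig_gauss P)) x = trig_gauss P (- x)" if P: "P \<in> trig_poly" for P
  proof -
    note F = fourier_integral_trig_gauss_L2[OF P]
    have "AE x in lebesgue. fourier (fourier (trig_gauss P)) x = fourier (fourier_integral (trig_gauss P)) x"
      using fourier_cong_AE[OF conjunct1[OF F] fourier_eq_fourier_integral[OF trig_gauss_L2[OF P] trig_gauss_integrable[OF P]]] .
    moreover have "AE x in lebesgue. fourier (fourier_integral (trig_gauss P)) x = fourier_integral (fourier_integral (trig_gauss P)) x"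
      using F by (intro fourier_eq_fourier_integral) auto
    moreover have "fourier_integral (fourier_integral (trig_gauss P)) x = trig_gauss P (- x)" for x
      using P
    proof (induction rule: trig_poly.induct)
      case (monomial c a)
      have "fourier_integral (fourier_integral (trig_gauss (\<lambda>x. c * fourier_char (a * x)))) x = fourier_integral (\<lambda>\<xi>. c * of_real (gauss (\<xi> - a))) x"
        by (simp add: fourier_integral_trig_gauss_monomial[abs_def])
      also have "\<dots> = c * (fourier_char (- (a * x)) * of_real (gauss x))"
        by (simp add: fourier_integral_cmult fourier_integral_translate[of "\<lambda>x. of_real (gauss x)"] fourier_integral_gauss)
      also have "\<dots> = trig_gauss (\<lambda>x. c * fourier_char (a * x)) (- x)" by (simp add: trig_gauss_def)
      finally show ?case .
    next
      case (add P Q)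
      have 1: "fourier_integral (trig_gauss (\<lambda>x. P x + Q x)) = (\<lambda>\<xi>. fourier_integral (trig_gauss P) \<xi> + fourier_integral (trig_gauss Q) \<xi>)"
        using fourier_integral_trig_gauss_add add by auto
      have "fourier_integral (\<lambda>\<xi>. fourier_integral (trig_gauss P) \<xi> + fourier_integral (trig_gauss Q) \<xi>) x = trig_gauss P (- x) + trig_gauss Q (- x)"
        using add fourier_integral_add[OF conjunct2[OF fourier_integral_trig_gauss_L2[OF add(1)]] conjunct2[OF fourier_integral_trig_gauss_L2[OF add(2)]]] by simp
      also have "\<dots> = trig_gauss (\<lambda>x. P x + Q x) (- x)" by (simp add: trig_gauss_def distrib_right)
      finally show ?case unfolding 1 .
    qed
    ultimately show ?thesis by auto
  qed
qed (use assms in \<open>auto intro: L2_reflect\<close>)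

lemma fourier_cnj:
  assumes "v \<in> L2"
  shows "AE \<xi> in lebesgue. fourier (\<lambda>x. cnj (v x)) \<xi> = cnj (fourier v (- \<xi>))"
proof (rule L2_operator_eq_AE[where A="\<lambda>v. fourier (\<lambda>x. cnj (v x))" and B="\<lambda>v \<xi>. cnj (fourier v (- \<xi>))" and C=1 and D=1])
  show "L2_norm (\<lambda>\<xi>. fourier (\<lambda>x. cnj (v x)) \<xi> - fourier (\<lambda>x. cnj (w x)) \<xi>) \<le> 1 * L2_norm (\<lambda>x. v x - w x)" if "v \<in> L2" "w \<in> L2" for v w
    using fourier_norm_diff[OF L2_cnj[OF that(1)] L2_cnj[OF that(2)]] L2_norm_cnj[of "\<lambda>x. v x - w x"] by simp
  show "L2_norm (\<lambda>\<xi>. cnj (fourier v (- \<xi>)) - cnj (fourier w (- \<xi>))) \<le> 1 * L2_norm (\<lambda>x. v x - w x)" if "v \<in> L2" "w \<in> L2" for v w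
    using fourier_norm_diff[OF that] L2_norm_cnj[of "\<lambda>\<xi>. fourier v (- \<xi>) - fourier w (- \<xi>)"]
      L2_norm_reflect[of "\<lambda>\<xi>. fourier v \<xi> - fourier w \<xi>"] by simp
  show "AE \<xi> in lebesgue. fourier (\<lambda>x. cnj (trig_gauss P x)) \<xi> = cnj (fourier (trig_gauss P) (- \<xi>))" if P: "P \<in> trig_poly" for P
  proof -
    have "AE \<xi> in lebesgue. fourier (trig_gauss P) (0 + (-1) * \<xi>) = fourier_integral (trig_gauss P) (0 + (-1) * \<xi>)"
      by (rule AE_lebesgue_affine[OF fourier_eq_fourier_integral[OF trig_gauss_L2[OF P] trig_gauss_integrable[OF P]]]) simp
    moreover have "AE \<xi> in lebesgue. fourier (\<lambda>x. cnj (trig_gauss P x)) \<xi> = fourier_integral (\<lambda>x. cnj (trig_gauss P x)) \<xi>"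
      using trig_gauss_L2[OF P] trig_gauss_integrable[OF P] by (intro fourier_eq_fourier_integral L2_cnj) auto
    ultimately show ?thesis by eventually_elim (simp add: fourier_integral_cnj)
  qed
  show "(\<lambda>\<xi>. cnj (fourier v (- \<xi>))) \<in> L2" if "v \<in> L2" for v
    by (rule L2_cnj[OF L2_reflect[OF fourier_L2[OF that]]])
qed (use assms in \<open>auto intro: L2_cnj\<close>)

definition inverse_fourier :: "(real \<Rightarrow> complex) \<Rightarrow> real \<Rightarrow> complex" where
  "inverse_fourier f x = fourier f (- x)"

lemma inverse_fourier_L2 [intro]: "f \<in> L2 \<Longrightarrow> inverse_fourier f \<in> L2"
  unfolding inverse_fourier_def[abs_def] by (intro L2_reflect fourier_L2)

lemma inverse_fourier_fourier:
  assumes "v \<in> L2" shows "AE x in lebesgue. inverse_fourier (fourier v) x = v x"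
  using AE_lebesgue_affine[OF fourier_fourier[OF assms], of "-1" 0] by (simp add: inverse_fourier_def)

lemma fourier_reflect:
  assumes "v \<in> L2" shows "AE \<xi> in lebesgue. fourier (\<lambda>x. v (- x)) \<xi> = fourier v (- \<xi>)"
  using fourier_scale[OF assms, of "-1"] by simp

lemma fourier_inverse_fourier:
  assumes "f \<in> L2" shows "AE \<xi> in lebesgue. fourier (inverse_fourier f) \<xi> = f \<xi>"
  using fourier_reflect[OF fourier_L2[OF assms]] AE_lebesgue_affine[OF fourier_fourier[OF assms], of "-1" 0]
  by (auto simp: inverse_fourier_def[abs_def])

text \<open>Parseval's identity for \<open>v\<close> and the conjugate \<open>z\<close> of
  \<open>fourier w\<close>. Conjugation reflects the transform and transforming twice reflects once
  more, so the transform of \<open>z\<close> is the conjugate of \<open>w\<close>.\<close>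

lemma fourier_multiplication_formula:
  assumes v: "v \<in> L2" and w: "w \<in> L2"
  shows "(LINT x|lebesgue. v x * fourier w x) = (LINT x|lebesgue. fourier v x * w x)"
proof -
  define z where "z x = cnj (fourier w x)" for x
  have z: "z \<in> L2" unfolding z_def by (intro L2_cnj fourier_L2 w)
  have "AE x in lebesgue. fourier z x = cnj (w x)"
  proof -
    have "AE \<xi> in lebesgue. fourier z \<xi> = cnj (fourier (fourier w) (- \<xi>))"
      unfolding z_def by (rule fourier_cnj[OF fourier_L2[OF w]])
    moreover have "AE \<xi> in lebesgue. fourier (fourier w) (- \<xi>) = w \<xi>"
      using inverse_fourier_fourier[OF w] by (simp add: inverse_fourier_def)
    ultimately show ?thesis by eventually_elim simp
  qed
  then have "L2_inner (fourier v) (fourier z) = (LINT x|lebesgue. fourier v x * w x)"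
    unfolding L2_inner_def using fourier_L2[OF v] fourier_L2[OF z] w L2_measurable
    by (intro integral_cong_AE) (auto intro!: borel_measurable_times borel_measurable_continuous_on[where f=cnj] continuous_intros)
  with fourier_inner[OF v z] show ?thesis by (simp add: L2_inner_def z_def)
qed

text \<open>A truncation of \<open>v\<close> is integrable, so its Fourier integral is its L2
  transform; by Plancherel the squared error is the mass of \<open>v\<close> outside [-R, R], which
  tends to 0.\<close>

lemma is_fourier_L2_I:
  assumes v: "v \<in> L2" and f: "f \<in> L2" and eq: "AE \<xi> in lebesgue. f \<xi> = fourier v \<xi>"
  shows "is_fourier_L2 v f"
  unfolding is_fourier_L2_def
proof (intro conjI v f)
  have tr: "(\<lambda>x. indicator {-R..R} x * v x) \<in> L2" for R :: real
  proof (rule L2_bounded_mult[OF v, where C=1])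
    show "(indicator {-R..R} :: real \<Rightarrow> complex) \<in> borel_measurable lebesgue" by (intro measurable_completion) measurable
  qed (auto simp: indicator_def)
  have tri: "integrable lebesgue (\<lambda>x. indicator {-R..R} x * v x)" for R :: real
    using L2_mult_integrable[OF L2_indicator_Icc[of 1 "-R" R] v] by simp
  have *: "(\<integral>\<^sup>+\<xi>. ennreal ((cmod (f \<xi> - fourier_integral (\<lambda>x. indicator {-R..R} x * v x) \<xi>))\<^sup>2) \<partial>lebesgue) =
        ennreal (LINT x|lebesgue. indicator (- {-R..R}) x * (cmod (v x))\<^sup>2)" for R :: real
  proof -
    let ?w = "\<lambda>x. indicator {-R..R} x * v x"
    have ae: "AE \<xi> in lebesgue. f \<xi> - fourier_integral ?w \<xi> = fourier v \<xi> - fourier ?w \<xi>"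
      using eq fourier_eq_fourier_integral[OF tr[of R] tri[of R]] by eventually_elim simp
    have d: "(\<lambda>\<xi>. fourier v \<xi> - fourier ?w \<xi>) \<in> L2" by (intro L2_diff fourier_L2 v tr)
    have "(\<integral>\<^sup>+\<xi>. ennreal ((cmod (f \<xi> - fourier_integral ?w \<xi>))\<^sup>2) \<partial>lebesgue) = (\<integral>\<^sup>+\<xi>. ennreal ((cmod (fourier v \<xi> - fourier ?w \<xi>))\<^sup>2) \<partial>lebesgue)"
      using ae by (intro nn_integral_cong_AE) (auto elim!: eventually_mono)
    also have "\<dots> = ennreal ((L2_norm (\<lambda>\<xi>. fourier v \<xi> - fourier ?w \<xi>))\<^sup>2)"
      using nn_integral_eq_integral[OF L2_integrable_sq[OF d]] by (simp add: L2_norm_sq)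
    also have "\<dots> = ennreal ((L2_norm (\<lambda>x. v x - ?w x))\<^sup>2)"
      by (simp only: fourier_norm_diff[OF v tr])
    also have "(L2_norm (\<lambda>x. v x - ?w x))\<^sup>2 = (LINT x|lebesgue. indicator (- {-R..R}) x * (cmod (v x))\<^sup>2)"
      unfolding L2_norm_sq by (intro Bochner_Integration.integral_cong) (auto simp: indicator_def)
    finally show ?thesis .
  qed
  have "((\<lambda>R. LINT x|lebesgue. indicator (- {-R..R}) x * (cmod (v x))\<^sup>2) \<longlongrightarrow> (LINT x|(lebesgue::real measure). (0::real))) at_top"
  proof (rule integral_dominated_convergence_at_top[where w="\<lambda>x. (cmod (v x))\<^sup>2"])
    show "AE x in lebesgue. ((\<lambda>R. indicator (- {-R..R}) x * (cmod (v x))\<^sup>2) \<longlongrightarrow> 0) at_top"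
    proof (rule AE_I2, rule tendsto_eventually)
      fix x :: real
      show "\<forall>\<^sub>F R in at_top. indicator (- {-R..R}) x * (cmod (v x))\<^sup>2 = 0"
        using eventually_ge_at_top[of "\<bar>x\<bar>"] by eventually_elim (auto simp: indicator_def)
    qed
    have "indicat_real (- {-R..R}) \<in> borel_measurable lebesgue" for R :: real by (intro measurable_completion) measurable
    then show "(\<lambda>x. indicator (- {-R..R}) x * (cmod (v x))\<^sup>2) \<in> borel_measurable lebesgue" for R :: real
      using L2_measurable[OF v] by (intro borel_measurable_times) auto
  qed (use L2_integrable_sq[OF v] in \<open>auto simp: indicator_def\<close>)
  then have "((\<lambda>R. ennreal (LINT x|lebesgue. indicator (- {-R..R}) x * (cmod (v x))\<^sup>2)) \<longlongrightarrow> ennreal 0) at_top"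
    by (intro tendsto_ennrealI) simp
  then show "((\<lambda>R. \<integral>\<^sup>+\<xi>. ennreal ((cmod (f \<xi> - fourier_integral (\<lambda>x. indicator {-R..R} x * v x) \<xi>))\<^sup>2) \<partial>lebesgue) \<longlongrightarrow> 0) at_top"
    unfolding * by simp
qed

section \<open>Convolution\<close>

text \<open>Convolution requires J(x - y) v(y) to be measurable in the pair (x, y) for Fubini's
  theorem over \<open>lborel\<close>. Borel representatives ensure this, and replacing them does not
  change the convolution.\<close>

lemma lebesgue_borel_representative:
  fixes f :: "real \<Rightarrow> complex"
  assumes "f \<in> borel_measurable lebesgue"
  shows "\<exists>g\<in>borel_measurable borel. AE x in lebesgue. f x = g x"
proof -
  have "(\<lambda>x. Re (f x)) \<in> borel_measurable lebesgue" "(\<lambda>x. Im (f x)) \<in> borel_measurable lebesgue" using assms by auto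
  from this[THEN completion_ex_borel_measurable_real]
  obtain a b where ab: "a \<in> borel_measurable lborel" "AE x in lborel. Re (f x) = a x"
     "b \<in> borel_measurable lborel" "AE x in lborel. Im (f x) = b x" by auto
  have "AE x in lebesgue. f x = Complex (a x) (b x)"
    using AE_completion[OF ab(2)] AE_completion[OF ab(4)] by eventually_elim (simp add: complex_eq_iff)
  moreover have "(\<lambda>x. Complex (a x) (b x)) \<in> borel_measurable borel"
    using ab(1,3) by (simp add: borel_measurable_complex_iff)
  ultimately show ?thesis by auto
qed

text \<open>The equality holds at every point: y |-> x - y preserves null sets for each fixed
  x.\<close>

lemma convol_cong_AE:
  assumes "J \<in> borel_measurable lebesgue" "v \<in> borel_measurable lebesgue"
    "AE x in lebesgue. J0 x = J x" "AE x in lebesgue. v0 x = v x"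
  shows "convol J0 v0 x = convol J v x"
proof -
  have "AE x in lebesgue. J x = J0 x" "AE x in lebesgue. v x = v0 x" using assms(3,4) by auto
  with assms(1,2) have m: "J0 \<in> borel_measurable lebesgue" "v0 \<in> borel_measurable lebesgue"
    by (blast intro: borel_measurable_AE)+
  have [measurable]: "(\<lambda>y. J (x - y)) \<in> borel_measurable lebesgue" "(\<lambda>y. J0 (x - y)) \<in> borel_measurable lebesgue"
    using lebesgue_measurable_affine[of "-1" J x] lebesgue_measurable_affine[of "-1" J0 x] assms(1) m(1) by auto
  note [measurable] = m assms(2)
  have "AE y in lebesgue. J0 (x - y) = J (x - y)"
    using AE_lebesgue_affine[OF assms(3), of "-1" x] by simp
  with assms(4) show ?thesis unfolding convol_def
    by (intro integral_cong_AE) auto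
qed

text \<open>Young's inequality by Cauchy-Schwarz, with |J| shared out as two factors sqrt |J|: the
  square of |J * v| is at most K times |J| * |v|^2, and integrating in x by Tonelli yields the
  second factor K. Where that last convolution is finite, which is almost everywhere, the integral
  defining J * v exists.\<close>

lemma convol_borel_L2:
  fixes J :: "real \<Rightarrow> real"
  assumes Jm [measurable]: "J \<in> borel_measurable borel" and Ji: "integrable lborel J"
    and vm [measurable]: "v \<in> borel_measurable borel" and v: "v \<in> L2"
  shows "convol J v \<in> borel_measurable borel" (is ?m)
    and "convol J v \<in> L2" (is ?L)
    and "L2_norm (convol J v) \<le> (LINT x|lborel. \<bar>J x\<bar>) * L2_norm v" (is ?n)
    and "AE x in lebesgue. integrable lebesgue (\<lambda>y. of_real (J (x - y)) * v y)" (is ?i)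
proof -
  define K where "K = (LINT x|lborel. \<bar>J x\<bar>)"
  have K0: "K \<ge> 0" by (simp add: K_def)
  have conv_eq: "convol J v x = (LINT y|lborel. of_real (J (x - y)) * v y)" for x
    unfolding convol_def by (subst integral_completion) auto
  show m: ?m unfolding conv_eq[abs_def] by measurable
  then have [measurable]: "convol J v \<in> borel_measurable lebesgue" by (simp add: measurable_completion)
  have Kx: "(\<integral>\<^sup>+x. ennreal \<bar>J (x - y)\<bar> \<partial>lborel) = ennreal K" for y
  proof -
    have "(\<integral>\<^sup>+x. ennreal \<bar>J (x - y)\<bar> \<partial>lborel) = (\<integral>\<^sup>+x. ennreal \<bar>J x\<bar> \<partial>lborel)"
      using nn_integral_real_affine[of "\<lambda>x. ennreal \<bar>J x\<bar>" 1 "-y"] by simp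
    also have "\<dots> = ennreal K" using Ji unfolding K_def by (subst nn_integral_eq_integral) auto
    finally show ?thesis .
  qed
  have Ky: "(\<integral>\<^sup>+y. ennreal \<bar>J (x - y)\<bar> \<partial>lborel) = ennreal K" for x
  proof -
    have "(\<integral>\<^sup>+y. ennreal \<bar>J (x - y)\<bar> \<partial>lborel) = (\<integral>\<^sup>+x. ennreal \<bar>J x\<bar> \<partial>lborel)"
      using nn_integral_real_affine[of "\<lambda>x. ennreal \<bar>J x\<bar>" "-1" x] by simp
    also have "\<dots> = ennreal K" using Ji unfolding K_def by (subst nn_integral_eq_integral) auto
    finally show ?thesis .
  qed
  have vsq: "(\<integral>\<^sup>+y. ennreal ((cmod (v y))\<^sup>2) \<partial>lborel) = ennreal ((L2_norm v)\<^sup>2)"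
    using nn_integral_eq_integral[OF L2_integrable_sq[OF v]] by (simp add: L2_norm_sq nn_integral_completion)
  have T: "(\<integral>\<^sup>+x. (\<integral>\<^sup>+y. ennreal (\<bar>J (x - y)\<bar> * (cmod (v y))\<^sup>2) \<partial>lborel) \<partial>lborel) = ennreal K * ennreal ((L2_norm v)\<^sup>2)"
  proof -
    have "(\<integral>\<^sup>+x. (\<integral>\<^sup>+y. ennreal (\<bar>J (x - y)\<bar> * (cmod (v y))\<^sup>2) \<partial>lborel) \<partial>lborel)
       = (\<integral>\<^sup>+y. (\<integral>\<^sup>+x. ennreal (\<bar>J (x - y)\<bar> * (cmod (v y))\<^sup>2) \<partial>lborel) \<partial>lborel)"
      by (rule lborel_pair.Fubini'[symmetric]) measurable
    also have "\<dots> = (\<integral>\<^sup>+y. ennreal K * ennreal ((cmod (v y))\<^sup>2) \<partial>lborel)"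
      by (intro nn_integral_cong) (simp add: ennreal_mult' nn_integral_multc Kx)
    finally show ?thesis by (simp add: nn_integral_cmult vsq)
  qed
  have ae: "AE x in lborel. (\<integral>\<^sup>+y. ennreal (\<bar>J (x - y)\<bar> * (cmod (v y))\<^sup>2) \<partial>lborel) \<noteq> \<infinity>"
    by (rule nn_integral_PInf_AE) (auto simp: T ennreal_mult_less_top simp flip: ennreal_mult'')
  have good: "integrable lebesgue (\<lambda>y. of_real (J (x - y)) * v y) \<and>
      ennreal ((cmod (convol J v x))\<^sup>2) \<le> ennreal K * (\<integral>\<^sup>+y. ennreal (\<bar>J (x - y)\<bar> * (cmod (v y))\<^sup>2) \<partial>lborel)"
    if fin: "(\<integral>\<^sup>+y. ennreal (\<bar>J (x - y)\<bar> * (cmod (v y))\<^sup>2) \<partial>lborel) \<noteq> \<infinity>" for x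
  proof -
    \<comment> \<open>The product of \<open>f\<close> and \<open>g\<close> is the integrand, while
      |f|^2 = |J(x - y)| and |g|^2 = |J(x - y)| |v y|^2. The sign of \<open>J\<close> is carried by
      \<open>f\<close>.\<close>
    define f where "f y = complex_of_real ((if J (x - y) < 0 then -1 else 1) * sqrt \<bar>J (x - y)\<bar>)" for y
    define g where "g y = complex_of_real (sqrt \<bar>J (x - y)\<bar>) * v y" for y
    have [measurable]: "f \<in> borel_measurable lborel" "g \<in> borel_measurable lborel" unfolding f_def g_def by measurable
    have f2: "(cmod (f y))\<^sup>2 = \<bar>J (x - y)\<bar>" for y by (simp add: f_def norm_mult power_mult_distrib)
    have g2: "(cmod (g y))\<^sup>2 = \<bar>J (x - y)\<bar> * (cmod (v y))\<^sup>2" for y by (simp add: g_def norm_mult power_mult_distrib)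
    have fi: "integrable lborel (\<lambda>y. (cmod (f y))\<^sup>2)" unfolding f2
      by (intro integrableI_nonneg) (auto simp: Ky)
    have gi: "integrable lborel (\<lambda>y. (cmod (g y))\<^sup>2)" unfolding g2
      using fin by (intro integrableI_nonneg) (auto simp: top.not_eq_extremum)
    have fL: "f \<in> L2" and gL: "g \<in> L2" using fi gi by (auto simp: L2_def measurable_completion integrable_completion)
    have fg: "f y * g y = of_real (J (x - y)) * v y" for y
    proof -
      have "(if J (x - y) < 0 then -1 else 1) * sqrt \<bar>J (x - y)\<bar> * sqrt \<bar>J (x - y)\<bar> = J (x - y)"
        by (simp add: mult.assoc)
      then show ?thesis unfolding f_def g_def by (metis mult.assoc of_real_mult)
    qed
    have "(cmod (convol J v x))\<^sup>2 \<le> (L2_norm f * L2_norm g)\<^sup>2"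
      using L2_Cauchy_Schwarz[OF fL gL] unfolding fg convol_def by (intro power_mono) auto
    also have "\<dots> = (LINT y|lborel. (cmod (f y))\<^sup>2) * (LINT y|lborel. (cmod (g y))\<^sup>2)"
      unfolding power_mult_distrib L2_norm_sq by (simp add: integral_completion)
    finally have "ennreal ((cmod (convol J v x))\<^sup>2) \<le> ennreal ((LINT y|lborel. (cmod (f y))\<^sup>2) * (LINT y|lborel. (cmod (g y))\<^sup>2))"
      by (rule ennreal_leI)
    also have "\<dots> = (\<integral>\<^sup>+y. ennreal ((cmod (f y))\<^sup>2) \<partial>lborel) * (\<integral>\<^sup>+y. ennreal ((cmod (g y))\<^sup>2) \<partial>lborel)"
      using fi gi by (simp add: nn_integral_eq_integral ennreal_mult)
    also have "\<dots> = ennreal K * (\<integral>\<^sup>+y. ennreal (\<bar>J (x - y)\<bar> * (cmod (v y))\<^sup>2) \<partial>lborel)"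
      unfolding f2 g2 Ky ..
    finally show ?thesis using L2_mult_integrable[OF fL gL] unfolding fg by simp
  qed
  show ?i using AE_completion[OF ae] by eventually_elim (use good in blast)
  have "(\<integral>\<^sup>+x. ennreal ((cmod (convol J v x))\<^sup>2) \<partial>lborel) \<le> (\<integral>\<^sup>+x. ennreal K * (\<integral>\<^sup>+y. ennreal (\<bar>J (x - y)\<bar> * (cmod (v y))\<^sup>2) \<partial>lborel) \<partial>lborel)"
    by (rule nn_integral_mono_AE) (use ae in eventually_elim, use good in blast)
  also have "\<dots> = ennreal K * (ennreal K * ennreal ((L2_norm v)\<^sup>2))"
    by (subst nn_integral_cmult) (auto simp: T)
  also have "\<dots> = ennreal ((K * L2_norm v)\<^sup>2)"
    using K0 by (simp add: power_mult_distrib power2_eq_square mult_ac flip: ennreal_mult)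
  finally have le: "(\<integral>\<^sup>+x. ennreal ((cmod (convol J v x))\<^sup>2) \<partial>lebesgue) \<le> ennreal ((K * L2_norm v)\<^sup>2)"
    by (simp add: nn_integral_completion)
  then have "integrable lebesgue (\<lambda>x. (cmod (convol J v x))\<^sup>2)"
    by (intro integrableI_nonneg) (auto simp: le_less_trans[OF _ ennreal_less_top])
  then show L: ?L by (simp add: L2_def)
  have "ennreal ((L2_norm (convol J v))\<^sup>2) \<le> ennreal ((K * L2_norm v)\<^sup>2)"
    using le nn_integral_eq_integral[OF L2_integrable_sq[OF L]] by (simp add: L2_norm_sq)
  then have "(L2_norm (convol J v))\<^sup>2 \<le> (K * L2_norm v)\<^sup>2" by (subst (asm) ennreal_le_iff) auto
  then show ?n unfolding K_def[symmetric] by (rule power2_le_imp_le) (use K0 in auto)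
qed

lemma fourier_integral_convol_borel:
  fixes J :: "real \<Rightarrow> real"
  assumes Jm [measurable]: "J \<in> borel_measurable borel" and Ji: "integrable lborel J"
    and vm [measurable]: "v \<in> borel_measurable borel" and vi: "integrable lborel v"
  shows "integrable lebesgue (convol J v)"
    and "fourier_integral (convol J v) \<xi> = fourier_integral (\<lambda>x. of_real (J x)) \<xi> * fourier_integral v \<xi>"
proof -
  have conv_eq: "convol J v x = (LINT y|lborel. of_real (J (x - y)) * v y)" for x
    unfolding convol_def by (subst integral_completion) auto
  have m [measurable]: "convol J v \<in> borel_measurable borel" unfolding conv_eq[abs_def] by measurable
  have int: "integrable (lborel \<Otimes>\<^sub>M lborel) (\<lambda>(x, y). of_real (J (x - y)) * v y * fourier_char (- (\<xi> * x)))" for \<xi>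
  proof (rule integrableI_bounded)
    show "(\<lambda>(x, y). of_real (J (x - y)) * v y * fourier_char (- (\<xi> * x))) \<in> borel_measurable (lborel \<Otimes>\<^sub>M lborel)"
      by measurable
    have "(\<integral>\<^sup>+p. ennreal (norm (case p of (x, y) \<Rightarrow> of_real (J (x - y)) * v y * fourier_char (- (\<xi> * x)))) \<partial>(lborel \<Otimes>\<^sub>M lborel))
       = (\<integral>\<^sup>+y. (\<integral>\<^sup>+x. ennreal (\<bar>J (x - y)\<bar> * cmod (v y)) \<partial>lborel) \<partial>lborel)"
      by (subst lborel_pair.nn_integral_snd[symmetric]) (auto simp: norm_mult)
    also have "\<dots> = (\<integral>\<^sup>+y. ennreal (LINT x|lborel. \<bar>J x\<bar>) * ennreal (cmod (v y)) \<partial>lborel)"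
    proof (rule nn_integral_cong)
      fix y
      have "(\<integral>\<^sup>+x. ennreal \<bar>J (x - y)\<bar> \<partial>lborel) = (\<integral>\<^sup>+x. ennreal \<bar>J x\<bar> \<partial>lborel)"
        using nn_integral_real_affine[of "\<lambda>x. ennreal \<bar>J x\<bar>" 1 "-y"] by simp
      also have "\<dots> = ennreal (LINT x|lborel. \<bar>J x\<bar>)" using Ji by (subst nn_integral_eq_integral) auto
      finally show "(\<integral>\<^sup>+x. ennreal (\<bar>J (x - y)\<bar> * cmod (v y)) \<partial>lborel) = ennreal (LINT x|lborel. \<bar>J x\<bar>) * ennreal (cmod (v y))"
        by (simp add: ennreal_mult' nn_integral_multc)
    qed
    also have "\<dots> < \<infinity>" using vi
      by (simp add: nn_integral_cmult ennreal_mult_less_top integrable_iff_bounded)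
    finally show "(\<integral>\<^sup>+p. ennreal (norm (case p of (x, y) \<Rightarrow> of_real (J (x - y)) * v y * fourier_char (- (\<xi> * x)))) \<partial>(lborel \<Otimes>\<^sub>M lborel)) < \<infinity>" .
  qed
  have "integrable lborel (\<lambda>x. LINT y|lborel. of_real (J (x - y)) * v y * fourier_char (- (0 * x)))"
    using lborel_pair.integrable_fst[OF int[of 0]] by simp
  then have "integrable lborel (convol J v)" by (simp add: conv_eq[abs_def])
  then show "integrable lebesgue (convol J v)" by (simp add: integrable_completion)
  have "fourier_integral (convol J v) \<xi> = (LINT x|lborel. convol J v x * fourier_char (- (\<xi> * x)))"
    unfolding fourier_integral_def by (subst integral_completion) auto
  also have "\<dots> = (LINT x|lborel. LINT y|lborel. of_real (J (x - y)) * v y * fourier_char (- (\<xi> * x)))"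
    by (simp add: conv_eq)
  also have "\<dots> = (LINT y|lborel. LINT x|lborel. of_real (J (x - y)) * v y * fourier_char (- (\<xi> * x)))"
    by (rule lborel_pair.Fubini_integral[symmetric, OF int])
  also have "\<dots> = (LINT y|lborel. fourier_integral (\<lambda>x. of_real (J x)) \<xi> * (v y * fourier_char (- (\<xi> * y))))"
  proof (rule Bochner_Integration.integral_cong[OF refl])
    fix y
    have "(LINT x|lborel. of_real (J (x - y)) * v y * fourier_char (- (\<xi> * x))) = v y * fourier_integral (\<lambda>x. of_real (J (x - y))) \<xi>"
      unfolding fourier_integral_def by (subst integral_completion) (auto simp: mult.assoc mult.left_commute)
    then show "(LINT x|lborel. of_real (J (x - y)) * v y * fourier_char (- (\<xi> * x))) = fourier_integral (\<lambda>x. of_real (J x)) \<xi> * (v y * fourier_char (- (\<xi> * y)))"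
      using fourier_integral_translate[of "\<lambda>x. of_real (J x)" y \<xi>] by (simp add: mult_ac)
  qed
  also have "\<dots> = fourier_integral (\<lambda>x. of_real (J x)) \<xi> * fourier_integral v \<xi>"
    unfolding fourier_integral_def[of v] by (subst integral_completion) auto
  finally show "fourier_integral (convol J v) \<xi> = fourier_integral (\<lambda>x. of_real (J x)) \<xi> * fourier_integral v \<xi>" .
qed

lemma
  fixes J :: "real \<Rightarrow> real"
  assumes Ji: "integrable lebesgue J" and v: "v \<in> L2"
  shows convol_L2: "convol J v \<in> L2"
    and convol_norm: "L2_norm (convol J v) \<le> (LINT x|lebesgue. \<bar>J x\<bar>) * L2_norm v"
    and convol_AE_integrable: "AE x in lebesgue. integrable lebesgue (\<lambda>y. of_real (J (x - y)) * v y)"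
proof -
  have Jm: "J \<in> borel_measurable lebesgue" using Ji by auto
  obtain J0 where J0: "J0 \<in> borel_measurable borel" "AE x in lebesgue. J0 x = J x"
    using completion_ex_borel_measurable_real[OF Jm] by (auto dest: AE_completion simp: eq_commute)
  obtain v0 where v0: "v0 \<in> borel_measurable borel" "AE x in lebesgue. v0 x = v x"
    using lebesgue_borel_representative[OF L2_measurable[OF v]] by (auto simp: eq_commute)
  have J0m: "J0 \<in> borel_measurable lebesgue" and v0m: "v0 \<in> borel_measurable lebesgue"
    using J0(1) v0(1) by (auto intro: measurable_completion)
  have J0i: "integrable lborel J0"
    using Ji integrable_cong_AE[OF J0m Jm J0(2)] J0(1) by (simp add: integrable_completion)
  have eq: "convol J0 v0 = convol J v"
    using convol_cong_AE[OF Jm L2_measurable[OF v] J0(2) v0(2)] by auto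
  have v0L: "v0 \<in> L2" by (rule L2_cong_AE[OF v v0(2)])
  note b = convol_borel_L2[OF J0(1) J0i v0(1) v0L]
  show "convol J v \<in> L2" using b(2) by (simp add: eq)
  have "(LINT x|lborel. \<bar>J0 x\<bar>) = (LINT x|lebesgue. \<bar>J0 x\<bar>)" using J0(1) by (subst integral_completion) auto
  also have "\<dots> = (LINT x|lebesgue. \<bar>J x\<bar>)" using J0(2) Jm J0m by (intro integral_cong_AE) auto
  finally show "L2_norm (convol J v) \<le> (LINT x|lebesgue. \<bar>J x\<bar>) * L2_norm v"
    using b(3) by (simp add: eq L2_norm_cong_AE[OF v v0(2)])
  show "AE x in lebesgue. integrable lebesgue (\<lambda>y. of_real (J (x - y)) * v y)"
    using b(4)
  proof eventually_elim
    case (elim x)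
    have JJ: "AE y in lebesgue. J0 (x - y) = J (x - y)"
      using AE_lebesgue_affine[OF J0(2), of "-1" x] by simp
    have m: "(\<lambda>y. J (x - y)) \<in> borel_measurable lebesgue" "(\<lambda>y. J0 (x - y)) \<in> borel_measurable lebesgue"
      using lebesgue_measurable_affine[of "-1" J x] lebesgue_measurable_affine[of "-1" J0 x] Jm J0m by auto
    show ?case
    proof (rule integrable_cong_AE_imp[OF elim])
      show "(\<lambda>y. of_real (J (x - y)) * v y) \<in> borel_measurable lebesgue" using m L2_measurable[OF v] by auto
      show "AE y in lebesgue. of_real (J0 (x - y)) * v0 y = of_real (J (x - y)) * v y"
        using JJ v0(2) by eventually_elim simp
    qed
  qed
qed

text \<open>Fubini gives the product formula when \<open>v\<close> is also integrable. Both sides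
  are Lipschitz in L2 with constant \<open>K\<close>, so agreement on the dense family
  suffices.\<close>

lemma fourier_convol:
  fixes J :: "real \<Rightarrow> real"
  assumes Ji: "integrable lebesgue J" and v: "v \<in> L2"
  shows "AE \<xi> in lebesgue. fourier (convol J v) \<xi> = fourier_integral (\<lambda>x. of_real (J x)) \<xi> * fourier v \<xi>"
proof -
  define K where "K = (LINT x|lebesgue. \<bar>J x\<bar>)"
  have K0: "K \<ge> 0" by (simp add: K_def)
  have Jm: "J \<in> borel_measurable lebesgue" using Ji by auto
  obtain J0 where J0: "J0 \<in> borel_measurable borel" "AE x in lebesgue. J0 x = J x"
    using completion_ex_borel_measurable_real[OF Jm] by (auto dest: AE_completion simp: eq_commute)
  have J0m: "J0 \<in> borel_measurable lebesgue" using J0(1) by (auto intro: measurable_completion)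
  have J0i: "integrable lborel J0"
    using Ji integrable_cong_AE[OF J0m Jm J0(2)] J0(1) by (simp add: integrable_completion)
  have JF: "fourier_integral (\<lambda>x. of_real (J0 x)) \<xi> = fourier_integral (\<lambda>x. of_real (J x)) \<xi>" for \<xi>
    unfolding fourier_integral_def using J0(2) Jm J0m
    by (intro integral_cong_AE borel_measurable_times) (auto simp: measurable_completion)
  have JFm: "fourier_integral (\<lambda>x. complex_of_real (J x)) \<in> borel_measurable lebesgue"
  proof -
    have "fourier_integral (\<lambda>x. complex_of_real (J x)) = (\<lambda>\<xi>. LINT x|lborel. of_real (J0 x) * fourier_char (- (\<xi> * x)))"
    proof
      fix \<xi>
      show "fourier_integral (\<lambda>x. complex_of_real (J x)) \<xi> = (LINT x|lborel. of_real (J0 x) * fourier_char (- (\<xi> * x)))"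
        unfolding JF[of \<xi>, symmetric] unfolding fourier_integral_def using J0(1) by (subst integral_completion) auto
    qed
    also have "\<dots> \<in> borel_measurable lborel" using J0(1) by measurable
    finally show ?thesis by (simp add: measurable_completion)
  qed
  have JFb: "cmod (fourier_integral (\<lambda>x. complex_of_real (J x)) \<xi>) \<le> K" for \<xi>
    using norm_fourier_integral[of "\<lambda>x. complex_of_real (J x)" \<xi>] by (simp add: K_def)
  let ?B = "\<lambda>v \<xi>. fourier_integral (\<lambda>x. of_real (J x)) \<xi> * fourier v \<xi>"
  show ?thesis
  proof (rule L2_operator_eq_AE[where A="\<lambda>v. fourier (convol J v)" and B="?B" and C=K and D=K])
    show "fourier (convol J v) \<in> L2" if "v \<in> L2" for v using convol_L2[OF Ji that] by (rule fourier_L2)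
    show B: "?B v \<in> L2" if "v \<in> L2" for v
      by (rule L2_bounded_mult[OF fourier_L2[OF that] JFm, where C=K]) (simp add: JFb)
    show "L2_norm (\<lambda>x. fourier (convol J v) x - fourier (convol J w) x) \<le> K * L2_norm (\<lambda>x. v x - w x)"
      if vw: "v \<in> L2" "w \<in> L2" for v w
    proof -
      have "AE x in lebesgue. convol J v x - convol J w x = convol J (\<lambda>x. v x - w x) x"
        using convol_AE_integrable[OF Ji vw(1)] convol_AE_integrable[OF Ji vw(2)]
        by eventually_elim (simp add: convol_def right_diff_distrib)
      then have "L2_norm (\<lambda>x. convol J v x - convol J w x) = L2_norm (convol J (\<lambda>x. v x - w x))"
        by (intro L2_norm_cong_AE convol_L2 Ji L2_diff vw)
      also have "\<dots> \<le> K * L2_norm (\<lambda>x. v x - w x)" unfolding K_def by (intro convol_norm Ji L2_diff vw)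
      finally show ?thesis using fourier_norm_diff[OF convol_L2[OF Ji vw(1)] convol_L2[OF Ji vw(2)]] by simp
    qed
    show "L2_norm (\<lambda>\<xi>. ?B v \<xi> - ?B w \<xi>) \<le> K * L2_norm (\<lambda>x. v x - w x)" if vw: "v \<in> L2" "w \<in> L2" for v w
      unfolding fourier_norm_diff[OF vw, symmetric]
    proof (rule L2_norm_bound)
      show "AE x in lebesgue. cmod (?B v x - ?B w x) \<le> K * cmod (fourier v x - fourier w x)"
        unfolding right_diff_distrib[symmetric] norm_mult by (intro AE_I2 mult_right_mono JFb) auto
    qed (use vw K0 L2_diff fourier_L2 L2_measurable[OF L2_diff[OF B B]] in auto)
    show "AE \<xi> in lebesgue. fourier (convol J (trig_gauss P)) \<xi> = ?B (trig_gauss P) \<xi>" if P: "P \<in> trig_poly" for P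
    proof -
      have m: "trig_gauss P \<in> borel_measurable borel" unfolding trig_gauss_def[abs_def] using trig_poly_measurable[OF P] by measurable
      have i: "integrable lborel (trig_gauss P)" using trig_gauss_integrable[OF P] m by (simp add: integrable_completion)
      have e: "convol J0 (trig_gauss P) = convol J (trig_gauss P)"
        using convol_cong_AE[OF Jm _ J0(2), of "trig_gauss P" "trig_gauss P"] m by (auto simp: measurable_completion)
      note F = fourier_integral_convol_borel[OF J0(1) J0i m i, unfolded e JF]
      show ?thesis
        using fourier_eq_fourier_integral[OF convol_L2[OF Ji trig_gauss_L2[OF P]] F(1)]
          fourier_eq_fourier_integral[OF trig_gauss_L2[OF P] trig_gauss_integrable[OF P]]
        by eventually_elim (simp add: F(2))
    qed
  qed (rule v)
qed

section \<open>Lebesgue points and Poisson means\<close>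

lemma L2_set_integrable:
  assumes "v \<in> L2" shows "set_integrable lebesgue {a..b::real} v"
  unfolding set_integrable_def scaleR_conv_of_real
  using L2_mult_integrable[OF L2_indicator_Icc[of 1 a b] assms] by (simp add: of_real_indicator)

lemma set_integrable_Icc_const: "set_integrable lebesgue {a..b::real} (\<lambda>x. c::complex)"
  unfolding set_integrable_def by (intro integrable_scaleR_left integrable_indicator_Icc)

lemma L2_set_integrable_norm_diff:
  assumes "v \<in> L2" shows "set_integrable lebesgue {a..b::real} (\<lambda>y. cmod (v y - q))"
  using set_integrable_norm[OF set_integral_diff(1)[OF L2_set_integrable[OF assms] set_integrable_Icc_const]] .

text \<open>Lebesgue's differentiation theorem for the scalar function |v - q|. The exceptional null
  set depends on \<open>q\<close>.\<close>

lemma right_averages: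
  assumes v: "v \<in> L2"
  shows "AE x in lebesgue. \<forall>e>0. \<exists>d>0. \<forall>h. 0 < h \<and> h < d \<longrightarrow> \<bar>(LINT y:{x..x+h}|lebesgue. cmod (v y - q)) - h * cmod (v x - q)\<bar> \<le> e * h"
proof -
  have i: "(\<lambda>y. cmod (v y - q)) integrable_on cbox a b" for a b
    using set_lebesgue_integral_eq_integral(1)[OF L2_set_integrable_norm_diff[OF v]] by simp
  obtain N where N: "negligible N" and d: "\<And>x e. x \<notin> N \<Longrightarrow> 0 < e \<Longrightarrow> \<exists>d>0. \<forall>h. 0 < h \<and> h < d \<longrightarrow>
       norm (integral (cbox x (x + h *\<^sub>R One)) (\<lambda>y. cmod (v y - q)) /\<^sub>R h ^ DIM(real) - cmod (v x - q)) < e"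
    using integrable_ccontinuous_explicit[OF i] by blast
  have "\<forall>e>0. \<exists>d>0. \<forall>h. 0 < h \<and> h < d \<longrightarrow> \<bar>(LINT y:{x..x+h}|lebesgue. cmod (v y - q)) - h * cmod (v x - q)\<bar> \<le> e * h"
    if "x \<notin> N" for x
  proof (intro allI impI)
    fix e :: real assume "e > 0"
    from d[OF that this] obtain d where d0: "d > 0" and dd: "\<And>h. 0 < h \<Longrightarrow> h < d \<Longrightarrow>
       norm (integral (cbox x (x + h *\<^sub>R One)) (\<lambda>y. cmod (v y - q)) /\<^sub>R h ^ DIM(real) - cmod (v x - q)) < e" by blast
    have "\<bar>(LINT y:{x..x+h}|lebesgue. cmod (v y - q)) - h * cmod (v x - q)\<bar> \<le> e * h" if h: "0 < h" "h < d" for h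
    proof -
      define I where "I = (LINT y:{x..x+h}|lebesgue. cmod (v y - q))"
      have "integral (cbox x (x + h *\<^sub>R One)) (\<lambda>y. cmod (v y - q)) = I"
        unfolding I_def using set_lebesgue_integral_eq_integral(2)[OF L2_set_integrable_norm_diff[OF v], of x "x+h" q] by simp
      with dd[OF h] have "\<bar>I / h - cmod (v x - q)\<bar> < e" by (simp add: divide_inverse mult.commute)
      then have "\<bar>I / h - cmod (v x - q)\<bar> * h \<le> e * h" using h by (intro mult_right_mono) auto
      moreover have "\<bar>I / h - cmod (v x - q)\<bar> * h = \<bar>(I / h - cmod (v x - q)) * h\<bar>" using h by (simp add: abs_mult)
      moreover have "(I / h - cmod (v x - q)) * h = I - h * cmod (v x - q)" using h by (simp add: field_simps)
      ultimately show ?thesis unfolding I_def by simp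
    qed
    with d0 show "\<exists>d>0. \<forall>h. 0 < h \<and> h < d \<longrightarrow> \<bar>(LINT y:{x..x+h}|lebesgue. cmod (v y - q)) - h * cmod (v x - q)\<bar> \<le> e * h" by blast
  qed
  then have "{x \<in> space lebesgue. \<not> (\<forall>e>0. \<exists>d>0. \<forall>h. 0 < h \<and> h < d \<longrightarrow> \<bar>(LINT y:{x..x+h}|lebesgue. cmod (v y - q)) - h * cmod (v x - q)\<bar> \<le> e * h)} \<subseteq> N"
    by blast
  then show ?thesis using N by (intro AE_I'[of N]) (simp add: negligible_iff_null_sets)
qed

text \<open>Differentiation does not apply to |v - v x| directly, because the constant moves with
  the point. Constants from a countable dense set have a common exceptional null set; replacing v x
  by a nearby q costs the average at most 2 |v x - q|, up to the error of differentiation.\<close>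

lemma lebesgue_point_right:
  assumes v: "v \<in> L2"
  shows "AE x in lebesgue. \<forall>e>0. \<exists>d>0. \<forall>h. 0 < h \<and> h < d \<longrightarrow> (LINT y:{x..x+h}|lebesgue. cmod (v y - v x)) \<le> e * h"
proof -
  obtain D :: "complex set" where D: "countable D" "\<And>U. open U \<Longrightarrow> U \<noteq> {} \<Longrightarrow> \<exists>d\<in>D. d \<in> U"
    using countable_dense_exists by blast
  have "AE x in lebesgue. \<forall>q\<in>D. \<forall>e>0. \<exists>d>0. \<forall>h. 0 < h \<and> h < d \<longrightarrow> \<bar>(LINT y:{x..x+h}|lebesgue. cmod (v y - q)) - h * cmod (v x - q)\<bar> \<le> e * h"
    by (rule AE_ball_countable'[OF right_averages[OF v] D(1)])
  then show ?thesis
  proof eventually_elim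
    case (elim x)
    show ?case
    proof (intro allI impI)
      fix e :: real assume e: "e > 0"
      obtain q where q: "q \<in> D" "dist (v x) q < e / 4"
        using D(2)[of "ball (v x) (e/4)"] e by auto
      obtain d where d: "d > 0" "\<And>h. 0 < h \<Longrightarrow> h < d \<Longrightarrow> \<bar>(LINT y:{x..x+h}|lebesgue. cmod (v y - q)) - h * cmod (v x - q)\<bar> \<le> (e / 4) * h"
        using elim[rule_format, OF q(1), of "e/4"] e by auto
      have "(LINT y:{x..x+h}|lebesgue. cmod (v y - v x)) \<le> e * h" if h: "0 < h" "h < d" for h
      proof -
        have "(LINT y:{x..x+h}|lebesgue. cmod (v y - v x)) \<le> (LINT y:{x..x+h}|lebesgue. cmod (v y - q) + cmod (q - v x))"
          by (rule set_integral_mono)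
             (use L2_set_integrable_norm_diff[OF v] set_integral_add(1)[OF L2_set_integrable_norm_diff[OF v] set_integrable_norm[OF set_integrable_Icc_const]] cmod_triangle_diff in auto)
        also have "\<dots> = (LINT y:{x..x+h}|lebesgue. cmod (v y - q)) + (LINT y:{x..x+h}|lebesgue. cmod (q - v x))"
          by (rule set_integral_add(2)[OF L2_set_integrable_norm_diff[OF v] set_integrable_norm[OF set_integrable_Icc_const]])
        also have "(LINT y:{x..x+h}|lebesgue. cmod (q - v x)) = h * cmod (q - v x)"
          using h by (subst set_integral_const) auto
        also have "(LINT y:{x..x+h}|lebesgue. cmod (v y - q)) \<le> h * cmod (v x - q) + (e / 4) * h"
          using d(2)[OF h] by linarith
        finally have "(LINT y:{x..x+h}|lebesgue. cmod (v y - v x)) \<le> h * cmod (v x - q) + (e / 4) * h + h * cmod (q - v x)" by simp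
        also have "\<dots> = 2 * (h * cmod (v x - q)) + (e / 4) * h" by (simp add: norm_minus_commute[of q])
        also have "h * cmod (v x - q) \<le> h * (e / 4)" using q(2) h by (intro mult_left_mono) (auto simp: dist_norm)
        finally have "(LINT y:{x..x+h}|lebesgue. cmod (v y - v x)) \<le> 2 * (h * (e / 4)) + (e / 4) * h" by simp
        also have "\<dots> \<le> e * h" using h e by (simp add: field_simps)
        finally show ?thesis .
      qed
      with d(1) show "\<exists>d>0. \<forall>h. 0 < h \<and> h < d \<longrightarrow> (LINT y:{x..x+h}|lebesgue. cmod (v y - v x)) \<le> e * h" by blast
    qed
  qed
qed

lemma set_integral_reflect:
  fixes f :: "real \<Rightarrow> real"
  shows "(LINT y:{a..b}|lebesgue. f (- y)) = (LINT y:{-b..-a}|lebesgue. f y)"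
proof -
  have "(LINT y:{-b..-a}|lebesgue. f y) = (LINT y|lebesgue. indicat_real {-b..-a} (0 + (-1) * y) *\<^sub>R f (0 + (-1) * y))"
    unfolding set_lebesgue_integral_def using lebesgue_integral_real_affine[of "-1" "\<lambda>y. indicat_real {-b..-a} y *\<^sub>R f y" 0] by simp
  also have "\<dots> = (LINT y:{a..b}|lebesgue. f (- y))"
    unfolding set_lebesgue_integral_def by (intro Bochner_Integration.integral_cong) (auto simp: indicator_def)
  finally show ?thesis by simp
qed

text \<open>The left half of the interval is the right half for the reflected function.\<close>

lemma lebesgue_point:
  assumes v: "v \<in> L2"
  shows "AE x in lebesgue. ((\<lambda>h. (LINT y:{x-h..x+h}|lebesgue. cmod (v y - v x)) / h) \<longlongrightarrow> 0) (at_right 0)"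
proof -
  have "AE x in lebesgue. \<forall>e>0. \<exists>d>0. \<forall>h. 0 < h \<and> h < d \<longrightarrow> (LINT y:{-x..-x+h}|lebesgue. cmod (v (- y) - v x)) \<le> e * h"
    using AE_lebesgue_affine[OF lebesgue_point_right[OF L2_reflect[OF v]], of "-1" 0] by simp
  with lebesgue_point_right[OF v] show ?thesis
  proof eventually_elim
    case (elim x)
    show ?case
    proof (rule tendstoI)
      fix e :: real assume e: "e > 0"
      obtain d1 where d1: "d1 > 0" "\<And>h. 0 < h \<Longrightarrow> h < d1 \<Longrightarrow> (LINT y:{x..x+h}|lebesgue. cmod (v y - v x)) \<le> (e/4) * h"
        using elim(1)[rule_format, of "e/4"] e by auto
      obtain d2 where d2: "d2 > 0" "\<And>h. 0 < h \<Longrightarrow> h < d2 \<Longrightarrow> (LINT y:{-x..-x+h}|lebesgue. cmod (v (- y) - v x)) \<le> (e/4) * h"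
        using elim(2)[rule_format, of "e/4"] e by auto
      have "\<forall>\<^sub>F h in at_right 0. 0 < h \<and> h < min d1 d2"
        using d1(1) d2(1) by (auto simp: eventually_at_right_field intro!: exI[of _ "min d1 d2"])
      then show "\<forall>\<^sub>F h in at_right 0. dist ((LINT y:{x-h..x+h}|lebesgue. cmod (v y - v x)) / h) 0 < e"
      proof eventually_elim
        case (elim h)
        have u: "{x-h..x+h} = {x-h..x} \<union> {x..x+h}" using elim by auto
        have ae: "AE y in lebesgue. \<not> (y \<in> {x-h..x} \<and> y \<in> {x..x+h})"
          using AE_completion[OF AE_lborel_singleton[of x]] by eventually_elim auto
        have "(LINT y:{x-h..x+h}|lebesgue. cmod (v y - v x)) = (LINT y:{x-h..x}|lebesgue. cmod (v y - v x)) + (LINT y:{x..x+h}|lebesgue. cmod (v y - v x))"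
          unfolding u by (rule set_integral_Un_AE[OF ae]) (use L2_set_integrable_norm_diff[OF v] in auto)
        also have "(LINT y:{x-h..x}|lebesgue. cmod (v y - v x)) = (LINT y:{-x..-x+h}|lebesgue. cmod (v (- y) - v x))"
          using set_integral_reflect[of "-x" "-x+h" "\<lambda>y. cmod (v y - v x)"] by simp
        finally have "(LINT y:{x-h..x+h}|lebesgue. cmod (v y - v x)) \<le> (e/4) * h + (e/4) * h"
          using d1(2)[of h] d2(2)[of h] elim by simp
        then have "(LINT y:{x-h..x+h}|lebesgue. cmod (v y - v x)) / h \<le> e / 2" using elim by (simp add: field_simps)
        moreover have "(LINT y:{x-h..x+h}|lebesgue. cmod (v y - v x)) / h \<ge> 0" using elim
          by (intro divide_nonneg_pos) (auto simp: set_lebesgue_integral_def)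
        ultimately show ?case using e unfolding dist_real_def by linarith
      qed
    qed
  qed
qed

text \<open>If n is the least index with |t| at most 2^n \<epsilon>, then either n = 0 and the
  kernel is at most 1/\<epsilon>, or |t| > 2^(n-1) \<epsilon> and it is at most 4 (1/4)^n /
  \<epsilon>. Hence the single term with index n of the series already dominates.\<close>

lemma poisson_dyadic_bound:
  fixes t :: real
  assumes "\<epsilon> > 0"
  shows "ennreal (\<epsilon> / (\<epsilon>\<^sup>2 + t\<^sup>2)) \<le> (\<Sum>k. ennreal (4 * (1/4)^k / \<epsilon> * indicator {-(2^k*\<epsilon>)..2^k*\<epsilon>} t))"
proof -
  have "\<exists>n. \<bar>t\<bar> \<le> 2^n * \<epsilon>"
  proof -
    obtain n where "\<bar>t\<bar> / \<epsilon> < 2^n" using real_arch_pow[of 2 "\<bar>t\<bar> / \<epsilon>"] by auto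
    then show ?thesis using assms by (intro exI[of _ n]) (simp add: field_simps)
  qed
  define n where "n = (LEAST n. \<bar>t\<bar> \<le> 2^n * \<epsilon>)"
  have n: "\<bar>t\<bar> \<le> 2^n * \<epsilon>" unfolding n_def using \<open>\<exists>n. \<bar>t\<bar> \<le> 2^n * \<epsilon>\<close> by (rule LeastI_ex)
  have n': "n > 0 \<Longrightarrow> \<bar>t\<bar> > 2^(n-1) * \<epsilon>" using not_less_Least[of "n-1" "\<lambda>n. \<bar>t\<bar> \<le> 2^n * \<epsilon>"] by (simp add: n_def)
  have "\<epsilon> / (\<epsilon>\<^sup>2 + t\<^sup>2) \<le> 4 * (1/4)^n / \<epsilon>"
  proof (cases "n = 0")
    case True
    have "\<epsilon>\<^sup>2 + t\<^sup>2 > 0" using assms by (simp add: add_pos_nonneg)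
    then have "\<epsilon> / (\<epsilon>\<^sup>2 + t\<^sup>2) \<le> \<epsilon> / \<epsilon>\<^sup>2" using assms by (intro divide_left_mono mult_pos_pos) simp_all
    also have "\<dots> \<le> 4 / \<epsilon>" using assms by (simp add: power2_eq_square field_simps)
    finally show ?thesis using True by simp
  next
    case False
    then obtain m where m: "n = Suc m" by (cases n) auto
    have "(2^m * \<epsilon>)\<^sup>2 \<le> t\<^sup>2" using n' m assms by (subst abs_le_square_iff[symmetric]) auto
    then have "4^m * \<epsilon>\<^sup>2 \<le> \<epsilon>\<^sup>2 + t\<^sup>2"
    proof -
      have "(2::real)^m * 2^m = 4^m" by (simp flip: power_mult_distrib)
      moreover have "(2^m * \<epsilon>)\<^sup>2 = (2^m * 2^m) * \<epsilon>\<^sup>2" by (simp add: power2_eq_square)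
      ultimately have "4^m * \<epsilon>\<^sup>2 \<le> t\<^sup>2" using \<open>(2^m * \<epsilon>)\<^sup>2 \<le> t\<^sup>2\<close> by simp
      then show ?thesis using zero_le_power2[of \<epsilon>] by linarith
    qed
    moreover have "\<epsilon>\<^sup>2 + t\<^sup>2 > 0" using assms by (simp add: add_pos_nonneg)
    ultimately have "\<epsilon> / (\<epsilon>\<^sup>2 + t\<^sup>2) \<le> \<epsilon> / (4^m * \<epsilon>\<^sup>2)" using assms by (intro divide_left_mono mult_pos_pos) simp_all
    also have "\<dots> = 4 * (1/4)^n / \<epsilon>" using assms by (simp add: m power_divide power2_eq_square field_simps)
    finally show ?thesis .
  qed
  then have "ennreal (\<epsilon> / (\<epsilon>\<^sup>2 + t\<^sup>2)) \<le> ennreal (4 * (1/4)^n / \<epsilon> * indicator {-(2^n*\<epsilon>)..2^n*\<epsilon>} t)"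
    using n by (intro ennreal_leI) (auto simp: abs_le_iff)
  also have "\<dots> = (\<Sum>k\<in>{n}. ennreal (4 * (1/4)^k / \<epsilon> * indicator {-(2^k*\<epsilon>)..2^k*\<epsilon>} t))" by simp
  also have "\<dots> \<le> (\<Sum>k. ennreal (4 * (1/4)^k / \<epsilon> * indicator {-(2^k*\<epsilon>)..2^k*\<epsilon>} t))"
    by (rule sum_le_suminf) auto
  finally show ?thesis .
qed

text \<open>The dyadic bound turns the Poisson mean into a series of averages over intervals of
  radius 2^k \<epsilon> with weights of order 2^-k. Each average tends to 0 at a Lebesgue point, and
  all of them are uniformly bounded, so Tannery's theorem applies. The integral is an extended
  nonnegative one, so that its integrability need not be settled beforehand.\<close>

lemma poisson_mean_tendsto_0:
  assumes v: "v \<in> L2" and lim: "((\<lambda>h. (LINT y:{x-h..x+h}|lebesgue. cmod (v y - v x)) / h) \<longlongrightarrow> 0) (at_right 0)"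
  shows "((\<lambda>\<epsilon>. \<integral>\<^sup>+y. ennreal (cmod (v y - v x) * (\<epsilon> / (\<epsilon>\<^sup>2 + (x - y)\<^sup>2))) \<partial>lebesgue) \<longlongrightarrow> 0) (at_right 0)"
proof -
  note [measurable] = L2_measurable[OF v]
  define \<Phi> where "\<Phi> h = (LINT y:{x-h..x+h}|lebesgue. cmod (v y - v x))" for h
  define A where "A h = \<Phi> h / h" for h
  have \<Phi>0: "\<Phi> h \<ge> 0" for h unfolding \<Phi>_def by (auto simp: set_lebesgue_integral_def)
  have \<Phi>neg: "\<Phi> h = 0" if "h < 0" for h using that by (auto simp: \<Phi>_def set_lebesgue_integral_def)
  have A0: "A h \<ge> 0" for h using \<Phi>0[of h] \<Phi>neg[of h] by (cases "h < 0") (auto simp: A_def)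
  have Alim: "(A \<longlongrightarrow> 0) (at_right 0)" using lim by (simp add: A_def[abs_def] \<Phi>_def)
  have "\<forall>\<^sub>F h in at_right 0. A h < 1" by (rule order_tendstoD[OF Alim]) simp
  then obtain \<delta> where \<delta>: "\<delta> > 0" "\<And>h. 0 < h \<Longrightarrow> h < \<delta> \<Longrightarrow> A h < 1"
    by (auto simp: eventually_at_right_field)
  \<comment> \<open>The Lebesgue point controls only short intervals; for long ones Cauchy-Schwarz
    bounds the average through the L2 norm of \<open>v\<close>.\<close>
  have Phi_le: "\<Phi> h \<le> L2_norm v * sqrt (2 * h) + 2 * h * cmod (v x)" if h: "h > 0" for h
  proof -
    have Ln: "L2_norm (\<lambda>y. indicator {x-h..x+h} y) = sqrt (2 * h)"
    proof -
      have "(LINT y|lebesgue. (cmod (indicator {x-h..x+h} y))\<^sup>2) = (LINT y|lebesgue. indicat_real {x-h..x+h} y)"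
        by (intro Bochner_Integration.integral_cong) (auto simp: indicator_def)
      also have "\<dots> = 2 * h" using h by simp
      finally show ?thesis by (simp add: L2_norm_def)
    qed
    have IL: "(\<lambda>y. indicator {x-h..x+h} y) \<in> L2" using L2_indicator_Icc[of 1] by simp
    have "\<Phi> h \<le> (LINT y:{x-h..x+h}|lebesgue. cmod (v y - 0) + cmod (v x))"
      unfolding \<Phi>_def
      by (rule set_integral_mono)
         (use L2_set_integrable_norm_diff[OF v] set_integral_add(1)[OF L2_set_integrable_norm_diff[OF v, where q=0] set_integrable_norm[OF set_integrable_Icc_const]] norm_triangle_ineq4 in auto)
    also have "\<dots> = (LINT y:{x-h..x+h}|lebesgue. cmod (v y - 0)) + (LINT y:{x-h..x+h}|lebesgue. cmod (v x))"
      by (rule set_integral_add(2)[OF L2_set_integrable_norm_diff[OF v] set_integrable_norm[OF set_integrable_Icc_const]])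
    also have "(LINT y:{x-h..x+h}|lebesgue. cmod (v x)) = 2 * h * cmod (v x)"
      using h by (simp add: set_lebesgue_integral_def)
    also have "(LINT y:{x-h..x+h}|lebesgue. cmod (v y - 0)) = (LINT y|lebesgue. cmod (v y) * cmod (indicator {x-h..x+h} y))"
      unfolding set_lebesgue_integral_def by (intro Bochner_Integration.integral_cong) (auto simp: indicator_def)
    also have "\<dots> \<le> L2_norm v * sqrt (2 * h)" using L2_Cauchy_Schwarz_abs[OF v IL] unfolding Ln .
    finally show ?thesis by simp
  qed
  \<comment> \<open>The 1 covers radii below \<delta>; the other entry is the Cauchy-Schwarz bound
    at \<delta>, which only decreases for larger radii.\<close>
  define M where "M = max 1 (L2_norm v * sqrt (2 / \<delta>) + 2 * cmod (v x))"
  have AM: "A h \<le> M" for h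
  proof -
    consider "h \<le> 0" | "0 < h" "h < \<delta>" | "h \<ge> \<delta>" by linarith
    then show ?thesis
    proof cases
      case 1 then have "A h = 0" using \<Phi>neg[of h] by (cases "h = 0") (auto simp: A_def) then show ?thesis by (simp add: M_def)
    next
      case 2 then show ?thesis using \<delta>(2)[of h] by (simp add: M_def)
    next
      case 3
      then have h: "h > 0" using \<delta>(1) by simp
      have "A h \<le> (L2_norm v * sqrt (2 * h) + 2 * h * cmod (v x)) / h"
        unfolding A_def using Phi_le[OF h] h by (intro divide_right_mono) auto
      also have "\<dots> = L2_norm v * (sqrt (2 * h) / h) + 2 * cmod (v x)" using h by (simp add: field_simps)
      also have "sqrt (2 * h) / h = sqrt (2 / h)" using h
        by (simp add: real_sqrt_mult real_sqrt_divide real_div_sqrt divide_simps)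
      also have "L2_norm v * sqrt (2 / h) \<le> L2_norm v * sqrt (2 / \<delta>)"
        using 3 \<delta>(1) h by (intro mult_left_mono real_sqrt_le_mono divide_left_mono) auto
      finally show ?thesis by (simp add: M_def)
    qed
  qed
  \<comment> \<open>The weight 4 (1/4)^k / \<epsilon> times the interval radius 2^k \<epsilon>
    leaves 4 (1/2)^k in front of the average \<open>A\<close>.\<close>
  define a where "a k \<epsilon> = 4 * (1/2)^k * A (2^k * \<epsilon>)" for k :: nat and \<epsilon> :: real
  have "((\<lambda>\<epsilon>. \<Sum>k. a k \<epsilon>) \<longlongrightarrow> (\<Sum>k::nat. (0::real))) (at_right 0)"
  proof (rule tannerys_theorem[where M="\<lambda>k. 4 * (1/2)^k * M", THEN conjunct2, THEN conjunct2])
    show "((\<lambda>\<epsilon>. a k \<epsilon>) \<longlongrightarrow> 0) (at_right 0)" for k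
    proof -
      have "filterlim (\<lambda>\<epsilon>::real. 2^k * \<epsilon>) (at_right 0) (at_right 0)"
        unfolding filterlim_at by (auto intro!: tendsto_eq_intros eventually_at_rightI[of 0 1])
      from filterlim_compose[OF Alim this] show ?thesis unfolding a_def by (intro tendsto_mult_right_zero)
    qed
    show "\<forall>\<^sub>F (k, \<epsilon>) in at_top \<times>\<^sub>F at_right 0. norm (a k \<epsilon>) \<le> 4 * (1/2)^k * M"
      by (intro always_eventually allI) (auto simp: a_def abs_mult abs_of_nonneg[OF A0] intro!: mult_left_mono AM)
    show "summable (\<lambda>k. 4 * (1/2)^k * M)" by (intro summable_mult summable_mult2 summable_geometric) auto
  qed auto
  then have lim2: "((\<lambda>\<epsilon>. ennreal (\<Sum>k. a k \<epsilon>)) \<longlongrightarrow> 0) (at_right 0)"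
    using tendsto_ennrealI by fastforce
  have le: "(\<integral>\<^sup>+y. ennreal (cmod (v y - v x) * (\<epsilon> / (\<epsilon>\<^sup>2 + (x - y)\<^sup>2))) \<partial>lebesgue) \<le> ennreal (\<Sum>k. a k \<epsilon>)" if \<epsilon>: "\<epsilon> > 0" for \<epsilon>
  proof -
    have sa: "summable (\<lambda>k. a k \<epsilon>)"
    proof (rule summable_comparison_test)
      show "\<exists>N. \<forall>n\<ge>N. norm (a n \<epsilon>) \<le> 4 * (1/2)^n * M" by (auto simp: a_def abs_mult abs_of_nonneg[OF A0] intro!: mult_left_mono AM)
      show "summable (\<lambda>k. 4 * (1/2)^k * M)" by (intro summable_mult summable_mult2 summable_geometric) auto
    qed
    have "(\<integral>\<^sup>+y. ennreal (cmod (v y - v x) * (\<epsilon> / (\<epsilon>\<^sup>2 + (x - y)\<^sup>2))) \<partial>lebesgue)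
       \<le> (\<integral>\<^sup>+y. (\<Sum>k. ennreal (4 * (1/4)^k / \<epsilon>) * ennreal (indicator {x - 2^k*\<epsilon>..x + 2^k*\<epsilon>} y * cmod (v y - v x))) \<partial>lebesgue)"
    proof (rule nn_integral_mono)
      fix y
      have "ennreal (cmod (v y - v x) * (\<epsilon> / (\<epsilon>\<^sup>2 + (x - y)\<^sup>2))) = ennreal (cmod (v y - v x)) * ennreal (\<epsilon> / (\<epsilon>\<^sup>2 + (x - y)\<^sup>2))"
        by (rule ennreal_mult') simp
      also have "\<dots> \<le> ennreal (cmod (v y - v x)) * (\<Sum>k. ennreal (4 * (1/4)^k / \<epsilon> * indicator {-(2^k*\<epsilon>)..2^k*\<epsilon>} (x - y)))"
        by (intro mult_left_mono poisson_dyadic_bound \<epsilon>) simp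
      also have "\<dots> = (\<Sum>k. ennreal (cmod (v y - v x)) * ennreal (4 * (1/4)^k / \<epsilon> * indicator {-(2^k*\<epsilon>)..2^k*\<epsilon>} (x - y)))"
        by (rule ennreal_suminf_cmult[symmetric])
      also have "\<dots> = (\<Sum>k. ennreal (4 * (1/4)^k / \<epsilon>) * ennreal (indicator {x - 2^k*\<epsilon>..x + 2^k*\<epsilon>} y * cmod (v y - v x)))"
        using \<epsilon> by (intro suminf_cong) (auto simp: indicator_def ennreal_mult'[symmetric] mult.commute)
      finally show "ennreal (cmod (v y - v x) * (\<epsilon> / (\<epsilon>\<^sup>2 + (x - y)\<^sup>2))) \<le> (\<Sum>k. ennreal (4 * (1/4)^k / \<epsilon>) * ennreal (indicator {x - 2^k*\<epsilon>..x + 2^k*\<epsilon>} y * cmod (v y - v x)))" .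
    qed
    also have "\<dots> = (\<Sum>k. ennreal (4 * (1/4)^k / \<epsilon>) * (\<integral>\<^sup>+y. ennreal (indicator {x - 2^k*\<epsilon>..x + 2^k*\<epsilon>} y * cmod (v y - v x)) \<partial>lebesgue))"
    proof -
      have [measurable]: "indicat_real {x - 2^k*\<epsilon>..x + 2^k*\<epsilon>} \<in> borel_measurable lebesgue" for k :: nat by (intro measurable_completion) measurable
      show ?thesis by (subst nn_integral_suminf) (auto simp: nn_integral_cmult)
    qed
    also have "\<dots> = (\<Sum>k. ennreal (a k \<epsilon>))"
    proof (rule suminf_cong)
      fix k :: nat
      have "(\<integral>\<^sup>+y. ennreal (indicator {x - 2^k*\<epsilon>..x + 2^k*\<epsilon>} y * cmod (v y - v x)) \<partial>lebesgue) = ennreal (\<Phi> (2^k * \<epsilon>))"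
        unfolding \<Phi>_def set_lebesgue_integral_def real_scaleR_def
        using L2_set_integrable_norm_diff[OF v, of "x - 2^k*\<epsilon>" "x + 2^k*\<epsilon>" "v x"]
        by (intro nn_integral_eq_integral) (auto simp: set_integrable_def)
      then have "ennreal (4 * (1/4)^k / \<epsilon>) * (\<integral>\<^sup>+y. ennreal (indicator {x - 2^k*\<epsilon>..x + 2^k*\<epsilon>} y * cmod (v y - v x)) \<partial>lebesgue)
         = ennreal (4 * (1/4)^k / \<epsilon> * \<Phi> (2^k * \<epsilon>))" using \<epsilon> by (simp add: ennreal_mult'[symmetric])
      also have "4 * (1/4)^k / \<epsilon> * \<Phi> (2^k * \<epsilon>) = a k \<epsilon>"
      proof -
        have "(4::real)^k = 2^k * 2^k" by (simp flip: power_mult_distrib)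
        then show ?thesis using \<epsilon> by (simp add: a_def A_def power_divide field_simps)
      qed
      finally show "ennreal (4 * (1/4)^k / \<epsilon>) * (\<integral>\<^sup>+y. ennreal (indicator {x - 2^k*\<epsilon>..x + 2^k*\<epsilon>} y * cmod (v y - v x)) \<partial>lebesgue) = ennreal (a k \<epsilon>)" .
    qed
    also have "\<dots> = ennreal (\<Sum>k. a k \<epsilon>)" by (rule suminf_ennreal2[OF _ sa]) (simp add: a_def A0)
    finally show ?thesis .
  qed
  show ?thesis
  proof (rule tendsto_sandwich[OF _ _ tendsto_const lim2])
    show "\<forall>\<^sub>F \<epsilon> in at_right 0. (\<integral>\<^sup>+y. ennreal (cmod (v y - v x) * (\<epsilon> / (\<epsilon>\<^sup>2 + (x - y)\<^sup>2))) \<partial>lebesgue) \<le> ennreal (\<Sum>k. a k \<epsilon>)"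
      using le by (auto simp: eventually_at_right_field intro!: exI[of _ 1])
  qed simp
qed

section \<open>The Hilbert transform\<close>

lemma L2_of_bounded_integrable:
  assumes i: "integrable lebesgue v" and b: "\<And>x. cmod (v x) \<le> C"
  shows "v \<in> L2"
proof -
  have [measurable]: "v \<in> borel_measurable lebesgue" using i by simp
  have "integrable lebesgue (\<lambda>x. (cmod (v x))\<^sup>2)"
  proof (rule Bochner_Integration.integrable_bound[where f="\<lambda>x. C * cmod (v x)"])
    show "AE x in lebesgue. norm ((cmod (v x))\<^sup>2) \<le> norm (C * cmod (v x))"
    proof (rule AE_I2)
      fix x
      have "cmod (v x) * cmod (v x) \<le> C * cmod (v x)" by (intro mult_right_mono b) simp
      then show "norm ((cmod (v x))\<^sup>2) \<le> norm (C * cmod (v x))" by (simp add: power2_eq_square)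
    qed
  qed (use i in auto)
  then show ?thesis by (simp add: L2_def)
qed

text \<open>One half of exp (-2 pi \<epsilon> |\<xi>|). Its transform 1 / (2 pi (\<epsilon> + i y))
  contains the Poisson kernel in its real part and the conjugate kernel in its imaginary
  part.\<close>

definition exp_half :: "real \<Rightarrow> real \<Rightarrow> real" where
  "exp_half \<epsilon> \<xi> = (if \<xi> > 0 then exp (- (2 * pi * \<epsilon> * \<xi>)) else 0)"

lemma exp_decay_at_top: "(c::real) > 0 \<Longrightarrow> ((\<lambda>x. exp (- (c * x))) \<longlongrightarrow> 0) at_top"
  by (rule filterlim_compose[OF exp_at_bot])
     (intro filterlim_uminus_at_bot_at_top[THEN filterlim_compose] filterlim_tendsto_pos_mult_at_top[OF tendsto_const] filterlim_ident)

lemma exp_half_measurable [measurable]: "exp_half \<epsilon> \<in> borel_measurable borel"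
  unfolding exp_half_def[abs_def] by measurable

lemma exp_half_set_integrable:
  assumes "\<epsilon> > 0" shows "set_integrable lborel {0<..} (\<lambda>\<xi>. exp (- (2 * pi * \<epsilon> * \<xi>)))"
proof -
  have "set_integrable lborel (einterval 0 \<infinity>) (\<lambda>\<xi>. exp (- (2 * pi * \<epsilon> * \<xi>)))"
  proof (rule interval_integral_FTC_nonneg(1)[where F="\<lambda>\<xi>. - exp (- (2 * pi * \<epsilon> * \<xi>)) / (2 * pi * \<epsilon>)"])
    show "DERIV (\<lambda>\<xi>. - exp (- (2 * pi * \<epsilon> * \<xi>)) / (2 * pi * \<epsilon>)) x :> exp (- (2 * pi * \<epsilon> * x))" for x
      using assms by (auto intro!: derivative_eq_intros)
    show "isCont (\<lambda>\<xi>. exp (- (2 * pi * \<epsilon> * \<xi>))) x" for x by (intro continuous_intros)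
    show "(((\<lambda>\<xi>. - exp (- (2 * pi * \<epsilon> * \<xi>)) / (2 * pi * \<epsilon>)) \<circ> real_of_ereal) \<longlongrightarrow> - exp (- (2 * pi * \<epsilon> * 0)) / (2 * pi * \<epsilon>)) (at_right 0)"
      unfolding zero_ereal_def ereal_tendsto_simps by (intro tendsto_intros) (use assms in auto)
    show "(((\<lambda>\<xi>. - exp (- (2 * pi * \<epsilon> * \<xi>)) / (2 * pi * \<epsilon>)) \<circ> real_of_ereal) \<longlongrightarrow> - 0 / (2 * pi * \<epsilon>)) (at_left \<infinity>)"
      unfolding ereal_tendsto_simps by (intro tendsto_intros exp_decay_at_top) (use assms in auto)
  qed auto
  moreover have "einterval 0 \<infinity> = {0<..}" by (auto simp: einterval_def)
  ultimately show ?thesis by simp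
qed

lemma exp_half_indicator: "complex_of_real (exp_half \<epsilon> \<xi>) * w = indicat_real {0<..} \<xi> *\<^sub>R (of_real (exp (- (2 * pi * \<epsilon> * \<xi>))) * w)"
  by (simp add: exp_half_def indicator_def)

lemma exp_half_integrable:
  assumes "\<epsilon> > 0" shows "integrable lebesgue (\<lambda>\<xi>. complex_of_real (exp_half \<epsilon> \<xi>))"
proof -
  have "integrable lborel (exp_half \<epsilon>)"
  proof -
    have "exp_half \<epsilon> = (\<lambda>\<xi>. indicat_real {0<..} \<xi> *\<^sub>R exp (- (2 * pi * \<epsilon> * \<xi>)))"
      by (auto simp: exp_half_def)
    then show ?thesis using exp_half_set_integrable[OF assms] unfolding set_integrable_def by simp
  qed
  then show ?thesis by (subst integrable_completion) auto
qed

lemma exp_half_le_1: "\<epsilon> > 0 \<Longrightarrow> cmod (of_real (exp_half \<epsilon> \<xi>)) \<le> 1"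
  by (simp add: exp_half_def)

lemma fourier_integral_exp_half:
  assumes \<epsilon>: "\<epsilon> > 0"
  shows "fourier_integral (\<lambda>\<xi>. of_real (exp_half \<epsilon> \<xi>)) y = 1 / (2 * of_real pi * Complex \<epsilon> y)"
proof -
  define z where "z = - (2 * of_real pi * Complex \<epsilon> y)"
  have z0: "z \<noteq> 0" using \<epsilon> by (simp add: z_def complex_eq_iff)
  have Re_z: "Re z = - (2 * pi * \<epsilon>)" by (simp add: z_def)
  have ez: "of_real (exp (- (2 * pi * \<epsilon> * \<xi>))) * fourier_char (- (y * \<xi>)) = exp (z * of_real \<xi>)" for \<xi>
    unfolding fourier_char_def exp_of_real[symmetric] exp_add[symmetric] z_def
    by (intro arg_cong[where f=exp]) (simp add: complex_eq_iff)
  have "fourier_integral (\<lambda>\<xi>. of_real (exp_half \<epsilon> \<xi>)) y = (LINT \<xi>|lborel. of_real (exp_half \<epsilon> \<xi>) * fourier_char (- (y * \<xi>)))"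
    unfolding fourier_integral_def by (subst integral_completion) auto
  also have "\<dots> = (LINT \<xi>:{0<..}|lborel. exp (z * of_real \<xi>))"
    unfolding exp_half_indicator ez set_lebesgue_integral_def ..
  also have "\<dots> = (LBINT \<xi>=0..\<infinity>. exp (z * of_real \<xi>))"
    unfolding zero_ereal_def by (simp add: interval_integral_to_infinity_eq)
  also have "\<dots> = 0 - exp (z * of_real 0) / z"
  proof (rule interval_integral_FTC_integrable[where F="\<lambda>\<xi>. exp (z * of_real \<xi>) / z"])
    show "((\<lambda>\<xi>. exp (z * of_real \<xi>) / z) has_vector_derivative exp (z * of_real x)) (at x)" for x
      by (rule has_vector_derivative_real_field) (use z0 in \<open>auto intro!: derivative_eq_intros\<close>)
    show "isCont (\<lambda>\<xi>. exp (z * complex_of_real \<xi>)) x" for x by (intro continuous_intros)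
    have "integrable lborel (\<lambda>\<xi>. complex_of_real (exp_half \<epsilon> \<xi>) * fourier_char (- (y * \<xi>)))"
      using integrable_times_char_minus[OF exp_half_integrable[OF \<epsilon>], of y] by (subst (asm) integrable_completion) auto
    then show "set_integrable lborel (einterval 0 \<infinity>) (\<lambda>\<xi>. exp (z * complex_of_real \<xi>))"
      unfolding exp_half_indicator ez set_integrable_def by (simp add: einterval_def greaterThan_def zero_ereal_def)
    show "(((\<lambda>\<xi>. exp (z * complex_of_real \<xi>) / z) \<circ> real_of_ereal) \<longlongrightarrow> exp (z * of_real 0) / z) (at_right 0)"
      unfolding zero_ereal_def ereal_tendsto_simps by (intro tendsto_intros) (use z0 in auto)
    show "(((\<lambda>\<xi>. exp (z * complex_of_real \<xi>) / z) \<circ> real_of_ereal) \<longlongrightarrow> 0) (at_left \<infinity>)"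
      unfolding ereal_tendsto_simps
    proof (rule tendsto_norm_zero_cancel)
      have "((\<lambda>x. exp (- (2 * pi * \<epsilon> * x)) / cmod z) \<longlongrightarrow> 0 / cmod z) at_top"
        by (intro tendsto_intros exp_decay_at_top) (use \<epsilon> z0 in auto)
      then show "((\<lambda>x. cmod (exp (z * complex_of_real x) / z)) \<longlongrightarrow> 0) at_top"
        by (simp add: norm_divide Re_z)
    qed
  qed auto
  also have "\<dots> = 1 / (2 * of_real pi * Complex \<epsilon> y)" by (simp add: z_def)
  finally show ?thesis .
qed

lemma poisson_kernel:
  assumes "\<epsilon> > 0"
  shows "integrable lebesgue (\<lambda>t. \<epsilon> / (\<epsilon>\<^sup>2 + t\<^sup>2))" and "(LINT t|lebesgue. \<epsilon> / (\<epsilon>\<^sup>2 + t\<^sup>2)) = pi"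
proof -
  have pos: "\<epsilon>\<^sup>2 + t\<^sup>2 > 0" for t using assms by (simp add: add_pos_nonneg)
  have D: "DERIV (\<lambda>t. arctan (t / \<epsilon>)) x :> \<epsilon> / (\<epsilon>\<^sup>2 + x\<^sup>2)" for x
  proof -
    have "inverse (1 + (x / \<epsilon>)\<^sup>2) * (1 / \<epsilon>) = \<epsilon> / (\<epsilon>\<^sup>2 + x\<^sup>2)"
    proof -
      have "1 + (x / \<epsilon>)\<^sup>2 = (\<epsilon>\<^sup>2 + x\<^sup>2) / \<epsilon>\<^sup>2" using assms by (simp add: power_divide add_divide_distrib)
      then show ?thesis using assms by (simp only: inverse_divide) (simp add: power2_eq_square)
    qed
    moreover have "DERIV (\<lambda>t. arctan (t / \<epsilon>)) x :> inverse (1 + (x / \<epsilon>)\<^sup>2) * (1 / \<epsilon>)"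
      using assms by (auto intro!: derivative_eq_intros)
    ultimately show ?thesis by simp
  qed
  have lim: "((\<lambda>t. arctan (t / \<epsilon>)) \<longlongrightarrow> pi / 2) at_top" "((\<lambda>t. arctan (t / \<epsilon>)) \<longlongrightarrow> - (pi / 2)) at_bot"
  proof -
    have scale: "t / \<epsilon> = inverse \<epsilon> * t" for t by (simp add: field_simps)
    have "filterlim (\<lambda>t. inverse \<epsilon> * t) at_top at_top"
      by (rule filterlim_tendsto_pos_mult_at_top[OF tendsto_const _ filterlim_ident]) (use assms in simp)
    from filterlim_compose[OF tendsto_arctan_at_top this] show "((\<lambda>t. arctan (t / \<epsilon>)) \<longlongrightarrow> pi / 2) at_top"
      unfolding scale .
    have "filterlim (\<lambda>t. inverse \<epsilon> * t) at_bot at_bot"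
      by (rule filterlim_tendsto_pos_mult_at_bot[OF tendsto_const _ filterlim_ident]) (use assms in simp)
    from filterlim_compose[OF tendsto_arctan_at_bot this] show "((\<lambda>t. arctan (t / \<epsilon>)) \<longlongrightarrow> - (pi / 2)) at_bot"
      unfolding scale .
  qed
  have cont: "isCont (\<lambda>t. \<epsilon> / (\<epsilon>\<^sup>2 + t\<^sup>2)) x" for x
    using pos[of x] by (intro continuous_intros) auto
  have A: "(((\<lambda>t. arctan (t / \<epsilon>)) \<circ> real_of_ereal) \<longlongrightarrow> - (pi / 2)) (at_right (-\<infinity>))"
    and B: "(((\<lambda>t. arctan (t / \<epsilon>)) \<circ> real_of_ereal) \<longlongrightarrow> pi / 2) (at_left \<infinity>)"
    unfolding ereal_tendsto_simps using lim by auto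
  have nn: "AE x in lborel. -\<infinity> < ereal x \<longrightarrow> ereal x < \<infinity> \<longrightarrow> 0 \<le> \<epsilon> / (\<epsilon>\<^sup>2 + x\<^sup>2)" using assms by simp
  have U: "einterval (-\<infinity>) \<infinity> = UNIV" by (auto simp: einterval_def)
  note F = interval_integral_FTC_nonneg[OF _ D cont nn A B]
  have i: "integrable lborel (\<lambda>t. \<epsilon> / (\<epsilon>\<^sup>2 + t\<^sup>2))" using F(1) by (simp add: U set_integrable_def)
  moreover have m: "(\<lambda>t. \<epsilon> / (\<epsilon>\<^sup>2 + t\<^sup>2)) \<in> borel_measurable borel" by measurable
  ultimately show "integrable lebesgue (\<lambda>t. \<epsilon> / (\<epsilon>\<^sup>2 + t\<^sup>2))" by (simp add: integrable_completion)
  have "(LBINT t=-\<infinity>..\<infinity>. \<epsilon> / (\<epsilon>\<^sup>2 + t\<^sup>2)) = pi" using F(2) by simp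
  then have "(LINT t|lborel. \<epsilon> / (\<epsilon>\<^sup>2 + t\<^sup>2)) = pi"
    by (simp add: interval_lebesgue_integral_def U set_lebesgue_integral_def)
  then show "(LINT t|lebesgue. \<epsilon> / (\<epsilon>\<^sup>2 + t\<^sup>2)) = pi" using m by (simp add: integral_completion)
qed

lemma poisson_kernel_translate:
  assumes "\<epsilon> > 0"
  shows "integrable lebesgue (\<lambda>y. \<epsilon> / (\<epsilon>\<^sup>2 + (x - y)\<^sup>2))" and "(LINT y|lebesgue. \<epsilon> / (\<epsilon>\<^sup>2 + (x - y)\<^sup>2)) = pi"
  using poisson_kernel[OF assms] lebesgue_integrable_real_affine_iff[of "-1" "\<lambda>t. \<epsilon> / (\<epsilon>\<^sup>2 + t\<^sup>2)" x]
    lebesgue_integral_real_affine[of "-1" "\<lambda>t. \<epsilon> / (\<epsilon>\<^sup>2 + t\<^sup>2)" x] by auto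

lemma poisson_kernel_L2:
  assumes "\<epsilon> > 0" shows "(\<lambda>y. complex_of_real (\<epsilon> / (\<epsilon>\<^sup>2 + (x - y)\<^sup>2))) \<in> L2"
proof (rule L2_of_bounded_integrable)
  show "integrable lebesgue (\<lambda>y. complex_of_real (\<epsilon> / (\<epsilon>\<^sup>2 + (x - y)\<^sup>2)))"
    by (intro integrable_of_real poisson_kernel_translate assms)
  fix y
  have "\<epsilon> / (\<epsilon>\<^sup>2 + (x - y)\<^sup>2) \<le> \<epsilon> / \<epsilon>\<^sup>2" using assms by (intro divide_left_mono mult_pos_pos) (auto simp: add_pos_nonneg)
  moreover have "0 \<le> \<epsilon> / (\<epsilon>\<^sup>2 + (x - y)\<^sup>2)" using assms by simp
  ultimately show "cmod (of_real (\<epsilon> / (\<epsilon>\<^sup>2 + (x - y)\<^sup>2))) \<le> \<epsilon> / \<epsilon>\<^sup>2" unfolding norm_of_real by linarith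
qed

text \<open>The even and the odd combination of the two halves. They are related by the factor - i
  pi sgn \<xi>, which is how the Hilbert multiplier becomes attached to a pair of explicit
  kernels.\<close>

lemma fourier_pair_poisson:
  assumes \<epsilon>: "\<epsilon> > 0"
  defines "p \<equiv> \<lambda>\<xi>. complex_of_real (exp_half \<epsilon> \<xi>) + complex_of_real (exp_half \<epsilon> (- \<xi>))"
    and "q \<equiv> \<lambda>\<xi>. - \<i> * of_real pi * (complex_of_real (exp_half \<epsilon> \<xi>) - complex_of_real (exp_half \<epsilon> (- \<xi>)))"
  shows "p \<in> L2" "q \<in> L2" "integrable lebesgue p" "integrable lebesgue q"
    "fourier_integral p s = of_real (\<epsilon> / (pi * (\<epsilon>\<^sup>2 + s\<^sup>2)))" "fourier_integral q s = of_real (- s / (\<epsilon>\<^sup>2 + s\<^sup>2))"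
proof -
  note E = exp_half_integrable[OF \<epsilon>]
  note E' = integrable_reflect[OF E]
  note EL = L2_of_bounded_integrable[OF E exp_half_le_1[OF \<epsilon>]]
  show "p \<in> L2" "q \<in> L2" "integrable lebesgue p" "integrable lebesgue q"
    unfolding p_def q_def
    by (rule L2_add[OF EL L2_reflect[OF EL]] L2_cmult[OF L2_diff[OF EL L2_reflect[OF EL]]]
        Bochner_Integration.integrable_add[OF E E'] integrable_mult_right[OF Bochner_Integration.integrable_diff[OF E E']])+
  have F': "fourier_integral (\<lambda>\<xi>. complex_of_real (exp_half \<epsilon> (- \<xi>))) s = 1 / (2 * of_real pi * Complex \<epsilon> (- s))"
    using fourier_integral_scale[of "-1" "\<lambda>\<xi>. complex_of_real (exp_half \<epsilon> \<xi>)" s] by (simp add: fourier_integral_exp_half[OF \<epsilon>])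
  have nz: "Complex \<epsilon> s \<noteq> 0" "Complex \<epsilon> (- s) \<noteq> 0" using \<epsilon> by (auto simp: complex_eq_iff)
  have pr: "Complex \<epsilon> s * Complex \<epsilon> (- s) = of_real (\<epsilon>\<^sup>2 + s\<^sup>2)" by (simp add: complex_eq_iff power2_eq_square)
  have pos: "\<epsilon>\<^sup>2 + s\<^sup>2 > 0" using \<epsilon> by (simp add: add_pos_nonneg)
  have "fourier_integral p s = 1 / (2 * of_real pi * Complex \<epsilon> s) + 1 / (2 * of_real pi * Complex \<epsilon> (- s))"
    unfolding p_def fourier_integral_add[OF E E'] F' fourier_integral_exp_half[OF \<epsilon>] ..
  also have "\<dots> = (Complex \<epsilon> (- s) + Complex \<epsilon> s) / (2 * of_real pi * (Complex \<epsilon> s * Complex \<epsilon> (- s)))"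
    using nz by (simp add: field_simps)
  also have "\<dots> = of_real (\<epsilon> / (pi * (\<epsilon>\<^sup>2 + s\<^sup>2)))" unfolding pr
    by (simp add: complex_add Complex_eq)
  finally show "fourier_integral p s = of_real (\<epsilon> / (pi * (\<epsilon>\<^sup>2 + s\<^sup>2)))" .
  have "fourier_integral q s = - \<i> * of_real pi * (1 / (2 * of_real pi * Complex \<epsilon> s) - 1 / (2 * of_real pi * Complex \<epsilon> (- s)))"
    unfolding q_def fourier_integral_cmult fourier_integral_diff[OF E E'] F' fourier_integral_exp_half[OF \<epsilon>] ..
  also have "\<dots> = - \<i> * (Complex \<epsilon> (- s) - Complex \<epsilon> s) / (2 * (Complex \<epsilon> s * Complex \<epsilon> (- s)))"
    using nz by (simp add: field_simps)
  also have "- \<i> * (Complex \<epsilon> (- s) - Complex \<epsilon> s) = of_real (2 * (- s))" by (simp add: complex_eq_iff)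
  also have "of_real (2 * (- s)) / (2 * (Complex \<epsilon> s * Complex \<epsilon> (- s))) = of_real (- s / (\<epsilon>\<^sup>2 + s\<^sup>2))" unfolding pr of_real_mult of_real_divide of_real_numeral
    by (rule mult_divide_mult_cancel_left) simp
  finally show "fourier_integral q s = of_real (- s / (\<epsilon>\<^sup>2 + s\<^sup>2))" .
qed

lemma L2_integral_mult_cong_AE:
  assumes "v \<in> L2" "w \<in> L2" "AE x in lebesgue. w' x = w x"
  shows "(LINT x|lebesgue. v x * w' x) = (LINT x|lebesgue. v x * w x)"
proof (rule integral_cong_AE)
  have "w' \<in> L2" using assms(2,3) by (rule L2_cong_AE)
  then show "(\<lambda>x. v x * w' x) \<in> borel_measurable lebesgue" "(\<lambda>x. v x * w x) \<in> borel_measurable lebesgue"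
    using assms(1,2) by (auto dest: L2_measurable)
  show "AE x in lebesgue. v x * w' x = v x * w x" using assms(3) by eventually_elim simp
qed

text \<open>The multiplier is moved from kernel to function: pairing \<open>v\<close> with the
  conjugate kernel is pairing \<open>fourier v\<close> with \<open>q'\<close>, and q' is - i pi sgn
  \<xi> times \<open>p'\<close>, which turns \<open>fourier v\<close> into \<open>fourier g\<close>
  and leaves the Poisson kernel.\<close>

lemma conjugate_poisson:
  assumes v: "v \<in> L2" and g: "g \<in> L2"
    and eq: "AE \<xi> in lebesgue. fourier g \<xi> = - \<i> * of_real (pi * sgn \<xi>) * fourier v \<xi>"
    and \<epsilon>: "\<epsilon> > 0"
  shows "(\<lambda>y. complex_of_real ((x - y) / (\<epsilon>\<^sup>2 + (x - y)\<^sup>2))) \<in> L2" (is "?Q \<in> L2")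
    and "(LINT y|lebesgue. v y * of_real ((x - y) / (\<epsilon>\<^sup>2 + (x - y)\<^sup>2))) =
         (LINT y|lebesgue. g y * of_real (\<epsilon> / (pi * (\<epsilon>\<^sup>2 + (x - y)\<^sup>2))))"
proof -
  let ?P = "\<lambda>y. complex_of_real (\<epsilon> / (pi * (\<epsilon>\<^sup>2 + (x - y)\<^sup>2)))"
  define p where "p \<xi> = complex_of_real (exp_half \<epsilon> \<xi>) + complex_of_real (exp_half \<epsilon> (- \<xi>))" for \<xi>
  define q where "q \<xi> = - \<i> * of_real pi * (complex_of_real (exp_half \<epsilon> \<xi>) - complex_of_real (exp_half \<epsilon> (- \<xi>)))" for \<xi>
  note pq = fourier_pair_poisson[OF \<epsilon>, folded p_def[abs_def] q_def[abs_def]]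
  have qp: "q \<xi> = - \<i> * of_real (pi * sgn \<xi>) * p \<xi>" for \<xi>
    by (auto simp: p_def q_def exp_half_def sgn_if)
  \<comment> \<open>Modulation by e(x\<xi>) centres the transformed kernels at x.\<close>
  define p' where "p' \<xi> = fourier_char (x * \<xi>) * p \<xi>" for \<xi>
  define q' where "q' \<xi> = fourier_char (x * \<xi>) * q \<xi>" for \<xi>
  have L: "p' \<in> L2" "q' \<in> L2" unfolding p'_def[abs_def] q'_def[abs_def] using pq by (auto intro: L2_char_mult)
  have I: "integrable lebesgue p'" "integrable lebesgue q'"
  proof -
    have "p' = (\<lambda>\<xi>. p \<xi> * fourier_char (x * \<xi>))" "q' = (\<lambda>\<xi>. q \<xi> * fourier_char (x * \<xi>))"
      by (auto simp: p'_def q'_def)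
    then show "integrable lebesgue p'" "integrable lebesgue q'"
      using integrable_times_char[OF pq(3), of x] integrable_times_char[OF pq(4), of x] by simp_all
  qed
  have "fourier_integral q' y = ?Q y" for y
    unfolding q'_def[abs_def] fourier_integral_modulate pq by (simp add: power2_commute)
  then have Q: "AE y in lebesgue. ?Q y = fourier q' y"
    using fourier_eq_fourier_integral[OF L(2) I(2)] by auto
  have "fourier_integral p' y = ?P y" for y
    unfolding p'_def[abs_def] fourier_integral_modulate pq by (simp add: power2_commute)
  then have P: "AE y in lebesgue. ?P y = fourier p' y"
    using fourier_eq_fourier_integral[OF L(1) I(1)] by auto
  show QL: "?Q \<in> L2" by (rule L2_cong_AE[OF fourier_L2[OF L(2)] Q])
  have PL: "?P \<in> L2" by (rule L2_cong_AE[OF fourier_L2[OF L(1)] P])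
  have "(LINT y|lebesgue. v y * ?Q y) = (LINT y|lebesgue. v y * fourier q' y)"
    by (rule L2_integral_mult_cong_AE[OF v fourier_L2[OF L(2)] Q])
  also have "\<dots> = (LINT \<xi>|lebesgue. fourier v \<xi> * q' \<xi>)" by (rule fourier_multiplication_formula[OF v L(2)])
  also have "\<dots> = (LINT \<xi>|lebesgue. fourier g \<xi> * p' \<xi>)"
  proof (rule integral_cong_AE)
    show "AE \<xi> in lebesgue. fourier v \<xi> * q' \<xi> = fourier g \<xi> * p' \<xi>"
      using eq by eventually_elim (simp add: q'_def p'_def qp)
  qed (use fourier_L2[OF v] fourier_L2[OF g] L in \<open>auto dest: L2_measurable\<close>)
  also have "\<dots> = (LINT y|lebesgue. g y * fourier p' y)" by (rule fourier_multiplication_formula[OF g L(1), symmetric])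
  also have "\<dots> = (LINT y|lebesgue. g y * ?P y)"
    by (rule L2_integral_mult_cong_AE[OF g fourier_L2[OF L(1)] P, symmetric])
  finally show "(LINT y|lebesgue. v y * ?Q y) = (LINT y|lebesgue. g y * ?P y)" .
qed

section \<open>The principal value at a Lebesgue point\<close>

lemma tendsto_0_of_ennreal_bound:
  fixes a :: "real \<Rightarrow> complex"
  assumes "(N \<longlongrightarrow> (0::ennreal)) F" "\<forall>\<^sub>F x in F. ennreal (cmod (a x)) \<le> N x"
  shows "(a \<longlongrightarrow> 0) F"
proof (rule tendstoI)
  fix e :: real assume "e > 0"
  then have "\<forall>\<^sub>F x in F. N x < ennreal e" by (intro order_tendstoD(2)[OF assms(1)]) simp
  with assms(2) show "\<forall>\<^sub>F x in F. dist (a x) 0 < e"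
  proof eventually_elim
    case (elim x)
    then have "ennreal (cmod (a x)) < ennreal e" by simp
    then show ?case by (simp add: ennreal_less_iff)
  qed
qed

text \<open>The truncated kernel differs from the conjugate Poisson kernel by an odd kernel that the Poisson
  kernel dominates, so the difference vanishes in the limit at every Lebesgue point.\<close>

theorem hilbert_transform_AE:
  assumes v: "v \<in> L2" and g: "g \<in> L2"
    and eq: "AE \<xi> in lebesgue. fourier g \<xi> = - \<i> * of_real (pi * sgn \<xi>) * fourier v \<xi>"
  shows "AE x in lebesgue. hilbert_transform v x = g x"
  using lebesgue_point[OF v] lebesgue_point[OF g]
proof eventually_elim
  case (elim x)
  define T where "T \<epsilon> y = (if \<bar>x - y\<bar> > \<epsilon> then 1 / (x - y) else 0)" for \<epsilon> y
  define k where "k \<epsilon> y = T \<epsilon> y - (x - y) / (\<epsilon>\<^sup>2 + (x - y)\<^sup>2)" for \<epsilon> y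
  have [measurable]: "T \<epsilon> \<in> borel_measurable borel" for \<epsilon> unfolding T_def[abs_def] by measurable
  have km [measurable]: "k \<epsilon> \<in> borel_measurable borel" for \<epsilon> unfolding k_def[abs_def] by measurable
  have kb: "\<bar>k \<epsilon> y\<bar> \<le> \<epsilon> / (\<epsilon>\<^sup>2 + (x - y)\<^sup>2)" if \<epsilon>: "\<epsilon> > 0" for \<epsilon> y
  proof -
    define t where "t = x - y"
    have pos: "\<epsilon>\<^sup>2 + t\<^sup>2 > 0" using \<epsilon> by (simp add: add_pos_nonneg)
    show ?thesis
    proof (cases "\<bar>t\<bar> > \<epsilon>")
      case True
      then have t0: "t \<noteq> 0" using \<epsilon> by auto
      have "k \<epsilon> y = 1 / t - t / (\<epsilon>\<^sup>2 + t\<^sup>2)" using True by (simp add: k_def T_def t_def)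
      also have "\<dots> = \<epsilon>\<^sup>2 / (t * (\<epsilon>\<^sup>2 + t\<^sup>2))" using t0 pos by (simp add: field_simps power2_eq_square)
      finally have "\<bar>k \<epsilon> y\<bar> = (\<epsilon> / \<bar>t\<bar>) * (\<epsilon> / (\<epsilon>\<^sup>2 + t\<^sup>2))"
        using pos by (simp add: abs_mult power2_eq_square)
      also have "\<dots> \<le> 1 * (\<epsilon> / (\<epsilon>\<^sup>2 + t\<^sup>2))" using True \<epsilon> pos by (intro mult_right_mono) auto
      finally show ?thesis by (simp add: t_def)
    next
      case False
      then have "k \<epsilon> y = - (t / (\<epsilon>\<^sup>2 + t\<^sup>2))" by (simp add: k_def T_def t_def)
      then have "\<bar>k \<epsilon> y\<bar> = \<bar>t\<bar> / (\<epsilon>\<^sup>2 + t\<^sup>2)" using pos by simp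
      also have "\<dots> \<le> \<epsilon> / (\<epsilon>\<^sup>2 + t\<^sup>2)" using False pos by (intro divide_right_mono) auto
      finally show ?thesis by (simp add: t_def)
    qed
  qed
  have kL: "(\<lambda>y. complex_of_real (k \<epsilon> y)) \<in> L2" if \<epsilon>: "\<epsilon> > 0" for \<epsilon>
  proof (rule L2_bound[OF poisson_kernel_L2[OF \<epsilon>], where C=1])
    show "(\<lambda>y. complex_of_real (k \<epsilon> y)) \<in> borel_measurable lebesgue" by (intro measurable_completion) measurable
    show "AE y in lebesgue. cmod (of_real (k \<epsilon> y)) \<le> 1 * cmod (of_real (\<epsilon> / (\<epsilon>\<^sup>2 + (x - y)\<^sup>2)))"
      using kb[OF \<epsilon>] \<epsilon> by (intro AE_I2) (simp add: norm_divide abs_of_nonneg del: of_real_divide of_real_add)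
  qed
  have ki: "integrable lebesgue (\<lambda>y. complex_of_real (k \<epsilon> y))" if \<epsilon>: "\<epsilon> > 0" for \<epsilon>
  proof (rule Bochner_Integration.integrable_bound[OF poisson_kernel_translate(1)[OF \<epsilon>, of x]])
    show "(\<lambda>y. complex_of_real (k \<epsilon> y)) \<in> borel_measurable lebesgue" by (intro measurable_completion) measurable
    show "AE y in lebesgue. norm (complex_of_real (k \<epsilon> y)) \<le> norm (\<epsilon> / (\<epsilon>\<^sup>2 + (x - y)\<^sup>2))"
      using kb[OF \<epsilon>] \<epsilon> by (intro AE_I2) simp
  qed
  \<comment> \<open>The kernel is odd about x. Its vanishing mean allows v y to be replaced by v y -
    v x, the quantity that Poisson means control.\<close>
  have k0: "(LINT y|lebesgue. complex_of_real (k \<epsilon> y)) = 0" if \<epsilon>: "\<epsilon> > 0" for \<epsilon>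
  proof -
    have "k \<epsilon> (2 * x + (-1) * y) = - k \<epsilon> y" for y
    proof -
      have "x - (2 * x + (-1) * y) = - (x - y)" by simp
      moreover have "(if c then 1 / (- t) else 0) - (- t) / d = - ((if c then 1 / t else 0) - t / d)" for t d :: real and c
        by simp
      ultimately show ?thesis unfolding k_def T_def by (simp only: abs_minus_cancel power2_minus)
    qed
    then have "(LINT y|lebesgue. complex_of_real (k \<epsilon> y)) = (LINT y|lebesgue. - complex_of_real (k \<epsilon> y))"
      using lebesgue_integral_real_affine[of "-1" "\<lambda>y. complex_of_real (k \<epsilon> y)" "2 * x"] by simp
    then show ?thesis by simp
  qed
  have lim1: "((\<lambda>\<epsilon>. LINT y|lebesgue. v y * of_real (k \<epsilon> y)) \<longlongrightarrow> 0) (at_right 0)"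
  proof (rule tendsto_0_of_ennreal_bound[OF poisson_mean_tendsto_0[OF v elim(1)]])
    have "ennreal (cmod (LINT y|lebesgue. v y * of_real (k \<epsilon> y))) \<le> (\<integral>\<^sup>+y. ennreal (cmod (v y - v x) * (\<epsilon> / (\<epsilon>\<^sup>2 + (x - y)\<^sup>2))) \<partial>lebesgue)"
      if \<epsilon>: "\<epsilon> > 0" for \<epsilon>
    proof -
      note i = L2_mult_integrable[OF v kL[OF \<epsilon>]] integrable_mult_right[OF ki[OF \<epsilon>], of "v x"]
      have "(LINT y|lebesgue. v y * of_real (k \<epsilon> y)) = (LINT y|lebesgue. v y * of_real (k \<epsilon> y)) - (LINT y|lebesgue. v x * of_real (k \<epsilon> y))"
        using k0[OF \<epsilon>] by simp
      also have "\<dots> = (LINT y|lebesgue. (v y - v x) * of_real (k \<epsilon> y))"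
        unfolding left_diff_distrib by (rule Bochner_Integration.integral_diff[OF i, symmetric])
      also have "ennreal (cmod \<dots>) \<le> (\<integral>\<^sup>+y. ennreal (cmod ((v y - v x) * of_real (k \<epsilon> y))) \<partial>lebesgue)"
        by (rule integral_norm_bound_ennreal) (use Bochner_Integration.integrable_diff[OF i] in \<open>simp add: left_diff_distrib\<close>)
      also have "\<dots> \<le> (\<integral>\<^sup>+y. ennreal (cmod (v y - v x) * (\<epsilon> / (\<epsilon>\<^sup>2 + (x - y)\<^sup>2))) \<partial>lebesgue)"
        unfolding norm_mult norm_of_real by (intro nn_integral_mono ennreal_leI mult_left_mono kb \<epsilon>) auto
      finally show ?thesis .
    qed
    then show "\<forall>\<^sub>F \<epsilon> in at_right 0. ennreal (cmod (LINT y|lebesgue. v y * of_real (k \<epsilon> y))) \<le> (\<integral>\<^sup>+y. ennreal (cmod (v y - v x) * (\<epsilon> / (\<epsilon>\<^sup>2 + (x - y)\<^sup>2))) \<partial>lebesgue)"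
      by (auto simp: eventually_at_right_field intro!: exI[of _ 1])
  qed
  have lim2: "((\<lambda>\<epsilon>. (LINT y|lebesgue. g y * of_real (\<epsilon> / (pi * (\<epsilon>\<^sup>2 + (x - y)\<^sup>2)))) - g x) \<longlongrightarrow> 0) (at_right 0)"
  proof (rule tendsto_0_of_ennreal_bound[OF poisson_mean_tendsto_0[OF g elim(2)]])
    have "ennreal (cmod ((LINT y|lebesgue. g y * of_real (\<epsilon> / (pi * (\<epsilon>\<^sup>2 + (x - y)\<^sup>2)))) - g x)) \<le> (\<integral>\<^sup>+y. ennreal (cmod (g y - g x) * (\<epsilon> / (\<epsilon>\<^sup>2 + (x - y)\<^sup>2))) \<partial>lebesgue)"
      if \<epsilon>: "\<epsilon> > 0" for \<epsilon>
    proof -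
      define P where "P y = complex_of_real (\<epsilon> / (pi * (\<epsilon>\<^sup>2 + (x - y)\<^sup>2)))" for y
      have P_eq: "P = (\<lambda>y. of_real (1 / pi) * complex_of_real (\<epsilon> / (\<epsilon>\<^sup>2 + (x - y)\<^sup>2)))" by (auto simp: P_def)
      have PL: "P \<in> L2" unfolding P_eq by (intro L2_cmult poisson_kernel_L2 \<epsilon>)
      have Pi: "integrable lebesgue P" unfolding P_eq by (intro integrable_mult_right integrable_of_real poisson_kernel_translate \<epsilon>)
      have P1: "(LINT y|lebesgue. P y) = 1" unfolding P_eq
        by (simp only: Bochner_Integration.integral_mult_right_zero integral_complex_of_real poisson_kernel_translate(2)[OF \<epsilon>]) simp
      note i = L2_mult_integrable[OF g PL] integrable_mult_right[OF Pi, of "g x"]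
      have "(LINT y|lebesgue. g y * P y) - g x = (LINT y|lebesgue. g y * P y) - (LINT y|lebesgue. g x * P y)"
        using P1 by simp
      also have "\<dots> = (LINT y|lebesgue. (g y - g x) * P y)"
        unfolding left_diff_distrib by (rule Bochner_Integration.integral_diff[OF i, symmetric])
      also have "ennreal (cmod \<dots>) \<le> (\<integral>\<^sup>+y. ennreal (cmod ((g y - g x) * P y)) \<partial>lebesgue)"
        by (rule integral_norm_bound_ennreal) (use Bochner_Integration.integrable_diff[OF i] in \<open>simp add: left_diff_distrib\<close>)
      also have "\<dots> \<le> (\<integral>\<^sup>+y. ennreal (cmod (g y - g x) * (\<epsilon> / (\<epsilon>\<^sup>2 + (x - y)\<^sup>2))) \<partial>lebesgue)"
        unfolding norm_mult
      proof (intro nn_integral_mono ennreal_leI mult_left_mono)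
        fix y
        have pos: "\<epsilon>\<^sup>2 + (x - y)\<^sup>2 > 0" using \<epsilon> by (simp add: add_pos_nonneg)
        have "1 * (\<epsilon>\<^sup>2 + (x - y)\<^sup>2) \<le> pi * (\<epsilon>\<^sup>2 + (x - y)\<^sup>2)" using pos pi_gt3 by (intro mult_right_mono) auto
        then have "\<epsilon> / (pi * (\<epsilon>\<^sup>2 + (x - y)\<^sup>2)) \<le> \<epsilon> / (\<epsilon>\<^sup>2 + (x - y)\<^sup>2)" using pos \<epsilon> by (intro divide_left_mono) auto
        then show "cmod (P y) \<le> \<epsilon> / (\<epsilon>\<^sup>2 + (x - y)\<^sup>2)"
          using pos \<epsilon> unfolding P_def norm_of_real by simp
      qed auto
      finally show ?thesis by (simp add: P_def)
    qed
    then show "\<forall>\<^sub>F \<epsilon> in at_right 0. ennreal (cmod ((LINT y|lebesgue. g y * of_real (\<epsilon> / (pi * (\<epsilon>\<^sup>2 + (x - y)\<^sup>2)))) - g x)) \<le> (\<integral>\<^sup>+y. ennreal (cmod (g y - g x) * (\<epsilon> / (\<epsilon>\<^sup>2 + (x - y)\<^sup>2))) \<partial>lebesgue)"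
      by (auto simp: eventually_at_right_field intro!: exI[of _ 1])
  qed
  \<comment> \<open>The truncated integral is the kernel error, plus the deviation of the Poisson
    mean of \<open>g\<close> from g x, plus g x; the first two tend to 0.\<close>
  have dec: "(LINT y:{y. \<bar>x - y\<bar> > \<epsilon>}|lebesgue. v y / of_real (x - y)) =
      (LINT y|lebesgue. v y * of_real (k \<epsilon> y)) + ((LINT y|lebesgue. g y * of_real (\<epsilon> / (pi * (\<epsilon>\<^sup>2 + (x - y)\<^sup>2)))) - g x) + g x"
    if \<epsilon>: "\<epsilon> > 0" for \<epsilon>
  proof -
    note QL = conjugate_poisson[OF v g eq \<epsilon>, of x]
    have "(LINT y:{y. \<bar>x - y\<bar> > \<epsilon>}|lebesgue. v y / of_real (x - y)) = (LINT y|lebesgue. v y * of_real (k \<epsilon> y) + v y * of_real ((x - y) / (\<epsilon>\<^sup>2 + (x - y)\<^sup>2)))"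
      unfolding set_lebesgue_integral_def
    proof (rule Bochner_Integration.integral_cong[OF refl])
      fix y
      have "v y * of_real (k \<epsilon> y) + v y * of_real ((x - y) / (\<epsilon>\<^sup>2 + (x - y)\<^sup>2)) = v y * of_real (T \<epsilon> y)"
        by (simp add: k_def distrib_left[symmetric] del: of_real_divide flip: of_real_add)
      then show "indicator {y. \<bar>x - y\<bar> > \<epsilon>} y *\<^sub>R (v y / of_real (x - y)) = v y * of_real (k \<epsilon> y) + v y * of_real ((x - y) / (\<epsilon>\<^sup>2 + (x - y)\<^sup>2))"
        by (simp add: T_def indicator_def)
    qed
    also have "\<dots> = (LINT y|lebesgue. v y * of_real (k \<epsilon> y)) + (LINT y|lebesgue. v y * of_real ((x - y) / (\<epsilon>\<^sup>2 + (x - y)\<^sup>2)))"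
      by (intro Bochner_Integration.integral_add L2_mult_integrable v kL \<epsilon> QL(1))
    finally show ?thesis unfolding QL(2) by simp
  qed
  have "((\<lambda>\<epsilon>. (LINT y|lebesgue. v y * of_real (k \<epsilon> y)) + ((LINT y|lebesgue. g y * of_real (\<epsilon> / (pi * (\<epsilon>\<^sup>2 + (x - y)\<^sup>2)))) - g x) + g x) \<longlongrightarrow> 0 + 0 + g x) (at_right 0)"
    by (intro tendsto_add lim1 lim2 tendsto_const)
  moreover have "\<forall>\<^sub>F \<epsilon> in at_right 0. (LINT y|lebesgue. v y * of_real (k \<epsilon> y)) + ((LINT y|lebesgue. g y * of_real (\<epsilon> / (pi * (\<epsilon>\<^sup>2 + (x - y)\<^sup>2)))) - g x) + g x
      = (LINT y:{y. \<bar>x - y\<bar> > \<epsilon>}|lebesgue. v y / of_real (x - y))"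
    using dec by (auto simp: eventually_at_right_field intro!: exI[of _ 1])
  ultimately have "((\<lambda>\<epsilon>. LINT y:{y. \<bar>x - y\<bar> > \<epsilon>}|lebesgue. v y / of_real (x - y)) \<longlongrightarrow> g x) (at_right 0)"
    by (simp add: Lim_transform_eventually)
  then show ?case unfolding hilbert_transform_def by (rule tendsto_Lim[OF trivial_limit_at_right_real])
qed

section \<open>The symbol\<close>

text \<open>A recursive form of having bounded derivatives up to order n. The derivative enters as a
  witness instead of an iterate of \<open>deriv\<close>, so closure properties follow by induction
  on the order.\<close>

fun smooth_bounded :: "nat \<Rightarrow> (real \<Rightarrow> real) \<Rightarrow> bool" where
  "smooth_bounded 0 f \<longleftrightarrow> bounded (range f)"
| "smooth_bounded (Suc n) f \<longleftrightarrow> bounded (range f) \<and> (\<exists>f'. (\<forall>x. (f has_real_derivative f' x) (at x)) \<and> smooth_bounded n f')"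

lemma smooth_bounded_SucI:
  "bounded (range f) \<Longrightarrow> (\<And>x. (f has_real_derivative f' x) (at x)) \<Longrightarrow> smooth_bounded n f' \<Longrightarrow> smooth_bounded (Suc n) f"
  by auto

lemma smooth_bounded_imp_bounded: "smooth_bounded n f \<Longrightarrow> bounded (range f)"
  by (cases n) auto

lemma smooth_bounded_Suc_D: "smooth_bounded (Suc n) f \<Longrightarrow> smooth_bounded n f"
  by (induction n arbitrary: f) (auto 4 4)

lemma smooth_bounded_imp_bounded_derivatives:
  "smooth_bounded n f \<Longrightarrow> bounded_derivatives_upto n f"
proof (induction n arbitrary: f)
  case 0
  then show ?case by (simp add: bounded_derivatives_upto_def)
next
  case (Suc n)
  then obtain f' where f': "\<And>x. (f has_real_derivative f' x) (at x)" "smooth_bounded n f'" by auto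
  have d: "deriv f = f'" using f'(1) by (auto intro!: ext DERIV_imp_deriv)
  have IH: "bounded_derivatives_upto n f'" by (rule Suc.IH[OF f'(2)])
  have sh: "(deriv ^^ Suc k) f = (deriv ^^ k) f'" for k by (simp only: funpow_Suc_right o_apply d)
  show ?case unfolding bounded_derivatives_upto_def
  proof (intro conjI allI impI)
    fix k x assume "k < Suc n"
    then show "(deriv ^^ k) f differentiable at x"
      using IH f'(1) by (cases k) (auto simp: sh bounded_derivatives_upto_def real_differentiable_def simp del: funpow.simps(2))
  next
    fix k assume "k \<le> Suc n"
    then show "bounded (range ((deriv ^^ k) f))"
      using IH smooth_bounded_imp_bounded[OF Suc.prems] by (cases k) (auto simp: sh bounded_derivatives_upto_def simp del: funpow.simps(2))
  qed
qed

lemma bounded_range_iff: "bounded (range f) \<longleftrightarrow> (\<exists>B. \<forall>x. \<bar>f x\<bar> \<le> B)" for f :: "real \<Rightarrow> real"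
  by (auto simp: bounded_iff)

lemma smooth_bounded_const: "smooth_bounded n (\<lambda>x. c)"
proof (induction n arbitrary: c)
  case (Suc n)
  then show ?case by (auto simp: bounded_range_iff intro!: exI[of _ "\<lambda>x. 0"])
qed (auto simp: bounded_range_iff)

lemma smooth_bounded_add: "smooth_bounded n f \<Longrightarrow> smooth_bounded n g \<Longrightarrow> smooth_bounded n (\<lambda>x. f x + g x)"
proof (induction n arbitrary: f g)
  case 0
  then obtain B C where "\<And>x. \<bar>f x\<bar> \<le> B" "\<And>x. \<bar>g x\<bar> \<le> C" by (auto simp: bounded_range_iff)
  then show ?case by (auto simp: bounded_range_iff intro!: exI[of _ "B + C"] order_trans[OF abs_triangle_ineq add_mono])
next
  case (Suc n)
  obtain B C where "\<And>x. \<bar>f x\<bar> \<le> B" "\<And>x. \<bar>g x\<bar> \<le> C" using Suc.prems by (auto simp: bounded_range_iff)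
  then have b: "bounded (range (\<lambda>x. f x + g x))" by (auto simp: bounded_range_iff intro!: exI[of _ "B + C"] order_trans[OF abs_triangle_ineq add_mono])
  obtain f' g' where f': "\<And>x. (f has_real_derivative f' x) (at x)" "smooth_bounded n f'" "\<And>x. (g has_real_derivative g' x) (at x)" "smooth_bounded n g'"
    using Suc.prems by auto
  have "((\<lambda>x. f x + g x) has_real_derivative (f' x + g' x)) (at x)" for x by (intro DERIV_add f')
  from smooth_bounded_SucI[OF b this Suc.IH[OF f'(2,4)]] show ?case .
qed

lemma bounded_range_mult:
  fixes f g :: "real \<Rightarrow> real"
  assumes "bounded (range f)" "bounded (range g)"
  shows "bounded (range (\<lambda>x. f x * g x))"
proof -
  obtain B C where "\<And>x. \<bar>f x\<bar> \<le> B" "\<And>x. \<bar>g x\<bar> \<le> C" using assms by (auto simp: bounded_range_iff)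
  then have "\<bar>f x * g x\<bar> \<le> B * C" for x unfolding abs_mult by (intro mult_mono) (auto intro: order_trans[OF abs_ge_zero])
  then show ?thesis by (auto simp: bounded_range_iff)
qed

lemma smooth_bounded_mult: "smooth_bounded n f \<Longrightarrow> smooth_bounded n g \<Longrightarrow> smooth_bounded n (\<lambda>x. f x * g x)"
proof (induction n arbitrary: f g)
  case 0
  then show ?case by (simp add: bounded_range_mult)
next
  case (Suc n)
  obtain f' g' where f': "\<And>x. (f has_real_derivative f' x) (at x)" "smooth_bounded n f'" "\<And>x. (g has_real_derivative g' x) (at x)" "smooth_bounded n g'"
    using Suc.prems by auto
  have "((\<lambda>x. f x * g x) has_real_derivative (f' x * g x + g' x * f x)) (at x)" for x by (intro DERIV_mult f')
  moreover have "smooth_bounded n (\<lambda>x. f' x * g x + g' x * f x)"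
    by (intro smooth_bounded_add Suc.IH f' smooth_bounded_Suc_D[OF Suc.prems(1)] smooth_bounded_Suc_D[OF Suc.prems(2)])
  moreover have "bounded (range (\<lambda>x. f x * g x))"
    by (intro bounded_range_mult smooth_bounded_imp_bounded[OF Suc.prems(1)] smooth_bounded_imp_bounded[OF Suc.prems(2)])
  ultimately show ?case by (intro smooth_bounded_SucI)
qed

text \<open>The exponent is general because differentiation lowers it by one. The positive lower
  bound on \<open>f\<close> is what keeps negative powers bounded.\<close>

lemma smooth_bounded_powr:
  assumes "smooth_bounded n f" "\<delta> > 0" "\<And>x. f x \<ge> \<delta>"
  shows "smooth_bounded n (\<lambda>x. f x powr a)"
  using assms
proof (induction n arbitrary: a)
  have b: "bounded (range (\<lambda>x. f x powr a))" if bf: "bounded (range f)" for a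
  proof -
    obtain B where B: "\<And>x. \<bar>f x\<bar> \<le> B" using bf by (auto simp: bounded_range_iff)
    have "\<bar>f x powr a\<bar> \<le> max (\<delta> powr a) (B powr a)" for x
    proof (cases "a \<ge> 0")
      case True
      then have "f x powr a \<le> B powr a" using B[of x] assms(2) assms(3)[of x] by (intro powr_mono2) auto
      then show ?thesis by simp
    next
      case False
      then have "f x powr a \<le> \<delta> powr a" using assms(2) assms(3)[of x] by (intro powr_mono2') auto
      then show ?thesis by simp
    qed
    then show ?thesis by (auto simp: bounded_range_iff)
  qed
  {
    case 0
    then show ?case using b by simp
  next
    case (Suc n)
    obtain f' where f': "\<And>x. (f has_real_derivative f' x) (at x)" "smooth_bounded n f'"
      using Suc.prems by auto
    have "((\<lambda>x. f x powr a) has_real_derivative (a * f x powr (a - 1) * f' x)) (at x)" for x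
      using assms(2) assms(3)[of x] DERIV_fun_powr[OF f'(1), of x a] by simp
    moreover have "smooth_bounded n (\<lambda>x. a * f x powr (a - 1) * f' x)"
      by (intro smooth_bounded_mult smooth_bounded_const Suc.IH[OF smooth_bounded_Suc_D[OF Suc.prems(1)]] f' Suc.prems)
    ultimately show ?case using b smooth_bounded_imp_bounded[OF Suc.prems(1)] by (intro smooth_bounded_SucI)
  }
qed

text \<open>With r = 1 / sqrt (1 + x^2) and u = x r one has r' = - u r^2 and u' = r^3: the
  derivatives are polynomials in the pair, so the two functions are treated in one
  induction.\<close>

lemma smooth_bounded_normalizer:
  "smooth_bounded n (\<lambda>x. 1 / sqrt (1 + x\<^sup>2)) \<and> smooth_bounded n (\<lambda>x. x / sqrt (1 + x\<^sup>2))"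
proof (induction n)
  have pos: "1 + x\<^sup>2 > 0" for x :: real by (simp add: add_pos_nonneg)
  have b: "bounded (range (\<lambda>x::real. 1 / sqrt (1 + x\<^sup>2)))" "bounded (range (\<lambda>x::real. x / sqrt (1 + x\<^sup>2)))"
  proof -
    have "\<bar>x\<bar> \<le> sqrt (1 + x\<^sup>2)" for x :: real by (rule real_le_rsqrt) simp
    then have "\<bar>1 / sqrt (1 + x\<^sup>2)\<bar> \<le> 1" "\<bar>x / sqrt (1 + x\<^sup>2)\<bar> \<le> 1" for x :: real
      using pos[of x] by (auto simp: abs_div divide_le_eq_1)
    then show "bounded (range (\<lambda>x::real. 1 / sqrt (1 + x\<^sup>2)))" "bounded (range (\<lambda>x::real. x / sqrt (1 + x\<^sup>2)))"
      unfolding bounded_range_iff by blast+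
  qed
  {
    case 0
    then show ?case using b by simp
  next
    case (Suc n)
    let ?r = "\<lambda>x::real. 1 / sqrt (1 + x\<^sup>2)" and ?u = "\<lambda>x::real. x / sqrt (1 + x\<^sup>2)"
    have rr: "?r x * ?r x = 1 / (1 + x\<^sup>2)" for x using pos[of x] by simp
    have dsq: "((\<lambda>x. sqrt (1 + x\<^sup>2)) has_real_derivative ?u x) (at x)" for x
      using pos[of x] by (auto intro!: derivative_eq_intros simp: field_simps)
    have dr: "(?r has_real_derivative (-1) * ?u x * (?r x * ?r x)) (at x)" for x
      using pos[of x] DERIV_divide[OF DERIV_const[of 1] dsq[of x]] by (simp add: field_simps)
    have du: "(?u has_real_derivative ?r x * (?r x * ?r x)) (at x)" for x
    proof -
      have "(1 * sqrt (1 + x\<^sup>2) - x * ?u x) / (sqrt (1 + x\<^sup>2) * sqrt (1 + x\<^sup>2)) = ?r x * (?r x * ?r x)"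
      proof -
        define s where "s = sqrt (1 + x\<^sup>2)"
        have s: "s > 0" "s * s = 1 + x\<^sup>2" using pos[of x] by (auto simp: s_def)
        have "(1 * s - x * (x / s)) = 1 / s" using s by (simp add: field_simps power2_eq_square)
        then show ?thesis unfolding s_def[symmetric] by simp
      qed
      moreover have "(?u has_real_derivative (1 * sqrt (1 + x\<^sup>2) - x * ?u x) / (sqrt (1 + x\<^sup>2) * sqrt (1 + x\<^sup>2))) (at x)"
        by (rule DERIV_divide[OF DERIV_ident dsq]) (use pos[of x] in simp)
      ultimately show ?thesis by simp
    qed
    have "smooth_bounded n (\<lambda>x. (-1) * ?u x * (?r x * ?r x))" "smooth_bounded n (\<lambda>x. ?r x * (?r x * ?r x))"
      by (intro smooth_bounded_mult smooth_bounded_const Suc.IH[THEN conjunct1] Suc.IH[THEN conjunct2])+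
    then show ?case using smooth_bounded_SucI[OF b(1) dr] smooth_bounded_SucI[OF b(2) du] by blast
  }
qed

section \<open>Differentiation under the integral sign\<close>

lemma parametric_integrand:
  fixes s w :: "real \<Rightarrow> real"
  assumes s: "continuous_on UNIV s" and b: "\<And>t. \<bar>s t\<bar> \<le> B" and w: "integrable lebesgue w"
  shows "integrable lebesgue (\<lambda>x. s (x * \<xi>) * w x)"
proof (rule Bochner_Integration.integrable_bound[where f="\<lambda>x. B * \<bar>w x\<bar>"])
  have "continuous_on UNIV (\<lambda>x. s (x * \<xi>))" by (intro continuous_on_compose2[OF s] continuous_intros) auto
  then have "(\<lambda>x. s (x * \<xi>)) \<in> borel_measurable lebesgue"
    by (intro measurable_completion) (simp add: borel_measurable_continuous_onI)
  then show "(\<lambda>x. s (x * \<xi>) * w x) \<in> borel_measurable lebesgue" using w by auto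
  show "AE x in lebesgue. norm (s (x * \<xi>) * w x) \<le> norm (B * \<bar>w x\<bar>)"
    using b order_trans[OF abs_ge_zero b] by (intro AE_I2) (simp add: abs_mult mult_right_mono)
qed (use w in auto)

lemma parametric_integral_isCont:
  fixes s w :: "real \<Rightarrow> real"
  assumes s: "continuous_on UNIV s" and b: "\<And>t. \<bar>s t\<bar> \<le> B" and w: "integrable lebesgue w"
  shows "isCont (\<lambda>\<xi>. LINT x|lebesgue. s (x * \<xi>) * w x) \<xi>"
proof (rule continuous_at_sequentiallyI)
  fix X assume X: "X \<longlonglongrightarrow> \<xi>"
  show "(\<lambda>n. LINT x|lebesgue. s (x * X n) * w x) \<longlonglongrightarrow> (LINT x|lebesgue. s (x * \<xi>) * w x)"
  proof (rule integral_dominated_convergence[where w="\<lambda>x. B * \<bar>w x\<bar>"])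
    show "AE x in lebesgue. (\<lambda>n. s (x * X n) * w x) \<longlonglongrightarrow> s (x * \<xi>) * w x"
    proof (rule AE_I2)
      fix x
      have "isCont s (x * \<xi>)" using s by (simp add: continuous_on_eq_continuous_at)
      then show "(\<lambda>n. s (x * X n) * w x) \<longlonglongrightarrow> s (x * \<xi>) * w x"
        by (intro tendsto_intros isCont_tendsto_compose[where g=s] X)
    qed
    show "AE x in lebesgue. norm (s (x * X n) * w x) \<le> B * \<bar>w x\<bar>" for n
      using b by (intro AE_I2) (simp add: abs_mult mult_right_mono)
  qed (use w parametric_integrand[OF s b w] in auto)
qed

lemma parametric_integral_deriv:
  fixes s s' w :: "real \<Rightarrow> real"
  assumes d: "\<And>t. (s has_real_derivative s' t) (at t)" and s': "continuous_on UNIV s'"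
    and b: "\<And>t. \<bar>s t\<bar> \<le> B" and b': "\<And>t. \<bar>s' t\<bar> \<le> B'"
    and w: "integrable lebesgue w" and xw: "integrable lebesgue (\<lambda>x. x * w x)"
  shows "((\<lambda>\<xi>. LINT x|lebesgue. s (x * \<xi>) * w x) has_real_derivative (LINT x|lebesgue. s' (x * \<xi>) * (x * w x))) (at \<xi>)"
proof -
  have s: "continuous_on UNIV s" using d by (meson DERIV_isCont continuous_at_imp_continuous_on)
  note i = parametric_integrand[OF s b w] and i' = parametric_integrand[OF s' b' xw]
  \<comment> \<open>The mean value bound majorizes every difference quotient by B' |x w x|,
    independently of the step, as dominated convergence requires.\<close>
  have lip: "\<bar>s a - s c\<bar> \<le> B' * \<bar>a - c\<bar>" for a c
    using field_differentiable_bound[of UNIV s s' B' a c] d b' by simp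
  have "((\<lambda>h. ((LINT x|lebesgue. s (x * (\<xi> + h)) * w x) - (LINT x|lebesgue. s (x * \<xi>) * w x)) / h) \<longlongrightarrow> (LINT x|lebesgue. s' (x * \<xi>) * (x * w x))) (at 0)"
    unfolding tendsto_at_iff_sequentially o_def
  proof (intro allI impI)
    fix X :: "nat \<Rightarrow> real" assume X0: "\<forall>i. X i \<in> UNIV - {0}" and X: "X \<longlonglongrightarrow> 0"
    have X0: "X n \<noteq> 0" for n using X0 by auto
    have eq: "((LINT x|lebesgue. s (x * (\<xi> + X n)) * w x) - (LINT x|lebesgue. s (x * \<xi>) * w x)) / X n
       = (LINT x|lebesgue. (s (x * (\<xi> + X n)) * w x - s (x * \<xi>) * w x) / X n)" for n
      using i by simp
    show "(\<lambda>n. ((LINT x|lebesgue. s (x * (\<xi> + X n)) * w x) - (LINT x|lebesgue. s (x * \<xi>) * w x)) / X n) \<longlonglongrightarrow> (LINT x|lebesgue. s' (x * \<xi>) * (x * w x))"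
      unfolding eq
    proof (rule integral_dominated_convergence[where w="\<lambda>x. B' * \<bar>x * w x\<bar>"])
      show "AE x in lebesgue. (\<lambda>n. (s (x * (\<xi> + X n)) * w x - s (x * \<xi>) * w x) / X n) \<longlonglongrightarrow> s' (x * \<xi>) * (x * w x)"
      proof (rule AE_I2)
        fix x
        have "((\<lambda>\<xi>. s (x * \<xi>)) has_real_derivative s' (x * \<xi>) * x) (at \<xi>)"
          by (rule DERIV_chain2[OF d]) (auto intro!: derivative_eq_intros)
        then have "((\<lambda>h. (s (x * (\<xi> + h)) - s (x * \<xi>)) / h) \<longlongrightarrow> s' (x * \<xi>) * x) (at 0)" by (simp add: DERIV_def)
        then have "(\<lambda>n. (s (x * (\<xi> + X n)) - s (x * \<xi>)) / X n) \<longlonglongrightarrow> s' (x * \<xi>) * x"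
          unfolding tendsto_at_iff_sequentially o_def using X X0 by simp
        then have "(\<lambda>n. ((s (x * (\<xi> + X n)) - s (x * \<xi>)) / X n) * w x) \<longlonglongrightarrow> (s' (x * \<xi>) * x) * w x" by (intro tendsto_intros)
        then show "(\<lambda>n. (s (x * (\<xi> + X n)) * w x - s (x * \<xi>) * w x) / X n) \<longlonglongrightarrow> s' (x * \<xi>) * (x * w x)"
          by (simp add: left_diff_distrib mult.assoc)
      qed
      show "AE x in lebesgue. norm ((s (x * (\<xi> + X n)) * w x - s (x * \<xi>) * w x) / X n) \<le> B' * \<bar>x * w x\<bar>" for n
      proof (rule AE_I2)
        fix x
        have "norm ((s (x * (\<xi> + X n)) * w x - s (x * \<xi>) * w x) / X n) = \<bar>s (x * (\<xi> + X n)) - s (x * \<xi>)\<bar> * \<bar>w x\<bar> / \<bar>X n\<bar>"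
          by (simp add: abs_mult flip: left_diff_distrib)
        also have "\<dots> \<le> (B' * \<bar>x * (\<xi> + X n) - x * \<xi>\<bar>) * \<bar>w x\<bar> / \<bar>X n\<bar>"
          by (intro divide_right_mono mult_right_mono lip) auto
        also have "x * (\<xi> + X n) - x * \<xi> = x * X n" by (simp add: distrib_left)
        finally show "norm ((s (x * (\<xi> + X n)) * w x - s (x * \<xi>) * w x) / X n) \<le> B' * \<bar>x * w x\<bar>"
          using X0[of n] by (simp add: abs_mult mult_ac)
      qed
      show "(\<lambda>x. s' (x * \<xi>) * (x * w x)) \<in> borel_measurable lebesgue" using i' by auto
      show "(\<lambda>x. (s (x * (\<xi> + X n)) * w x - s (x * \<xi>) * w x) / X n) \<in> borel_measurable lebesgue" for n
        using i[of "\<xi> + X n"] i[of \<xi>] by (intro borel_measurable_divide borel_measurable_diff) auto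
      show "integrable lebesgue (\<lambda>x. B' * \<bar>x * w x\<bar>)" using xw by auto
    qed
  qed
  then show ?thesis by (simp add: DERIV_def)
qed

text \<open>Each differentiation in \<xi> replaces the weight w by x w; therefore n derivatives cost
  n moments of the weight.\<close>

lemma parametric_integral_smooth_bounded:
  fixes s :: "nat \<Rightarrow> real \<Rightarrow> real" and w :: "real \<Rightarrow> real"
  assumes "\<And>k t. (s k has_real_derivative s (Suc k) t) (at t)" "\<And>k. \<exists>B. \<forall>t. \<bar>s k t\<bar> \<le> B"
    and "\<And>k. k \<le> n \<Longrightarrow> integrable lebesgue (\<lambda>x. x^k * w x)"
  shows "smooth_bounded n (\<lambda>\<xi>. LINT x|lebesgue. s 0 (x * \<xi>) * w x)"
  using assms
proof (induction n arbitrary: s w)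
  have sc: "continuous_on UNIV (s k)" if "\<And>k t. (s k has_real_derivative s (Suc k) t) (at t)" for s :: "nat \<Rightarrow> real \<Rightarrow> real" and k
    using that by (meson DERIV_isCont continuous_at_imp_continuous_on)
  have bd: "bounded (range (\<lambda>\<xi>. LINT x|lebesgue. s 0 (x * \<xi>) * w x))"
    if s: "\<And>k t. (s k has_real_derivative s (Suc k) t) (at t)" and b: "\<And>k. \<exists>B. \<forall>t. \<bar>s k t\<bar> \<le> B" and w: "integrable lebesgue w"
    for s :: "nat \<Rightarrow> real \<Rightarrow> real" and w
  proof -
    obtain B where B: "\<And>t. \<bar>s 0 t\<bar> \<le> B" using b by blast
    have "\<bar>LINT x|lebesgue. s 0 (x * \<xi>) * w x\<bar> \<le> (LINT x|lebesgue. B * \<bar>w x\<bar>)" for \<xi>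
    proof -
      have "\<bar>LINT x|lebesgue. s 0 (x * \<xi>) * w x\<bar> \<le> (LINT x|lebesgue. \<bar>s 0 (x * \<xi>) * w x\<bar>)"
        by (rule integral_abs_bound)
      also have "\<dots> \<le> (LINT x|lebesgue. B * \<bar>w x\<bar>)"
      proof (rule integral_mono)
        show "integrable lebesgue (\<lambda>x. \<bar>s 0 (x * \<xi>) * w x\<bar>)"
          by (intro integrable_abs parametric_integrand[OF sc[of s 0, OF s] B w])
      qed (use w B in \<open>auto simp: abs_mult mult_right_mono\<close>)
      finally show ?thesis .
    qed
    then show ?thesis unfolding bounded_range_iff by blast
  qed
  {
    case 0
    then show ?case using bd[of s w] by simp
  next
    case (Suc n)
    have w: "integrable lebesgue w" and xw: "integrable lebesgue (\<lambda>x. x * w x)"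
      using Suc.prems(3)[of 0] Suc.prems(3)[of 1] by auto
    obtain B where B: "\<And>t. \<bar>s 0 t\<bar> \<le> B" using Suc.prems(2) by blast
    obtain B' where B': "\<And>t. \<bar>s (Suc 0) t\<bar> \<le> B'" using Suc.prems(2) by blast
    have "((\<lambda>\<xi>. LINT x|lebesgue. s 0 (x * \<xi>) * w x) has_real_derivative (LINT x|lebesgue. s (Suc 0) (x * \<xi>) * (x * w x))) (at \<xi>)" for \<xi>
      by (rule parametric_integral_deriv[OF Suc.prems(1) sc[of s "Suc 0", OF Suc.prems(1)] B B' w xw])
    moreover have "smooth_bounded n (\<lambda>\<xi>. LINT x|lebesgue. s (Suc 0) (x * \<xi>) * (x * w x))"
    proof (rule Suc.IH[where s="\<lambda>k. s (Suc k)"])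
      show "integrable lebesgue (\<lambda>x. x^k * (x * w x))" if "k \<le> n" for k
        using Suc.prems(3)[of "Suc k"] that by (simp add: mult_ac)
    qed (use Suc.prems in auto)
    ultimately show ?case using bd[of s w, OF Suc.prems(1,2) w] by (intro smooth_bounded_SucI)
  }
qed

text \<open>The k-th derivative of cosine: every differentiation advances the phase by a quarter
  period.\<close>

definition cos_shift :: "nat \<Rightarrow> real \<Rightarrow> real" where "cos_shift k t = cos (t + real k * (pi / 2))"

lemma cos_shift_deriv: "(cos_shift k has_real_derivative cos_shift (Suc k) t) (at t)"
proof -
  have "cos_shift (Suc k) t = - sin (t + real k * (pi / 2))"
  proof -
    have "t + real (Suc k) * (pi / 2) = (t + real k * (pi / 2)) + pi / 2" by (simp add: algebra_simps)
    then show ?thesis unfolding cos_shift_def by (simp only: cos_add cos_pi_half sin_pi_half)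
  qed
  then show ?thesis unfolding cos_shift_def[abs_def]
    by (auto intro!: derivative_eq_intros simp: cos_shift_def)
qed

lemma cos_shift_le: "\<bar>cos_shift k t\<bar> \<le> 1" by (simp add: cos_shift_def)

lemma cos_shift_cont: "continuous_on UNIV (cos_shift k)"
  unfolding cos_shift_def[abs_def] by (intro continuous_intros)

text \<open>\<open>cos_quotient 0 t = (1 - cos t) / t\<^sup>2\<close>, in the integral form that makes it smooth at \<open>0\<close>;
  \<open>cos_quotient k\<close> is its \<open>k\<close>-th derivative.\<close>

definition cos_quotient :: "nat \<Rightarrow> real \<Rightarrow> real" where
  "cos_quotient k t = (LINT r|lebesgue. cos_shift k (r * t) * (r^k * ((1 - r) * indicator {0..1} r)))"

lemma cos_quotient_weight: "integrable lebesgue (\<lambda>r. r^k * ((1 - r) * indicat_real {0..1} r))"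
proof (rule Bochner_Integration.integrable_bound[OF integrable_indicator_Icc[of 0 1]])
  show "(\<lambda>r. r^k * ((1 - r) * indicat_real {0..1} r)) \<in> borel_measurable lebesgue"
    by (intro measurable_completion) measurable
  show "AE r in lebesgue. norm (r^k * ((1 - r) * indicat_real {0..1} r)) \<le> norm (indicat_real {0..1} r)"
    by (intro AE_I2) (auto simp: indicator_def abs_mult power_le_one mult_le_one)
qed

lemma cos_quotient_deriv: "(cos_quotient k has_real_derivative cos_quotient (Suc k) t) (at t)"
  using parametric_integral_deriv[OF cos_shift_deriv cos_shift_cont cos_shift_le cos_shift_le cos_quotient_weight[of k], of k t] cos_quotient_weight[of "Suc k"]
  by (simp add: cos_quotient_def[abs_def] mult.assoc)

lemma cos_quotient_le: "\<bar>cos_quotient k t\<bar> \<le> (LINT r|lebesgue. \<bar>r^k * ((1 - r) * indicat_real {0..1} r)\<bar>)"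
proof -
  have "\<bar>cos_quotient k t\<bar> \<le> (LINT r|lebesgue. \<bar>cos_shift k (r * t) * (r^k * ((1 - r) * indicat_real {0..1} r))\<bar>)"
    unfolding cos_quotient_def by (rule integral_abs_bound)
  also have "\<dots> \<le> (LINT r|lebesgue. \<bar>r^k * ((1 - r) * indicat_real {0..1} r)\<bar>)"
  proof (rule integral_mono)
    fix r show "\<bar>cos_shift k (r * t) * (r^k * ((1 - r) * indicat_real {0..1} r))\<bar> \<le> \<bar>r^k * ((1 - r) * indicat_real {0..1} r)\<bar>"
      unfolding abs_mult[of "cos_shift k (r * t)"] by (intro mult_left_le_one_le cos_shift_le) auto
  qed (intro integrable_abs parametric_integrand[OF cos_shift_cont cos_shift_le] cos_quotient_weight)+
  finally show ?thesis .
qed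

text \<open>Taylor's formula for cosine at 0 with integral remainder; the primitive comes from
  integrating by parts once in r.\<close>

lemma cos_quotient_eq: "t\<^sup>2 * cos_quotient 0 t = 1 - cos t"
proof -
  have "t\<^sup>2 * cos_quotient 0 t = (LINT r|lborel. (t\<^sup>2 * (1 - r) * cos (r * t)) * indicator {0..1} r)"
    unfolding cos_quotient_def cos_shift_def
    by (subst integral_completion) (auto simp: mult_ac simp flip: Bochner_Integration.integral_mult_right_zero)
  also have "\<dots> = (t * (1 - 1) * sin (1 * t) - cos (1 * t)) - (t * (1 - 0) * sin (0 * t) - cos (0 * t))"
  proof (rule integral_FTC_Icc_real)
    show "DERIV (\<lambda>r. t * (1 - r) * sin (r * t) - cos (r * t)) r :> t\<^sup>2 * (1 - r) * cos (r * t)" for r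
      by (auto intro!: derivative_eq_intros simp: algebra_simps power2_eq_square)
    show "isCont (\<lambda>r. t\<^sup>2 * (1 - r) * cos (r * t)) r" for r by (intro continuous_intros)
  qed simp
  finally show ?thesis by simp
qed

lemma cos_quotient_0: "cos_quotient 0 0 = 1 / 2"
proof -
  have "cos_quotient 0 0 = (LINT r|lborel. (1 - r) * indicator {0..1} r)"
    unfolding cos_quotient_def cos_shift_def by (subst integral_completion) auto
  also have "\<dots> = (1 - 1\<^sup>2 / 2) - (0 - 0\<^sup>2 / 2)"
  proof (rule integral_FTC_Icc_real)
    show "DERIV (\<lambda>r. r - r\<^sup>2 / 2) r :> 1 - r" for r :: real
      by (auto intro!: derivative_eq_intros)
  qed auto
  finally show ?thesis by simp
qed

lemma cos_quotient_nonneg: "0 \<le> cos_quotient 0 t"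
proof (cases "t = 0")
  case False
  have "t\<^sup>2 * cos_quotient 0 t \<ge> 0" unfolding cos_quotient_eq by simp
  then show ?thesis using False by (simp add: zero_le_mult_iff)
qed (simp add: cos_quotient_0)

section \<open>Decay of the transform and strict positivity away from the origin\<close>

lemma gauss_tendsto_0: "((\<lambda>\<xi>. complex_of_real (gauss (\<xi> - a))) \<longlongrightarrow> 0) at_infinity"
proof -
  have g: "gauss t \<le> 1 / (1 + t\<^sup>2)" for t
  proof -
    have "t\<^sup>2 * 1 \<le> t\<^sup>2 * pi" using pi_gt3 by (intro mult_left_mono) auto
    then have "1 + t\<^sup>2 \<le> 1 + pi * t\<^sup>2" by (simp add: mult.commute)
    also have "\<dots> \<le> exp (pi * t\<^sup>2)" by (rule exp_ge_add_one_self)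
    finally have "inverse (exp (pi * t\<^sup>2)) \<le> inverse (1 + t\<^sup>2)" by (intro le_imp_inverse_le) (auto simp: add_pos_nonneg)
    then show ?thesis by (simp add: gauss_def exp_minus inverse_eq_divide)
  qed
  show ?thesis
  proof (rule tendstoI)
    fix e :: real assume e: "e > 0"
    have "dist (complex_of_real (gauss (\<xi> - a))) 0 < e" if \<xi>: "norm \<xi> \<ge> \<bar>a\<bar> + 1 + 1 / e" for \<xi>
    proof -
      have t: "\<bar>\<xi> - a\<bar> \<ge> 1 + 1 / e" using \<xi> by simp
      moreover have "1 + 1 / e \<ge> 1" using e by simp
      ultimately have "\<bar>\<xi> - a\<bar> * 1 \<le> \<bar>\<xi> - a\<bar> * \<bar>\<xi> - a\<bar>" by (intro mult_left_mono) linarith+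
      then have "\<bar>\<xi> - a\<bar> \<le> (\<xi> - a)\<^sup>2" by (simp add: power2_eq_square)
      then have "1 / e < 1 + (\<xi> - a)\<^sup>2" using t by linarith
      then have "1 / (1 + (\<xi> - a)\<^sup>2) < e" using e by (simp add: field_simps add_pos_nonneg)
      then show ?thesis using g[of "\<xi> - a"] by simp
    qed
    then show "\<forall>\<^sub>F \<xi> in at_infinity. dist (complex_of_real (gauss (\<xi> - a))) 0 < e"
      unfolding eventually_at_infinity by blast
  qed
qed

text \<open>Cutting \<open>v\<close> off in height makes it square-integrable at small L1 cost, so
  it can be approximated in L1 by functions whose transforms are finite sums of translated
  Gaussians. The L1 error bounds the transform uniformly.\<close>

lemma riemann_lebesgue:
  assumes v: "integrable lebesgue v"
  shows "(fourier_integral v \<longlongrightarrow> 0) at_infinity"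
proof (rule tendstoI)
  fix e :: real assume e: "e > 0"
  have [measurable]: "v \<in> borel_measurable lebesgue" using v by simp
  define vn where "vn n x = (if cmod (v x) \<le> real n then v x else 0)" for n x
  have vnm [measurable]: "vn n \<in> borel_measurable lebesgue" for n unfolding vn_def by measurable
  have "(\<lambda>n. LINT x|lebesgue. cmod (vn n x - v x)) \<longlonglongrightarrow> 0"
  proof (rule L1_dominated_convergence[where g="\<lambda>x. cmod (v x)"])
    show "AE x in lebesgue. (\<lambda>n. vn n x) \<longlonglongrightarrow> v x"
    proof (rule AE_I2, rule tendsto_eventually)
      fix x
      obtain N where N: "cmod (v x) \<le> real N" using real_arch_simple by blast
      then have "cmod (v x) \<le> real n" if "n \<ge> N" for n using of_nat_mono[OF that, where 'a=real] by linarith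
      then show "\<forall>\<^sub>F n in sequentially. vn n x = v x" by (intro eventually_sequentiallyI[of N]) (auto simp: vn_def)
    qed
  qed (use v in \<open>auto simp: vn_def\<close>)
  then have "\<forall>\<^sub>F n in sequentially. (LINT x|lebesgue. cmod (vn n x - v x)) < e / 3" using e by (intro order_tendstoD(2)) auto
  then obtain n where n: "(LINT x|lebesgue. cmod (vn n x - v x)) < e / 3" unfolding eventually_sequentially by blast
  define u where "u = vn n"
  have ui: "integrable lebesgue u" unfolding u_def
    by (rule Bochner_Integration.integrable_bound[OF v]) (auto simp: vn_def)
  have "u \<in> L2" by (rule L2_of_bounded_integrable[OF ui, where C="real n"]) (auto simp: u_def vn_def)
  then obtain P where P: "P \<in> trig_poly" "(LINT x|lebesgue. cmod (trig_gauss P x - u x)) < e / 3"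
    using trig_gauss_dense[of u "e/3"] ui e by auto
  have "(fourier_integral (trig_gauss P) \<longlongrightarrow> 0) at_infinity"
    using P(1)
  proof (induction rule: trig_poly.induct)
    case (monomial c a)
    show ?case unfolding fourier_integral_trig_gauss_monomial[abs_def]
      by (intro tendsto_mult_right_zero gauss_tendsto_0)
  next
    case (add P Q)
    have "fourier_integral (trig_gauss (\<lambda>x. P x + Q x)) = (\<lambda>\<xi>. fourier_integral (trig_gauss P) \<xi> + fourier_integral (trig_gauss Q) \<xi>)"
      using fourier_integral_trig_gauss_add add by auto
    then show ?case using tendsto_add[OF add(3,4)] by simp
  qed
  then have "\<forall>\<^sub>F \<xi> in at_infinity. dist (fourier_integral (trig_gauss P) \<xi>) 0 < e / 3" using e by (intro tendstoD) auto
  then show "\<forall>\<^sub>F \<xi> in at_infinity. dist (fourier_integral v \<xi>) 0 < e"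
  proof eventually_elim
    case (elim \<xi>)
    have 1: "cmod (fourier_integral (trig_gauss P) \<xi> - fourier_integral u \<xi>) < e / 3"
      using norm_fourier_integral[of "\<lambda>x. trig_gauss P x - u x" \<xi>] P(2)
      unfolding fourier_integral_diff[OF trig_gauss_integrable[OF P(1)] ui] by linarith
    have 2: "cmod (fourier_integral u \<xi> - fourier_integral v \<xi>) < e / 3"
      using norm_fourier_integral[of "\<lambda>x. u x - v x" \<xi>] n[folded u_def]
      unfolding fourier_integral_diff[OF ui v] by linarith
    have "cmod (fourier_integral (trig_gauss P) \<xi>) < e / 3" using elim by simp
    moreover have "cmod (fourier_integral v \<xi>) \<le> cmod (fourier_integral (trig_gauss P) \<xi>)
        + cmod (fourier_integral (trig_gauss P) \<xi> - fourier_integral u \<xi>) + cmod (fourier_integral u \<xi> - fourier_integral v \<xi>)"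
      using norm_triangle_sub[of "fourier_integral v \<xi>" "fourier_integral u \<xi>"] norm_triangle_sub[of "fourier_integral u \<xi>" "fourier_integral (trig_gauss P) \<xi>"]
      by (simp add: norm_minus_commute)
    ultimately show ?case using 1 2 by simp
  qed
qed

text \<open>For strict positivity of \<mu>_0 minus the transform of \<open>J\<close> at \<xi>: the
  factor 1 - cos (2 pi x \<xi>) of its integrand vanishes only on a countable set of x.\<close>

lemma AE_cos_ne_1:
  assumes "\<xi> \<noteq> 0" shows "AE x in lebesgue. cos (2 * pi * (x * \<xi>)) \<noteq> 1"
proof -
  have "{x. cos (2 * pi * (x * \<xi>)) = 1} \<subseteq> range (\<lambda>n::int. of_int n / \<xi>)"
  proof
    fix x assume "x \<in> {x. cos (2 * pi * (x * \<xi>)) = 1}"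
    then obtain n :: int where "2 * pi * (x * \<xi>) = of_int n * 2 * pi" by (auto simp: cos_one_2pi_int)
    then have "x = of_int n / \<xi>" using assms by (simp add: field_simps)
    then show "x \<in> range (\<lambda>n::int. of_int n / \<xi>)" by blast
  qed
  then have "countable {x. cos (2 * pi * (x * \<xi>)) = 1}" by (rule countable_subset) simp
  then have "{x. cos (2 * pi * (x * \<xi>)) = 1} \<in> null_sets lborel" by (rule countable_imp_null_set_lborel)
  then have "AE x in lborel. cos (2 * pi * (x * \<xi>)) \<noteq> 1" by (intro AE_I'[of "{x. cos (2 * pi * (x * \<xi>)) = 1}"]) auto
  then show ?thesis by (rule AE_completion)
qed

lemma integral_pos_of_AE_ne_0:
  fixes f J :: "real \<Rightarrow> real"
  assumes "integrable lebesgue (\<lambda>x. f x * J x)" "\<And>x. f x \<ge> 0" "AE x in lebesgue. f x \<noteq> 0"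
    and "AE x in lebesgue. 0 \<le> J x" "\<not> (AE x in lebesgue. J x = 0)"
  shows "(LINT x|lebesgue. f x * J x) > 0"
proof -
  have nn: "AE x in lebesgue. 0 \<le> f x * J x" using assms(4) by eventually_elim (simp add: assms(2))
  have "(LINT x|lebesgue. f x * J x) \<noteq> 0"
  proof
    assume "(LINT x|lebesgue. f x * J x) = 0"
    then have "AE x in lebesgue. f x * J x = 0" using integral_nonneg_eq_0_iff_AE[OF assms(1) nn] by simp
    with assms(3) have "AE x in lebesgue. J x = 0" by eventually_elim simp
    with assms(5) show False by simp
  qed
  moreover have "(LINT x|lebesgue. f x * J x) \<ge> 0" by (rule integral_nonneg_AE[OF nn])
  ultimately show ?thesis by simp
qed

text \<open>The square root of \<open>\<mu>\<^sub>0 - \<integral> e(-\<xi>x) J(x) dx = \<xi>\<^sup>2 Q(\<xi>)\<close> with the sign of \<open>\<xi>\<close>.  It is smooth both at \<open>0\<close> and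
  at infinity because \<open>(1 + \<xi>\<^sup>2) Q(\<xi>)\<close> is bounded below and has bounded derivatives.\<close>

theorem nonlocal_symbol:
  fixes J :: "real \<Rightarrow> real" and l :: nat
  assumes Ji: "integrable lebesgue J"
    and Jnn: "AE x in lebesgue. 0 \<le> J x"
    and Jeven: "AE x in lebesgue. J (- x) = J x"
    and Jmom: "\<And>k. k \<le> l + 2 \<Longrightarrow> integrable lebesgue (\<lambda>x. x ^ k * J x)"
    and Jne: "\<not> (AE x in lebesgue. J x = 0)"
  obtains \<psi> :: "real \<Rightarrow> real" and c C :: real where "c > 0" "smooth_bounded l \<psi>" "continuous_on UNIV \<psi>"
    "\<And>\<xi>. fourier_integral (\<lambda>x. of_real (J x)) \<xi> - of_real (moment J 0) = of_real (c\<^sup>2) * (2 * of_real pi * \<i> * of_real (\<psi> \<xi>))\<^sup>2"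
    "\<And>\<xi>. sgn (\<psi> \<xi>) = sgn \<xi>" "((\<lambda>\<xi>. \<psi> \<xi> / \<xi>) \<longlongrightarrow> 1) (at 0)" "\<And>\<xi>. \<bar>\<psi> \<xi>\<bar> \<le> C * \<bar>\<xi>\<bar>"
proof -
  \<comment> \<open>\<open>a\<close> lists the derivatives of cos (2 pi t) and \<open>b\<close>
    those of (1 - cos (2 pi t)) / (2 pi t)^2. The factor 4 pi^2 x^2 in \<open>w\<close> restores the
    denominator, apart from \<xi>^2, when t = x \<xi>.\<close>
  define a where "a k t = (2 * pi)^k * cos_shift k (2 * pi * t)" for k t
  define b where "b k t = (2 * pi)^k * cos_quotient k (2 * pi * t)" for k t
  define w where "w x = 4 * pi\<^sup>2 * (x\<^sup>2 * J x)" for x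
  have a_deriv: "(a k has_real_derivative a (Suc k) t) (at t)" for k t
  proof -
    have "((\<lambda>t. cos_shift k (2 * pi * t)) has_real_derivative cos_shift (Suc k) (2 * pi * t) * (2 * pi)) (at t)"
      by (rule DERIV_chain2[OF cos_shift_deriv]) (auto intro!: derivative_eq_intros)
    from DERIV_cmult[OF this, of "(2 * pi)^k"] show ?thesis by (simp add: a_def[abs_def] mult_ac)
  qed
  have b_deriv: "(b k has_real_derivative b (Suc k) t) (at t)" for k t
  proof -
    have "((\<lambda>t. cos_quotient k (2 * pi * t)) has_real_derivative cos_quotient (Suc k) (2 * pi * t) * (2 * pi)) (at t)"
      by (rule DERIV_chain2[OF cos_quotient_deriv]) (auto intro!: derivative_eq_intros)
    from DERIV_cmult[OF this, of "(2 * pi)^k"] show ?thesis by (simp add: b_def[abs_def] mult_ac)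
  qed
  have a_le: "\<bar>a k t\<bar> \<le> (2 * pi)^k" for k t
    unfolding a_def abs_mult using cos_shift_le[of k "2 * pi * t"] by (simp add: mult_left_le)
  have b_le: "\<bar>b k t\<bar> \<le> (2 * pi)^k * (LINT r|lebesgue. \<bar>r^k * ((1 - r) * indicat_real {0..1} r)\<bar>)" for k t
    unfolding b_def abs_mult[of "(2 * pi)^k"] by (simp only: abs_of_nonneg zero_le_power pi_ge_zero mult_nonneg_nonneg zero_le_numeral) (intro mult_left_mono cos_quotient_le; simp)
  have a_cont: "continuous_on UNIV (a 0)" and b_cont: "continuous_on UNIV (b 0)"
    using a_deriv b_deriv by (meson DERIV_isCont continuous_at_imp_continuous_on)+
  have x2J: "integrable lebesgue (\<lambda>x. x\<^sup>2 * J x)" using Jmom[of 2] by simp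
  have wi: "integrable lebesgue w" unfolding w_def by (intro integrable_mult_right x2J)
  define \<mu> where "\<mu> = (LINT x|lebesgue. J x)"
  define \<mu>2 where "\<mu>2 = (LINT x|lebesgue. x\<^sup>2 * J x)"
  define F where "F \<xi> = (LINT x|lebesgue. a 0 (x * \<xi>) * J x)" for \<xi>
  define Q where "Q \<xi> = (LINT x|lebesgue. b 0 (x * \<xi>) * w x)" for \<xi>
  define p where "p \<xi> = \<mu> + (-1) * F \<xi>" for \<xi>
  have a0: "a 0 t = cos (2 * pi * t)" for t by (simp add: a_def cos_shift_def)
  have Fi: "integrable lebesgue (\<lambda>x. a 0 (x * \<xi>) * J x)" for \<xi> by (rule parametric_integrand[OF a_cont a_le Ji])
  have Qi: "integrable lebesgue (\<lambda>x. b 0 (x * \<xi>) * w x)" for \<xi> by (rule parametric_integrand[OF b_cont b_le wi])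
  have p_eq: "p \<xi> = (LINT x|lebesgue. (1 - cos (2 * pi * (x * \<xi>))) * J x)" for \<xi>
    unfolding p_def \<mu>_def F_def using Ji Fi[of \<xi>] by (simp add: a0 left_diff_distrib)
  have pi_int: "integrable lebesgue (\<lambda>x. (1 - cos (2 * pi * (x * \<xi>))) * J x)" for \<xi>
    using Ji Fi[of \<xi>] by (simp add: a0 left_diff_distrib)
  have pQ: "p \<xi> = \<xi>\<^sup>2 * Q \<xi>" for \<xi>
  proof -
    have "\<xi>\<^sup>2 * (b 0 (x * \<xi>) * w x) = (1 - cos (2 * pi * (x * \<xi>))) * J x" for x
    proof -
      have "\<xi>\<^sup>2 * (b 0 (x * \<xi>) * w x) = ((2 * pi * (x * \<xi>))\<^sup>2 * cos_quotient 0 (2 * pi * (x * \<xi>))) * J x"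
        by (simp add: b_def w_def power_mult_distrib)
      then show ?thesis by (simp only: cos_quotient_eq)
    qed
    then show ?thesis unfolding p_eq Q_def by (simp flip: Bochner_Integration.integral_mult_right_zero)
  qed
  have smooth_F: "smooth_bounded l F" unfolding F_def
    by (rule parametric_integral_smooth_bounded[where s=a, OF a_deriv]) (use a_le Jmom in auto)
  \<comment> \<open>This is where the moments up to order l + 2 are spent: the weight
    \<open>w\<close> already contains x^2, and l derivatives add x^l.\<close>
  have smooth_Q: "smooth_bounded l Q" unfolding Q_def
  proof (rule parametric_integral_smooth_bounded[where s=b, OF b_deriv])
    show "\<exists>B. \<forall>t. \<bar>b k t\<bar> \<le> B" for k using b_le by blast
    show "integrable lebesgue (\<lambda>x. x^k * w x)" if "k \<le> l" for k
    proof -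
      have "(\<lambda>x. x^k * w x) = (\<lambda>x. 4 * pi\<^sup>2 * (x^(k+2) * J x))" by (auto simp: w_def power_add power2_eq_square)
      then show ?thesis using Jmom[of "k+2"] that by simp
    qed
  qed
  define G where "G \<xi> = p \<xi> + Q \<xi>" for \<xi>
  have smooth_G: "smooth_bounded l G" unfolding G_def p_def
    by (intro smooth_bounded_add smooth_bounded_mult smooth_bounded_const smooth_F smooth_Q)
  have F_cont: "isCont F \<xi>" for \<xi> unfolding F_def by (rule parametric_integral_isCont[OF a_cont a_le Ji])
  have Q_cont: "isCont Q \<xi>" for \<xi> unfolding Q_def by (rule parametric_integral_isCont[OF b_cont b_le wi])
  have G_cont: "isCont G \<xi>" for \<xi> unfolding G_def p_def by (intro continuous_intros F_cont Q_cont)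
  have \<mu>_pos: "\<mu> > 0" unfolding \<mu>_def
    using integral_pos_of_AE_ne_0[of "\<lambda>x. 1" J] Ji Jnn Jne by simp
  have \<mu>2_pos: "\<mu>2 > 0" unfolding \<mu>2_def
    by (rule integral_pos_of_AE_ne_0[OF x2J _ _ Jnn Jne])
       (use AE_completion[OF AE_lborel_singleton[of "0::real"]] in \<open>auto elim!: eventually_mono\<close>)
  have p_pos: "p \<xi> > 0" if "\<xi> \<noteq> 0" for \<xi>
    unfolding p_eq by (rule integral_pos_of_AE_ne_0[OF pi_int _ _ Jnn Jne])
       (use AE_cos_ne_1[OF that] in \<open>auto elim!: eventually_mono\<close>)
  have Q_nonneg: "Q \<xi> \<ge> 0" for \<xi>
    unfolding Q_def
  proof (rule integral_nonneg_AE)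
    show "AE x in lebesgue. 0 \<le> b 0 (x * \<xi>) * w x"
      using Jnn by eventually_elim (simp add: b_def w_def cos_quotient_nonneg)
  qed
  have Q0: "Q 0 = 2 * pi\<^sup>2 * \<mu>2"
  proof -
    have "Q 0 = (LINT x|lebesgue. 2 * pi\<^sup>2 * (x\<^sup>2 * J x))"
      unfolding Q_def by (intro Bochner_Integration.integral_cong refl) (simp add: b_def w_def cos_quotient_0)
    then show ?thesis by (simp only: Bochner_Integration.integral_mult_right_zero \<mu>2_def)
  qed
  have G_pos: "G \<xi> > 0" for \<xi>
  proof (cases "\<xi> = 0")
    case True
    then show ?thesis using \<mu>2_pos by (simp add: G_def pQ Q0)
  next
    case False
    then show ?thesis using p_pos[OF False] Q_nonneg[of \<xi>] by (simp add: G_def)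
  qed
  have FJ: "fourier_integral (\<lambda>x. of_real (J x)) \<xi> = of_real (F \<xi>)" for \<xi>
  proof -
    let ?z = "fourier_integral (\<lambda>x. complex_of_real (J x)) \<xi>"
    have Jm: "J \<in> borel_measurable lebesgue" using Ji by auto
    have m: "(\<lambda>x. complex_of_real (J (- x))) \<in> borel_measurable lebesgue"
      using lebesgue_measurable_affine[of "-1" J 0] Jm by simp
    have "fourier_integral (\<lambda>x. complex_of_real (J x)) (- \<xi>) = fourier_integral (\<lambda>x. complex_of_real (J (- x))) \<xi>"
      using fourier_integral_scale[of "-1" "\<lambda>x. complex_of_real (J x)" \<xi>] by simp
    also have "\<dots> = ?z"
      unfolding fourier_integral_def using Jeven m Jm
      by (intro integral_cong_AE borel_measurable_times) (auto simp: measurable_completion)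
    \<comment> \<open>Evenness of \<open>J\<close> makes its transform even, realness makes
      reflection the same as conjugation; together they make it real.\<close>
    finally have "?z = cnj ?z" using fourier_integral_cnj[of "\<lambda>x. complex_of_real (J x)" \<xi>] by simp
    then have "Im ?z = 0" by (simp add: complex_eq_iff)
    moreover have "Re ?z = F \<xi>"
    proof -
      have "integrable lebesgue (\<lambda>x. complex_of_real (J x) * fourier_char (- (\<xi> * x)))"
        by (intro integrable_times_char_minus integrable_of_real Ji)
      then have "Re ?z = (LINT x|lebesgue. Re (complex_of_real (J x) * fourier_char (- (\<xi> * x))))"
        unfolding fourier_integral_def by (rule integral_Re[symmetric])
      also have "\<dots> = F \<xi>" unfolding F_def a0
        by (intro Bochner_Integration.integral_cong) (auto simp: fourier_char_cis mult_ac)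
      finally show ?thesis .
    qed
    ultimately show ?thesis by (simp add: complex_eq_iff)
  qed
  \<comment> \<open>Far out \<open>p\<close> is close to \<mu> by Riemann-Lebesgue while
    \<open>Q\<close> is nonnegative; on the remaining compact interval the continuous function
    \<open>G\<close> attains its positive minimum.\<close>
  obtain \<delta> where \<delta>: "\<delta> > 0" "\<And>\<xi>. G \<xi> \<ge> \<delta>"
  proof -
    have "(fourier_integral (\<lambda>x. complex_of_real (J x)) \<longlongrightarrow> 0) at_infinity"
      by (intro riemann_lebesgue integrable_of_real Ji)
    then have "\<forall>\<^sub>F \<xi> in at_infinity. dist (fourier_integral (\<lambda>x. complex_of_real (J x)) \<xi>) 0 < \<mu> / 2"
      using \<mu>_pos by (intro tendstoD) auto
    then obtain R where R: "\<And>\<xi>. \<bar>\<xi>\<bar> \<ge> R \<Longrightarrow> \<bar>F \<xi>\<bar> < \<mu> / 2"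
      by (auto simp: eventually_at_infinity FJ)
    have far: "G \<xi> \<ge> \<mu> / 2" if "\<bar>\<xi>\<bar> \<ge> R" for \<xi>
      using R[OF that] Q_nonneg[of \<xi>] by (simp add: G_def p_def abs_less_iff)
    have "\<exists>x\<in>{-\<bar>R\<bar>..\<bar>R\<bar>}. \<forall>y\<in>{-\<bar>R\<bar>..\<bar>R\<bar>}. G x \<le> G y"
      by (rule continuous_attains_inf) (auto intro!: continuous_at_imp_continuous_on G_cont)
    then obtain x0 where x0: "\<And>y. y \<in> {-\<bar>R\<bar>..\<bar>R\<bar>} \<Longrightarrow> G x0 \<le> G y" by blast
    have "G \<xi> \<ge> min (\<mu> / 2) (G x0)" for \<xi>
    proof (cases "\<bar>\<xi>\<bar> \<ge> R")
      case False
      then have "\<xi> \<in> {-\<bar>R\<bar>..\<bar>R\<bar>}" by (auto simp: abs_le_iff)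
      from x0[OF this] show ?thesis by simp
    qed (use far in \<open>auto simp: min_le_iff_disj\<close>)
    then show thesis using that[of "min (\<mu> / 2) (G x0)"] \<mu>_pos G_pos[of x0] by auto
  qed
  \<comment> \<open>The limit of \<psi> \<xi> / \<xi> at 0 is sqrt (G 0) / (2 pi c), and G 0 = 2
    pi^2 \<mu>2 equals (2 pi c)^2 for exactly this positive c.\<close>
  define c where "c = sqrt (\<mu>2 / 2)"
  have c: "c > 0" "c\<^sup>2 = \<mu>2 / 2" using \<mu>2_pos by (auto simp: c_def)
  define \<psi> where "\<psi> \<xi> = 1 / (2 * pi * c) * (\<xi> / sqrt (1 + \<xi>\<^sup>2)) * (G \<xi> powr (1/2))" for \<xi>
  have pos: "1 + \<xi>\<^sup>2 > 0" for \<xi> :: real by (simp add: add_pos_nonneg)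
  have Gs: "G \<xi> powr (1/2) = sqrt (G \<xi>)" for \<xi> using G_pos[of \<xi>] by (simp add: powr_half_sqrt)
  obtain B where B: "\<And>\<xi>. \<bar>G \<xi>\<bar> \<le> B" using smooth_bounded_imp_bounded[OF smooth_G] by (auto simp: bounded_range_iff)
  show thesis
  proof (rule that[of c \<psi>])
    show "c > 0" by (rule c)
    show "smooth_bounded l \<psi>" unfolding \<psi>_def
      by (intro smooth_bounded_mult smooth_bounded_const smooth_bounded_powr[OF smooth_G \<delta>] smooth_bounded_normalizer[THEN conjunct2])
    show "continuous_on UNIV \<psi>" unfolding \<psi>_def Gs
      by (intro continuous_intros continuous_at_imp_continuous_on ballI G_cont) (use pos less_imp_neq[OF pos] c in \<open>auto simp: add_nonneg_eq_0_iff\<close>)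
    show "fourier_integral (\<lambda>x. of_real (J x)) \<xi> - of_real (moment J 0) = of_real (c\<^sup>2) * (2 * of_real pi * \<i> * of_real (\<psi> \<xi>))\<^sup>2" for \<xi>
    proof -
      have "G \<xi> = (1 + \<xi>\<^sup>2) * Q \<xi>" by (simp add: G_def pQ algebra_simps)
      then have "(\<psi> \<xi>)\<^sup>2 = 1 / (4 * pi\<^sup>2 * c\<^sup>2) * (\<xi>\<^sup>2 / (1 + \<xi>\<^sup>2)) * ((1 + \<xi>\<^sup>2) * Q \<xi>)"
        unfolding \<psi>_def Gs power_mult_distrib power_divide using G_pos[of \<xi>] pos[of \<xi>] by (simp add: power_mult_distrib)
      also have "\<dots> = p \<xi> / (4 * pi\<^sup>2 * c\<^sup>2)" using pos[of \<xi>] by (simp add: pQ)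
      finally have ps': "(\<psi> \<xi>)\<^sup>2 = p \<xi> / (4 * pi\<^sup>2 * c\<^sup>2)" .
      have cancel: "K \<noteq> 0 \<Longrightarrow> K * (y / K) = y" for K y :: real by simp
      have "4 * pi\<^sup>2 * c\<^sup>2 \<noteq> 0" using c(1) by simp
      then have "(4 * pi\<^sup>2 * c\<^sup>2) * (\<psi> \<xi>)\<^sup>2 = p \<xi>" unfolding ps' by (rule cancel)
      then have ps: "c\<^sup>2 * (4 * pi\<^sup>2 * (\<psi> \<xi>)\<^sup>2) = p \<xi>" by (simp only: mult_ac)
      have "of_real (c\<^sup>2) * (2 * of_real pi * \<i> * of_real (\<psi> \<xi>))\<^sup>2 = - complex_of_real (c\<^sup>2 * (4 * pi\<^sup>2 * (\<psi> \<xi>)\<^sup>2))"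
        by (simp add: power_mult_distrib)
      also have "\<dots> = - of_real (p \<xi>)" by (simp only: ps)
      also have "\<dots> = of_real (F \<xi>) - of_real (moment J 0)" by (simp add: p_def \<mu>_def moment_def)
      finally show ?thesis by (simp add: FJ)
    qed
    show "sgn (\<psi> \<xi>) = sgn \<xi>" for \<xi>
      using G_pos[of \<xi>] pos[of \<xi>] c by (simp add: \<psi>_def Gs sgn_mult sgn_divide)
    show "((\<lambda>\<xi>. \<psi> \<xi> / \<xi>) \<longlongrightarrow> 1) (at 0)"
    proof -
      define k where "k \<xi> = 1 / (2 * pi * c) * (1 / sqrt (1 + \<xi>\<^sup>2)) * sqrt (G \<xi>)" for \<xi>
      have "isCont k 0" unfolding k_def by (intro continuous_intros G_cont) (use c in auto)
      then have "(k \<longlongrightarrow> k 0) (at 0)" by (simp add: isCont_def)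
      moreover have "k 0 = 1"
      proof -
        have "G 0 = (2 * pi * c)\<^sup>2" by (simp add: G_def pQ Q0 power_mult_distrib c)
        then have "sqrt (G 0) = 2 * pi * c" using c by simp
        then show ?thesis using c by (simp add: k_def)
      qed
      moreover have "\<forall>\<^sub>F \<xi> in at 0. k \<xi> = \<psi> \<xi> / \<xi>"
        unfolding eventually_at_filter by (intro always_eventually) (auto simp: k_def \<psi>_def Gs)
      ultimately show ?thesis by (simp add: Lim_transform_eventually)
    qed
    show "\<bar>\<psi> \<xi>\<bar> \<le> (sqrt B / (2 * pi * c)) * \<bar>\<xi>\<bar>" for \<xi>
    proof -
      have "1 \<le> sqrt (1 + \<xi>\<^sup>2)" by simp
      then have "\<bar>\<xi> / sqrt (1 + \<xi>\<^sup>2)\<bar> \<le> \<bar>\<xi>\<bar>" using divide_left_mono[of 1 "sqrt (1 + \<xi>\<^sup>2)" "\<bar>\<xi>\<bar>"] pos[of \<xi>] by simp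
      moreover have "sqrt (G \<xi>) \<le> sqrt B" using B[of \<xi>] by (simp add: abs_le_iff)
      ultimately have "\<bar>\<xi> / sqrt (1 + \<xi>\<^sup>2)\<bar> * sqrt (G \<xi>) \<le> \<bar>\<xi>\<bar> * sqrt B" using G_pos[of \<xi>] by (intro mult_mono) auto
      then have "1 / (2 * pi * c) * (\<bar>\<xi> / sqrt (1 + \<xi>\<^sup>2)\<bar> * sqrt (G \<xi>)) \<le> 1 / (2 * pi * c) * (\<bar>\<xi>\<bar> * sqrt B)"
        using c by (intro mult_left_mono) auto
      moreover have "\<bar>\<psi> \<xi>\<bar> = 1 / (2 * pi * c) * (\<bar>\<xi> / sqrt (1 + \<xi>\<^sup>2)\<bar> * sqrt (G \<xi>))"
        unfolding \<psi>_def Gs abs_mult using c G_pos[of \<xi>] by simp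
      ultimately show ?thesis by (simp add: mult_ac)
    qed
  qed
qed

section \<open>Test functions and weak derivatives\<close>

fun times_differentiable :: "nat \<Rightarrow> (real \<Rightarrow> real) \<Rightarrow> bool" where
  "times_differentiable 0 f \<longleftrightarrow> True"
| "times_differentiable (Suc n) f \<longleftrightarrow> (\<exists>f'. (\<forall>x. (f has_real_derivative f' x) (at x)) \<and> times_differentiable n f')"

lemma times_differentiable_SucI:
  "(\<And>x. (f has_real_derivative f' x) (at x)) \<Longrightarrow> times_differentiable n f' \<Longrightarrow> times_differentiable (Suc n) f"
  by auto

lemma times_differentiable_Suc_D: "times_differentiable (Suc n) f \<Longrightarrow> times_differentiable n f"
proof (induction n arbitrary: f)
  case (Suc n)
  then obtain f' where f': "\<And>x. (f has_real_derivative f' x) (at x)" "times_differentiable (Suc n) f'" by auto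
  show ?case by (rule times_differentiable_SucI[OF f'(1) Suc.IH[OF f'(2)]])
qed simp

lemma times_differentiable_differentiable:
  "times_differentiable (Suc n) f \<Longrightarrow> (deriv ^^ n) f differentiable at x"
proof (induction n arbitrary: f)
  case 0
  then show ?case by (auto simp: real_differentiable_def)
next
  case (Suc n)
  then obtain f' where f': "\<And>x. (f has_real_derivative f' x) (at x)" "times_differentiable (Suc n) f'" by auto
  have "deriv f = f'" using f'(1) by (auto intro!: ext DERIV_imp_deriv)
  then show ?case using Suc.IH[OF f'(2)] by (simp only: funpow_Suc_right o_apply)
qed

lemma times_differentiable_const: "times_differentiable n (\<lambda>x. c)"
proof (induction n arbitrary: c)
  case (Suc n)
  show ?case by (rule times_differentiable_SucI[of _ "\<lambda>x. 0", OF DERIV_const Suc.IH])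
qed simp

lemma times_differentiable_ident: "times_differentiable n (\<lambda>x. x)"
proof (cases n)
  case (Suc n)
  show ?thesis unfolding Suc by (rule times_differentiable_SucI[of _ "\<lambda>x. 1", OF DERIV_ident times_differentiable_const])
qed simp

lemma times_differentiable_add:
  "times_differentiable n f \<Longrightarrow> times_differentiable n g \<Longrightarrow> times_differentiable n (\<lambda>x. f x + g x)"
proof (induction n arbitrary: f g)
  case (Suc n)
  obtain f' g' where f': "\<And>x. (f has_real_derivative f' x) (at x)" "times_differentiable n f'" "\<And>x. (g has_real_derivative g' x) (at x)" "times_differentiable n g'"
    using Suc.prems by auto
  show ?case by (rule times_differentiable_SucI[OF DERIV_add[OF f'(1,3)] Suc.IH[OF f'(2,4)]])
qed simp

lemma times_differentiable_mult:
  "times_differentiable n f \<Longrightarrow> times_differentiable n g \<Longrightarrow> times_differentiable n (\<lambda>x. f x * g x)"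
proof (induction n arbitrary: f g)
  case (Suc n)
  obtain f' g' where f': "\<And>x. (f has_real_derivative f' x) (at x)" "times_differentiable n f'" "\<And>x. (g has_real_derivative g' x) (at x)" "times_differentiable n g'"
    using Suc.prems by auto
  show ?case
    by (rule times_differentiable_SucI[OF DERIV_mult[OF f'(1,3)]])
       (intro times_differentiable_add Suc.IH f' times_differentiable_Suc_D[OF Suc.prems(1)] times_differentiable_Suc_D[OF Suc.prems(2)])
qed simp

lemma times_differentiable_compose:
  "times_differentiable n f \<Longrightarrow> times_differentiable n g \<Longrightarrow> times_differentiable n (\<lambda>x. f (g x))"
proof (induction n arbitrary: f g)
  case (Suc n)
  obtain f' g' where f': "\<And>x. (f has_real_derivative f' x) (at x)" "times_differentiable n f'" "\<And>x. (g has_real_derivative g' x) (at x)" "times_differentiable n g'"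
    using Suc.prems by auto
  show ?case
    by (rule times_differentiable_SucI[OF DERIV_chain2[OF f'(1,3)]])
       (rule times_differentiable_mult[OF Suc.IH[OF f'(2) times_differentiable_Suc_D[OF Suc.prems(2)]] f'(4)])
qed simp

lemma times_differentiable_exp: "times_differentiable n (exp :: real \<Rightarrow> real)"
proof (induction n)
  case (Suc n)
  show ?case by (rule times_differentiable_SucI[OF DERIV_exp Suc.IH])
qed simp

lemma times_differentiable_gauss: "times_differentiable n (\<lambda>x. gauss (x - b))"
proof -
  have e: "gauss (x - b) = exp (- pi * ((x + - b) * (x + - b)))" for x by (simp add: gauss_def power2_eq_square)
  show ?thesis unfolding e
    by (intro times_differentiable_compose[OF times_differentiable_exp] times_differentiable_mult times_differentiable_add
        times_differentiable_const times_differentiable_ident)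
qed

section \<open>A smooth bump function\<close>

lemma poly_exp_tendsto_0: "((\<lambda>s. poly p s * exp (- s)) \<longlongrightarrow> (0::real)) at_top"
proof -
  have "((\<lambda>s. \<Sum>i\<le>degree p. coeff p i * (s ^ i / exp s)) \<longlongrightarrow> (\<Sum>i\<le>degree p. coeff p i * 0)) at_top"
    by (intro tendsto_sum tendsto_mult tendsto_const tendsto_power_div_exp_0)
  then show ?thesis by (simp add: poly_altdef exp_minus sum_distrib_right divide_inverse mult.assoc)
qed

text \<open>exp (-1/t) extended by 0, with a polynomial in 1/t in front: the smallest natural family
  that contains the standard flat function and is closed under differentiation.\<close>

definition flat :: "real poly \<Rightarrow> real \<Rightarrow> real" where
  "flat p t = (if t > 0 then poly p (1 / t) * exp (- (1 / t)) else 0)"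

text \<open>For t > 0, differentiating the exponential gives p and differentiating the polynomial
  gives -p', each with a factor 1/t^2; \<open>[:0, 0, 1:]\<close> encodes that factor as
  multiplication by the square of the variable 1/t. At 0 the exponential beats every power of
  1/t.\<close>

lemma flat_deriv: "(flat p has_real_derivative flat ([:0, 0, 1:] * (p - pderiv p)) t) (at t)"
proof -
  consider "t > 0" | "t < 0" | "t = 0" by linarith
  then show ?thesis
  proof cases
    case 1
    have "((\<lambda>t. poly p (1 / t) * exp (- (1 / t))) has_real_derivative
        poly (pderiv p) (1 / t) * (- 1 / t\<^sup>2) * exp (- (1 / t)) + exp (- (1 / t)) * (1 / t\<^sup>2) * poly p (1 / t)) (at t)"
    proof (rule DERIV_mult)
      have d: "((\<lambda>t. 1 / t) has_real_derivative - 1 / t\<^sup>2) (at t)"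
        using 1 by (auto intro!: derivative_eq_intros simp: power2_eq_square)
      show "((\<lambda>t. poly p (1 / t)) has_real_derivative poly (pderiv p) (1 / t) * (- 1 / t\<^sup>2)) (at t)"
        by (rule DERIV_chain2[OF poly_DERIV d])
      have "((\<lambda>t. - (1 / t)) has_real_derivative 1 / t\<^sup>2) (at t)" using DERIV_minus[OF d] by simp
      from DERIV_chain2[OF DERIV_exp this] show "((\<lambda>t. exp (- (1 / t))) has_real_derivative exp (- (1 / t)) * (1 / t\<^sup>2)) (at t)" .
    qed
    moreover have "poly (pderiv p) (1 / t) * (- 1 / t\<^sup>2) * exp (- (1 / t)) + exp (- (1 / t)) * (1 / t\<^sup>2) * poly p (1 / t)
       = flat ([:0, 0, 1:] * (p - pderiv p)) t"
      using 1 by (simp add: flat_def algebra_simps power2_eq_square)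
    ultimately have "((\<lambda>t. poly p (1 / t) * exp (- (1 / t))) has_real_derivative flat ([:0, 0, 1:] * (p - pderiv p)) t) (at t)" by simp
    moreover have "\<forall>\<^sub>F s in nhds t. s \<in> {0<..}" using 1 by (intro eventually_nhds_in_open) auto
    then have "\<forall>\<^sub>F s in nhds t. poly p (1 / s) * exp (- (1 / s)) = flat p s"
      by eventually_elim (simp add: flat_def)
    ultimately show ?thesis by (rule DERIV_cong_ev[OF refl _ refl, THEN iffD1, rotated])
  next
    case 2
    have "\<forall>\<^sub>F s in nhds t. s \<in> {..<0}" using 2 by (intro eventually_nhds_in_open) auto
    then have "\<forall>\<^sub>F s in nhds t. 0 = flat p s"
      by eventually_elim (simp add: flat_def)
    moreover have "((\<lambda>t. 0) has_real_derivative flat ([:0, 0, 1:] * (p - pderiv p)) t) (at t)" using 2 by (simp add: flat_def)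
    ultimately show ?thesis by (rule DERIV_cong_ev[OF refl _ refl, THEN iffD1])
  next
    case 3
    have "((\<lambda>h. flat p h / h) \<longlongrightarrow> 0) (at_right 0)"
    proof -
      \<comment> \<open>Dividing by h is multiplying by the polynomial variable 1/h, that is,
        passing to \<open>pCons 0 p\<close>.\<close>
      have "((\<lambda>h. poly (pCons 0 p) (inverse h) * exp (- inverse h)) \<longlongrightarrow> 0) (at_right 0)"
        by (rule filterlim_compose[OF poly_exp_tendsto_0 filterlim_inverse_at_top_right])
      then show ?thesis
        by (rule Lim_transform_eventually)
           (auto simp: eventually_at_right_field flat_def divide_inverse mult_ac intro!: exI[of _ 1])
    qed
    moreover have "((\<lambda>h. flat p h / h) \<longlongrightarrow> 0) (at_left 0)"
      by (rule tendsto_eventually) (auto simp: eventually_at_left_field flat_def intro!: exI[of _ "-1"])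
    ultimately have "((\<lambda>h. flat p h / h) \<longlongrightarrow> 0) (at 0)" by (simp add: filterlim_at_split)
    then show ?thesis using 3 by (simp add: DERIV_def flat_def[of p 0] flat_def[of _ 0])
  qed
qed

lemma times_differentiable_flat: "times_differentiable n (flat p)"
proof (induction n arbitrary: p)
  case (Suc n)
  show ?case by (rule times_differentiable_SucI[OF flat_deriv Suc.IH])
qed simp

text \<open>The factor \<open>exp 1\<close> normalizes the value at 0 to 1, so that dilated bumps
  tend to 1 pointwise and act as cut-offs.\<close>

definition bump :: "real \<Rightarrow> real" where "bump x = exp 1 * flat 1 (1 + - (x * x))"

lemma bump_eq: "bump x = (if \<bar>x\<bar> < 1 then exp (1 - 1 / (1 - x\<^sup>2)) else 0)"
  by (auto simp: bump_def flat_def power2_eq_square exp_diff exp_minus divide_inverse abs_square_less_1[unfolded power2_eq_square])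

lemma bump_0: "bump 0 = 1" by (simp add: bump_eq)

lemma bump_le: "0 \<le> bump x" "bump x \<le> 1"
proof -
  show "0 \<le> bump x" by (simp add: bump_eq)
  have "1 - 1 / (1 - x\<^sup>2) \<le> 0" if "\<bar>x\<bar> < 1"
  proof -
    have "0 < 1 - x\<^sup>2" using that by (simp add: abs_square_less_1)
    then show ?thesis by (simp add: le_divide_eq)
  qed
  then show "bump x \<le> 1" by (simp add: bump_eq)
qed

lemma times_differentiable_bump: "times_differentiable n bump"
  unfolding bump_def
  by (intro times_differentiable_mult times_differentiable_const times_differentiable_compose[OF times_differentiable_flat]
      times_differentiable_add times_differentiable_ident)
     (use times_differentiable_mult[OF times_differentiable_const[of n "-1"] times_differentiable_mult[OF times_differentiable_ident times_differentiable_ident]] in simp)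

text \<open>Outside [-1, 1] the derivative vanishes, and inside it is continuous on a compact set.
  The uniform bound later dominates the derivative of the cut-off.\<close>

lemma bump_deriv_bounded:
  "\<exists>bump' C. (\<forall>x. (bump has_real_derivative bump' x) (at x)) \<and> continuous_on UNIV bump' \<and> (\<forall>x. \<bar>bump' x\<bar> \<le> C)"
proof -
  have "times_differentiable (Suc (Suc 0)) bump" by (rule times_differentiable_bump)
  then obtain b' where b': "\<And>x. (bump has_real_derivative b' x) (at x)" "times_differentiable (Suc 0) b'" by auto
  then obtain b'' where "\<And>x. (b' has_real_derivative b'' x) (at x)" by auto
  then have c: "continuous_on UNIV b'" by (meson DERIV_isCont continuous_at_imp_continuous_on)
  have "bounded (b' ` {-1..1})" by (intro compact_imp_bounded compact_continuous_image continuous_on_subset[OF c]) auto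
  then obtain C where C: "C > 0" "\<And>x. x \<in> {-1..1} \<Longrightarrow> \<bar>b' x\<bar> \<le> C" unfolding bounded_pos by auto
  have "b' x = 0" if "\<bar>x\<bar> > 1" for x
  proof -
    have "\<forall>\<^sub>F y in nhds x. bump y = 0"
    proof (rule eventually_mono[OF eventually_nhds_in_open[of "{y. \<bar>y\<bar> > 1}" x]])
      show "open {y::real. \<bar>y\<bar> > 1}" by (intro open_Collect_less continuous_intros)
    qed (use that in \<open>auto simp: bump_eq\<close>)
    then have "(bump has_real_derivative 0) (at x)" using DERIV_cong_ev[of x x bump "\<lambda>_. 0" 0 0] by simp
    then show ?thesis using b'(1)[of x] DERIV_unique by blast
  qed
  then have "\<bar>b' x\<bar> \<le> C" for x using C(2)[of x] C(1) by (cases "\<bar>x\<bar> > 1") (auto simp: abs_le_iff not_less)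
  then show ?thesis using b'(1) c by blast
qed

section \<open>Testing weak derivatives with Gaussians\<close>

lemma gauss_deriv: "((\<lambda>x. gauss (x - b)) has_real_derivative - (2 * pi * (x - b)) * gauss (x - b)) (at x)"
  unfolding gauss_def by (auto intro!: derivative_eq_intros)

text \<open>Half of the exponent absorbs the quadratic factor; the other half is the Gaussian at x /
  sqrt 2.\<close>

lemma gauss_weight_le: "(1 + x\<^sup>2) * gauss x \<le> gauss (x / sqrt 2)"
proof -
  have "x\<^sup>2 * 1 \<le> x\<^sup>2 * (pi / 2)" using pi_gt3 by (intro mult_left_mono) auto
  then have "1 + x\<^sup>2 \<le> 1 + pi * x\<^sup>2 / 2" by (simp add: mult.commute)
  also have "\<dots> \<le> exp (pi * x\<^sup>2 / 2)" by (rule exp_ge_add_one_self)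
  finally have "(1 + x\<^sup>2) * gauss x \<le> exp (pi * x\<^sup>2 / 2) * gauss x" by (intro mult_right_mono) auto
  also have "\<dots> = gauss (x / sqrt 2)" unfolding gauss_def exp_add[symmetric] by (simp add: power_divide)
  finally show ?thesis .
qed

lemma gauss_dominated:
  assumes "f \<in> borel_measurable borel" "\<And>x. cmod (f x) \<le> C * (1 + x\<^sup>2)"
  shows "integrable lebesgue (\<lambda>x. f x * of_real (gauss x))" "(\<lambda>x. f x * of_real (gauss x)) \<in> L2"
proof -
  have g: "integrable lebesgue (\<lambda>x. complex_of_real (gauss (x / sqrt 2)))"
    using integrable_affine[OF integrable_gauss, of "1 / sqrt 2" 0] by simp
  have gL: "(\<lambda>x. complex_of_real (gauss (x / sqrt 2))) \<in> L2"
    using L2_affine[OF gauss_L2, of "1 / sqrt 2" 0] by simp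
  have C: "C \<ge> 0" using order_trans[OF norm_ge_zero assms(2)[of 0]] by simp
  have m: "(\<lambda>x. f x * of_real (gauss x)) \<in> borel_measurable lebesgue"
    using assms(1) by (intro measurable_completion) simp
  have le: "cmod (f x * of_real (gauss x)) \<le> C * cmod (of_real (gauss (x / sqrt 2)))" for x
  proof -
    have "cmod (f x * of_real (gauss x)) = cmod (f x) * gauss x" by (simp add: norm_mult)
    also have "\<dots> \<le> (C * (1 + x\<^sup>2)) * gauss x"
      by (intro mult_right_mono assms(2)) simp
    also have "\<dots> \<le> C * gauss (x / sqrt 2)" using gauss_weight_le[of x] C by (simp add: mult.assoc mult_left_mono)
    finally show ?thesis by simp
  qed
  show "(\<lambda>x. f x * of_real (gauss x)) \<in> L2" by (rule L2_bound[OF gL m]) (use le in auto)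
  show "integrable lebesgue (\<lambda>x. f x * of_real (gauss x))"
    by (rule Bochner_Integration.integrable_bound[OF integrable_mult_right[OF g, of "of_real C"] m])
       (use le C in \<open>auto simp: norm_mult\<close>)
qed

lemma abs_le_1_plus_sq: "\<bar>x\<bar> \<le> 1 + x\<^sup>2" for x :: real
proof -
  have "0 \<le> (\<bar>x\<bar> - 1)\<^sup>2" by simp
  then show ?thesis by (simp add: power2_eq_square algebra_simps)
qed

lemma x_gauss:
  "integrable lebesgue (\<lambda>x. of_real x * complex_of_real (gauss x))" "(\<lambda>x. of_real x * complex_of_real (gauss x)) \<in> L2"
  using gauss_dominated[of "\<lambda>x. of_real x" 1] abs_le_1_plus_sq by auto

text \<open>Differentiating the cosine form of the transform of \<open>gauss\<close> under the
  integral sign brings down a factor x and yields the imaginary part; the real part vanishes by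
  parity.\<close>

lemma fourier_integral_x_gauss:
  "fourier_integral (\<lambda>x. of_real x * of_real (gauss x)) s = - \<i> * of_real s * of_real (gauss s)"
proof -
  have gi: "integrable lebesgue gauss"
    using integrable_gauss integrable_norm by fastforce
  have xi: "integrable lebesgue (\<lambda>x. x * gauss x)" using integrable_Re[OF x_gauss(1)] by simp
  have C: "gauss t = (LINT x|lebesgue. cos_shift 0 (x * (2 * pi * t)) * gauss x)" for t
  proof -
    have "complex_of_real (gauss t) = (LINT x|lebesgue. complex_of_real (gauss x) * fourier_char (- (t * x)))"
      using fourier_integral_gauss[of t] by (simp add: fourier_integral_def)
    then have "Re (complex_of_real (gauss t)) = (LINT x|lebesgue. Re (complex_of_real (gauss x) * fourier_char (- (t * x))))"
      using integral_Re[OF integrable_times_char_minus[OF integrable_gauss, of t]] by simp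
    then show ?thesis by (simp add: fourier_char_cis cos_shift_def mult_ac)
  qed
  have "((\<lambda>u. LINT x|lebesgue. cos_shift 0 (x * u) * gauss x) has_real_derivative (LINT x|lebesgue. cos_shift (Suc 0) (x * u) * (x * gauss x))) (at u)" for u
    by (rule parametric_integral_deriv[OF cos_shift_deriv cos_shift_cont cos_shift_le cos_shift_le gi xi])
  from DERIV_chain2[OF this, of "\<lambda>t. 2 * pi * t" "2 * pi" s UNIV]
  have "(gauss has_real_derivative (LINT x|lebesgue. cos_shift (Suc 0) (x * (2 * pi * s)) * (x * gauss x)) * (2 * pi)) (at s)"
    unfolding C[symmetric] by (auto intro!: derivative_eq_intros)
  moreover have "(gauss has_real_derivative - (2 * pi * s) * gauss s) (at s)" using gauss_deriv[of 0 s] by simp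
  ultimately have "(LINT x|lebesgue. cos_shift (Suc 0) (x * (2 * pi * s)) * (x * gauss x)) * (2 * pi) = - (2 * pi * s) * gauss s"
    by (rule DERIV_unique)
  also have "- (2 * pi * s) * gauss s = (- s * gauss s) * (2 * pi)" by simp
  finally have I: "(LINT x|lebesgue. cos_shift (Suc 0) (x * (2 * pi * s)) * (x * gauss x)) = - s * gauss s"
    by (subst (asm) mult_right_cancel) auto
  define z where "z = fourier_integral (\<lambda>x. of_real x * complex_of_real (gauss x)) s"
  note i = integrable_times_char_minus[OF x_gauss(1), of s]
  have "Im z = (LINT x|lebesgue. Im (of_real x * complex_of_real (gauss x) * fourier_char (- (s * x))))"
    unfolding z_def fourier_integral_def by (rule integral_Im[OF i, symmetric])
  also have "\<dots> = (LINT x|lebesgue. cos_shift (Suc 0) (x * (2 * pi * s)) * (x * gauss x))"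
  proof (intro Bochner_Integration.integral_cong refl)
    fix x
    have "cos_shift (Suc 0) (x * (2 * pi * s)) = - sin (x * (2 * pi * s))" by (simp add: cos_shift_def cos_add)
    then show "Im (of_real x * complex_of_real (gauss x) * fourier_char (- (s * x))) = cos_shift (Suc 0) (x * (2 * pi * s)) * (x * gauss x)"
      by (simp add: fourier_char_cis mult_ac)
  qed
  finally have Im: "Im z = - s * gauss s" by (simp only: I)
  \<comment> \<open>The integrand's first factor is odd and real, so the transform equals minus its
    own conjugate.\<close>
  have "z = fourier_integral (\<lambda>x. (-1) * (of_real (- x) * complex_of_real (gauss (- x)))) s" unfolding z_def by simp
  also have "\<dots> = - fourier_integral (\<lambda>x. of_real x * complex_of_real (gauss x)) (- s)"
    unfolding fourier_integral_cmult using fourier_integral_scale[of "-1" "\<lambda>x. of_real x * complex_of_real (gauss x)" s] by simp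
  also have "\<dots> = - cnj z"
    unfolding z_def using fourier_integral_cnj[of "\<lambda>x. of_real x * complex_of_real (gauss x)" "- s"] by simp
  finally have "Re z = 0" by (simp add: complex_eq_iff)
  with Im show ?thesis unfolding z_def[symmetric] by (simp add: complex_eq_iff)
qed

lemma test_function_gauss_bump:
  assumes "n > 0" shows "test_function (\<lambda>x. gauss (x - b) * bump (x / n))"
proof -
  have "times_differentiable k (\<lambda>x. gauss (x - b) * bump (inverse n * x))" for k
    by (intro times_differentiable_mult times_differentiable_gauss times_differentiable_compose[OF times_differentiable_bump]
        times_differentiable_const times_differentiable_ident)
  then have "times_differentiable k (\<lambda>x. gauss (x - b) * bump (x / n))" for k by (simp add: divide_inverse mult.commute)
  then have 1: "(deriv ^^ k) (\<lambda>x. gauss (x - b) * bump (x / n)) differentiable (at x)" for k x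
    by (rule times_differentiable_differentiable)
  have "\<bar>x\<bar> \<le> n" if "gauss (x - b) * bump (x / n) \<noteq> 0" for x
    using that assms by (simp add: bump_eq split: if_splits)
  then have "-n \<le> x \<and> x \<le> n" if "gauss (x - b) * bump (x / n) \<noteq> 0" for x
    using that by (fastforce simp: abs_le_iff)
  then have "{x. gauss (x - b) * bump (x / n) \<noteq> 0} \<subseteq> {-n..n}" by auto
  then have "bounded {x. gauss (x - b) * bump (x / n) \<noteq> 0}" by (rule bounded_subset[rotated]) auto
  with 1 show ?thesis by (auto simp: test_function_def compact_closure)
qed

text \<open>A Gaussian lacks compact support, so it is multiplied by dilated bumps. The extra term
  of the derivative carries a factor 1 / N k and disappears in the limit; N k being at least 1 keeps
  it dominated throughout.\<close>

lemma weak_derivative_gauss_test: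
  assumes v: "v \<in> L2" and v': "v' \<in> L2" and w: "weak_derivative v v'"
  shows "(LINT x|lebesgue. v x * of_real (- (2 * pi * (x - b)) * gauss (x - b))) = - (LINT x|lebesgue. v' x * of_real (gauss (x - b)))"
proof -
  obtain bump' C where b': "\<And>x. (bump has_real_derivative bump' x) (at x)" "continuous_on UNIV bump'" "\<And>x. \<bar>bump' x\<bar> \<le> C"
    using bump_deriv_bounded by blast
  have C: "C \<ge> 0" using order_trans[OF abs_ge_zero b'(3)[of 0]] .
  define g where "g x = gauss (x - b)" for x
  define g' where "g' x = - (2 * pi * (x - b)) * gauss (x - b)" for x
  define N where "N k = real (Suc k)" for k
  have N: "N k > 0" "N k \<ge> 1" for k by (auto simp: N_def)
  have Nlim: "(\<lambda>k. x / N k) \<longlonglongrightarrow> 0" for x :: real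
    unfolding N_def divide_inverse using tendsto_mult_right_zero[OF LIMSEQ_inverse_real_of_nat] by simp
  define \<phi> where "\<phi> k x = g x * bump (x / N k)" for k x
  define \<phi>' where "\<phi>' k x = g' x * bump (x / N k) + g x * (bump' (x / N k) / N k)" for k x
  have d\<phi>: "deriv (\<phi> k) x = \<phi>' k x" for k x
  proof (rule DERIV_imp_deriv)
    have "((\<lambda>x. bump (x / N k)) has_real_derivative bump' (x / N k) * (1 / N k)) (at x)"
      by (rule DERIV_chain2[OF b'(1)]) (use N(1)[of k] in \<open>auto intro!: derivative_eq_intros\<close>)
    from DERIV_mult[OF gauss_deriv this] show "(\<phi> k has_real_derivative \<phi>' k x) (at x)"
      unfolding \<phi>_def[abs_def] \<phi>'_def g_def g'_def by (simp add: mult.commute add.commute)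
  qed
  have "test_function (\<phi> k)" for k unfolding \<phi>_def[abs_def] g_def by (rule test_function_gauss_bump[OF N(1)])
  then have eq: "(LINT x|lebesgue. v x * of_real (\<phi>' k x)) = - (LINT x|lebesgue. v' x * of_real (\<phi> k x))" for k
    using w unfolding weak_derivative_def d\<phi>[symmetric] by blast
  have bc: "continuous_on UNIV bump" using b'(1) by (meson DERIV_isCont continuous_at_imp_continuous_on)
  have [measurable]: "bump \<in> borel_measurable borel" "bump' \<in> borel_measurable borel"
    using bc b'(2) by (auto intro: borel_measurable_continuous_onI)
  have gm [measurable]: "g \<in> borel_measurable borel" "g' \<in> borel_measurable borel" unfolding g_def[abs_def] g'_def[abs_def] by measurable
  have gL: "(\<lambda>x. complex_of_real (g x)) \<in> L2" unfolding g_def by (rule L2_translate[OF gauss_L2])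
  have g'L: "(\<lambda>x. complex_of_real (g' x)) \<in> L2"
    using L2_translate[OF L2_cmult[OF x_gauss(2), of "of_real (- 2 * pi)"], of b] by (simp add: g'_def mult.assoc)
  have ml: "(\<lambda>x. complex_of_real (f x)) \<in> borel_measurable lebesgue" if "f \<in> borel_measurable borel" for f :: "real \<Rightarrow> real"
    using that by (intro measurable_completion) simp
  have "(\<lambda>k. LINT x|lebesgue. v x * of_real (\<phi>' k x)) \<longlonglongrightarrow> (LINT x|lebesgue. v x * of_real (g' x))"
  proof (rule integral_dominated_convergence[where w="\<lambda>x. cmod (v x * of_real (g' x)) + C * cmod (v x * of_real (g x))"])
    show "integrable lebesgue (\<lambda>x. cmod (v x * of_real (g' x)) + C * cmod (v x * of_real (g x)))"
      using L2_mult_integrable[OF v gL] L2_mult_integrable[OF v g'L] by auto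
    show "AE x in lebesgue. (\<lambda>k. v x * of_real (\<phi>' k x)) \<longlonglongrightarrow> v x * of_real (g' x)"
    proof (rule AE_I2)
      fix x
      have "isCont bump 0" "isCont bump' 0" using bc b'(2) by (auto simp: continuous_on_eq_continuous_at)
      then have l: "(\<lambda>k. bump (x / N k)) \<longlonglongrightarrow> 1" "(\<lambda>k. bump' (x / N k)) \<longlonglongrightarrow> bump' 0"
        using isCont_tendsto_compose[OF _ Nlim[of x], of bump] isCont_tendsto_compose[OF _ Nlim[of x], of bump'] by (auto simp: bump_0)
      have "(\<lambda>k. bump' (x / N k) * (1 / N k)) \<longlonglongrightarrow> bump' 0 * 0" by (intro tendsto_mult l Nlim)
      then have "(\<lambda>k. \<phi>' k x) \<longlonglongrightarrow> g' x * 1 + g x * 0" unfolding \<phi>'_def by (intro tendsto_intros l) simp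
      then show "(\<lambda>k. v x * of_real (\<phi>' k x)) \<longlonglongrightarrow> v x * of_real (g' x)" by (intro tendsto_intros) simp
    qed
    show "AE x in lebesgue. norm (v x * of_real (\<phi>' k x)) \<le> cmod (v x * of_real (g' x)) + C * cmod (v x * of_real (g x))" for k
    proof (rule AE_I2)
      fix x
      have 1: "\<bar>g' x * bump (x / N k)\<bar> \<le> \<bar>g' x\<bar>" unfolding abs_mult using bump_le[of "x / N k"] by (simp add: mult_left_le)
      have "\<bar>bump' (x / N k) / N k\<bar> \<le> C / 1" unfolding abs_divide using b'(3)[of "x / N k"] N[of k] C by (intro frac_le) auto
      then have 2: "\<bar>g x * (bump' (x / N k) / N k)\<bar> \<le> \<bar>g x\<bar> * C" unfolding abs_mult[of "g x"] by (intro mult_left_mono) auto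
      have "\<bar>\<phi>' k x\<bar> \<le> \<bar>g' x\<bar> + \<bar>g x\<bar> * C" unfolding \<phi>'_def
        using 1 2 abs_triangle_ineq[of "g' x * bump (x / N k)" "g x * (bump' (x / N k) / N k)"] by linarith
      then have "cmod (v x) * \<bar>\<phi>' k x\<bar> \<le> cmod (v x) * (\<bar>g' x\<bar> + \<bar>g x\<bar> * C)" by (intro mult_left_mono) auto
      then show "norm (v x * of_real (\<phi>' k x)) \<le> cmod (v x * of_real (g' x)) + C * cmod (v x * of_real (g x))"
        by (simp add: norm_mult algebra_simps)
    qed
    show "(\<lambda>x. v x * of_real (g' x)) \<in> borel_measurable lebesgue" using L2_measurable[OF v] ml[OF gm(2)] by auto
    have "\<phi>' k \<in> borel_measurable borel" for k unfolding \<phi>'_def[abs_def] by measurable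
    then show "(\<lambda>x. v x * of_real (\<phi>' k x)) \<in> borel_measurable lebesgue" for k using L2_measurable[OF v] ml by auto
  qed
  moreover have "(\<lambda>k. LINT x|lebesgue. v' x * of_real (\<phi> k x)) \<longlonglongrightarrow> (LINT x|lebesgue. v' x * of_real (g x))"
  proof (rule integral_dominated_convergence[where w="\<lambda>x. cmod (v' x * of_real (g x))"])
    show "integrable lebesgue (\<lambda>x. cmod (v' x * of_real (g x)))"
      using L2_mult_integrable[OF v' gL] by auto
    show "AE x in lebesgue. (\<lambda>k. v' x * of_real (\<phi> k x)) \<longlonglongrightarrow> v' x * of_real (g x)"
    proof (rule AE_I2)
      fix x
      have "isCont bump 0" using bc by (auto simp: continuous_on_eq_continuous_at)
      then have l: "(\<lambda>k. bump (x / N k)) \<longlonglongrightarrow> 1"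
        using isCont_tendsto_compose[OF _ Nlim[of x], of bump] by (auto simp: bump_0)
      then have "(\<lambda>k. \<phi> k x) \<longlonglongrightarrow> g x * 1" unfolding \<phi>_def by (intro tendsto_intros)
      then show "(\<lambda>k. v' x * of_real (\<phi> k x)) \<longlonglongrightarrow> v' x * of_real (g x)" by (intro tendsto_intros) simp
    qed
    show "AE x in lebesgue. norm (v' x * of_real (\<phi> k x)) \<le> cmod (v' x * of_real (g x))" for k
    proof (rule AE_I2)
      fix x
      have "\<bar>\<phi> k x\<bar> \<le> \<bar>g x\<bar>" unfolding \<phi>_def abs_mult using bump_le[of "x / N k"] by (simp add: mult_left_le)
      then show "norm (v' x * of_real (\<phi> k x)) \<le> cmod (v' x * of_real (g x))" unfolding norm_mult norm_of_real by (intro mult_left_mono) auto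
    qed
    show "(\<lambda>x. v' x * of_real (g x)) \<in> borel_measurable lebesgue" using L2_measurable[OF v'] ml[OF gm(1)] by auto
    have "\<phi> k \<in> borel_measurable borel" for k unfolding \<phi>_def[abs_def] by measurable
    then show "(\<lambda>x. v' x * of_real (\<phi> k x)) \<in> borel_measurable lebesgue" for k using L2_measurable[OF v'] ml by auto
  qed
  ultimately have "(LINT x|lebesgue. v x * of_real (g' x)) = - (LINT x|lebesgue. v' x * of_real (g x))"
    unfolding eq using tendsto_minus LIMSEQ_unique by blast
  then show ?thesis by (simp only: g_def g'_def)
qed

text \<open>Orthogonality passes to all trigonometric polynomials times \<open>g\<close>. These
  approximate the conjugate of \<open>h\<close>, so the squared norm of \<open>h\<close> is at most
  its norm times an arbitrarily small number.\<close>

lemma L2_eq_0_of_orthogonal: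
  fixes g :: "real \<Rightarrow> real"
  assumes g: "continuous_on UNIV g" "\<And>x. g x > 0" "(\<lambda>x. complex_of_real (g x)) \<in> L2" "integrable lebesgue (\<lambda>x. complex_of_real (g x))"
    and h: "h \<in> L2" and orth: "\<And>b. (LINT x|lebesgue. h x * (fourier_char (b * x) * of_real (g x))) = 0"
  shows "AE x in lebesgue. h x = 0"
proof -
  have eL: "(\<lambda>x. fourier_char (b * x) * of_real (g x)) \<in> L2" for b by (rule L2_char_mult[OF g(3)])
  have P: "(\<lambda>x. P x * of_real (g x)) \<in> L2 \<and> (LINT x|lebesgue. h x * (P x * of_real (g x))) = 0" if "P \<in> trig_poly" for P
    using that
  proof (induction rule: trig_poly.induct)
    case (monomial c a)
    have e: "h x * (c * fourier_char (a * x) * of_real (g x)) = c * (h x * (fourier_char (a * x) * of_real (g x)))" for x by simp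
    show ?case using L2_cmult[OF eL[of a], of c] orth[of a] unfolding e by (simp add: mult.assoc)
  next
    case (add P Q)
    have e: "h x * ((P x + Q x) * of_real (g x)) = h x * (P x * of_real (g x)) + h x * (Q x * of_real (g x))" for x by (simp add: algebra_simps)
    have "(LINT x|lebesgue. h x * ((P x + Q x) * of_real (g x))) = 0"
      unfolding e using add.IH L2_mult_integrable[OF h] by (subst Bochner_Integration.integral_add) auto
    moreover have "(\<lambda>x. (P x + Q x) * of_real (g x)) \<in> L2" using L2_add add.IH by (simp add: distrib_right)
    ultimately show ?case by simp
  qed
  have "(L2_norm h)\<^sup>2 \<le> 0 + e" if e: "e > 0" for e
  proof -
    \<comment> \<open>The added 1 only avoids division by zero when \<open>h\<close> has norm
      0.\<close>
    define d where "d = e / (L2_norm h + 1)"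
    have n: "L2_norm h + 1 > 0" using L2_norm_nonneg[of h] by linarith
    have d: "d > 0" using e n by (simp add: d_def)
    obtain P where PP: "P \<in> trig_poly" "L2_norm (\<lambda>x. P x * of_real (g x) - cnj (h x)) < d"
      using trig_poly_dense[OF g L2_cnj[OF h] d] by blast
    note PL = conjunct1[OF P[OF PP(1)]]
    have "complex_of_real ((L2_norm h)\<^sup>2) = (LINT x|lebesgue. h x * cnj (h x))"
      by (simp only: L2_inner_self[symmetric] L2_inner_def)
    also have "\<dots> = (LINT x|lebesgue. h x * cnj (h x)) - (LINT x|lebesgue. h x * (P x * of_real (g x)))" using P[OF PP(1)] by simp
    also have "\<dots> = (LINT x|lebesgue. h x * (cnj (h x) - P x * of_real (g x)))"
      unfolding right_diff_distrib by (rule Bochner_Integration.integral_diff[symmetric]) (intro L2_mult_integrable h L2_cnj PL)+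
    also have "cmod \<dots> \<le> L2_norm h * L2_norm (\<lambda>x. cnj (h x) - P x * of_real (g x))"
      by (intro L2_Cauchy_Schwarz h L2_diff L2_cnj PL)
    also have "\<dots> \<le> L2_norm h * d" using PP(2) by (intro mult_left_mono) (auto simp: L2_norm_minus_commute[of "\<lambda>x. cnj (h x)"])
    also have "\<dots> \<le> e" unfolding d_def times_divide_eq_right using n e by (subst pos_divide_le_eq) (auto simp: algebra_simps)
    finally show ?thesis by (simp add: norm_power)
  qed
  then have "(L2_norm h)\<^sup>2 \<le> 0" by (rule field_le_epsilon)
  then have "L2_norm h = 0" by simp
  then show ?thesis using L2_norm_eq_0_iff[OF h] by simp
qed

lemma integrable_char_times:
  "integrable lebesgue v \<Longrightarrow> integrable lebesgue (\<lambda>x. fourier_char (a * x) * v x)"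
  by (subst mult.commute) (rule integrable_times_char)

text \<open>It is not known in advance that \<xi> times \<open>fourier v\<close> is
  square-integrable, so the difference of the two sides is divided by 1 + \<xi>^2 and the weight (1
  + \<xi>^2) \<open>gauss\<close> compensates. Orthogonality to all modulations of that weight is
  the weak derivative identity for translated Gaussians, carried over by the multiplication
  formula.\<close>

theorem fourier_weak_derivative:
  assumes v: "v \<in> L2" and v': "v' \<in> L2" and w: "weak_derivative v v'"
  shows "AE \<xi> in lebesgue. fourier v' \<xi> = 2 * of_real pi * \<i> * of_real \<xi> * fourier v \<xi>"
proof -
  define h where "h \<xi> = (fourier v' \<xi> - 2 * of_real pi * \<i> * of_real \<xi> * fourier v \<xi>) / of_real (1 + \<xi>\<^sup>2)" for \<xi>
  have nz: "complex_of_real (1 + \<xi>\<^sup>2) \<noteq> 0" for \<xi>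
  proof -
    have "1 + \<xi>\<^sup>2 \<noteq> 0" by (simp add: add_nonneg_eq_0_iff)
    then show ?thesis by (simp only: of_real_eq_0_iff not_False_eq_True)
  qed
  have m1: "(\<lambda>\<xi>. complex_of_real (1 / (1 + \<xi>\<^sup>2))) \<in> borel_measurable lebesgue"
    and m2: "(\<lambda>\<xi>. - 2 * of_real pi * \<i> * complex_of_real (\<xi> / (1 + \<xi>\<^sup>2))) \<in> borel_measurable lebesgue"
    by (intro measurable_completion; measurable)+
  have h_eq: "h = (\<lambda>\<xi>. of_real (1 / (1 + \<xi>\<^sup>2)) * fourier v' \<xi> + (- 2 * of_real pi * \<i> * of_real (\<xi> / (1 + \<xi>\<^sup>2))) * fourier v \<xi>)"
    unfolding h_def by (auto simp: diff_divide_distrib)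
  have hL: "h \<in> L2" unfolding h_eq
  proof (intro L2_add L2_bounded_mult[OF fourier_L2[OF v'] m1, where C=1] L2_bounded_mult[OF fourier_L2[OF v] m2, where C="2 * pi"] AE_I2)
    fix \<xi> :: real
    have p: "1 + \<xi>\<^sup>2 > 0" by (simp add: add_pos_nonneg)
    show "cmod (complex_of_real (1 / (1 + \<xi>\<^sup>2))) \<le> 1" unfolding norm_of_real using p by simp
    have "\<bar>\<xi> / (1 + \<xi>\<^sup>2)\<bar> \<le> 1" using p abs_le_1_plus_sq[of \<xi>] by simp
    then have le: "2 * pi * \<bar>\<xi> / (1 + \<xi>\<^sup>2)\<bar> \<le> 2 * pi * 1" by (intro mult_left_mono) auto
    have eq: "cmod (- 2 * of_real pi * \<i> * complex_of_real t) = 2 * pi * \<bar>t\<bar>" for t by (simp add: norm_mult)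
    show "cmod (- 2 * of_real pi * \<i> * complex_of_real (\<xi> / (1 + \<xi>\<^sup>2))) \<le> 2 * pi" unfolding eq using le by (simp only: mult_1_right)
  qed
  define g where "g \<xi> = (1 + \<xi>\<^sup>2) * gauss \<xi>" for \<xi>
  have gL: "(\<lambda>\<xi>. complex_of_real (g \<xi>)) \<in> L2" "integrable lebesgue (\<lambda>\<xi>. complex_of_real (g \<xi>))"
    unfolding g_def of_real_mult by (intro gauss_dominated[where C=1]; simp add: norm_power del: of_real_add; measurable?)+
  have "AE \<xi> in lebesgue. h \<xi> = 0"
  proof (rule L2_eq_0_of_orthogonal[OF _ _ gL hL])
    show "continuous_on UNIV g" unfolding g_def[abs_def] by (intro continuous_intros)
    show "g \<xi> > 0" for \<xi> unfolding g_def by (simp add: add_pos_nonneg)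
    fix b
    \<comment> \<open>The transforms of \<open>k\<close> and \<open>k'\<close> are the Gaussian
      centred at \<open>b\<close> and its derivative.\<close>
    define k where "k \<xi> = fourier_char (b * \<xi>) * of_real (gauss \<xi>)" for \<xi>
    define k' where "k' \<xi> = - 2 * of_real pi * \<i> * (fourier_char (b * \<xi>) * (of_real \<xi> * of_real (gauss \<xi>)))" for \<xi>
    have kL: "k \<in> L2" "integrable lebesgue k" unfolding k_def[abs_def]
      using L2_char_mult[OF gauss_L2] integrable_char_times[OF integrable_gauss, of b] by auto
    have k'L: "k' \<in> L2" "integrable lebesgue k'" unfolding k'_def[abs_def]
      by (rule L2_cmult[OF L2_char_mult[OF x_gauss(2)]] integrable_mult_right[OF integrable_char_times[OF x_gauss(1), of b]])+
    have Fk: "fourier_integral k x = of_real (gauss (x - b))" for x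
      unfolding k_def[abs_def] fourier_integral_modulate fourier_integral_gauss ..
    have Fk': "fourier_integral k' x = of_real (- (2 * pi * (x - b)) * gauss (x - b))" for x
      unfolding k'_def[abs_def] fourier_integral_cmult fourier_integral_modulate fourier_integral_x_gauss by simp
    have gk: "AE x in lebesgue. of_real (gauss (x - b)) = fourier k x"
      using fourier_eq_fourier_integral[OF kL] by eventually_elim (simp add: Fk)
    have gk': "AE x in lebesgue. of_real (- (2 * pi * (x - b)) * gauss (x - b)) = fourier k' x"
      using fourier_eq_fourier_integral[OF k'L] by eventually_elim (simp add: Fk')
    have 1: "(LINT x|lebesgue. v' x * of_real (gauss (x - b))) = (LINT \<xi>|lebesgue. fourier v' \<xi> * k \<xi>)"
      using L2_integral_mult_cong_AE[OF v' fourier_L2[OF kL(1)] gk] fourier_multiplication_formula[OF v' kL(1)] by simp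
    have 2: "(LINT x|lebesgue. v x * of_real (- (2 * pi * (x - b)) * gauss (x - b))) = (LINT \<xi>|lebesgue. fourier v \<xi> * k' \<xi>)"
      using L2_integral_mult_cong_AE[OF v fourier_L2[OF k'L(1)] gk'] fourier_multiplication_formula[OF v k'L(1)] by simp
    have "h \<xi> * (fourier_char (b * \<xi>) * of_real (g \<xi>)) = fourier v' \<xi> * k \<xi> + fourier v \<xi> * k' \<xi>" for \<xi>
    proof -
      have "h \<xi> * (fourier_char (b * \<xi>) * of_real (g \<xi>)) = (h \<xi> * of_real (1 + \<xi>\<^sup>2)) * k \<xi>"
        by (simp add: g_def k_def mult_ac)
      also have "h \<xi> * of_real (1 + \<xi>\<^sup>2) = fourier v' \<xi> - 2 * of_real pi * \<i> * of_real \<xi> * fourier v \<xi>"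
        unfolding h_def using nz by (rule nonzero_eq_divide_eq[THEN iffD1, OF _ refl])
      finally show ?thesis by (simp add: k_def k'_def algebra_simps)
    qed
    then have "(LINT \<xi>|lebesgue. h \<xi> * (fourier_char (b * \<xi>) * of_real (g \<xi>))) = (LINT \<xi>|lebesgue. fourier v' \<xi> * k \<xi> + fourier v \<xi> * k' \<xi>)"
      by simp
    also have "\<dots> = (LINT \<xi>|lebesgue. fourier v' \<xi> * k \<xi>) + (LINT \<xi>|lebesgue. fourier v \<xi> * k' \<xi>)"
      by (intro Bochner_Integration.integral_add L2_mult_integrable fourier_L2 v v' kL k'L)
    also have "\<dots> = 0" using weak_derivative_gauss_test[OF v v' w, of b] unfolding 1 2 by simp
    finally show "(LINT \<xi>|lebesgue. h \<xi> * (fourier_char (b * \<xi>) * of_real (g \<xi>))) = 0" .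
  qed
  then show ?thesis by eventually_elim (use nz in \<open>auto simp: h_def\<close>)
qed

text \<open>Provides a nonzero element of the domain of the derivative on which the scaling limit
  can be evaluated to compare constants.\<close>

lemma weak_derivative_gauss:
  "weak_derivative (\<lambda>x. of_real (gauss x)) (\<lambda>x. of_real (- (2 * pi * x) * gauss x))"
  unfolding weak_derivative_def
proof (intro allI impI)
  fix \<phi> assume t: "test_function \<phi>"
  have d: "(\<phi> has_real_derivative deriv \<phi> x) (at x)" for x
    using t[unfolded test_function_def, THEN conjunct1, rule_format, of 0 x] by (simp add: DERIV_deriv_iff_real_differentiable)
  have "deriv \<phi> differentiable (at x)" for x
    using t[unfolded test_function_def, THEN conjunct1, rule_format, of 1 x] by simp
  then have dc: "isCont (deriv \<phi>) x" for x by (simp add: differentiable_imp_continuous_within)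
  have "bounded (closure {x. \<phi> x \<noteq> 0})" using t by (simp add: test_function_def compact_imp_bounded)
  then obtain R where R0: "\<And>x. x \<in> closure {x. \<phi> x \<noteq> 0} \<Longrightarrow> norm x \<le> R" unfolding bounded_iff by blast
  have R: "\<bar>x\<bar> \<le> R" if "\<phi> x \<noteq> 0" for x
    using R0[of x] subsetD[OF closure_subset, of x "{x. \<phi> x \<noteq> 0}"] that by simp
  \<comment> \<open>Strictly beyond the support, so the boundary terms of the integration by parts
    vanish.\<close>
  define S where "S = \<bar>R\<bar> + 1"
  have z: "\<phi> x = 0" if "\<bar>x\<bar> \<ge> S" for x using R[of x] that by (force simp: S_def)
  have z': "deriv \<phi> x = 0" if "\<bar>x\<bar> > \<bar>R\<bar>" for x
  proof (rule DERIV_imp_deriv)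
    have "\<forall>\<^sub>F y in nhds x. \<phi> y = 0"
    proof (rule eventually_mono[OF eventually_nhds_in_open[of "{y. \<bar>y\<bar> > \<bar>R\<bar>}" x]])
      show "open {y::real. \<bar>y\<bar> > \<bar>R\<bar>}" by (intro open_Collect_less continuous_intros)
      show "\<phi> y = 0" if "y \<in> {y. \<bar>y\<bar> > \<bar>R\<bar>}" for y using R[of y] that by force
    qed (use that in auto)
    then show "(\<phi> has_real_derivative 0) (at x)" using DERIV_cong_ev[of x x \<phi> "\<lambda>_. 0" 0 0] by simp
  qed
  let ?f = "\<lambda>x. gauss x * deriv \<phi> x + (- (2 * pi * x) * gauss x) * \<phi> x"
  have D: "DERIV (\<lambda>x. gauss x * \<phi> x) x :> ?f x" for x
    using DERIV_mult[OF gauss_deriv[of 0 x, simplified] d[of x]] by (simp add: add.commute mult.commute)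
  have c: "isCont \<phi> x" for x using d by (rule DERIV_isCont)
  have cg: "isCont gauss x" for x using gauss_deriv[of 0 x, simplified] by (rule DERIV_isCont)
  have fc: "isCont ?f x" for x by (intro continuous_intros dc c cg)
  have "(LINT x|lborel. ?f x * indicator {-S..S} x) = gauss S * \<phi> S - gauss (- S) * \<phi> (- S)"
    by (rule integral_FTC_Icc_real) (use D fc in \<open>auto simp: S_def\<close>)
  also have "\<dots> = 0" using z[of S] z[of "-S"] by (simp add: S_def)
  finally have I0: "(LINT x|lborel. ?f x * indicator {-S..S} x) = 0" .
  have ind: "u x * indicat_real {-S..S} x = u x" if "\<And>x. \<bar>x\<bar> > \<bar>R\<bar> \<Longrightarrow> u x = 0" for u :: "real \<Rightarrow> real" and x
  proof (cases "\<bar>x\<bar> > \<bar>R\<bar>")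
    case False
    then have "x \<in> {-S..S}" unfolding S_def atLeastAtMost_iff by linarith
    then show ?thesis by simp
  qed (simp add: that)
  have i1: "integrable lborel (\<lambda>x. gauss x * deriv \<phi> x * indicat_real {-S..S} x)"
    by (rule borel_integrable_atLeastAtMost) (intro continuous_intros cg dc)
  have i2: "integrable lborel (\<lambda>x. (- (2 * pi * x) * gauss x) * \<phi> x * indicat_real {-S..S} x)"
    by (rule borel_integrable_atLeastAtMost) (intro continuous_intros cg c)
  have e1: "(\<lambda>x. gauss x * deriv \<phi> x * indicat_real {-S..S} x) = (\<lambda>x. gauss x * deriv \<phi> x)"
    by (rule ext, rule ind) (simp add: z')
  have e2: "(\<lambda>x. (- (2 * pi * x) * gauss x) * \<phi> x * indicat_real {-S..S} x) = (\<lambda>x. (- (2 * pi * x) * gauss x) * \<phi> x)"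
    by (rule ext, rule ind) (use R in force)
  have "(LINT x|lborel. gauss x * deriv \<phi> x) + (LINT x|lborel. (- (2 * pi * x) * gauss x) * \<phi> x) = 0"
    using I0 i1 i2 unfolding distrib_right by (subst (asm) Bochner_Integration.integral_add) (simp_all only: e1 e2)
  then have I: "(LINT x|lborel. gauss x * deriv \<phi> x) = - (LINT x|lborel. (- (2 * pi * x) * gauss x) * \<phi> x)" by linarith
  have co: "(LINT x|lebesgue. complex_of_real (u x)) = complex_of_real (LINT x|lborel. u x)" if "\<And>x. isCont u x" for u :: "real \<Rightarrow> real"
  proof -
    have "u \<in> borel_measurable borel"
      using that by (intro borel_measurable_continuous_onI continuous_at_imp_continuous_on ballI)
    then show ?thesis by (subst integral_completion) auto
  qed
  have "(LINT x|lebesgue. complex_of_real (gauss x * deriv \<phi> x)) = complex_of_real (LINT x|lborel. gauss x * deriv \<phi> x)"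
    by (intro co continuous_intros cg dc)
  also have "\<dots> = - complex_of_real (LINT x|lborel. (- (2 * pi * x) * gauss x) * \<phi> x)" unfolding I by (rule of_real_minus)
  also have "complex_of_real (LINT x|lborel. (- (2 * pi * x) * gauss x) * \<phi> x) = (LINT x|lebesgue. complex_of_real ((- (2 * pi * x) * gauss x) * \<phi> x))"
    by (rule co[symmetric]) (intro continuous_intros cg c)
  finally have "(LINT x|lebesgue. complex_of_real (gauss x * deriv \<phi> x)) = - (LINT x|lebesgue. complex_of_real ((- (2 * pi * x) * gauss x) * \<phi> x))" .
  then show "(LINT x|lebesgue. complex_of_real (gauss x) * of_real (deriv \<phi> x)) = - (LINT x|lebesgue. of_real (- (2 * pi * x) * gauss x) * of_real (\<phi> x))"
    by (simp only: of_real_mult)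
qed

section \<open>Translation-invariant operators\<close>

lemma AE_eq_of_fourier:
  assumes "v \<in> L2" "w \<in> L2" "AE \<xi> in lebesgue. fourier v \<xi> = fourier w \<xi>"
  shows "AE x in lebesgue. v x = w x"
  using fourier_eq_iff[OF assms(1,2)] assms(3) by simp

lemma hilbert_multiplier_L2:
  assumes "f \<in> L2" shows "(\<lambda>\<xi>. - \<i> * of_real (pi * sgn \<xi>) * f \<xi>) \<in> L2"
proof (rule L2_bounded_mult[OF assms, where C=pi])
  have "(\<lambda>\<xi>::real. if \<xi> = 0 then 0 else if 0 < \<xi> then 1 else - 1 :: real) \<in> borel_measurable borel" by measurable
  then have "(sgn :: real \<Rightarrow> real) \<in> borel_measurable borel" unfolding sgn_real_def by simp
  then show "(\<lambda>\<xi>. - \<i> * complex_of_real (pi * sgn \<xi>)) \<in> borel_measurable lebesgue"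
    by (intro measurable_completion) measurable
  have "cmod (- \<i> * complex_of_real (pi * sgn \<xi>)) = pi * \<bar>sgn \<xi>\<bar>" for \<xi> :: real by (simp add: norm_mult abs_mult)
  then show "AE \<xi> in lebesgue. cmod (- \<i> * complex_of_real (pi * sgn \<xi>)) \<le> pi"
    by (intro AE_I2) (simp only: abs_sgn_eq, simp)
qed

text \<open>The candidate \<open>g\<close> is first produced from the multiplier by the inverse
  transform; the pointwise principal value is then identified with it almost everywhere, so its
  membership in L2 is a consequence.\<close>

lemma hilbert_transform_L2:
  assumes v: "v \<in> L2"
  shows "hilbert_transform v \<in> L2"
    and "AE \<xi> in lebesgue. fourier (hilbert_transform v) \<xi> = - \<i> * of_real (pi * sgn \<xi>) * fourier v \<xi>"
proof -
  define g where "g = inverse_fourier (\<lambda>\<xi>. - \<i> * of_real (pi * sgn \<xi>) * fourier v \<xi>)"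
  note m = hilbert_multiplier_L2[OF fourier_L2[OF v]]
  have g: "g \<in> L2" unfolding g_def by (rule inverse_fourier_L2[OF m])
  have Fg: "AE \<xi> in lebesgue. fourier g \<xi> = - \<i> * of_real (pi * sgn \<xi>) * fourier v \<xi>"
    unfolding g_def by (rule fourier_inverse_fourier[OF m])
  have H: "AE x in lebesgue. hilbert_transform v x = g x" by (rule hilbert_transform_AE[OF v g Fg])
  show "hilbert_transform v \<in> L2" by (rule L2_cong_AE[OF g H])
  show "AE \<xi> in lebesgue. fourier (hilbert_transform v) \<xi> = - \<i> * of_real (pi * sgn \<xi>) * fourier v \<xi>"
    using fourier_cong_AE[OF g H] Fg by eventually_elim simp
qed

lemma L2_inner_cong_AE:
  assumes "u \<in> L2" "v \<in> L2" "AE x in lebesgue. u' x = u x" "AE x in lebesgue. v' x = v x"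
  shows "L2_inner u' v' = L2_inner u v"
  unfolding L2_inner_def
proof (rule integral_cong_AE)
  have m: "(\<lambda>x. u x * cnj (v x)) \<in> borel_measurable lebesgue" if "u \<in> L2" "v \<in> L2" for u v
    using that(1) L2_cnj[OF that(2)] by (auto dest!: L2_measurable)
  show "(\<lambda>x. u' x * cnj (v' x)) \<in> borel_measurable lebesgue" "(\<lambda>x. u x * cnj (v x)) \<in> borel_measurable lebesgue"
    using L2_cong_AE[OF assms(1,3)] L2_cong_AE[OF assms(2,4)] assms(1,2) by (auto intro: m)
  show "AE x in lebesgue. u' x * cnj (v' x) = u x * cnj (v x)"
    using assms(3,4) by eventually_elim simp
qed

lemma bounded_operator_L2_lipschitz:
  assumes T: "bounded_operator_L2 T"
  obtains C where "C \<ge> 0" "\<And>v w. v \<in> L2 \<Longrightarrow> w \<in> L2 \<Longrightarrow> L2_norm (\<lambda>x. T v x - T w x) \<le> C * L2_norm (\<lambda>x. v x - w x)"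
proof -
  note TL = T[unfolded bounded_operator_L2_def, THEN conjunct1, rule_format]
  note Tadd = T[unfolded bounded_operator_L2_def, THEN conjunct2, THEN conjunct1, rule_format]
  note Tmult = T[unfolded bounded_operator_L2_def, THEN conjunct2, THEN conjunct2, THEN conjunct1, rule_format]
  obtain C where C: "\<And>v. v \<in> L2 \<Longrightarrow> L2_norm (T v) \<le> C * L2_norm v" using T unfolding bounded_operator_L2_def by blast
  have "L2_norm (\<lambda>x. T v x - T w x) \<le> \<bar>C\<bar> * L2_norm (\<lambda>x. v x - w x)" if v: "v \<in> L2" and w: "w \<in> L2" for v w
  proof -
    have m: "(\<lambda>x. (-1) * w x) \<in> L2" by (rule L2_cmult[OF w])
    have d: "(\<lambda>x. v x + (-1) * w x) \<in> L2" by (rule L2_add[OF v m])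
    have "AE x in lebesgue. T v x - T w x = T (\<lambda>x. v x + (-1) * w x) x"
      using Tadd[OF v m] Tmult[OF w, of "-1"] by eventually_elim simp
    then have "L2_norm (\<lambda>x. T v x - T w x) = L2_norm (T (\<lambda>x. v x + (-1) * w x))"
      by (rule L2_norm_cong_AE[OF TL[OF d]])
    also have "\<dots> \<le> C * L2_norm (\<lambda>x. v x + (-1) * w x)" by (rule C[OF d])
    also have "\<dots> \<le> \<bar>C\<bar> * L2_norm (\<lambda>x. v x + (-1) * w x)" by (intro mult_right_mono) auto
    finally show ?thesis by simp
  qed
  then show thesis using that[of "\<bar>C\<bar>"] by auto
qed

text \<open>The translates of \<open>gauss\<close> span a dense subspace, and on them a translation-invariant operator is determined
  by its value at \<open>gauss\<close>.\<close>

theorem translation_invariant_multiplier: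
  assumes T: "bounded_operator_L2 T" and ti: "translation_invariant T"
  obtains m where "m \<in> borel_measurable lebesgue" "\<And>v. v \<in> L2 \<Longrightarrow> AE \<xi> in lebesgue. fourier (T v) \<xi> = m \<xi> * fourier v \<xi>"
proof -
  note TL = T[unfolded bounded_operator_L2_def, THEN conjunct1, rule_format]
  note Tadd = T[unfolded bounded_operator_L2_def, THEN conjunct2, THEN conjunct1, rule_format]
  note Tmult = T[unfolded bounded_operator_L2_def, THEN conjunct2, THEN conjunct2, THEN conjunct1, rule_format]
  obtain C where C: "C \<ge> 0" "\<And>v w. v \<in> L2 \<Longrightarrow> w \<in> L2 \<Longrightarrow> L2_norm (\<lambda>x. T v x - T w x) \<le> C * L2_norm (\<lambda>x. v x - w x)"
    using bounded_operator_L2_lipschitz[OF T] by blast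
  define g where "g x = complex_of_real (gauss x)" for x
  have g: "g \<in> L2" unfolding g_def by (rule gauss_L2)
  \<comment> \<open>The only possible multiplier: the transform of \<open>g\<close> is the Gaussian
    itself, which is nowhere zero.\<close>
  define m where "m \<xi> = fourier (T g) \<xi> / of_real (gauss \<xi>)" for \<xi>
  have mm: "m \<in> borel_measurable lebesgue"
    unfolding m_def using L2_measurable[OF fourier_L2[OF TL[OF g]]] L2_measurable[OF gauss_L2] by measurable
  have Fg: "AE \<xi> in lebesgue. fourier g \<xi> = of_real (gauss \<xi>)"
    using fourier_eq_fourier_integral[OF gauss_L2 integrable_gauss] by (simp add: g_def[abs_def] fourier_integral_gauss)
  \<comment> \<open>The Fourier transforms of modulated Gaussians are translated ones, so
    \<open>S\<close> runs through the span of the translates of \<open>g\<close>, and its density is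
    read off from that of \<open>trig_gauss\<close>.\<close>
  define S where "S P = fourier_integral (trig_gauss P)" for P
  have SL: "S P \<in> L2" if "P \<in> trig_poly" for P
    unfolding S_def using fourier_integral_trig_gauss_L2[OF that] by blast
  have span: "AE \<xi> in lebesgue. fourier (T (S P)) \<xi> = m \<xi> * fourier (S P) \<xi>" if "P \<in> trig_poly" for P
    using that
  proof (induction rule: trig_poly.induct)
    case (monomial c a)
    have S_eq: "S (\<lambda>x. c * fourier_char (a * x)) = (\<lambda>x. c * g (x - a))"
      unfolding S_def g_def by (rule ext) (rule fourier_integral_trig_gauss_monomial)
    have ga: "(\<lambda>x. g (x - a)) \<in> L2" by (rule L2_translate[OF g])
    have "AE x in lebesgue. T (\<lambda>x. c * g (x - a)) x = c * T g (x - a)"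
      using Tmult[OF ga, of c] ti[unfolded translation_invariant_def, rule_format, OF g, of a] by eventually_elim simp
    then have 1: "AE \<xi> in lebesgue. fourier (T (\<lambda>x. c * g (x - a))) \<xi> = fourier (\<lambda>x. c * T g (x - a)) \<xi>"
      by (rule fourier_cong_AE[OF L2_cmult[OF L2_translate[OF TL[OF g]]]])
    show ?case unfolding S_eq
      using 1 fourier_cmult[OF L2_translate[OF TL[OF g], of a], of c] fourier_translate[OF TL[OF g], of a]
        fourier_cmult[OF ga, of c] fourier_translate[OF g, of a] Fg
      by eventually_elim (simp add: m_def)
  next
    case (add P Q)
    have S_eq: "S (\<lambda>x. P x + Q x) = (\<lambda>x. S P x + S Q x)"
      unfolding S_def by (rule ext) (rule fourier_integral_trig_gauss_add[OF add(1,2)])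
    have 1: "AE \<xi> in lebesgue. fourier (T (\<lambda>x. S P x + S Q x)) \<xi> = fourier (\<lambda>x. T (S P) x + T (S Q) x) \<xi>"
      by (intro fourier_cong_AE L2_add TL SL add Tadd)
    show ?case unfolding S_eq
      using 1 fourier_add[OF TL[OF SL[OF add(1)]] TL[OF SL[OF add(2)]]] fourier_add[OF SL[OF add(1)] SL[OF add(2)]] add.IH
      by eventually_elim (simp add: distrib_left)
  qed
  have "AE \<xi> in lebesgue. fourier (T v) \<xi> = m \<xi> * fourier v \<xi>" if v: "v \<in> L2" for v
  proof -
    \<comment> \<open>Approximating the inverse transform of \<open>v\<close> by
      \<open>trig_gauss\<close> and transforming back approximates \<open>v\<close> by
      translates.\<close>
    define u where "u = inverse_fourier v"
    have u: "u \<in> L2" unfolding u_def by (rule inverse_fourier_L2[OF v])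
    have Fu: "AE x in lebesgue. fourier u x = v x" unfolding u_def by (rule fourier_inverse_fourier[OF v])
    have "\<exists>P\<in>trig_poly. L2_norm (\<lambda>x. trig_gauss P x - u x) < inverse (real (Suc n))" for n
      using trig_gauss_dense[OF u, of "inverse (real (Suc n))"] by auto
    then obtain P where P: "\<And>n. P n \<in> trig_poly" "\<And>n. L2_norm (\<lambda>x. trig_gauss (P n) x - u x) < inverse (real (Suc n))"
      by metis
    have nP: "L2_norm (\<lambda>x. S (P n) x - v x) \<le> inverse (real (Suc n))" for n
    proof -
      have "AE x in lebesgue. S (P n) x - v x = S (P n) x - fourier u x" using Fu by eventually_elim simp
      then have "L2_norm (\<lambda>x. S (P n) x - v x) = L2_norm (\<lambda>x. S (P n) x - fourier u x)"
        by (rule L2_norm_cong_AE[OF L2_diff[OF SL[OF P(1)] fourier_L2[OF u]]])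
      also have "\<dots> = L2_norm (\<lambda>x. trig_gauss (P n) x - u x)"
        unfolding S_def using fourier_trig_gauss_diff[OF u P(1)[of n]] by (simp add: L2_norm_minus_commute[of _ "fourier u"] L2_norm_minus_commute[of _ u])
      finally show ?thesis using P(2)[of n] by simp
    qed
    have lim: "(\<lambda>n. L2_norm (\<lambda>x. S (P n) x - v x)) \<longlonglongrightarrow> 0"
      by (rule tendsto_sandwich[OF _ _ tendsto_const LIMSEQ_inverse_real_of_nat])
         (intro always_eventually allI L2_norm_nonneg nP)+
    have limF: "(\<lambda>n. L2_norm (\<lambda>x. fourier (S (P n)) x - fourier v x)) \<longlonglongrightarrow> 0"
      using lim by (simp only: fourier_norm_diff[OF SL[OF P(1)] v])
    have "(\<lambda>n. L2_norm (\<lambda>x. T (S (P n)) x - T v x)) \<longlonglongrightarrow> 0"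
    proof (rule tendsto_sandwich[OF _ _ tendsto_const])
      show "(\<lambda>n. C * L2_norm (\<lambda>x. S (P n) x - v x)) \<longlonglongrightarrow> 0" by (rule tendsto_mult_right_zero[OF lim])
    qed (intro always_eventually allI L2_norm_nonneg C(2) SL P v)+
    then have limT: "(\<lambda>n. L2_norm (\<lambda>x. fourier (T (S (P n))) x - fourier (T v) x)) \<longlonglongrightarrow> 0"
      by (simp only: fourier_norm_diff[OF TL[OF SL[OF P(1)]] TL[OF v]])
    \<comment> \<open>At this point \<open>m\<close> is not known to be bounded, so the limit is
      taken pointwise: a subsequence \<open>r\<close> for \<open>v\<close>, refined by
      \<open>s\<close> for \<open>T v\<close>, gives convergence of both sides at almost every
      \<xi>.\<close>
    from L2_tendsto_subseq_AE[OF fourier_L2[OF SL[OF P(1)]] fourier_L2[OF v] limF]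
    obtain r :: "nat \<Rightarrow> nat" where r: "strict_mono r" "AE \<xi> in lebesgue. (\<lambda>n. fourier (S (P (r n))) \<xi>) \<longlonglongrightarrow> fourier v \<xi>" by blast
    have limT': "(\<lambda>n. L2_norm (\<lambda>x. fourier (T (S (P (r n)))) x - fourier (T v) x)) \<longlonglongrightarrow> 0"
      using LIMSEQ_subseq_LIMSEQ[OF limT r(1)] by (simp add: o_def)
    from L2_tendsto_subseq_AE[OF fourier_L2[OF TL[OF SL[OF P(1)]]] fourier_L2[OF TL[OF v]] limT']
    obtain s :: "nat \<Rightarrow> nat" where s: "strict_mono s" "AE \<xi> in lebesgue. (\<lambda>n. fourier (T (S (P (r (s n))))) \<xi>) \<longlonglongrightarrow> fourier (T v) \<xi>" by blast
    have "AE \<xi> in lebesgue. \<forall>n. fourier (T (S (P n))) \<xi> = m \<xi> * fourier (S (P n)) \<xi>"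
      unfolding AE_all_countable using span P(1) by blast
    with r(2) s(2) show ?thesis
    proof eventually_elim
      case (elim \<xi>)
      have "(\<lambda>n. fourier (S (P (r (s n)))) \<xi>) \<longlonglongrightarrow> fourier v \<xi>"
        using LIMSEQ_subseq_LIMSEQ[OF elim(1) s(1)] by (simp add: o_def)
      then have "(\<lambda>n. m \<xi> * fourier (S (P (r (s n)))) \<xi>) \<longlonglongrightarrow> m \<xi> * fourier v \<xi>" by (intro tendsto_intros)
      moreover have "(\<lambda>n. m \<xi> * fourier (S (P (r (s n)))) \<xi>) \<longlonglongrightarrow> fourier (T v) \<xi>" using elim(2,3) by simp
      ultimately show ?case using LIMSEQ_unique by blast
    qed
  qed
  with mm show thesis by (rule that)
qed

text \<open>Test on functions whose transform is the Gaussian restricted to a measurable set A: the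
  inner product becomes the integral of n \<open>gauss\<close>^2 over A, which is real and
  nonnegative for every A. Taking for A the sets where the imaginary part has a given sign, or the
  real part is negative, shows that these sets are null.\<close>

lemma positive_multiplier:
  assumes pos: "positive_operator S" and n: "n \<in> borel_measurable lebesgue"
    and mult: "\<And>v. v \<in> L2 \<Longrightarrow> AE \<xi> in lebesgue. fourier (S v) \<xi> = n \<xi> * fourier v \<xi>"
  shows "AE \<xi> in lebesgue. n \<xi> \<in> \<real>\<^sub>\<ge>\<^sub>0"
proof -
  define F where "F \<xi> = n \<xi> * of_real (gauss \<xi>) * of_real (gauss \<xi>)" for \<xi>
  have Fm: "F \<in> borel_measurable lebesgue" unfolding F_def using n L2_measurable[OF gauss_L2] by measurable
  have key: "(\<lambda>\<xi>. indicator A \<xi> * F \<xi>) \<in> {f. integrable lebesgue f \<and> (LINT \<xi>|lebesgue. f \<xi>) \<in> \<real>\<^sub>\<ge>\<^sub>0}"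
    if A: "A \<in> sets lebesgue" for A
  proof -
    define f where "f \<xi> = indicator A \<xi> * complex_of_real (gauss \<xi>)" for \<xi>
    have f: "f \<in> L2" unfolding f_def[abs_def]
      by (rule L2_bounded_mult[OF gauss_L2, where C=1]) (use A in \<open>auto simp: indicator_def\<close>)
    define v where "v = inverse_fourier f"
    have v: "v \<in> L2" unfolding v_def by (rule inverse_fourier_L2[OF f])
    have Fv: "AE \<xi> in lebesgue. fourier v \<xi> = f \<xi>" unfolding v_def by (rule fourier_inverse_fourier[OF f])
    have Sv: "S v \<in> L2" "L2_inner (S v) v \<in> \<real>\<^sub>\<ge>\<^sub>0" using pos v by (auto simp: positive_operator_def)
    have ae: "AE \<xi> in lebesgue. fourier (S v) \<xi> * cnj (fourier v \<xi>) = indicator A \<xi> * F \<xi>"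
      using Fv mult[OF v] by eventually_elim (simp add: f_def F_def indicator_def)
    have i: "integrable lebesgue (\<lambda>\<xi>. fourier (S v) \<xi> * cnj (fourier v \<xi>))"
      by (intro L2_mult_integrable L2_cnj fourier_L2 Sv v)
    have m: "(\<lambda>\<xi>. indicator A \<xi> * F \<xi>) \<in> borel_measurable lebesgue" using A Fm by measurable
    have "L2_inner (S v) v = (LINT \<xi>|lebesgue. fourier (S v) \<xi> * cnj (fourier v \<xi>))"
      using fourier_inner[OF Sv(1) v] by (simp add: L2_inner_def)
    also have "\<dots> = (LINT \<xi>|lebesgue. indicator A \<xi> * F \<xi>)"
      by (rule integral_cong_AE[OF borel_measurable_integrable[OF i] m ae])
    finally show ?thesis using Sv(2) integrable_cong_AE_imp[OF i m] ae by auto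
  qed
  have im: "AE \<xi> in lebesgue. \<not> (\<sigma> * Im (F \<xi>) > 0)" if \<sigma>: "\<sigma> \<noteq> 0" for \<sigma> :: real
  proof -
    define A where "A = (\<lambda>\<xi>. \<sigma> * Im (F \<xi>)) -` {0<..}"
    have "(\<lambda>\<xi>. \<sigma> * Im (F \<xi>)) \<in> borel_measurable lebesgue" using Fm by measurable
    from measurable_sets[OF this, of "{0<..}"] have A: "A \<in> sets lebesgue" by (simp add: A_def)
    note k = key[OF A, unfolded mem_Collect_eq, THEN conjunct1] key[OF A, unfolded mem_Collect_eq, THEN conjunct2]
    have i: "integrable lebesgue (\<lambda>\<xi>. \<sigma> * Im (indicator A \<xi> * F \<xi>))" by (intro integrable_mult_right integrable_Im k)
    have nn: "AE \<xi> in lebesgue. 0 \<le> \<sigma> * Im (indicator A \<xi> * F \<xi>)" by (intro AE_I2) (auto simp: A_def indicator_def)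
    have "(LINT \<xi>|lebesgue. \<sigma> * Im (indicator A \<xi> * F \<xi>)) = \<sigma> * Im (LINT \<xi>|lebesgue. indicator A \<xi> * F \<xi>)"
      by (simp only: Bochner_Integration.integral_mult_right_zero integral_Im[OF k(1)])
    also have "\<dots> = 0" using k by (simp add: complex_nonneg_Reals_iff)
    finally have "AE \<xi> in lebesgue. \<sigma> * Im (indicator A \<xi> * F \<xi>) = 0" using integral_nonneg_eq_0_iff_AE[OF i nn] by simp
    then show ?thesis by eventually_elim (auto simp: A_def indicator_def split: if_splits)
  qed
  have re: "AE \<xi> in lebesgue. \<not> (Re (F \<xi>) < 0)"
  proof -
    define A where "A = (\<lambda>\<xi>. Re (F \<xi>)) -` {..<0}"
    have "(\<lambda>\<xi>. Re (F \<xi>)) \<in> borel_measurable lebesgue" using Fm by measurable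
    from measurable_sets[OF this, of "{..<0}"] have A: "A \<in> sets lebesgue" by (simp add: A_def)
    note k = key[OF A, unfolded mem_Collect_eq, THEN conjunct1] key[OF A, unfolded mem_Collect_eq, THEN conjunct2]
    have i: "integrable lebesgue (\<lambda>\<xi>. - Re (indicator A \<xi> * F \<xi>))" by (intro Bochner_Integration.integrable_minus integrable_Re k)
    have nn: "AE \<xi> in lebesgue. 0 \<le> - Re (indicator A \<xi> * F \<xi>)" by (intro AE_I2) (auto simp: A_def indicator_def)
    have "(LINT \<xi>|lebesgue. - Re (indicator A \<xi> * F \<xi>)) = - Re (LINT \<xi>|lebesgue. indicator A \<xi> * F \<xi>)"
      by (simp only: Bochner_Integration.integral_minus integral_Re[OF k(1)])
    also have "\<dots> \<le> 0" using k by (simp add: complex_nonneg_Reals_iff)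
    finally have "(LINT \<xi>|lebesgue. - Re (indicator A \<xi> * F \<xi>)) = 0" using integral_nonneg_AE[OF nn] by linarith
    then have "AE \<xi> in lebesgue. - Re (indicator A \<xi> * F \<xi>) = 0" using integral_nonneg_eq_0_iff_AE[OF i nn] by simp
    then show ?thesis by eventually_elim (auto simp: A_def indicator_def split: if_splits)
  qed
  have "AE \<xi> in lebesgue. \<not> (1 * Im (F \<xi>) > 0)" "AE \<xi> in lebesgue. \<not> (- 1 * Im (F \<xi>) > 0)"
    by (rule im; simp)+
  with re show ?thesis
  proof eventually_elim
    case (elim \<xi>)
    define r where "r = gauss \<xi> * gauss \<xi>"
    have r: "r > 0" by (simp add: r_def)
    have F: "Re (F \<xi>) = Re (n \<xi>) * r" "Im (F \<xi>) = Im (n \<xi>) * r" by (simp_all add: F_def r_def)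
    have "Re (n \<xi>) \<ge> 0" using elim(1) mult_neg_pos[OF _ r] unfolding F by (meson not_less)
    moreover have "Im (n \<xi>) * r = 0" using elim(2,3) unfolding F by linarith
    ultimately show ?case using r by (simp add: complex_nonneg_Reals_iff)
  qed
qed

text \<open>Conjugation by dilations turns the multiplier 2 pi i \<psi>(\<xi>) into 2 pi i
  \<psi>(h\<xi>)/h, which tends to 2 pi i \<xi>. The linear bound on \<psi> dominates its product
  with \<open>fourier v\<close> by C |\<open>fourier v'\<close>|, which is square-integrable exactly
  because \<open>v\<close> has a weak derivative in L2.\<close>

lemma L2_inner_tendsto_dilation:
  assumes D: "\<And>v. v \<in> L2 \<Longrightarrow> D v \<in> L2" "\<And>v. v \<in> L2 \<Longrightarrow> AE \<xi> in lebesgue. fourier (D v) \<xi> = 2 * of_real pi * \<i> * of_real (\<psi> \<xi>) * fourier v \<xi>"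
    and \<psi>: "continuous_on UNIV \<psi>" "((\<lambda>\<xi>. \<psi> \<xi> / \<xi>) \<longlongrightarrow> 1) (at 0)" "\<And>\<xi>. \<bar>\<psi> \<xi>\<bar> \<le> C * \<bar>\<xi>\<bar>"
    and v: "v \<in> L2" and v': "v' \<in> L2" and wd: "weak_derivative v v'" and w: "w \<in> L2"
  shows "((\<lambda>h. L2_inner (\<lambda>x. of_real (inverse h) * dilation h (D (dilation (inverse h) v)) x) w) \<longlongrightarrow> L2_inner v' w) (at_right 0)"
proof -
  have F': "AE \<xi> in lebesgue. fourier v' \<xi> = 2 * of_real pi * \<i> * of_real \<xi> * fourier v \<xi>"
    by (rule fourier_weak_derivative[OF v v' wd])
  define q where "q h \<xi> = 2 * of_real pi * \<i> * of_real (\<psi> (h * \<xi>) / h)" for h \<xi>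
  define K where "K h = (LINT \<xi>|lebesgue. q h \<xi> * fourier v \<xi> * cnj (fourier w \<xi>))" for h
  have qm: "q h \<in> borel_measurable lebesgue" for h
  proof -
    have "continuous_on UNIV (\<lambda>\<xi>. \<psi> (h * \<xi>))" by (intro continuous_on_compose2[OF \<psi>(1)] continuous_intros) auto
    then have [measurable]: "(\<lambda>\<xi>. \<psi> (h * \<xi>)) \<in> borel_measurable borel" by (rule borel_measurable_continuous_onI)
    show ?thesis unfolding q_def[abs_def] by (intro measurable_completion) measurable
  qed
  have qb: "cmod (q h \<xi>) \<le> 2 * pi * C * \<bar>\<xi>\<bar>" if h: "h > 0" for h \<xi>
  proof -
    have "\<bar>\<psi> (h * \<xi>)\<bar> / h \<le> (C * \<bar>h * \<xi>\<bar>) / h" using \<psi>(3)[of "h * \<xi>"] h by (intro divide_right_mono) auto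
    also have "\<dots> = C * \<bar>\<xi>\<bar>" using h by (simp add: abs_mult)
    finally have "2 * pi * (\<bar>\<psi> (h * \<xi>)\<bar> / h) \<le> 2 * pi * (C * \<bar>\<xi>\<bar>)" by (intro mult_left_mono) auto
    moreover have "cmod (q h \<xi>) = 2 * pi * (\<bar>\<psi> (h * \<xi>)\<bar> / h)"
      unfolding q_def norm_mult norm_of_real using h by simp
    ultimately show ?thesis by (simp add: mult.assoc)
  qed
  have C0: "C \<ge> 0" using order_trans[OF abs_ge_zero \<psi>(3)[of 1]] by simp
  have eq: "L2_inner (\<lambda>x. of_real (inverse h) * dilation h (D (dilation (inverse h) v)) x) w = K h" if h: "h > 0" for h
  proof -
    define u where "u x = v (h * x)" for x
    have du: "dilation (inverse h) v = u" by (auto simp: dilation_def u_def)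
    have u: "u \<in> L2" unfolding u_def using L2_affine[OF v, of h 0] h by simp
    define z where "z x = of_real (inverse h) * D u (inverse h * x)" for x
    have Duh: "(\<lambda>x. D u (inverse h * x)) \<in> L2" using L2_affine[OF D(1)[OF u], of "inverse h" 0] h by simp
    have z: "z \<in> L2" unfolding z_def by (rule L2_cmult[OF Duh])
    have "AE \<xi> in lebesgue. fourier z \<xi> = q h \<xi> * fourier v \<xi>"
    proof -
      have 1: "AE \<xi> in lebesgue. fourier z \<xi> = of_real (inverse h) * fourier (\<lambda>x. D u (inverse h * x)) \<xi>"
        unfolding z_def by (rule fourier_cmult[OF Duh])
      have 2: "AE \<xi> in lebesgue. fourier (\<lambda>x. D u (inverse h * x)) \<xi> = fourier (D u) (\<xi> / inverse h) / of_real \<bar>inverse h\<bar>"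
        by (rule fourier_scale[OF D(1)[OF u]]) (use h in simp)
      have 3: "AE \<xi> in lebesgue. fourier (D u) (0 + h * \<xi>) = 2 * of_real pi * \<i> * of_real (\<psi> (0 + h * \<xi>)) * fourier u (0 + h * \<xi>)"
        by (rule AE_lebesgue_affine[OF D(2)[OF u]]) (use h in simp)
      have "AE \<xi> in lebesgue. fourier u \<xi> = fourier v (\<xi> / h) / of_real \<bar>h\<bar>"
        unfolding u_def by (rule fourier_scale[OF v]) (use h in simp)
      then have 4: "AE \<xi> in lebesgue. fourier u (0 + h * \<xi>) = fourier v ((0 + h * \<xi>) / h) / of_real \<bar>h\<bar>"
        by (rule AE_lebesgue_affine) (use h in simp)
      show ?thesis using 1 2 3 4
      proof eventually_elim
        case (elim \<xi>)
        have "\<xi> / inverse h = h * \<xi>" using h by (simp add: field_simps)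
        then show ?case using elim h by (simp add: q_def field_simps)
      qed
    qed
    then have ae: "AE \<xi> in lebesgue. q h \<xi> * fourier v \<xi> = fourier z \<xi>" by eventually_elim simp
    have "L2_inner z w = L2_inner (fourier z) (fourier w)" by (rule fourier_inner[OF z w, symmetric])
    also have "\<dots> = L2_inner (\<lambda>\<xi>. q h \<xi> * fourier v \<xi>) (fourier w)"
      by (rule L2_inner_cong_AE[OF fourier_L2[OF z] fourier_L2[OF w] ae, symmetric]) simp
    finally show ?thesis unfolding du by (simp add: z_def[abs_def] dilation_def K_def L2_inner_def)
  qed
  define W where "W \<xi> = (C * cmod (fourier v' \<xi>)) * cmod (fourier w \<xi>)" for \<xi>
  have Wi: "integrable lebesgue W"
  proof -
    have "integrable lebesgue (\<lambda>\<xi>. C * cmod (fourier v' \<xi> * fourier w \<xi>))"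
      by (intro integrable_mult_right integrable_norm L2_mult_integrable fourier_L2 v' w)
    then show ?thesis by (simp add: W_def[abs_def] norm_mult mult.assoc)
  qed
  have vm: "fourier v \<in> borel_measurable lebesgue" "fourier v' \<in> borel_measurable lebesgue" "(\<lambda>\<xi>. cnj (fourier w \<xi>)) \<in> borel_measurable lebesgue"
    using L2_measurable[OF fourier_L2[OF v]] L2_measurable[OF fourier_L2[OF v']] L2_measurable[OF L2_cnj[OF fourier_L2[OF w]]] .
  have "(K \<longlongrightarrow> (LINT \<xi>|lebesgue. fourier v' \<xi> * cnj (fourier w \<xi>))) (at_right 0)"
    unfolding tendsto_at_iff_sequentially o_def
  proof (intro allI impI)
    fix X :: "nat \<Rightarrow> real" assume X0: "\<forall>i. X i \<in> {0<..} - {0}" and X: "X \<longlonglongrightarrow> 0"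
    have X0: "X n > 0" for n using X0 by auto
    show "(\<lambda>n. K (X n)) \<longlonglongrightarrow> (LINT \<xi>|lebesgue. fourier v' \<xi> * cnj (fourier w \<xi>))"
      unfolding K_def
    proof (rule integral_dominated_convergence[OF _ _ Wi])
      show "(\<lambda>\<xi>. fourier v' \<xi> * cnj (fourier w \<xi>)) \<in> borel_measurable lebesgue" using vm by (intro borel_measurable_times)
      show "(\<lambda>\<xi>. q (X n) \<xi> * fourier v \<xi> * cnj (fourier w \<xi>)) \<in> borel_measurable lebesgue" for n
        using vm qm by (intro borel_measurable_times)
      show "AE \<xi> in lebesgue. (\<lambda>n. q (X n) \<xi> * fourier v \<xi> * cnj (fourier w \<xi>)) \<longlonglongrightarrow> fourier v' \<xi> * cnj (fourier w \<xi>)"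
        using F'
      proof eventually_elim
        case (elim \<xi>)
        have "(\<lambda>n. \<psi> (X n * \<xi>) / X n) \<longlonglongrightarrow> \<xi>"
        proof (cases "\<xi> = 0")
          case True
          have "\<psi> 0 = 0" using \<psi>(3)[of 0] by simp
          then show ?thesis using True by simp
        next
          case False
          have "(\<lambda>n. X n * \<xi>) \<longlonglongrightarrow> 0" using tendsto_mult_left_zero[OF X] by simp
          moreover have "X n * \<xi> \<noteq> 0" for n using X0[of n] False by simp
          ultimately have "(\<lambda>n. \<psi> (X n * \<xi>) / (X n * \<xi>)) \<longlonglongrightarrow> 1"
            using \<psi>(2) unfolding tendsto_at_iff_sequentially o_def by simp
          then have "(\<lambda>n. \<psi> (X n * \<xi>) / (X n * \<xi>) * \<xi>) \<longlonglongrightarrow> 1 * \<xi>" by (intro tendsto_intros)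
          then show ?thesis using False by simp
        qed
        then have "(\<lambda>n. q (X n) \<xi> * fourier v \<xi> * cnj (fourier w \<xi>)) \<longlonglongrightarrow> 2 * of_real pi * \<i> * of_real \<xi> * fourier v \<xi> * cnj (fourier w \<xi>)"
          unfolding q_def by (intro tendsto_intros)
        then show ?case by (simp only: elim)
      qed
      show "AE \<xi> in lebesgue. norm (q (X n) \<xi> * fourier v \<xi> * cnj (fourier w \<xi>)) \<le> W \<xi>" for n
        using F'
      proof eventually_elim
        case (elim \<xi>)
        have "cmod (q (X n) \<xi>) * cmod (fourier v \<xi>) \<le> (2 * pi * C * \<bar>\<xi>\<bar>) * cmod (fourier v \<xi>)"
          by (intro mult_right_mono qb X0) auto
        also have "\<dots> = C * cmod (fourier v' \<xi>)" unfolding elim by (simp add: norm_mult)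
        finally show ?case unfolding W_def norm_mult complex_mod_cnj by (intro mult_right_mono) auto
      qed
    qed
  qed
  moreover have "(LINT \<xi>|lebesgue. fourier v' \<xi> * cnj (fourier w \<xi>)) = L2_inner v' w"
    using fourier_inner[OF v' w] by (simp add: L2_inner_def)
  moreover have "\<forall>\<^sub>F h in at_right 0. K h = L2_inner (\<lambda>x. of_real (inverse h) * dilation h (D (dilation (inverse h) v)) x) w"
    using eq by (auto simp: eventually_at_right_field intro!: exI[of _ 1])
  ultimately show ?thesis by (simp add: Lim_transform_eventually)
qed

theorem lemma1:
  fixes J :: "real \<Rightarrow> real" and l :: nat
  assumes "integrable lebesgue J"
    and "AE x in lebesgue. 0 \<le> J x"
    and "AE x in lebesgue. J (- x) = J x"
    and "\<And>k. k \<le> l + 2 \<Longrightarrow> integrable lebesgue (\<lambda>x. x ^ k * J x)"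
    and "\<not> (AE x in lebesgue. J x = 0)"
  shows "\<exists>c D. c > 0 \<and> nonlocal_derivative J c D \<and>
           (\<forall>c' D'. c' > 0 \<and> nonlocal_derivative J c' D' \<longrightarrow>
              c' = c \<and> (\<forall>v\<in>L2. AE x in lebesgue. D' v x = D v x)) \<and>
           (\<exists>\<psi>. bounded_derivatives_upto l \<psi> \<and> has_double_integral_form D \<psi>)"
proof -
  note Ji = assms(1)
  obtain \<psi> :: "real \<Rightarrow> real" and c C :: real where c: "c > 0" and smooth: "smooth_bounded l \<psi>" and cont: "continuous_on UNIV \<psi>"
    and sq: "\<And>\<xi>. fourier_integral (\<lambda>x. of_real (J x)) \<xi> - of_real (moment J 0) = of_real (c\<^sup>2) * (2 * of_real pi * \<i> * of_real (\<psi> \<xi>))\<^sup>2"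
    and sgn: "\<And>\<xi>. sgn (\<psi> \<xi>) = sgn \<xi>" and lim: "((\<lambda>\<xi>. \<psi> \<xi> / \<xi>) \<longlongrightarrow> 1) (at 0)" and C: "\<And>\<xi>. \<bar>\<psi> \<xi>\<bar> \<le> C * \<bar>\<xi>\<bar>"
    by (rule nonlocal_symbol[of J l, OF assms]) (assumption, rule that, assumption+)
  define m where "m \<xi> = 2 * of_real pi * \<i> * complex_of_real (\<psi> \<xi>)" for \<xi>
  have \<psi>m: "\<psi> \<in> borel_measurable borel" by (rule borel_measurable_continuous_onI[OF cont])
  then have mm: "m \<in> borel_measurable lebesgue" unfolding m_def[abs_def] by (intro measurable_completion) measurable
  obtain B where B: "\<And>\<xi>. \<bar>\<psi> \<xi>\<bar> \<le> B" using smooth_bounded_imp_bounded[OF smooth] by (auto simp: bounded_range_iff)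
  have B0: "B \<ge> 0" using order_trans[OF abs_ge_zero B[of 0]] .
  have mb: "cmod (m \<xi>) \<le> 2 * pi * B" for \<xi>
    unfolding m_def norm_mult norm_of_real using B[of \<xi>] by (simp add: mult_left_mono)
  have mL: "(\<lambda>\<xi>. m \<xi> * f \<xi>) \<in> L2" if "f \<in> L2" for f
    by (rule L2_bounded_mult[OF that mm, where C="2 * pi * B"]) (simp add: mb)
  define D where "D v = inverse_fourier (\<lambda>\<xi>. m \<xi> * fourier v \<xi>)" for v
  have DL: "D v \<in> L2" if "v \<in> L2" for v unfolding D_def by (rule inverse_fourier_L2[OF mL[OF fourier_L2[OF that]]])
  have FD: "AE \<xi> in lebesgue. fourier (D v) \<xi> = m \<xi> * fourier v \<xi>" if "v \<in> L2" for v
    unfolding D_def by (rule fourier_inverse_fourier[OF mL[OF fourier_L2[OF that]]])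
  have conv: "AE \<xi> in lebesgue. fourier (\<lambda>x. convol J v x - of_real (moment J 0) * v x) \<xi> = of_real (c\<^sup>2) * (m \<xi>)\<^sup>2 * fourier v \<xi>"
    if v: "v \<in> L2" for v
    using fourier_diff[OF convol_L2[OF Ji v] L2_cmult[OF v, of "of_real (moment J 0)"]] fourier_cmult[OF v, of "of_real (moment J 0)"] fourier_convol[OF Ji v]
    by eventually_elim (simp only: left_diff_distrib[symmetric] sq m_def)
  have convL: "(\<lambda>x. convol J v x - of_real (moment J 0) * v x) \<in> L2" if v: "v \<in> L2" for v
    by (intro L2_diff L2_cmult v convol_L2 Ji)
  have bop: "bounded_operator_L2 D"
    unfolding bounded_operator_L2_def
  proof (intro conjI ballI allI)
    fix v w assume v: "v \<in> L2" and w: "w \<in> L2"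
    show "AE x in lebesgue. D (\<lambda>x. v x + w x) x = D v x + D w x"
    proof (rule AE_eq_of_fourier[OF DL[OF L2_add[OF v w]] L2_add[OF DL[OF v] DL[OF w]]])
      show "AE \<xi> in lebesgue. fourier (D (\<lambda>x. v x + w x)) \<xi> = fourier (\<lambda>x. D v x + D w x) \<xi>"
        using FD[OF L2_add[OF v w]] fourier_add[OF v w] fourier_add[OF DL[OF v] DL[OF w]] FD[OF v] FD[OF w]
        by eventually_elim (simp add: distrib_left)
    qed
  next
    fix a v assume v: "v \<in> L2"
    show "AE x in lebesgue. D (\<lambda>x. a * v x) x = a * D v x"
    proof (rule AE_eq_of_fourier[OF DL[OF L2_cmult[OF v]] L2_cmult[OF DL[OF v]]])
      show "AE \<xi> in lebesgue. fourier (D (\<lambda>x. a * v x)) \<xi> = fourier (\<lambda>x. a * D v x) \<xi>"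
        using FD[OF L2_cmult[OF v, of a]] fourier_cmult[OF v, of a] fourier_cmult[OF DL[OF v], of a] FD[OF v]
        by eventually_elim simp
    qed
  next
    have "L2_norm (D v) \<le> (2 * pi * B) * L2_norm v" if v: "v \<in> L2" for v
    proof -
      have "L2_norm (fourier (D v)) \<le> (2 * pi * B) * L2_norm (fourier v)"
      proof (rule L2_norm_bound[OF fourier_L2[OF v]])
        show "AE \<xi> in lebesgue. cmod (fourier (D v) \<xi>) \<le> 2 * pi * B * cmod (fourier v \<xi>)"
          using FD[OF v] by eventually_elim (simp only: norm_mult, intro mult_right_mono mb norm_ge_zero)
      qed (use L2_measurable[OF fourier_L2[OF DL[OF v]]] B0 in auto)
      then show ?thesis using v DL[OF v] by simp
    qed
    then show "\<exists>C. \<forall>v\<in>L2. L2_norm (D v) \<le> C * L2_norm v" by blast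
  qed (rule DL)
  have ti: "translation_invariant D"
    unfolding translation_invariant_def
  proof (intro allI ballI)
    fix a v assume v: "v \<in> L2"
    show "AE x in lebesgue. D (\<lambda>x. v (x - a)) x = D v (x - a)"
    proof (rule AE_eq_of_fourier[OF DL[OF L2_translate[OF v]] L2_translate[OF DL[OF v]]])
      show "AE \<xi> in lebesgue. fourier (D (\<lambda>x. v (x - a))) \<xi> = fourier (\<lambda>x. D v (x - a)) \<xi>"
        using FD[OF L2_translate[OF v, of a]] fourier_translate[OF v, of a] fourier_translate[OF DL[OF v], of a] FD[OF v]
        by eventually_elim simp
    qed
  qed
  have root: "AE x in lebesgue. convol J v x - of_real (moment J 0) * v x = of_real (c\<^sup>2) * D (D v) x" if v: "v \<in> L2" for v
  proof (rule AE_eq_of_fourier[OF convL[OF v] L2_cmult[OF DL[OF DL[OF v]]]])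
    show "AE \<xi> in lebesgue. fourier (\<lambda>x. convol J v x - of_real (moment J 0) * v x) \<xi> = fourier (\<lambda>x. of_real (c\<^sup>2) * D (D v) x) \<xi>"
      using conv[OF v] fourier_cmult[OF DL[OF DL[OF v]], of "of_real (c\<^sup>2)"] FD[OF DL[OF v]] FD[OF v]
      by eventually_elim (simp add: power2_eq_square)
  qed
  have pos: "positive_operator (\<lambda>v. hilbert_transform (D v))"
    unfolding positive_operator_def
  proof (intro ballI conjI)
    fix v assume v: "v \<in> L2"
    note H = hilbert_transform_L2[OF DL[OF v]]
    show "hilbert_transform (D v) \<in> L2" by (rule H)
    \<comment> \<open>The two imaginary factors cancel: - i pi sgn \<xi> times 2 pi i \<psi> is 2
      pi^2 |\<psi>|, because \<psi> has the sign of \<xi>.\<close>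
    have ae: "AE \<xi> in lebesgue. fourier (hilbert_transform (D v)) \<xi> * cnj (fourier v \<xi>) = of_real (2 * pi\<^sup>2 * \<bar>\<psi> \<xi>\<bar> * (cmod (fourier v \<xi>))\<^sup>2)"
      using H(2) FD[OF v]
    proof eventually_elim
      case (elim \<xi>)
      have "fourier (hilbert_transform (D v)) \<xi> * cnj (fourier v \<xi>) = of_real (2 * pi\<^sup>2 * (\<psi> \<xi> * sgn (\<psi> \<xi>))) * (fourier v \<xi> * cnj (fourier v \<xi>))"
        unfolding elim sgn by (simp add: m_def power2_eq_square)
      also have "\<psi> \<xi> * sgn (\<psi> \<xi>) = \<bar>\<psi> \<xi>\<bar>" by (simp add: abs_sgn)
      finally show ?case unfolding complex_norm_square[symmetric] of_real_mult[symmetric] .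
    qed
    have i: "integrable lebesgue (\<lambda>\<xi>. fourier (hilbert_transform (D v)) \<xi> * cnj (fourier v \<xi>))"
      by (intro L2_mult_integrable L2_cnj fourier_L2 H v)
    have "L2_inner (hilbert_transform (D v)) v = (LINT \<xi>|lebesgue. fourier (hilbert_transform (D v)) \<xi> * cnj (fourier v \<xi>))"
      using fourier_inner[OF H(1) v] by (simp add: L2_inner_def)
    moreover have "Im (LINT \<xi>|lebesgue. fourier (hilbert_transform (D v)) \<xi> * cnj (fourier v \<xi>)) = 0"
    proof -
      have "AE \<xi> in lebesgue. Im (fourier (hilbert_transform (D v)) \<xi> * cnj (fourier v \<xi>)) = 0"
        using ae by eventually_elim (simp only: Im_complex_of_real)
      then show ?thesis unfolding integral_Im[OF i, symmetric] by (rule integral_eq_zero_AE)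
    qed
    moreover have "Re (LINT \<xi>|lebesgue. fourier (hilbert_transform (D v)) \<xi> * cnj (fourier v \<xi>)) \<ge> 0"
    proof -
      have "AE \<xi> in lebesgue. 0 \<le> Re (fourier (hilbert_transform (D v)) \<xi> * cnj (fourier v \<xi>))"
        using ae by eventually_elim (simp only: Re_complex_of_real, simp)
      then show ?thesis unfolding integral_Re[OF i, symmetric] by (rule integral_nonneg_AE)
    qed
    ultimately show "L2_inner (hilbert_transform (D v)) v \<in> \<real>\<^sub>\<ge>\<^sub>0" by (simp add: complex_nonneg_Reals_iff)
  qed
  have FD': "AE \<xi> in lebesgue. fourier (D v) \<xi> = 2 * of_real pi * \<i> * of_real (\<psi> \<xi>) * fourier v \<xi>" if "v \<in> L2" for v
    using FD[OF that] by (simp add: m_def)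
  have nd: "nonlocal_derivative J c D"
    unfolding nonlocal_derivative_def
    using bop ti root pos L2_inner_tendsto_dilation[OF DL FD' cont lim C] by blast
  have unique: "c' = c \<and> (\<forall>v\<in>L2. AE x in lebesgue. D' v x = D v x)" if c': "c' > 0" and nd': "nonlocal_derivative J c' D'" for c' D'
  proof -
    have bop': "bounded_operator_L2 D'" and ti': "translation_invariant D'"
      and root': "\<And>v. v \<in> L2 \<Longrightarrow> AE x in lebesgue. convol J v x - of_real (moment J 0) * v x = of_real (c'\<^sup>2) * D' (D' v) x"
      and pos': "positive_operator (\<lambda>v. hilbert_transform (D' v))"
      and lim': "\<And>v v' w. v \<in> L2 \<Longrightarrow> v' \<in> L2 \<Longrightarrow> weak_derivative v v' \<Longrightarrow> w \<in> L2 \<Longrightarrow>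
          ((\<lambda>h. L2_inner (\<lambda>x. of_real (inverse h) * dilation h (D' (dilation (inverse h) v)) x) w) \<longlongrightarrow> L2_inner v' w) (at_right 0)"
      using nd' unfolding nonlocal_derivative_def by blast+
    have D'L: "D' v \<in> L2" if "v \<in> L2" for v using bop' that by (simp add: bounded_operator_L2_def)
    obtain m' where m': "m' \<in> borel_measurable lebesgue" and FD'': "\<And>v. v \<in> L2 \<Longrightarrow> AE \<xi> in lebesgue. fourier (D' v) \<xi> = m' \<xi> * fourier v \<xi>"
      using translation_invariant_multiplier[OF bop' ti'] by blast
    \<comment> \<open>The multiplier of the Hilbert transform composed with \<open>D'\<close>. Its
      nonnegativity places m' \<xi> on a known half of the imaginary axis, so its square determines
      it.\<close>
    define n where "n \<xi> = - \<i> * of_real (pi * sgn \<xi>) * m' \<xi>" for \<xi>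
    have "AE \<xi> in lebesgue. n \<xi> \<in> \<real>\<^sub>\<ge>\<^sub>0"
    proof (rule positive_multiplier[OF pos'])
      have "(\<lambda>\<xi>::real. if \<xi> = 0 then 0 else if 0 < \<xi> then 1 else - 1 :: real) \<in> borel_measurable borel" by measurable
      then have "(sgn :: real \<Rightarrow> real) \<in> borel_measurable borel" unfolding sgn_real_def by simp
      then have "(\<lambda>\<xi>. - \<i> * complex_of_real (pi * sgn \<xi>)) \<in> borel_measurable lebesgue"
        by (intro measurable_completion) measurable
      then show "n \<in> borel_measurable lebesgue" unfolding n_def[abs_def] using m' by (rule borel_measurable_times)
      show "AE \<xi> in lebesgue. fourier (hilbert_transform (D' v)) \<xi> = n \<xi> * fourier v \<xi>" if "v \<in> L2" for v
        using hilbert_transform_L2(2)[OF D'L[OF that]] FD''[OF that] by eventually_elim (simp add: n_def)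
    qed
    moreover have "AE \<xi> in lebesgue. of_real (c'\<^sup>2) * (m' \<xi>)\<^sup>2 = of_real (c\<^sup>2) * (m \<xi>)\<^sup>2"
    proof -
      \<comment> \<open>Applying the operator equation to one function with nowhere vanishing
        transform is enough to obtain the identity of the multipliers.\<close>
      define g where "g x = complex_of_real (gauss x)" for x
      have g: "g \<in> L2" unfolding g_def by (rule gauss_L2)
      have Fg: "AE \<xi> in lebesgue. fourier g \<xi> = of_real (gauss \<xi>)"
        using fourier_eq_fourier_integral[OF gauss_L2 integrable_gauss] by (simp add: g_def[abs_def] fourier_integral_gauss)
      have "AE \<xi> in lebesgue. fourier (\<lambda>x. convol J g x - of_real (moment J 0) * g x) \<xi> = fourier (\<lambda>x. of_real (c'\<^sup>2) * D' (D' g) x) \<xi>"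
        by (rule fourier_cong_AE[OF L2_cmult[OF D'L[OF D'L[OF g]]] root'[OF g]])
      then show ?thesis
        using conv[OF g] fourier_cmult[OF D'L[OF D'L[OF g]], of "of_real (c'\<^sup>2)"] FD''[OF D'L[OF g]] FD''[OF g] Fg
      proof eventually_elim
        case (elim \<xi>)
        have "of_real (c\<^sup>2) * (m \<xi>)\<^sup>2 * of_real (gauss \<xi>) = of_real (c'\<^sup>2) * (m' \<xi>)\<^sup>2 * complex_of_real (gauss \<xi>)"
          using trans[OF elim(2)[symmetric] trans[OF elim(1,3)]] unfolding elim(4) elim(5) elim(6)
          by (simp only: power2_eq_square mult_ac)
        then show ?case by (subst (asm) mult_right_cancel) auto
      qed
    qed
    ultimately have mm': "AE \<xi> in lebesgue. m' \<xi> = of_real (c / c') * m \<xi>"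
      \<comment> \<open>At \<xi> = 0 the sign is 0 and \<open>n\<close> carries no information about
        \<open>m'\<close>; the point is null.\<close>
      using AE_completion[OF AE_lborel_singleton[of "0::real"]]
    proof eventually_elim
      case (elim \<xi>)
      obtain r where r: "r \<ge> 0" "n \<xi> = of_real r" using elim(1) by (auto elim!: nonneg_Reals_cases)
      define s where "s = sgn \<xi>"
      have ss: "s * s = 1" using elim(3) by (simp add: sgn_if s_def)
      have n_eq: "n \<xi> = - \<i> * of_real (pi * s) * m' \<xi>" by (simp add: n_def s_def)
      have m'_eq: "m' \<xi> = \<i> * of_real (s * (r / pi))"
      proof -
        have "\<i> * of_real (s) * n \<xi> = of_real (pi * (s * s)) * m' \<xi>" by (simp add: n_eq complex_eq_iff algebra_simps)
        then have "of_real pi * m' \<xi> = \<i> * of_real (s) * of_real r" unfolding ss r(2) by simp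
        then show ?thesis by (simp add: field_simps)
      qed
      \<comment> \<open>With m' = i s r / pi and s^2 = 1, the equation of squares, multiplied by
        pi^2, compares squares of two nonnegative numbers, so the roots agree.\<close>
      have "(c' * r)\<^sup>2 = (c * (2 * pi\<^sup>2 * \<bar>\<psi> \<xi>\<bar>))\<^sup>2"
      proof -
        have "complex_of_real (c'\<^sup>2 * (- ((s * s) * (r / pi)\<^sup>2))) = of_real (c\<^sup>2 * (- (4 * pi\<^sup>2 * (\<psi> \<xi>)\<^sup>2)))"
          using elim(2) unfolding m'_eq m_def by (simp add: power2_eq_square mult_ac)
        then have "c'\<^sup>2 * (- ((s * s) * (r / pi)\<^sup>2)) = c\<^sup>2 * (- (4 * pi\<^sup>2 * (\<psi> \<xi>)\<^sup>2))" by (simp only: of_real_eq_iff)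
        then have "c'\<^sup>2 * (r / pi)\<^sup>2 = c\<^sup>2 * (4 * pi\<^sup>2 * (\<psi> \<xi>)\<^sup>2)" unfolding ss by simp
        then have "c'\<^sup>2 * (r / pi)\<^sup>2 * pi\<^sup>2 = c\<^sup>2 * (4 * pi\<^sup>2 * (\<psi> \<xi>)\<^sup>2) * pi\<^sup>2" by simp
        then show ?thesis by (simp add: power_mult_distrib power_divide power2_eq_square mult_ac)
      qed
      then have "c' * r = c * (2 * pi\<^sup>2 * \<bar>\<psi> \<xi>\<bar>)"
        using c c' r by (subst (asm) power2_eq_iff_nonneg) auto
      then have r_eq: "r / pi = (c / c') * (2 * pi * \<bar>\<psi> \<xi>\<bar>)" using c' by (simp add: field_simps power2_eq_square)
      have "s * (r / pi) = (c / c') * (2 * pi * (sgn (\<psi> \<xi>) * \<bar>\<psi> \<xi>\<bar>))" unfolding r_eq sgn s_def by simp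
      also have "sgn (\<psi> \<xi>) * \<bar>\<psi> \<xi>\<bar> = \<psi> \<xi>" by (simp add: sgn_mult_abs)
      finally show ?case unfolding m'_eq m_def by simp
    qed
    have DD: "AE x in lebesgue. D' v x = of_real (c / c') * D v x" if v: "v \<in> L2" for v
    proof (rule AE_eq_of_fourier[OF D'L[OF v] L2_cmult[OF DL[OF v]]])
      show "AE \<xi> in lebesgue. fourier (D' v) \<xi> = fourier (\<lambda>x. of_real (c / c') * D v x) \<xi>"
        using FD''[OF v] mm' FD[OF v] fourier_cmult[OF DL[OF v], of "of_real (c / c')"] by eventually_elim (simp only: mult.assoc)
    qed
    have "c' = c"
    proof -
      define g where "g x = complex_of_real (gauss x)" for x
      define g' where "g' x = complex_of_real (- (2 * pi * x) * gauss x)" for x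
      have g: "g \<in> L2" unfolding g_def by (rule gauss_L2)
      have g': "g' \<in> L2" using L2_cmult[OF x_gauss(2), of "of_real (- 2 * pi)"] by (simp add: g'_def[abs_def] mult.assoc)
      have wd: "weak_derivative g g'" using weak_derivative_gauss by (simp add: g_def[abs_def] g'_def[abs_def])
      \<comment> \<open>Pairing with \<open>g'\<close> itself makes the common limit the squared
        norm of \<open>g'\<close>, which is nonzero, so the factor c / c' must be 1.\<close>
      define L where "L D h = L2_inner (\<lambda>x. of_real (inverse h) * dilation h (D (dilation (inverse h) g)) x) g'" for D h
      have l1: "(L D \<longlongrightarrow> L2_inner g' g') (at_right 0)"
        unfolding L_def[abs_def] by (rule L2_inner_tendsto_dilation[OF DL FD' cont lim C g g' wd g'])
      have l2: "(L D' \<longlongrightarrow> L2_inner g' g') (at_right 0)"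
        unfolding L_def[abs_def] by (rule lim'[OF g g' wd g'])
      have "L D' h = of_real (c / c') * L D h" if h: "h > 0" for h
      proof -
        define u where "u = dilation (inverse h) g"
        have u: "u \<in> L2" unfolding u_def dilation_def using L2_affine[OF g, of h 0] h by simp
        have "AE x in lebesgue. D' u (0 + inverse h * x) = of_real (c / c') * D u (0 + inverse h * x)"
          by (rule AE_lebesgue_affine[OF DD[OF u]]) (use h in simp)
        then have ae: "AE x in lebesgue. of_real (inverse h) * dilation h (D' u) x = of_real (c / c') * (of_real (inverse h) * dilation h (D u) x)"
          by eventually_elim (simp add: dilation_def)
        have Dh: "(\<lambda>x. of_real (inverse h) * dilation h (D u) x) \<in> L2"
          unfolding dilation_def using L2_cmult[OF L2_affine[OF DL[OF u], of "inverse h" 0]] h by simp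
        show ?thesis
          unfolding L_def u_def[symmetric] L2_inner_cmult_left[symmetric]
          by (rule L2_inner_cong_AE[OF L2_cmult[OF Dh] g' ae]) simp
      qed
      then have "\<forall>\<^sub>F h in at_right 0. of_real (c / c') * L D h = L D' h"
        by (auto simp: eventually_at_right_field intro!: exI[of _ 1])
      then have "(L D' \<longlongrightarrow> of_real (c / c') * L2_inner g' g') (at_right 0)"
        by (rule Lim_transform_eventually[rotated]) (intro tendsto_intros l1)
      then have "of_real (c / c') * L2_inner g' g' = L2_inner g' g'"
        using l2 tendsto_unique trivial_limit_at_right_real by blast
      moreover have "L2_inner g' g' \<noteq> 0"
      proof
        assume "L2_inner g' g' = 0"
        then have "L2_norm g' = 0" by (simp add: L2_inner_self)
        then have "AE x in lebesgue. g' x = 0" using L2_norm_eq_0_iff[OF g'] by simp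
        then have "AE x in (lebesgue :: real measure). False"
          using AE_completion[OF AE_lborel_singleton[of "0::real"]] by eventually_elim (simp add: g'_def)
        then show False by (simp add: eventually_False ae_filter_eq_bot_iff)
      qed
      ultimately have "complex_of_real (c / c') = 1" by (metis mult_1_left mult_right_cancel)
      then have "c / c' = 1" by (simp only: of_real_eq_1_iff)
      then show ?thesis using c' by simp
    qed
    then show ?thesis using DD c' by simp
  qed
  have form: "has_double_integral_form D \<psi>"
    unfolding has_double_integral_form_def
  proof (intro conjI ballI impI)
    fix v assume v: "v \<in> L2"
    show "\<exists>f. is_fourier_L2 v f \<and> is_fourier_L2 (D v) (\<lambda>\<xi>. 2 * of_real pi * \<i> * of_real (\<psi> \<xi>) * f \<xi>)"
    proof (intro exI[of _ "fourier v"] conjI)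
      show "is_fourier_L2 v (fourier v)" by (rule is_fourier_L2_I[OF v fourier_L2[OF v]]) simp
      show "is_fourier_L2 (D v) (\<lambda>\<xi>. 2 * of_real pi * \<i> * of_real (\<psi> \<xi>) * fourier v \<xi>)"
        using mL[OF fourier_L2[OF v]] FD'[OF v] by (intro is_fourier_L2_I DL v) (auto simp: m_def)
    qed
  next
    fix v assume v: "v \<in> L2" and vi: "integrable lebesgue v"
      and \<psi>i: "integrable lebesgue (\<lambda>\<xi>. of_real (\<psi> \<xi>) * fourier_integral v \<xi>)"
    \<comment> \<open>The inner y integral produces f(\<xi>) e(x\<xi>). As \<open>f\<close> is
      integrable and square-integrable, its transform at -x is at once the remaining \<xi> integral
      and the inverse transform that defines \<open>D v\<close>.\<close>
    define f where "f \<xi> = m \<xi> * fourier_integral v \<xi>" for \<xi>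
    have ae: "AE \<xi> in lebesgue. f \<xi> = m \<xi> * fourier v \<xi>"
      using fourier_eq_fourier_integral[OF v vi] by eventually_elim (simp add: f_def)
    have f: "f \<in> L2" by (rule L2_cong_AE[OF mL[OF fourier_L2[OF v]] ae])
    have fi: "integrable lebesgue f"
      using integrable_mult_right[OF \<psi>i, of "2 * of_real pi * \<i>"] by (simp add: f_def[abs_def] m_def mult.assoc)
    have "AE \<xi> in lebesgue. fourier f \<xi> = fourier (\<lambda>\<xi>. m \<xi> * fourier v \<xi>) \<xi>"
      by (rule fourier_cong_AE[OF mL[OF fourier_L2[OF v]] ae])
    then have "AE x in lebesgue. fourier (\<lambda>\<xi>. m \<xi> * fourier v \<xi>) x = fourier_integral f x"
      using fourier_eq_fourier_integral[OF f fi] by eventually_elim simp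
    from AE_lebesgue_affine[OF this, of "-1" 0]
    have "AE x in lebesgue. D v x = fourier_integral f (- x)" by (simp add: D_def inverse_fourier_def)
    moreover have "fourier_integral f (- x) = (LINT \<xi>|lebesgue. LINT y|lebesgue. 2 * of_real pi * \<i> * of_real (\<psi> \<xi>) * fourier_char (\<xi> * (x - y)) * v y)" for x
    proof -
      have "(LINT y|lebesgue. 2 * of_real pi * \<i> * of_real (\<psi> \<xi>) * fourier_char (\<xi> * (x - y)) * v y) = f \<xi> * fourier_char (- (- x * \<xi>))" for \<xi>
      proof -
        have "2 * of_real pi * \<i> * of_real (\<psi> \<xi>) * fourier_char (\<xi> * (x - y)) * v y
            = (m \<xi> * fourier_char (x * \<xi>)) * (v y * fourier_char (- (\<xi> * y)))" for y
        proof -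
          have "fourier_char (\<xi> * (x - y)) = fourier_char (x * \<xi>) * fourier_char (- (\<xi> * y))"
            unfolding fourier_char_add[symmetric] by (simp add: algebra_simps)
          then show ?thesis by (simp add: m_def)
        qed
        then have "(LINT y|lebesgue. 2 * of_real pi * \<i> * of_real (\<psi> \<xi>) * fourier_char (\<xi> * (x - y)) * v y)
            = (LINT y|lebesgue. (m \<xi> * fourier_char (x * \<xi>)) * (v y * fourier_char (- (\<xi> * y))))" by (simp only:)
        also have "\<dots> = (m \<xi> * fourier_char (x * \<xi>)) * fourier_integral v \<xi>"
          by (simp only: Bochner_Integration.integral_mult_right_zero fourier_integral_def)
        finally show ?thesis by (simp add: f_def)
      qed
      then show ?thesis unfolding fourier_integral_def[of f] by simp
    qed
    ultimately show "AE x in lebesgue. D v x = (LINT \<xi>|lebesgue. LINT y|lebesgue. 2 * of_real pi * \<i> * of_real (\<psi> \<xi>) * fourier_char (\<xi> * (x - y)) * v y)"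
      by simp
  qed
  show ?thesis
    using c nd unique form smooth_bounded_imp_bounded_derivatives[OF smooth] by blast
qed

end
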